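(* Let $Y=\mathrm{TV}(\Sigma)$ be a smooth, complete toric surface, let $R\in M$ be primitive, and let $(\widetilde\Xi_0,\widetilde\Xi_t)$ be an admissible subdivision decomposition of $\Xi_0$, encoded by an integer $\lambda_0$ and an admissible tuple $a\in\{-1,1\}^{m+2}$. Then the associated family $\pi:X\to\mathbb{A}^1=\operatorname{Spec}\mathbb{C}[t]$, obtained by gluing the schemes $\operatorname{Spec}\widetilde A_i$ ($0\le i\le l-1$), is a one-parameter deformation of $Y$.
   Context: Everything is over $\mathbb{C}$. A one-parameter deformation of $Y$ is a flat morphism $\pi:X\to\mathbb{A}^1$ whose fiber $\pi^{-1}(0)$ is (identified with) $Y$. Fan and slice. $N$ is a rank $2$ lattice with dual $M$, and $\Sigma$ is a complete smooth fan on $N_\mathbb{Q}$ with rays $\rho_1,\dots,\rho_l$ numbered counterclockwise, indices modulo $l$ ($\rho_0=\rho_l$, $\rho_{l+1}=\rho_1$); $\nu(\rho_i)$ is the minimal lattice generator of $\rho_i$. Choose a basis of $N$ such that $R=[0,1]$ in the dual basis of $M$; write $x=\chi^{[1,0]}$, $y=\chi^{[0,1]}$, so $\chi^{[r,s]}=x^ry^s$. Let $\Xi_0=\Sigma\cap\{v\in N_\mathbb{Q}:\langle v,R\rangle=1\}$, regarded as a polyhedral subdivision of $\mathbb{Q}$ by taking $(0,1)$ as origin (the point $(p,1)$ corresponds to $p\in\mathbb{Q}$; lattice points are the integers). Its segments are $\Delta_0^0,\dots,\Delta_0^{m+1}$, ordered with $\Delta_0^i\ge\Delta_0^{i+1}$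 (from right to left), so $\Delta_0^0$ and $\Delta_0^{m+1}$ are half-lines and the others are bounded. The rays are numbered so that $\rho_1$ passes through $\Delta_0^0\cap\Delta_0^1$; hence $\rho_i$ passes through $\Delta_0^{i-1}\cap\Delta_0^i$ for $1\le i\le m+1$. Decompositions. A subdivision decomposition $(\widetilde\Xi_0,\widetilde\Xi_t)$ of $\Xi_0$ consists of $\widetilde\Xi_0=\{\widetilde\Delta_0^0,\dots,\widetilde\Delta_0^{m+1}\}$ and $\widetilde\Xi_t=\{\widetilde\Delta_t^0,\dots,\widetilde\Delta_t^{m+1}\}$, where all $\widetilde\Delta_0^i,\widetilde\Delta_t^i$ are polyhedra in $\mathbb{Q}$ (points, segments or half-lines), $\widetilde\Delta_0^i\ge\widetilde\Delta_0^{i+1}$ and $\widetilde\Delta_t^i\ge\widetilde\Delta_t^{i+1}$ for all $i$, both $\widetilde\Xi_0$ and $\widetilde\Xi_t$ cover $\mathbb{Q}$, and $\Delta_0^i=\widetilde\Delta_0^i+\widetilde\Delta_t^i$ (Minkowski sum) for all $i$. It is admissible if for each $1\le i\le m$ either $\widetilde\Delta_0^i$ or $\widetilde\Delta_t^i$ is a lattice point. Admissible decompositions are encoded by an integer $\lambda_0$ and a tuple $a=(a_0,\dots,a_{m+1})\in\{-1,1\}^{m+2}$ that is admissible, meaning that $\Delta_0^i\cap\Delta_0^{i+1}$ is a lattice point for every $0\le i\le m$ with $a_i\ne a_{i+1}$. The integers $\lambda_1,\dots,\lambda_{m+1}$ are determined by $\lambda_{i+1}=\lambda_i$ if $a_{i+1}=a_i$,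 and $\lambda_i+\lambda_{i+1}=\Delta_0^i\cap\Delta_0^{i+1}$ if $a_{i+1}\neq a_i$. The decomposition satisfies $\Delta_0^i=\widetilde\Delta_0^i+\lambda_i$ if $a_i=1$ and $\Delta_0^i=\widetilde\Delta_t^i+\lambda_i$ if $a_i=-1$ (for $1\le i\le m$ the other summand is the lattice point $\lambda_i$). For $m+1<i<l$ put $a_i=1$, $\lambda_i=0$. The family. Let $\sigma_i\in\Sigma$ be the cone spanned by $\rho_i,\rho_{i+1}$. Let $w_i^1=[r_i^1,s_i^1]$, $w_i^2=[r_i^2,s_i^2]$ be the positively oriented minimal lattice generators of $\sigma_i^\vee$ (so $w_i^1$ vanishes on $\rho_{i+1}$, $w_i^2$ vanishes on $\rho_i$, and $w_i^1=-w_{i+1}^2$). Then $\mathrm{TV}(\sigma_i)=\operatorname{Spec}A_i$ with $A_i=\mathbb{C}[\sigma_i^\vee\cap M]=\mathbb{C}[Z_{i,1},Z_{i,2}]$, $Z_{i,j}=x^{r_i^j}y^{s_i^j}$. For $0\le i\le l-1$ and $j\in\{1,2\}$ define, in $\mathbb{C}(x,y,t)$, $$\widetilde Z_{i,j}=\begin{cases}x^{r_i^j}y^{s_i^j+\lambda_ir_i^j}(y-t)^{-\lambda_ir_i^j}&\text{if }a_i=1,\\ x^{r_i^j}y^{-\lambda_ir_i^j}(y-t)^{s_i^j+\lambda_ir_i^j}&\text{if }a_i=-1,\end{cases}$$ and let $\widetilde A_i=\mathbb{C}[t,\widetilde Z_{i,1},\widetilde Z_{i,2}]$ for $0\le i\le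 m+1$, and $\widetilde A_i=\mathbb{C}[t,\widetilde Z_{i,1},\widetilde Z_{i,2},y(y-t)^{-1}]$ for $m+1<i\le l-1$. The inclusions $\mathbb{C}[t]\subset\widetilde A_i$ give maps $\pi_i:\operatorname{Spec}\widetilde A_i\to\operatorname{Spec}\mathbb{C}[t]$. The scheme $X$ is obtained by identifying, for all $0\le i,j<l$, $\operatorname{Spec}\widetilde A_i$ with $\operatorname{Spec}\widetilde A_j$ along all open subsets $\operatorname{Spec}B$, where $B\subset\mathbb{C}(x,y,t)$ is a localization of both $\widetilde A_i$ and $\widetilde A_j$; $\pi:X\to\mathbb{A}^1$ is the map glued from the $\pi_i$. *)

theory Defs
  imports
    "HOL-Analysis.Analysis"
    "HOL-Computational_Algebra.Fraction_Field"
    "HOL-Computational_Algebra.Polynomial"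
    "HOL-Algebra.QuotRing"
    "HOL-Algebra.Generated_Rings"
    "HOL-Algebra.Free_Abelian_Groups"
begin

section \<open>Commutative algebra\<close>

definition ring_on :: "'k::field set \<Rightarrow> 'k ring" where
  "ring_on S = \<lparr>carrier = S, mult = (*), one = 1, ring.zero = 0, ring.add = (+)\<rparr>"

text \<open>The subring of a field generated by the constants (the image of \<^term>\<open>k\<close>) and a set
  \<^term>\<open>G\<close>.\<close>

definition calg :: "(complex \<Rightarrow> 'k::field) \<Rightarrow> 'k set \<Rightarrow> 'k set" where
  "calg k G = generate_ring (ring_on UNIV) (range k \<union> G)"

definition local_ring :: "'r ring \<Rightarrow> bool" where
  "local_ring L \<longleftrightarrow> cring L \<and> (\<exists>!I. maximalideal I L)"

definition max_ideal :: "'r ring \<Rightarrow> 'r set" where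
  "max_ideal L = (THE I. maximalideal I L)"

definition local_hom :: "'r ring \<Rightarrow> 's ring \<Rightarrow> ('r \<Rightarrow> 's) \<Rightarrow> bool" where
  "local_hom L L' h \<longleftrightarrow> h \<in> ring_hom L L' \<and> h ` max_ideal L \<subseteq> max_ideal L'"

subsection \<open>Localization of a commutative ring\<close>

definition frac_rel :: "'r ring \<Rightarrow> 'r set \<Rightarrow> (('r \<times> 'r) \<times> ('r \<times> 'r)) set" where
  "frac_rel R S = {((a, s), (b, u)). a \<in> carrier R \<and> s \<in> S \<and> b \<in> carrier R \<and> u \<in> S \<and>
     (\<exists>v\<in>S. v \<otimes>\<^bsub>R\<^esub> (a \<otimes>\<^bsub>R\<^esub> u) = v \<otimes>\<^bsub>R\<^esub> (b \<otimes>\<^bsub>R\<^esub> s))}"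

definition fraction :: "'r ring \<Rightarrow> 'r set \<Rightarrow> 'r \<Rightarrow> 'r \<Rightarrow> ('r \<times> 'r) set" where
  "fraction R S a s = frac_rel R S `` {(a, s)}"

definition localization :: "'r ring \<Rightarrow> 'r set \<Rightarrow> ('r \<times> 'r) set ring" where
  "localization R S =
    \<lparr>carrier = (carrier R \<times> S) // frac_rel R S,
     mult = (\<lambda>p q. \<Union>(a, s)\<in>p. \<Union>(b, u)\<in>q. fraction R S (a \<otimes>\<^bsub>R\<^esub> b) (s \<otimes>\<^bsub>R\<^esub> u)),
     one = fraction R S \<one>\<^bsub>R\<^esub> \<one>\<^bsub>R\<^esub>,
     ring.zero = fraction R S \<zero>\<^bsub>R\<^esub> \<one>\<^bsub>R\<^esub>,
     ring.add = (\<lambda>p q. \<Union>(a, s)\<in>p. \<Union>(b, u)\<in>q.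
              fraction R S (a \<otimes>\<^bsub>R\<^esub> u \<oplus>\<^bsub>R\<^esub> b \<otimes>\<^bsub>R\<^esub> s) (s \<otimes>\<^bsub>R\<^esub> u))\<rparr>"

text \<open>For a subring \<^term>\<open>A\<close> of a field, localizations are taken inside that field.\<close>

definition localization_in :: "'k::field set \<Rightarrow> 'k set \<Rightarrow> 'k set" where
  "localization_in A S = {a / s | a s. a \<in> A \<and> s \<in> S}"

definition is_localization_of :: "'k::field set \<Rightarrow> 'k set \<Rightarrow> bool" where
  "is_localization_of B A \<longleftrightarrow> (\<exists>S. S \<subseteq> A \<and> 1 \<in> S \<and> 0 \<notin> S \<and> (\<forall>s\<in>S. \<forall>u\<in>S. s * u \<in> S) \<and>
     B = localization_in A S)"

subsection \<open>Tensor products and flat modules\<close>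

definition tensor_relations :: "'r ring \<Rightarrow> ('r, 'm) module \<Rightarrow> ('r, 'n) module \<Rightarrow> (('m \<times> 'n) \<Rightarrow>\<^sub>0 int) set"
  where
  "tensor_relations R M N = generate (free_Abelian_group (carrier M \<times> carrier N))
    ({frag_of (m \<oplus>\<^bsub>M\<^esub> m', n) - frag_of (m, n) - frag_of (m', n) | m m' n.
        m \<in> carrier M \<and> m' \<in> carrier M \<and> n \<in> carrier N} \<union>
     {frag_of (m, n \<oplus>\<^bsub>N\<^esub> n') - frag_of (m, n) - frag_of (m, n') | m n n'.
        m \<in> carrier M \<and> n \<in> carrier N \<and> n' \<in> carrier N} \<union>
     {frag_of (r \<odot>\<^bsub>M\<^esub> m, n) - frag_of (m, r \<odot>\<^bsub>N\<^esub> n) | r m n.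
        r \<in> carrier R \<and> m \<in> carrier M \<and> n \<in> carrier N})"

definition tensor :: "'r ring \<Rightarrow> ('r, 'm) module \<Rightarrow> ('r, 'n) module \<Rightarrow> (('m \<times> 'n) \<Rightarrow>\<^sub>0 int) set monoid"
  where
  "tensor R M N = free_Abelian_group (carrier M \<times> carrier N) Mod tensor_relations R M N"

text \<open>\<^term>\<open>M\<close> is flat if for every module \<^term>\<open>N\<close> and every submodule \<^term>\<open>H\<close> of \<^term>\<open>N\<close>
  the canonical map from the tensor product of \<^term>\<open>M\<close> and \<^term>\<open>H\<close> to that of \<^term>\<open>M\<close>
  and \<^term>\<open>N\<close> is injective. On cosets this map enlarges a coset of the relations for
  \<^term>\<open>H\<close> to the coset of the relations for \<^term>\<open>N\<close> containing it. HOL cannot quantify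
  over the type of the elements of \<^term>\<open>N\<close> inside a formula, so that type is a parameter;
  a theorem in which it is a free type variable speaks about all of them.\<close>

definition flat_module :: "'n itself \<Rightarrow> 'r ring \<Rightarrow> ('r, 'm) module \<Rightarrow> bool" where
  "flat_module T R M \<longleftrightarrow> (\<forall>(N :: ('r, 'n) module) H. Module.module R N \<and> submodule H R N \<longrightarrow>
     inj_on (\<lambda>C. tensor_relations R M N <#>\<^bsub>free_Abelian_group (carrier M \<times> carrier N)\<^esub> C)
       (carrier (tensor R M (N\<lparr>carrier := H\<rparr>))))"

definition as_module :: "('r \<Rightarrow> 's) \<Rightarrow> 's ring \<Rightarrow> ('r, 's) module" where
  "as_module h S = \<lparr>carrier = carrier S, mult = monoid.mult S, one = monoid.one S, ring.zero = ring.zero S,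
     ring.add = ring.add S, smult = (\<lambda>r z. h r \<otimes>\<^bsub>S\<^esub> z)\<rparr>"


section \<open>Ringed spaces and schemes over the complex numbers\<close>

text \<open>The structure sheaf is given in its etale-space form: by its stalks and, for each open
  set, the sections, where a section is identified with the function sending a point to its
  germ there. All sheaves are sheaves of complex algebras; \<^term>\<open>rs_const X x c\<close> is
  the germ at \<^term>\<open>x\<close> of the constant \<^term>\<open>c\<close>.\<close>

record ('p, 's) rspace =
  rs_top :: "'p topology"
  rs_stalk :: "'p \<Rightarrow> 's ring"
  rs_sec :: "'p set \<Rightarrow> ('p \<Rightarrow> 's) set"
  rs_const :: "'p \<Rightarrow> complex \<Rightarrow> 's"

definition locally_ringed_space :: "('p, 's) rspace \<Rightarrow> bool" where
  "locally_ringed_space X \<longleftrightarrow>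
    (\<forall>x\<in>topspace (rs_top X). local_ring (rs_stalk X x)) \<and>
    (\<forall>x\<in>topspace (rs_top X). rs_const X x \<in> ring_hom (ring_on UNIV) (rs_stalk X x)) \<and>
    (\<forall>U. openin (rs_top X) U \<longrightarrow>
       rs_sec X U \<subseteq> (\<Pi>\<^sub>E x\<in>U. carrier (rs_stalk X x)) \<and>
       (\<forall>c. (\<lambda>x\<in>U. rs_const X x c) \<in> rs_sec X U) \<and>
       (\<forall>s\<in>rs_sec X U. \<forall>s'\<in>rs_sec X U.
          (\<lambda>x\<in>U. s x \<oplus>\<^bsub>rs_stalk X x\<^esub> s' x) \<in> rs_sec X U \<and>
          (\<lambda>x\<in>U. s x \<otimes>\<^bsub>rs_stalk X x\<^esub> s' x) \<in> rs_sec X U) \<and>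
       (\<forall>s\<in>rs_sec X U. \<forall>V. openin (rs_top X) V \<and> V \<subseteq> U \<longrightarrow> restrict s V \<in> rs_sec X V) \<and>
       (\<forall>s\<in>(\<Pi>\<^sub>E x\<in>U. carrier (rs_stalk X x)).
          (\<forall>x\<in>U. \<exists>V. openin (rs_top X) V \<and> x \<in> V \<and> V \<subseteq> U \<and> restrict s V \<in> rs_sec X V) \<longrightarrow>
          s \<in> rs_sec X U) \<and>
       (\<forall>s\<in>rs_sec X U. \<forall>s'\<in>rs_sec X U. \<forall>x\<in>U. s x = s' x \<longrightarrow>
          (\<exists>V. openin (rs_top X) V \<and> x \<in> V \<and> V \<subseteq> U \<and> (\<forall>y\<in>V. s y = s' y)))) \<and>
    (\<forall>x\<in>topspace (rs_top X). \<forall>z\<in>carrier (rs_stalk X x).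
       \<exists>U. openin (rs_top X) U \<and> x \<in> U \<and> (\<exists>s\<in>rs_sec X U. s x = z))"

text \<open>A morphism consists of a continuous map \<^term>\<open>f\<close> and the maps \<^term>\<open>h x\<close> that it induces
  from the stalk at \<^term>\<open>f x\<close> to the stalk at \<^term>\<open>x\<close>.\<close>

definition rs_morphism ::
  "('p, 's) rspace \<Rightarrow> ('q, 'u) rspace \<Rightarrow> ('p \<Rightarrow> 'q) \<Rightarrow> ('p \<Rightarrow> 'u \<Rightarrow> 's) \<Rightarrow> bool" where
  "rs_morphism X Y f h \<longleftrightarrow>
    continuous_map (rs_top X) (rs_top Y) f \<and>
    (\<forall>x\<in>topspace (rs_top X). local_hom (rs_stalk Y (f x)) (rs_stalk X x) (h x)) \<and>
    (\<forall>x\<in>topspace (rs_top X). \<forall>c. h x (rs_const Y (f x) c) = rs_const X x c) \<and>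
    (\<forall>V s. openin (rs_top Y) V \<and> s \<in> rs_sec Y V \<longrightarrow>
       (\<lambda>x\<in>{x \<in> topspace (rs_top X). f x \<in> V}. h x (s (f x)))
         \<in> rs_sec X {x \<in> topspace (rs_top X). f x \<in> V})"

definition rs_isomorphic :: "('p, 's) rspace \<Rightarrow> ('q, 'u) rspace \<Rightarrow> bool" where
  "rs_isomorphic X Y \<longleftrightarrow> (\<exists>f h g k. rs_morphism X Y f h \<and> rs_morphism Y X g k \<and>
    (\<forall>x\<in>topspace (rs_top X). g (f x) = x \<and>
       (\<forall>z\<in>carrier (rs_stalk X x). h x (k (f x) z) = z)) \<and>
    (\<forall>y\<in>topspace (rs_top Y). f (g y) = y \<and>
       (\<forall>z\<in>carrier (rs_stalk Y y). k y (h (g y) z) = z)))"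

definition open_subspace :: "('p, 's) rspace \<Rightarrow> 'p set \<Rightarrow> ('p, 's) rspace" where
  "open_subspace X U = X\<lparr>rs_top := subtopology (rs_top X) U\<rparr>"

subsection \<open>Spectra\<close>

definition primes :: "'r ring \<Rightarrow> 'r set set" where
  "primes R = {p. primeideal p R}"

definition zariski :: "'r ring \<Rightarrow> 'r set topology" where
  "zariski R = topology (\<lambda>U. \<exists>E\<subseteq>carrier R. U = {p \<in> primes R. \<not> E \<subseteq> p})"

text \<open>The prime spectrum of a complex algebra \<^term>\<open>R\<close> with structure map \<^term>\<open>k\<close>, for a given
  model \<^term>\<open>L p\<close> of the localization of \<^term>\<open>R\<close> at each prime \<^term>\<open>p\<close>, in which the fraction
  \<open>a/s\<close> is \<^term>\<open>fr p a s\<close>. Sections are the functions that are locally fractions.\<close>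

definition spec_with ::
  "'r ring \<Rightarrow> ('r set \<Rightarrow> 's ring) \<Rightarrow> ('r set \<Rightarrow> 'r \<Rightarrow> 'r \<Rightarrow> 's) \<Rightarrow> (complex \<Rightarrow> 'r) \<Rightarrow> ('r set, 's) rspace"
  where
  "spec_with R L fr k = \<lparr>rs_top = zariski R, rs_stalk = L,
     rs_sec = (\<lambda>U. {s \<in> (\<Pi>\<^sub>E p\<in>U. carrier (L p)). \<forall>p\<in>U. \<exists>V. openin (zariski R) V \<and> p \<in> V \<and> V \<subseteq> U \<and>
        (\<exists>a\<in>carrier R. \<exists>b\<in>carrier R. \<forall>q\<in>V. b \<notin> q \<and> s q = fr q a b)}),
     rs_const = (\<lambda>p c. fr p (k c) \<one>\<^bsub>R\<^esub>)\<rparr>"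

definition spec :: "'r ring \<Rightarrow> (complex \<Rightarrow> 'r) \<Rightarrow> ('r set, ('r \<times> 'r) set) rspace" where
  "spec R k = spec_with R (\<lambda>p. localization R (carrier R - p)) (\<lambda>p. fraction R (carrier R - p)) k"

definition local_ring_in :: "'k::field set \<Rightarrow> 'k set \<Rightarrow> 'k set" where
  "local_ring_in A p = localization_in A (A - p)"

text \<open>The spectrum of a subring \<^term>\<open>A\<close> of a field, with local rings in that field.\<close>

definition spec_in :: "(complex \<Rightarrow> 'k::field) \<Rightarrow> 'k set \<Rightarrow> ('k set, 'k) rspace" where
  "spec_in k A = spec_with (ring_on A) (\<lambda>p. ring_on (local_ring_in A p)) (\<lambda>p a s. a / s) k"

text \<open>An affine open subset is the spectrum of its ring of sections; the elements of that ring
  are functions from points to germs, so it suffices to let \<^term>\<open>R\<close> range over rings with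
  elements of this type.\<close>

definition is_scheme :: "('p, 's) rspace \<Rightarrow> bool" where
  "is_scheme X \<longleftrightarrow> locally_ringed_space X \<and>
    (\<forall>x\<in>topspace (rs_top X). \<exists>U (R :: ('p \<Rightarrow> 's) ring) k.
       openin (rs_top X) U \<and> x \<in> U \<and> cring R \<and> k \<in> ring_hom (ring_on UNIV) R \<and>
       rs_isomorphic (open_subspace X U) (spec R k))"

subsection \<open>Flat morphisms and fibers\<close>

definition flat_morphism ::
  "'n itself \<Rightarrow> ('p, 's) rspace \<Rightarrow> ('q, 'u) rspace \<Rightarrow> ('p \<Rightarrow> 'q) \<Rightarrow> ('p \<Rightarrow> 'u \<Rightarrow> 's) \<Rightarrow> bool" where
  "flat_morphism T X B f h \<longleftrightarrow> (\<forall>x\<in>topspace (rs_top X).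
     flat_module T (rs_stalk B (f x)) (as_module (h x) (rs_stalk X x)))"

text \<open>The scheme-theoretic fiber over a closed point \<^term>\<open>b\<close>: the closed subspace cut out by
  the ideal sheaf that the maximal ideal of \<^term>\<open>b\<close> generates in the structure sheaf of
  \<^term>\<open>X\<close>. Its sections are the functions that are locally induced by sections of the
  structure sheaf of \<^term>\<open>X\<close>.\<close>

definition fiber_ideal ::
  "('p, 's) rspace \<Rightarrow> ('q, 'u) rspace \<Rightarrow> ('p \<Rightarrow> 'q) \<Rightarrow> ('p \<Rightarrow> 'u \<Rightarrow> 's) \<Rightarrow> 'p \<Rightarrow> 's set" where
  "fiber_ideal X B f h x = genideal (rs_stalk X x) (h x ` max_ideal (rs_stalk B (f x)))"

definition fiber ::
  "('p, 's) rspace \<Rightarrow> ('q, 'u) rspace \<Rightarrow> ('p \<Rightarrow> 'q) \<Rightarrow> ('p \<Rightarrow> 'u \<Rightarrow> 's) \<Rightarrow> 'q \<Rightarrow> ('p, 's set) rspace" where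
  "fiber X B f h b =
    (let F = {x \<in> topspace (rs_top X). f x = b};
         I = fiber_ideal X B f h;
         L = (\<lambda>x. rs_stalk X x Quot I x)
     in \<lparr>rs_top = subtopology (rs_top X) F, rs_stalk = L,
         rs_sec = (\<lambda>U. {s \<in> (\<Pi>\<^sub>E x\<in>U. carrier (L x)). \<forall>x\<in>U. \<exists>W \<sigma>.
            openin (rs_top X) W \<and> x \<in> W \<and> \<sigma> \<in> rs_sec X W \<and>
            (\<forall>y\<in>W \<inter> U. s y = I y +>\<^bsub>rs_stalk X y\<^esub> \<sigma> y)}),
         rs_const = (\<lambda>x c. I x +>\<^bsub>rs_stalk X x\<^esub> rs_const X x c)\<rparr>)"

subsection \<open>Gluing spectra of subrings of a field\<close>

text \<open>Glue the spectra of the subrings \<^term>\<open>A i\<close> (\<open>i \<in> J\<close>) of a field by identifying, for each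
  \<^term>\<open>B\<close> in \<^term>\<open>Bs i j\<close>, the images of the spectrum of \<^term>\<open>B\<close> in the spectra of
  \<^term>\<open>A i\<close> and \<^term>\<open>A j\<close>. The local rings of points that are identified coincide as subrings
  of the field, because they both coincide with a local ring of \<^term>\<open>B\<close>.\<close>

definition glue_rel ::
  "'i set \<Rightarrow> ('i \<Rightarrow> 'k::field set) \<Rightarrow> ('i \<Rightarrow> 'i \<Rightarrow> 'k set set) \<Rightarrow> (('i \<times> 'k set) \<times> ('i \<times> 'k set)) set"
  where
  "glue_rel J A Bs = {((i, p), (j, q)). i \<in> J \<and> j \<in> J \<and>
     p \<in> primes (ring_on (A i)) \<and> q \<in> primes (ring_on (A j)) \<and>
     (\<exists>B\<in>Bs i j. \<exists>P\<in>primes (ring_on B). P \<inter> A i = p \<and> P \<inter> A j = q)}"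

definition glue_class ::
  "'i set \<Rightarrow> ('i \<Rightarrow> 'k::field set) \<Rightarrow> ('i \<Rightarrow> 'i \<Rightarrow> 'k set set) \<Rightarrow> 'i \<Rightarrow> 'k set \<Rightarrow> ('i \<times> 'k set) set"
  where
  "glue_class J A Bs i p = glue_rel J A Bs `` {(i, p)}"

definition glued_spec ::
  "(complex \<Rightarrow> 'k::field) \<Rightarrow> 'i set \<Rightarrow> ('i \<Rightarrow> 'k set) \<Rightarrow> ('i \<Rightarrow> 'i \<Rightarrow> 'k set set)
     \<Rightarrow> (('i \<times> 'k set) set, 'k) rspace" where
  "glued_spec k J A Bs =
    (let pts = (SIGMA i:J. primes (ring_on (A i))) // glue_rel J A Bs;
         pre = (\<lambda>W i. {p \<in> primes (ring_on (A i)). glue_class J A Bs i p \<in> W});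
         L = (\<lambda>x. ring_on (\<Union>(i, p)\<in>x. local_ring_in (A i) p))
     in \<lparr>rs_top = topology (\<lambda>W. W \<subseteq> pts \<and> (\<forall>i\<in>J. openin (zariski (ring_on (A i))) (pre W i))),
         rs_stalk = L,
         rs_sec = (\<lambda>W. {s \<in> (\<Pi>\<^sub>E x\<in>W. carrier (L x)). \<forall>i\<in>J.
            (\<lambda>p\<in>pre W i. s (glue_class J A Bs i p)) \<in> rs_sec (spec_in k (A i)) (pre W i)}),
         rs_const = (\<lambda>x. k)\<rparr>)"

text \<open>The subrings \<^term>\<open>B\<close> that are localizations both of \<^term>\<open>A\<close> and of \<^term>\<open>A'\<close> and whose
  spectrum is an open subset of both spectra.\<close>

definition common_localizations :: "'k::field set \<Rightarrow> 'k set \<Rightarrow> 'k set set" where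
  "common_localizations A A' = {B. is_localization_of B A \<and> is_localization_of B A' \<and>
     openin (zariski (ring_on A)) ((\<lambda>P. P \<inter> A) ` primes (ring_on B)) \<and>
     openin (zariski (ring_on A')) ((\<lambda>P. P \<inter> A') ` primes (ring_on B))}"


section \<open>Fans in the plane and toric surfaces\<close>

text \<open>By the choice of a basis, the lattices \<open>N\<close> and \<open>M\<close> are identified with pairs of integers,
  and \<open>R = [0,1]\<close>.\<close>

definition qvec :: "int \<times> int \<Rightarrow> rat \<times> rat" where
  "qvec v = (of_int (fst v), of_int (snd v))"

definition pairing :: "rat \<times> rat \<Rightarrow> rat \<times> rat \<Rightarrow> rat" where
  "pairing v u = fst v * fst u + snd v * snd u"

definition det2 :: "int \<times> int \<Rightarrow> int \<times> int \<Rightarrow> int" where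
  "det2 v w = fst v * snd w - snd v * fst w"

definition primitive :: "int \<times> int \<Rightarrow> bool" where
  "primitive v \<longleftrightarrow> coprime (fst v) (snd v)"

definition cone_gen :: "(int \<times> int) set \<Rightarrow> (rat \<times> rat) set" where
  "cone_gen V = {(\<Sum>v\<in>V. c v * of_int (fst v), \<Sum>v\<in>V. c v * of_int (snd v)) | c. \<forall>v\<in>V. c v \<ge> (0::rat)}"

definition dual_cone :: "(rat \<times> rat) set \<Rightarrow> (rat \<times> rat) set" where
  "dual_cone \<sigma> = {u. \<forall>v\<in>\<sigma>. pairing v u \<ge> 0}"

definition face_of_cone :: "(rat \<times> rat) set \<Rightarrow> (rat \<times> rat) set \<Rightarrow> bool" where
  "face_of_cone \<tau> \<sigma> \<longleftrightarrow> (\<exists>u. u \<in> dual_cone \<sigma> \<and> \<tau> = {v \<in> \<sigma>. pairing v u = 0})"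

definition is_fan :: "(rat \<times> rat) set set \<Rightarrow> bool" where
  "is_fan \<Sigma> \<longleftrightarrow> finite \<Sigma> \<and>
    (\<forall>\<sigma>\<in>\<Sigma>. (\<exists>V. finite V \<and> \<sigma> = cone_gen V) \<and> (\<forall>v\<in>\<sigma>. - v \<in> \<sigma> \<longrightarrow> v = 0)) \<and>
    (\<forall>\<sigma>\<in>\<Sigma>. \<forall>\<tau>. face_of_cone \<tau> \<sigma> \<longrightarrow> \<tau> \<in> \<Sigma>) \<and>
    (\<forall>\<sigma>\<in>\<Sigma>. \<forall>\<tau>\<in>\<Sigma>. face_of_cone (\<sigma> \<inter> \<tau>) \<sigma> \<and> face_of_cone (\<sigma> \<inter> \<tau>) \<tau>)"

definition complete_fan :: "(rat \<times> rat) set set \<Rightarrow> bool" where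
  "complete_fan \<Sigma> \<longleftrightarrow> \<Union>\<Sigma> = UNIV"

definition lattice_basis :: "int \<times> int \<Rightarrow> int \<times> int \<Rightarrow> bool" where
  "lattice_basis b b' \<longleftrightarrow>
    (\<forall>v. \<exists>!(i, j). v = (i * fst b + j * fst b', i * snd b + j * snd b'))"

definition smooth_fan :: "(rat \<times> rat) set set \<Rightarrow> bool" where
  "smooth_fan \<Sigma> \<longleftrightarrow>
    (\<forall>\<sigma>\<in>\<Sigma>. \<exists>b b' V. lattice_basis b b' \<and> V \<subseteq> {b, b'} \<and> \<sigma> = cone_gen V)"

definition rays :: "(rat \<times> rat) set set \<Rightarrow> (rat \<times> rat) set set" where
  "rays \<Sigma> = {\<rho> \<in> \<Sigma>. \<exists>v. v \<noteq> 0 \<and> \<rho> = cone_gen {v}}"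

text \<open>\<open>\<nu> 1, \<dots>, \<nu> l\<close> are the minimal generators of the rays, in counterclockwise order:
  consecutive rays span a positively oriented cone of the (complete) fan. The value
  \<open>\<nu> 0 = \<nu> l\<close> implements the cyclic numbering.\<close>

definition numbers_rays :: "(rat \<times> rat) set set \<Rightarrow> nat \<Rightarrow> (nat \<Rightarrow> int \<times> int) \<Rightarrow> bool" where
  "numbers_rays \<Sigma> l \<nu> \<longleftrightarrow> \<nu> 0 = \<nu> l \<and> (\<forall>i\<in>{1..l}. primitive (\<nu> i)) \<and>
    bij_betw (\<lambda>i. cone_gen {\<nu> i}) {1..l} (rays \<Sigma>) \<and>
    (\<forall>i<l. cone_gen {\<nu> i, \<nu> (Suc i)} \<in> \<Sigma> \<and> det2 (\<nu> i) (\<nu> (Suc i)) > 0)"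

text \<open>\<open>w = w\<^sub>i\<^sup>1\<close> and \<open>w' = w\<^sub>i\<^sup>2\<close>.\<close>

definition dual_generators :: "(nat \<Rightarrow> int \<times> int) \<Rightarrow> nat \<Rightarrow> int \<times> int \<Rightarrow> int \<times> int \<Rightarrow> bool" where
  "dual_generators \<nu> i w w' \<longleftrightarrow> primitive w \<and> primitive w' \<and> det2 w w' > 0 \<and>
    dual_cone (cone_gen {\<nu> i, \<nu> (Suc i)}) = cone_gen {w, w'} \<and>
    pairing (qvec (\<nu> (Suc i))) (qvec w) = 0 \<and> pairing (qvec (\<nu> i)) (qvec w') = 0"

subsection \<open>The toric surface of a fan\<close>

text \<open>The function field of the torus, with \<^typ>\<open>complex poly poly\<close> read as polynomials in
  \<open>y\<close> with coefficients in the polynomials in \<open>x\<close>.\<close>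

type_synonym field_xy = "complex poly poly fract"

definition const_xy :: "complex \<Rightarrow> field_xy" where
  "const_xy c = Fract [:[:c:]:] 1"

definition character :: "int \<times> int \<Rightarrow> field_xy" where
  "character u = Fract [:[:0, 1:]:] 1 powi fst u * Fract [:0, 1:] 1 powi snd u"

definition toric_ring :: "(rat \<times> rat) set \<Rightarrow> field_xy set" where
  "toric_ring \<sigma> = {\<Sum>u\<in>F. const_xy (c u) * character u | F c.
     finite F \<and> F \<subseteq> {u. qvec u \<in> dual_cone \<sigma>}}"

definition toric_surface ::
  "(rat \<times> rat) set set \<Rightarrow> (((rat \<times> rat) set \<times> field_xy set) set, field_xy) rspace" where
  "toric_surface \<Sigma> = glued_spec const_xy \<Sigma> toric_ring (\<lambda>\<sigma> \<tau>. {toric_ring (\<sigma> \<inter> \<tau>)})"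


section \<open>Slices and their decompositions\<close>

text \<open>The part of a cone where \<open>R\<close> equals 1; the point \<open>(p, 1)\<close> corresponds to \<open>p\<close>.\<close>

definition slice :: "(rat \<times> rat) set \<Rightarrow> rat set" where
  "slice \<sigma> = {p. (p, 1) \<in> \<sigma>}"

definition segments :: "(rat \<times> rat) set set \<Rightarrow> rat set set" where
  "segments \<Sigma> = {D \<in> slice ` \<Sigma>. \<exists>p\<in>D. \<exists>q\<in>D. p \<noteq> q}"

definition set_geq :: "rat set \<Rightarrow> rat set \<Rightarrow> bool" where
  "set_geq D D' \<longleftrightarrow> (\<forall>p\<in>D. \<forall>q\<in>D'. p \<ge> q)"

definition numbers_segments ::
  "(rat \<times> rat) set set \<Rightarrow> (nat \<Rightarrow> int \<times> int) \<Rightarrow> nat \<Rightarrow> (nat \<Rightarrow> rat set) \<Rightarrow> bool" where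
  "numbers_segments \<Sigma> \<nu> m \<Delta> \<longleftrightarrow> bij_betw \<Delta> {0..m+1} (segments \<Sigma>) \<and>
    (\<forall>i\<le>m. set_geq (\<Delta> i) (\<Delta> (Suc i))) \<and>
    (\<forall>i\<in>{1..m+1}. slice (cone_gen {\<nu> i}) = \<Delta> (i - 1) \<inter> \<Delta> i)"

definition polyhedron_in_Q :: "rat set \<Rightarrow> bool" where
  "polyhedron_in_Q D \<longleftrightarrow> (\<exists>p q. p \<le> q \<and> D = {p..q}) \<or> (\<exists>p. D = {p..}) \<or> (\<exists>q. D = {..q})"

definition subdivision_decomposition ::
  "nat \<Rightarrow> (nat \<Rightarrow> rat set) \<Rightarrow> (nat \<Rightarrow> rat set) \<Rightarrow> (nat \<Rightarrow> rat set) \<Rightarrow> bool" where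
  "subdivision_decomposition m \<Delta> D0 Dt \<longleftrightarrow>
    (\<forall>i\<le>m+1. polyhedron_in_Q (D0 i) \<and> polyhedron_in_Q (Dt i)) \<and>
    (\<forall>i\<le>m. set_geq (D0 i) (D0 (Suc i)) \<and> set_geq (Dt i) (Dt (Suc i))) \<and>
    (\<Union>i\<le>m+1. D0 i) = UNIV \<and> (\<Union>i\<le>m+1. Dt i) = UNIV \<and>
    (\<forall>i\<le>m+1. \<Delta> i = D0 i + Dt i)"

definition lattice_point :: "rat set \<Rightarrow> bool" where
  "lattice_point D \<longleftrightarrow> (\<exists>n::int. D = {of_int n})"

definition admissible_decomposition ::
  "nat \<Rightarrow> (nat \<Rightarrow> rat set) \<Rightarrow> (nat \<Rightarrow> rat set) \<Rightarrow> (nat \<Rightarrow> rat set) \<Rightarrow> bool" where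
  "admissible_decomposition m \<Delta> D0 Dt \<longleftrightarrow> subdivision_decomposition m \<Delta> D0 Dt \<and>
    (\<forall>i\<in>{1..m}. lattice_point (D0 i) \<or> lattice_point (Dt i))"

definition admissible_tuple :: "nat \<Rightarrow> (nat \<Rightarrow> rat set) \<Rightarrow> (nat \<Rightarrow> int) \<Rightarrow> bool" where
  "admissible_tuple m \<Delta> a \<longleftrightarrow> (\<forall>i\<le>m+1. a i \<in> {-1, 1}) \<and>
    (\<forall>i\<le>m. a i \<noteq> a (Suc i) \<longrightarrow> lattice_point (\<Delta> i \<inter> \<Delta> (Suc i)))"

text \<open>For admissible \<open>a\<close> this recursion determines \<open>lam 1, \<dots>, lam (m+1)\<close> from \<open>lam 0\<close>.\<close>

definition lambda_sequence ::
  "nat \<Rightarrow> (nat \<Rightarrow> rat set) \<Rightarrow> (nat \<Rightarrow> int) \<Rightarrow> (nat \<Rightarrow> int) \<Rightarrow> bool" where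
  "lambda_sequence m \<Delta> a lam \<longleftrightarrow> (\<forall>i\<le>m.
     if a (Suc i) = a i then lam (Suc i) = lam i
     else \<Delta> i \<inter> \<Delta> (Suc i) = {of_int (lam i + lam (Suc i))})"

definition encodes_decomposition ::
  "nat \<Rightarrow> (nat \<Rightarrow> rat set) \<Rightarrow> (nat \<Rightarrow> rat set) \<Rightarrow> (nat \<Rightarrow> rat set) \<Rightarrow> (nat \<Rightarrow> int) \<Rightarrow> (nat \<Rightarrow> int) \<Rightarrow> bool"
  where
  "encodes_decomposition m \<Delta> D0 Dt a lam \<longleftrightarrow>
    admissible_tuple m \<Delta> a \<and> lambda_sequence m \<Delta> a lam \<and>
    (\<forall>i\<le>m+1. \<Delta> i = (if a i = 1 then D0 i else Dt i) + {of_int (lam i)}) \<and>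
    (\<forall>i\<in>{1..m}. (if a i = 1 then Dt i else D0 i) = {of_int (lam i)})"


section \<open>The family\<close>

text \<open>\<^typ>\<open>complex poly poly poly\<close> is read as polynomials in \<open>t\<close> over polynomials in \<open>y\<close> over
  polynomials in \<open>x\<close>.\<close>

type_synonym field_xyt = "complex poly poly poly fract"

definition const_xyt :: "complex \<Rightarrow> field_xyt" where
  "const_xyt c = Fract [:[:[:c:]:]:] 1"

definition var_x :: field_xyt where "var_x = Fract [:[:[:0, 1:]:]:] 1"
definition var_y :: field_xyt where "var_y = Fract [:[:0, 1:]:] 1"
definition var_t :: field_xyt where "var_t = Fract [:0, 1:] 1"

definition Ztilde :: "int \<Rightarrow> int \<Rightarrow> int \<times> int \<Rightarrow> field_xyt" where
  "Ztilde a lam w = (let r = fst w; s = snd w in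
     if a = 1 then var_x powi r * var_y powi (s + lam * r) * (var_y - var_t) powi (- (lam * r))
     else var_x powi r * var_y powi (- (lam * r)) * (var_y - var_t) powi (s + lam * r))"

definition Atilde ::
  "nat \<Rightarrow> (nat \<Rightarrow> int) \<Rightarrow> (nat \<Rightarrow> int) \<Rightarrow> (nat \<Rightarrow> int \<times> int) \<Rightarrow> (nat \<Rightarrow> int \<times> int) \<Rightarrow> nat \<Rightarrow> field_xyt set"
  where
  "Atilde m a lam w1 w2 i =
    (if i \<le> m + 1
     then calg const_xyt {var_t, Ztilde (a i) (lam i) (w1 i), Ztilde (a i) (lam i) (w2 i)}
     else calg const_xyt {var_t, Ztilde 1 0 (w1 i), Ztilde 1 0 (w2 i), var_y / (var_y - var_t)})"

definition family ::
  "nat \<Rightarrow> nat \<Rightarrow> (nat \<Rightarrow> int) \<Rightarrow> (nat \<Rightarrow> int) \<Rightarrow> (nat \<Rightarrow> int \<times> int) \<Rightarrow> (nat \<Rightarrow> int \<times> int)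
     \<Rightarrow> ((nat \<times> field_xyt set) set, field_xyt) rspace" where
  "family l m a lam w1 w2 = glued_spec const_xyt {0..<l} (Atilde m a lam w1 w2)
     (\<lambda>i j. common_localizations (Atilde m a lam w1 w2 i) (Atilde m a lam w1 w2 j))"

definition ring_t :: "field_xyt set" where
  "ring_t = calg const_xyt {var_t}"

definition affine_line :: "(field_xyt set, field_xyt) rspace" where
  "affine_line = spec_in const_xyt ring_t"

definition origin :: "field_xyt set" where
  "origin = genideal (ring_on ring_t) {var_t}"

text \<open>The map glued from the maps of spectra given by the inclusions of \<^term>\<open>ring_t\<close> in the
  rings of the charts; a class \<^term>\<open>x\<close> consists of pairs of a chart and a prime ideal. On local
  rings it is given by inclusions of subrings of \<^typ>\<open>field_xyt\<close>.\<close>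

definition family_map :: "(nat \<times> field_xyt set) set \<Rightarrow> field_xyt set" where
  "family_map x = the_elem ((\<lambda>(i, p). p \<inter> ring_t) ` x)"

definition family_stalk_map :: "(nat \<times> field_xyt set) set \<Rightarrow> field_xyt \<Rightarrow> field_xyt" where
  "family_stalk_map x = (\<lambda>z. z)"

text \<open>The parameter of type \<^typ>\<open>'n itself\<close> is the one of \<^const>\<open>flat_module\<close>.\<close>

definition one_parameter_deformation ::
  "'n itself \<Rightarrow> ('q, 'u) rspace \<Rightarrow> ('p, 's) rspace \<Rightarrow> ('p \<Rightarrow> field_xyt set) \<Rightarrow> ('p \<Rightarrow> field_xyt \<Rightarrow> 's) \<Rightarrow> bool"
  where
  "one_parameter_deformation T Y X f h \<longleftrightarrow>
    is_scheme X \<and> rs_morphism X affine_line f h \<and> flat_morphism T X affine_line f h \<and>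
    rs_isomorphic (fiber X affine_line f h origin) Y"

end

theory Submission
  imports Defs "HOL-Computational_Algebra.Polynomial_Factorial" "HOL-Computational_Algebra.Field_as_Ring"
begin

text \<open>A point of a spectrum of a subring of a field is determined by its local ring in that field.
  On a scheme glued from such spectra along common localizations, two points are identified exactly
  when their local rings agree, and sections are locally constant functions with values in the field
  that lie in all local rings. Hence everything about \<open>X\<close> and \<open>Y\<close> can be read off from
  families of local rings in the two function fields.

  The family is flat because the local rings of the affine line are valuation rings, over which the
  torsion-free local rings of \<open>X\<close> are flat. For the special fibre, let \<open>red\<close> be the partial map
  from \<open>\<complex>(x, y, t)\<close> to \<open>\<complex>(x, y)\<close> that sets \<open>t = 0\<close>. It maps the ring of a chart of \<open>X\<close>
  onto the coordinate ring of the toric chart, with kernel generated by \<open>t\<close>, hence also the local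
  rings of \<open>X\<close> at points over the origin onto local rings of \<open>Y\<close>. It remains to show that local
  rings with the same image coincide. The lifts of a monomial to two charts differ by a power of
  \<open>y / (y - t)\<close>. This is a unit in the local ring unless the point lies on the orbit of a ray on
  which \<open>R\<close> is positive, and then the relation between \<open>\<lambda>\<^sub>i\<close> and \<open>\<lambda>\<^bsub>i+1\<^esub>\<close> makes both
  lifts lie in the local ring.\<close>

section \<open>Local subrings of a field\<close>

text \<open>Since charts are glued along all their common localizations, neither the points nor the
  open sets of \<open>X\<close> are given explicitly. Finite generation of the chart rings makes
  this tractable: if two points of two charts have equal local rings, finitely many denominators cut
  out a common localization around both of them. Away from \<open>t = 0\<close> the charts need not
  be compared at all, because being a scheme and being flat are local conditions on a chart or a
  stalk. The comparison with \<open>Y\<close> rests on a Nakayama-type remark: in a local ring over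
  the origin an element is a unit as soon as its reduction has an inverse that lifts to the ring. An
  inclusion between two such local rings can therefore be tested on the generators of one chart, and
  these are \<open>t\<close>, two lifted monomials and possibly \<open>y / (y - t)\<close>.
  Monomials of a toric chart also detect faces: those in a local ring of \<open>Y\<close> are the
  lattice points of the dual of one face, so equal local rings in two charts come from one common
  face.\<close>

lemma ring_on_simps [simp]:
  "carrier (ring_on S) = S" "a \<otimes>\<^bsub>ring_on S\<^esub> b = a * b" "a \<oplus>\<^bsub>ring_on S\<^esub> b = a + b"
  "\<one>\<^bsub>ring_on S\<^esub> = 1" "\<zero>\<^bsub>ring_on S\<^esub> = 0"
  by (simp_all add: ring_on_def)

definition field_subring :: "'k::field set \<Rightarrow> bool" where
  "field_subring A \<longleftrightarrow> 1 \<in> A \<and> (\<forall>a\<in>A. \<forall>b\<in>A. a - b \<in> A \<and> a * b \<in> A)"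

lemma field_subringI:
  assumes "1 \<in> A" "\<And>a b. a \<in> A \<Longrightarrow> b \<in> A \<Longrightarrow> a - b \<in> A" "\<And>a b. a \<in> A \<Longrightarrow> b \<in> A \<Longrightarrow> a * b \<in> A"
  shows "field_subring A"
  using assms by (simp add: field_subring_def)

context
  fixes A :: "'k::field set"
  assumes A: "field_subring A"
begin

lemma fs_one: "1 \<in> A" and fs_diff: "a \<in> A \<Longrightarrow> b \<in> A \<Longrightarrow> a - b \<in> A"
  and fs_mult: "a \<in> A \<Longrightarrow> b \<in> A \<Longrightarrow> a * b \<in> A"
  using A by (auto simp: field_subring_def)

lemma fs_zero: "0 \<in> A"
  using fs_diff[OF fs_one fs_one] by simp

lemma fs_minus: "a \<in> A \<Longrightarrow> - a \<in> A"
  using fs_diff[OF fs_zero, of a] by simp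

lemma fs_add: "a \<in> A \<Longrightarrow> b \<in> A \<Longrightarrow> a + b \<in> A"
  using fs_diff[of a "- b"] fs_minus by simp

lemma fs_power: "a \<in> A \<Longrightarrow> a ^ n \<in> A"
  by (induction n) (auto intro: fs_one fs_mult)

lemma fs_sum: "(\<And>i. i \<in> I \<Longrightarrow> f i \<in> A) \<Longrightarrow> sum f I \<in> A"
  by (induction I rule: infinite_finite_induct) (auto intro: fs_zero fs_add)

lemma fs_powi: "a \<in> A \<Longrightarrow> inverse a \<in> A \<Longrightarrow> a powi n \<in> A"
  unfolding power_int_def using fs_power by (auto simp flip: power_inverse)

lemmas fs_intros = fs_one fs_diff fs_mult fs_zero fs_minus fs_add fs_power fs_powi

lemma cring_ring_on: "cring (ring_on A)"
proof (rule cringI)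
  show "abelian_group (ring_on A)"
  proof (rule abelian_groupI)
    fix x assume "x \<in> carrier (ring_on A)"
    then show "\<exists>y\<in>carrier (ring_on A). y \<oplus>\<^bsub>ring_on A\<^esub> x = \<zero>\<^bsub>ring_on A\<^esub>"
      by (intro bexI[of _ "- x"]) (auto intro: fs_minus)
  qed (auto intro: fs_zero fs_add)
  show "Group.comm_monoid (ring_on A)"
    by (rule comm_monoidI) (auto intro: fs_one fs_mult)
qed (auto simp: algebra_simps)

lemma ideal_ring_on_iff:
  "ideal p (ring_on A) \<longleftrightarrow> p \<subseteq> A \<and> 0 \<in> p \<and> (\<forall>a\<in>p. \<forall>b\<in>p. a + b \<in> p) \<and> (\<forall>a\<in>A. \<forall>b\<in>p. a * b \<in> p)"
proof
  assume p: "ideal p (ring_on A)"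
  then interpret ideal p "ring_on A" .
  show "p \<subseteq> A \<and> 0 \<in> p \<and> (\<forall>a\<in>p. \<forall>b\<in>p. a + b \<in> p) \<and> (\<forall>a\<in>A. \<forall>b\<in>p. a * b \<in> p)"
    using a_subset I_l_closed additive_subgroup.zero_closed[OF is_additive_subgroup]
      additive_subgroup.a_closed[OF is_additive_subgroup] by auto
next
  assume p: "p \<subseteq> A \<and> 0 \<in> p \<and> (\<forall>a\<in>p. \<forall>b\<in>p. a + b \<in> p) \<and> (\<forall>a\<in>A. \<forall>b\<in>p. a * b \<in> p)"
  interpret cring "ring_on A" by (rule cring_ring_on)
  have inv: "\<ominus>\<^bsub>ring_on A\<^esub> x = - x" if "x \<in> A" for x
    using that minus_equality[of "- x" x] by (auto intro: fs_minus)
  have m: "- x \<in> p" if "x \<in> p" for x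
    using p that fs_minus[OF fs_one] by (metis mult_minus1)
  show "ideal p (ring_on A)"
  proof (rule idealI[OF ring_axioms])
    show "subgroup p (add_monoid (ring_on A))"
    proof (rule add.subgroupI)
      fix x assume "x \<in> p" then show "\<ominus>\<^bsub>ring_on A\<^esub> x \<in> p" using inv m p by auto
    qed (use p in auto)
    fix a x assume "a \<in> p" "x \<in> carrier (ring_on A)"
    then have "x * a \<in> p" using p by simp
    then show "x \<otimes>\<^bsub>ring_on A\<^esub> a \<in> p" "a \<otimes>\<^bsub>ring_on A\<^esub> x \<in> p" by (simp_all add: mult.commute)
  qed
qed

lemma primes_ring_on_iff:
  "p \<in> primes (ring_on A) \<longleftrightarrow> p \<subseteq> A \<and> 0 \<in> p \<and> (\<forall>a\<in>p. \<forall>b\<in>p. a + b \<in> p) \<and> (\<forall>a\<in>A. \<forall>b\<in>p. a * b \<in> p)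
     \<and> 1 \<notin> p \<and> (\<forall>a\<in>A. \<forall>b\<in>A. a * b \<in> p \<longrightarrow> a \<in> p \<or> b \<in> p)" (is "_ \<longleftrightarrow> ?R")
proof
  assume "p \<in> primes (ring_on A)"
  then interpret primeideal p "ring_on A" by (simp add: primes_def)
  show ?R
    using ideal_ring_on_iff is_ideal I_notcarr one_imp_carrier I_prime by auto
next
  assume p: ?R
  then have "ideal p (ring_on A)" using ideal_ring_on_iff by blast
  then have "primeideal p (ring_on A)"
    by (rule primeidealI[OF _ cring_ring_on]) (use p fs_one in auto)
  then show "p \<in> primes (ring_on A)" by (simp add: primes_def)
qed

end

lemma range_UNIV_field_subring: "field_subring (UNIV :: 'k::field set)"
  by (simp add: field_subring_def)

lemma calg_minimal:
  assumes "field_subring A" "range k \<subseteq> A" "G \<subseteq> A"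
  shows "calg k G \<subseteq> A"
proof
  fix z assume "z \<in> calg k G"
  then have "z \<in> generate_ring (ring_on UNIV) (range k \<union> G)" by (simp add: calg_def)
  then show "z \<in> A"
  proof induction
    case (a_inv h)
    interpret cring "ring_on (UNIV :: 'a set)" by (rule cring_ring_on[OF range_UNIV_field_subring])
    have "\<ominus>\<^bsub>ring_on UNIV\<^esub> h = - h" using minus_equality[of "- h" h] by simp
    then show ?case using fs_minus[OF assms(1)] a_inv by simp
  qed (use assms fs_intros[OF assms(1)] in auto)
qed

lemma field_subring_calg: "field_subring (calg k G)"
proof -
  interpret cring "ring_on (UNIV :: 'a set)" by (rule cring_ring_on[OF range_UNIV_field_subring])
  have m: "- h \<in> calg k G" if "h \<in> calg k G" for h
    using that generate_ring.a_inv[of h "ring_on UNIV" "range k \<union> G"] minus_equality[of "- h" h]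
    by (simp add: calg_def)
  have a: "h + h' \<in> calg k G" if "h \<in> calg k G" "h' \<in> calg k G" for h h'
    using that generate_ring.eng_add[of h "ring_on UNIV" "range k \<union> G" h'] by (simp add: calg_def)
  show ?thesis
  proof (rule field_subringI)
    show "1 \<in> calg k G"
      using generate_ring.one[of "ring_on UNIV" "range k \<union> G"] by (simp add: calg_def)
    show "h - h' \<in> calg k G" if "h \<in> calg k G" "h' \<in> calg k G" for h h'
      using a[OF that(1) m[OF that(2)]] by simp
    show "h * h' \<in> calg k G" if "h \<in> calg k G" "h' \<in> calg k G" for h h'
      using that generate_ring.eng_mult[of h "ring_on UNIV" "range k \<union> G" h'] by (simp add: calg_def)
  qed
qed

lemma calg_incl: "z \<in> G \<Longrightarrow> z \<in> calg k G" and calg_const: "k c \<in> calg k G"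
  unfolding calg_def by (auto intro: generate_ring.incl)

text \<open>Zero has to be listed separately, because \<open>inverse 0 = 0\<close> belongs to every
  subring. For a local subring this is the maximal ideal.\<close>

definition nonunits :: "'k::field set \<Rightarrow> 'k set" where
  "nonunits L = {z \<in> L. z = 0 \<or> inverse z \<notin> L}"

definition local_subring :: "'k::field set \<Rightarrow> bool" where
  "local_subring L \<longleftrightarrow> field_subring L \<and> (\<forall>a\<in>nonunits L. \<forall>b\<in>nonunits L. a + b \<in> nonunits L)"

lemma nonunits_mult:
  assumes "field_subring L" "a \<in> L" "b \<in> nonunits L"
  shows "a * b \<in> nonunits L"
proof (cases "a = 0 \<or> b = 0")
  case True then show ?thesis using assms fs_zero[OF assms(1)] by (auto simp: nonunits_def)
next
  case False
  have "inverse b \<in> L" if "inverse (a * b) \<in> L"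
    using fs_mult[OF assms(1) assms(2) that] False by (simp add: field_simps)
  then show ?thesis using assms False fs_mult[OF assms(1)] by (auto simp: nonunits_def)
qed

text \<open>The contraction of a maximal ideal; points of charts are produced from local rings in
  this way.\<close>

lemma local_subring_primes:
  assumes L: "local_subring L" and B: "field_subring B" "B \<subseteq> L"
  shows "nonunits L \<inter> B \<in> primes (ring_on B)"
proof -
  have FL: "field_subring L" using L by (simp add: local_subring_def)
  have "inverse (a * b) \<in> L" if "inverse a \<in> L" "inverse b \<in> L" for a b
    using fs_mult[OF FL that] by (simp add: mult.commute)
  then show ?thesis
    unfolding primes_ring_on_iff[OF B(1)]
    using L B fs_intros[OF B(1)] nonunits_mult[OF FL] fs_intros[OF FL]
    by (auto simp: local_subring_def) (auto simp: nonunits_def)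
qed

text \<open>An ideal containing a unit contains 1, so every proper ideal consists of
  nonunits.\<close>

lemma maximalideal_nonunits:
  assumes L: "local_subring L"
  shows "maximalideal I (ring_on L) \<longleftrightarrow> I = nonunits L"
proof -
  have FL: "field_subring L" using L by (simp add: local_subring_def)
  have pr: "nonunits L \<in> primes (ring_on L)"
    using local_subring_primes[OF L FL order.refl]
    by (simp add: Int_absorb2 nonunits_def)
  have sub: "I \<subseteq> nonunits L" if I: "ideal I (ring_on L)" "I \<noteq> L" for I
  proof
    fix z assume z: "z \<in> I"
    have zL: "z \<in> L" using z I ideal_ring_on_iff[OF FL] by auto
    have "z \<in> nonunits L" if "z \<noteq> 0" "inverse z \<in> L"
    proof -
      have "1 \<in> I" using I(1) z that ideal_ring_on_iff[OF FL] by (metis left_inverse)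
      then have "I = L" using I(1) ideal_ring_on_iff[OF FL]
        by (metis mult.right_neutral subsetI subset_antisym)
      then show ?thesis using I by simp
    qed
    then show "z \<in> nonunits L" using zL by (auto simp: nonunits_def)
  qed
  have id: "ideal (nonunits L) (ring_on L)" and one: "1 \<notin> nonunits L"
    using pr unfolding primes_ring_on_iff[OF FL] ideal_ring_on_iff[OF FL] by auto
  have ne: "nonunits L \<noteq> L" using one fs_one[OF FL] by auto
  show ?thesis
  proof
    assume "maximalideal I (ring_on L)"
    then interpret maximalideal I "ring_on L" .
    show "I = nonunits L"
      using I_maximal[OF id] sub[OF is_ideal] I_notcarr ne by (auto simp: nonunits_def)
  next
    assume "I = nonunits L"
    moreover have "maximalideal (nonunits L) (ring_on L)"
      by (rule maximalidealI[OF id]) (use ne sub in auto)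
    ultimately show "maximalideal I (ring_on L)" by simp
  qed
qed

lemma local_ring_ring_on: "local_subring L \<Longrightarrow> local_ring (ring_on L)"
  unfolding local_ring_def using maximalideal_nonunits
  by (auto simp: local_subring_def cring_ring_on)

lemma max_ideal_ring_on: "local_subring L \<Longrightarrow> max_ideal (ring_on L) = nonunits L"
  unfolding max_ideal_def by (simp add: maximalideal_nonunits)

lemma local_hom_subset:
  assumes "local_subring L" "local_subring L'" "L \<subseteq> L'" "nonunits L \<subseteq> nonunits L'"
  shows "local_hom (ring_on L) (ring_on L') (\<lambda>z. z)"
  using assms by (auto simp: local_hom_def max_ideal_ring_on ring_hom_def)

section \<open>Localization at a prime, inside the field\<close>

context
  fixes A p :: "'k::field set"
  assumes A: "field_subring A" and p: "p \<in> primes (ring_on A)"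
begin

lemma prime_simps:
  shows pr_sub: "p \<subseteq> A" and pr_zero: "0 \<in> p" and pr_one: "1 \<notin> p"
    and pr_add: "a \<in> p \<Longrightarrow> b \<in> p \<Longrightarrow> a + b \<in> p"
    and pr_mult: "a \<in> A \<Longrightarrow> b \<in> p \<Longrightarrow> a * b \<in> p"
    and pr_mult_iff: "a \<in> A \<Longrightarrow> b \<in> A \<Longrightarrow> a * b \<in> p \<longleftrightarrow> a \<in> p \<or> b \<in> p"
proof -
  note * = p[unfolded primes_ring_on_iff[OF A]]
  show "p \<subseteq> A" "0 \<in> p" "1 \<notin> p" "a \<in> p \<Longrightarrow> b \<in> p \<Longrightarrow> a + b \<in> p" using * by blast+
  show m: "a * b \<in> p" if "a \<in> A" "b \<in> p" for a b using * that by blast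
  show "a \<in> A \<Longrightarrow> b \<in> A \<Longrightarrow> a * b \<in> p \<longleftrightarrow> a \<in> p \<or> b \<in> p"
    using * m[of a b] m[of b a] by (metis mult.commute)
qed

lemma pr_power_iff: "a \<in> A \<Longrightarrow> a ^ n \<in> p \<longleftrightarrow> a \<in> p \<and> n > 0"
  by (induction n) (auto simp: pr_one pr_mult_iff fs_power[OF A])

lemma local_ring_in_iff: "z \<in> local_ring_in A p \<longleftrightarrow> (\<exists>s\<in>A - p. s * z \<in> A)"
proof
  assume "z \<in> local_ring_in A p"
  then obtain a s where "z = a / s" "a \<in> A" "s \<in> A - p" by (auto simp: local_ring_in_def localization_in_def)
  then show "\<exists>s\<in>A - p. s * z \<in> A" using pr_zero by (intro bexI[of _ s]) auto
next
  assume "\<exists>s\<in>A - p. s * z \<in> A"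
  then obtain s where "s \<in> A - p" "s * z \<in> A" by auto
  moreover from this have "z = (s * z) / s" using pr_zero by auto
  ultimately show "z \<in> local_ring_in A p" unfolding local_ring_in_def localization_in_def by blast
qed

lemma local_ring_in_div: "a \<in> A \<Longrightarrow> s \<in> A \<Longrightarrow> s \<notin> p \<Longrightarrow> a / s \<in> local_ring_in A p"
  by (auto simp: local_ring_in_def localization_in_def)

lemma local_ring_in_incl: "A \<subseteq> local_ring_in A p"
  using local_ring_in_div[of _ 1] pr_one fs_one[OF A] by auto

lemma inverse_in_local_ring: "s \<in> A \<Longrightarrow> s \<notin> p \<Longrightarrow> inverse s \<in> local_ring_in A p"
  using local_ring_in_div[of 1 s] fs_one[OF A] by (simp add: field_simps)

lemma inverse_in_local_ring_iff: "s \<in> A \<Longrightarrow> s \<noteq> 0 \<Longrightarrow> inverse s \<in> local_ring_in A p \<longleftrightarrow> s \<notin> p"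
proof
  assume s: "s \<in> A" "s \<noteq> 0" "inverse s \<in> local_ring_in A p"
  then obtain u where u: "u \<in> A - p" "u * inverse s \<in> A" using local_ring_in_iff by blast
  show "s \<notin> p"
  proof
    assume "s \<in> p"
    then have "(u * inverse s) * s \<in> p" using u pr_mult by blast
    then show False using u s by (simp add: mult.assoc)
  qed
qed (rule inverse_in_local_ring)

lemma field_subring_local: "field_subring (local_ring_in A p)"
proof (rule field_subringI)
  show "1 \<in> local_ring_in A p" using local_ring_in_incl fs_one[OF A] by auto
  fix a b assume "a \<in> local_ring_in A p" "b \<in> local_ring_in A p"
  then obtain s u where s: "s \<in> A - p" "s * a \<in> A" and u: "u \<in> A - p" "u * b \<in> A"
    using local_ring_in_iff by blast
  have su: "s * u \<in> A - p" using s u pr_mult_iff fs_mult[OF A] by auto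
  have "(s * u) * (a - b) = u * (s * a) - s * (u * b)" by (simp add: algebra_simps)
  moreover have "(s * u) * (a * b) = (s * a) * (u * b)" by (simp add: algebra_simps)
  ultimately show "a - b \<in> local_ring_in A p" "a * b \<in> local_ring_in A p"
    using su s u fs_intros[OF A] local_ring_in_iff by (metis DiffD1)+
qed

lemma nonunits_local_iff: "z \<in> nonunits (local_ring_in A p) \<longleftrightarrow> (\<exists>s\<in>A - p. s * z \<in> p)"
proof
  assume z: "z \<in> nonunits (local_ring_in A p)"
  then obtain s where s: "s \<in> A - p" "s * z \<in> A" by (auto simp: nonunits_def local_ring_in_iff)
  have "s * z \<in> p"
  proof (rule ccontr)
    assume "s * z \<notin> p"
    then have "s / (s * z) \<in> local_ring_in A p" using s local_ring_in_div by blast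
    moreover have "z \<noteq> 0" using \<open>s * z \<notin> p\<close> pr_zero by auto
    moreover have "s / (s * z) = inverse z" using s pr_zero by (auto simp: field_simps)
    ultimately show False using z by (auto simp: nonunits_def)
  qed
  then show "\<exists>s\<in>A - p. s * z \<in> p" using s by blast
next
  assume "\<exists>s\<in>A - p. s * z \<in> p"
  then obtain s where s: "s \<in> A - p" "s * z \<in> p" by blast
  have zl: "z \<in> local_ring_in A p" using s pr_sub by (auto simp: local_ring_in_iff)
  have "z \<in> nonunits (local_ring_in A p)" if zi: "inverse z \<in> local_ring_in A p" "z \<noteq> 0"
  proof -
    obtain u where u: "u \<in> A - p" "u * inverse z \<in> A" using zi(1) unfolding local_ring_in_iff by blast
    have "(u * inverse z) * (s * z) \<in> p" using u s pr_mult by blast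
    then have "u * s \<in> p" using zi by (simp add: field_simps)
    then show ?thesis using u s pr_mult_iff by auto
  qed
  then show "z \<in> nonunits (local_ring_in A p)" using zl by (auto simp: nonunits_def)
qed

lemma local_subring_local: "local_subring (local_ring_in A p)"
  unfolding local_subring_def
proof (intro conjI field_subring_local ballI)
  fix a b assume "a \<in> nonunits (local_ring_in A p)" "b \<in> nonunits (local_ring_in A p)"
  then obtain s u where s: "s \<in> A - p" "s * a \<in> p" and u: "u \<in> A - p" "u * b \<in> p"
    using nonunits_local_iff by blast
  have su: "s * u \<in> A - p" using s u pr_mult_iff fs_mult[OF A] by auto
  have "(s * u) * (a + b) = u * (s * a) + s * (u * b)" by (simp add: algebra_simps)
  then have "(s * u) * (a + b) \<in> p" using s u pr_mult pr_add by auto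
  then show "a + b \<in> nonunits (local_ring_in A p)" using su nonunits_local_iff by blast
qed

text \<open>Hence a prime of a chart can be recovered from its local ring.\<close>

lemma nonunits_local_Int: "nonunits (local_ring_in A p) \<inter> A = p"
proof (intro equalityI subsetI)
  fix z assume "z \<in> nonunits (local_ring_in A p) \<inter> A"
  then show "z \<in> p" using nonunits_local_iff pr_mult_iff by auto
next
  fix z assume z: "z \<in> p"
  then have "1 * z \<in> p" by simp
  then show "z \<in> nonunits (local_ring_in A p) \<inter> A"
    using z nonunits_local_iff pr_one fs_one[OF A] pr_sub by blast
qed

end

text \<open>Localization without a chosen multiplicative set: the largest possible one, the nonzero
  elements of \<open>A\<close> with inverse in \<open>B\<close>, takes its place. For subrings this
  agrees with \<open>is_localization_of\<close>.\<close>

definition localizes :: "'k::field set \<Rightarrow> 'k set \<Rightarrow> bool" where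
  "localizes B A \<longleftrightarrow> A \<subseteq> B \<and> (\<forall>z\<in>B. \<exists>s\<in>A. s \<noteq> 0 \<and> inverse s \<in> B \<and> s * z \<in> A)"

lemma is_localization_of_localizes:
  assumes A: "field_subring A" and B: "is_localization_of B A"
  shows "field_subring B" "localizes B A"
proof -
  obtain S where S: "S \<subseteq> A" "1 \<in> S" "0 \<notin> S" "\<And>s u. s \<in> S \<Longrightarrow> u \<in> S \<Longrightarrow> s * u \<in> S"
    and Beq: "B = localization_in A S" using B by (auto simp: is_localization_of_def)
  have mem: "z \<in> B \<longleftrightarrow> (\<exists>s\<in>S. s * z \<in> A)" for z
  proof
    assume "\<exists>s\<in>S. s * z \<in> A"
    then obtain s where "s \<in> S" "s * z \<in> A" by auto
    moreover from this have "z = (s * z) / s" using S by auto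
    ultimately show "z \<in> B" unfolding Beq localization_in_def by blast
  qed (use S in \<open>force simp: Beq localization_in_def\<close>)
  have inv: "inverse s \<in> B" if "s \<in> S" for s
  proof -
    have "s * inverse s = 1" using that S by (metis right_inverse)
    then show ?thesis using that fs_one[OF A] unfolding mem by (intro bexI[of _ s]) auto
  qed
  show "field_subring B"
  proof (rule field_subringI)
    show "1 \<in> B" using S fs_one[OF A] mem by auto
    fix a b assume "a \<in> B" "b \<in> B"
    then obtain s u where s: "s \<in> S" "s * a \<in> A" and u: "u \<in> S" "u * b \<in> A" using mem by blast
    have "(s * u) * (a - b) = u * (s * a) - s * (u * b)" by (simp add: algebra_simps)
    moreover have "(s * u) * (a * b) = (s * a) * (u * b)" by (simp add: algebra_simps)
    ultimately show "a - b \<in> B" "a * b \<in> B"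
      using S(1) S(4)[OF s(1) u(1)] s u fs_intros[OF A] mem by (metis subsetD)+
  qed
  show "localizes B A" unfolding localizes_def
  proof (intro conjI ballI)
    show "A \<subseteq> B" using mem S by force
    show "\<exists>s\<in>A. s \<noteq> 0 \<and> inverse s \<in> B \<and> s * z \<in> A" if "z \<in> B" for z
      using that inv S mem by (metis subsetD)
  qed
qed

lemma localizes_is_localization_of:
  assumes A: "field_subring A" and B: "field_subring B" and AB: "localizes B A"
  shows "is_localization_of B A"
proof -
  let ?S = "{s \<in> A. s \<noteq> 0 \<and> inverse s \<in> B}"
  have "B = localization_in A ?S"
  proof (intro equalityI subsetI)
    fix z assume "z \<in> B"
    then obtain s where s: "s \<in> ?S" "s * z \<in> A" using AB by (auto simp: localizes_def)
    then have "z = (s * z) / s" by auto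
    then show "z \<in> localization_in A ?S" using s unfolding localization_in_def by blast
  next
    fix z assume "z \<in> localization_in A ?S"
    then show "z \<in> B" using AB fs_mult[OF B] by (auto simp: localization_in_def localizes_def divide_inverse)
  qed
  then show ?thesis unfolding is_localization_of_def
    using fs_intros[OF A] fs_intros[OF B] by (intro exI[of _ ?S]) auto
qed

text \<open>A denominator from \<open>B\<close> becomes one from \<open>A\<close> after
  multiplication by an element of \<open>A\<close> that is a unit of \<open>B\<close> and hence
  avoids \<open>P\<close>.\<close>

lemma local_ring_localizes:
  assumes A: "field_subring A" and B: "field_subring B" and AB: "localizes B A"
    and P: "P \<in> primes (ring_on B)"
  shows "P \<inter> A \<in> primes (ring_on A)" "local_ring_in B P = local_ring_in A (P \<inter> A)"
proof -
  note PS = prime_simps[OF B P]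
  have sub: "A \<subseteq> B" using AB by (simp add: localizes_def)
  show PA: "P \<inter> A \<in> primes (ring_on A)"
    unfolding primes_ring_on_iff[OF A] using PS(1-5) PS(6)[OF subsetD[OF sub] subsetD[OF sub]]
      sub fs_intros[OF A] by auto
  have unit: "s \<notin> P" if "s \<noteq> 0" "inverse s \<in> B" for s
    using that PS(3) PS(5)[of "inverse s" s] by auto
  show "local_ring_in B P = local_ring_in A (P \<inter> A)"
  proof (intro equalityI subsetI)
    fix z assume "z \<in> local_ring_in B P"
    then obtain w where w: "w \<in> B - P" "w * z \<in> B" using local_ring_in_iff[OF B P] by blast
    obtain s where s: "s \<in> A" "s \<noteq> 0" "inverse s \<in> B" "s * w \<in> A" using AB w by (auto simp: localizes_def)
    obtain u where u: "u \<in> A" "u \<noteq> 0" "inverse u \<in> B" "u * (w * z) \<in> A" using AB w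
      by (auto simp: localizes_def)
    have "u * (s * w) \<in> A - (P \<inter> A)"
    proof -
      have "s * w \<notin> P" "u \<notin> P" using PS(6)[of s w] s u w unit sub by auto
      then have "u * (s * w) \<notin> P" using PS(6)[of u "s * w"] s u sub by auto
      then show ?thesis using fs_mult[OF A u(1) s(4)] by auto
    qed
    moreover have "u * (s * w) * z = s * (u * (w * z))" by (simp add: algebra_simps)
    ultimately show "z \<in> local_ring_in A (P \<inter> A)"
      using fs_mult[OF A s(1) u(4)] local_ring_in_iff[OF A PA] by metis
  next
    fix z assume "z \<in> local_ring_in A (P \<inter> A)"
    then show "z \<in> local_ring_in B P"
      using sub unfolding local_ring_in_def localization_in_def by blast
  qed
qed

text \<open>Describes the image of a spectrum through local rings alone. The prime of
  \<open>B\<close> above \<open>q\<close> is the contraction of the maximal ideal of the local ring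
  at \<open>q\<close>.\<close>

lemma localizes_primes_image:
  assumes A: "field_subring A" and B: "field_subring B" and AB: "localizes B A"
  shows "(\<lambda>P. P \<inter> A) ` primes (ring_on B) = {q \<in> primes (ring_on A). B \<subseteq> local_ring_in A q}"
proof (intro equalityI subsetI)
  fix q assume "q \<in> (\<lambda>P. P \<inter> A) ` primes (ring_on B)"
  then obtain P where P: "P \<in> primes (ring_on B)" "q = P \<inter> A" by blast
  then show "q \<in> {q \<in> primes (ring_on A). B \<subseteq> local_ring_in A q}"
    using local_ring_localizes[OF A B AB P(1)] local_ring_in_incl[OF B P(1)] by auto
next
  fix q assume "q \<in> {q \<in> primes (ring_on A). B \<subseteq> local_ring_in A q}"
  then have q: "q \<in> primes (ring_on A)" "B \<subseteq> local_ring_in A q" by auto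
  let ?P = "nonunits (local_ring_in A q) \<inter> B"
  have "?P \<in> primes (ring_on B)"
    by (rule local_subring_primes[OF local_subring_local[OF A q(1)] B q(2)])
  moreover have "?P \<inter> A = q"
    using nonunits_local_Int[OF A q(1)] AB by (auto simp: localizes_def)
  ultimately show "q \<in> (\<lambda>P. P \<inter> A) ` primes (ring_on B)" by blast
qed

lemma local_ring_in_subset_eq:
  assumes A: "field_subring A" and p: "p \<in> primes (ring_on A)"
    and B: "field_subring B" and q: "q \<in> primes (ring_on B)"
    and sub: "A \<subseteq> local_ring_in B q" and un: "\<And>z. z \<in> A - p \<Longrightarrow> inverse z \<in> local_ring_in B q"
  shows "local_ring_in A p \<subseteq> local_ring_in B q"
proof
  fix z assume "z \<in> local_ring_in A p"
  then obtain a s where "z = a / s" "a \<in> A" "s \<in> A - p" by (auto simp: local_ring_in_def localization_in_def)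
  then show "z \<in> local_ring_in B q"
    using sub un fs_mult[OF field_subring_local[OF B q]] by (auto simp: divide_inverse)
qed

section \<open>The Zariski topology\<close>

text \<open>The definition applies \<open>topology\<close> to a predicate, which says nothing about
  open sets until the predicate is known to be closed under finite intersections and unions.\<close>

lemma openin_zariski:
  assumes "cring R"
  shows "openin (zariski R) U \<longleftrightarrow> (\<exists>E\<subseteq>carrier R. U = {p \<in> primes R. \<not> E \<subseteq> p})"
proof -
  interpret cring R by (rule assms)
  let ?O = "\<lambda>U. \<exists>E\<subseteq>carrier R. U = {p \<in> primes R. \<not> E \<subseteq> p}"
  have "istopology ?O" unfolding istopology_def
  proof (intro conjI allI impI)
    fix U V assume "?O U" "?O V"
    then obtain E F where E: "E \<subseteq> carrier R" "U = {p \<in> primes R. \<not> E \<subseteq> p}"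
      and F: "F \<subseteq> carrier R" "V = {p \<in> primes R. \<not> F \<subseteq> p}" by blast
    \<comment> \<open>A prime contains a product exactly if it contains a factor, so the products
      cut out the intersection.\<close>
    let ?G = "{a \<otimes>\<^bsub>R\<^esub> b | a b. a \<in> E \<and> b \<in> F}"
    have "U \<inter> V = {p \<in> primes R. \<not> ?G \<subseteq> p}"
    proof (intro equalityI subsetI)
      fix p assume p: "p \<in> U \<inter> V"
      then interpret primeideal p R by (simp add: E primes_def)
      show "p \<in> {p \<in> primes R. \<not> ?G \<subseteq> p}"
      proof -
        obtain a b where "a \<in> E" "a \<notin> p" "b \<in> F" "b \<notin> p" using p E F by blast
        moreover from this have "a \<otimes>\<^bsub>R\<^esub> b \<notin> p" using I_prime E F by blast
        ultimately show ?thesis using p E by blast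
      qed
    next
      fix p assume p: "p \<in> {p \<in> primes R. \<not> ?G \<subseteq> p}"
      then interpret primeideal p R by (simp add: primes_def)
      show "p \<in> U \<inter> V"
      proof -
        obtain a b where ab: "a \<in> E" "b \<in> F" "a \<otimes>\<^bsub>R\<^esub> b \<notin> p" using p by blast
        then have "a \<notin> p" "b \<notin> p" using I_l_closed[of b a] I_r_closed[of a b] E F by blast+
        then show ?thesis using p E F ab by blast
      qed
    qed
    moreover have "?G \<subseteq> carrier R" using E F by auto
    ultimately show "?O (U \<inter> V)" by blast
  next
    fix \<U> assume *: "\<forall>U\<in>\<U>. ?O U"
    then obtain E where E: "\<And>U. U \<in> \<U> \<Longrightarrow> E U \<subseteq> carrier R \<and> U = {p \<in> primes R. \<not> E U \<subseteq> p}" by metis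
    have "\<Union>\<U> = {p \<in> primes R. \<not> (\<Union>U\<in>\<U>. E U) \<subseteq> p}"
    proof (intro equalityI subsetI)
      fix p assume "p \<in> \<Union>\<U>"
      then obtain U where U: "U \<in> \<U>" "p \<in> U" by blast
      then have "p \<in> {p \<in> primes R. \<not> E U \<subseteq> p}" using E by blast
      then show "p \<in> {p \<in> primes R. \<not> (\<Union>U\<in>\<U>. E U) \<subseteq> p}" using U by blast
    next
      fix p assume "p \<in> {p \<in> primes R. \<not> (\<Union>U\<in>\<U>. E U) \<subseteq> p}"
      then obtain U where U: "U \<in> \<U>" "\<not> E U \<subseteq> p" "p \<in> primes R" by blast
      then have "p \<in> U" using E[OF U(1)] by blast
      then show "p \<in> \<Union>\<U>" using U by blast
    qed
    moreover have "(\<Union>U\<in>\<U>. E U) \<subseteq> carrier R" using E by blast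
    ultimately show "?O (\<Union>\<U>)" by blast
  qed
  then show ?thesis unfolding zariski_def by (simp add: topology_inverse')
qed

lemma topspace_zariski: "cring R \<Longrightarrow> topspace (zariski R) = primes R"
proof -
  assume R: "cring R"
  then interpret cring R .
  have "primes R = {p \<in> primes R. \<not> carrier R \<subseteq> p}"
  proof (intro equalityI subsetI CollectI conjI)
    fix p assume p: "p \<in> primes R"
    then interpret primeideal p R by (simp add: primes_def)
    show "\<not> carrier R \<subseteq> p" using I_notcarr a_subset by auto
    show "p \<in> primes R" by (rule p)
  qed blast
  then have "openin (zariski R) (primes R)" using openin_zariski[OF R] by blast
  moreover have "U \<subseteq> primes R" if "openin (zariski R) U" for U using that openin_zariski[OF R] by auto
  ultimately show ?thesis unfolding topspace_def by blast
qed

lemma openin_zariski_iff: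
  assumes R: "cring R"
  shows "openin (zariski R) U \<longleftrightarrow>
    U \<subseteq> primes R \<and> (\<forall>p\<in>U. \<exists>a\<in>carrier R - p. \<forall>q\<in>primes R. a \<notin> q \<longrightarrow> q \<in> U)" (is "_ \<longleftrightarrow> ?R")
proof
  assume "openin (zariski R) U"
  then obtain E where E: "E \<subseteq> carrier R" "U = {p \<in> primes R. \<not> E \<subseteq> p}"
    using openin_zariski[OF R] by blast
  show ?R
  proof (intro conjI ballI)
    fix p assume "p \<in> U"
    then obtain a where "a \<in> E" "a \<notin> p" using E by auto
    then show "\<exists>a\<in>carrier R - p. \<forall>q\<in>primes R. a \<notin> q \<longrightarrow> q \<in> U"
      using E by (intro bexI[of _ a]) auto
  qed (simp add: E)
next
  assume U: ?R
  \<comment> \<open>The largest possible set of equations: all \<open>a\<close> whose distinguished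
    open set lies in \<open>U\<close>.\<close>
  let ?E = "{a \<in> carrier R. \<forall>q\<in>primes R. a \<notin> q \<longrightarrow> q \<in> U}"
  have "U = {p \<in> primes R. \<not> ?E \<subseteq> p}" using U by blast
  then show "openin (zariski R) U" unfolding openin_zariski[OF R] by (intro exI[of _ ?E]) auto
qed

lemma openin_basic:
  assumes A: "field_subring A"
  shows "a \<in> A \<Longrightarrow> openin (zariski (ring_on A)) {q \<in> primes (ring_on A). a \<notin> q}"
  unfolding openin_zariski_iff[OF cring_ring_on[OF A]] by auto

text \<open>The domain of definition of a rational function is open: a denominator at
  \<open>p\<close> still works at every prime that avoids it.\<close>

lemma openin_local_ring_mem:
  assumes A: "field_subring A"
  shows "openin (zariski (ring_on A)) {q \<in> primes (ring_on A). z \<in> local_ring_in A q}"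
  unfolding openin_zariski_iff[OF cring_ring_on[OF A]]
proof (intro conjI ballI)
  fix p assume "p \<in> {q \<in> primes (ring_on A). z \<in> local_ring_in A q}"
  then have "\<exists>s\<in>A - p. s * z \<in> A" using local_ring_in_iff[OF A] by blast
  then show "\<exists>a\<in>carrier (ring_on A) - p. \<forall>q\<in>primes (ring_on A). a \<notin> q \<longrightarrow>
      q \<in> {q \<in> primes (ring_on A). z \<in> local_ring_in A q}"
    using local_ring_in_iff[OF A] by fastforce
qed auto

section \<open>Ring isomorphisms and local rings\<close>

lemma ring_iso_maximalideal:
  assumes h: "h \<in> ring_iso R S" and R: "ring R" and S: "ring S" and I: "maximalideal I R"
  shows "maximalideal (h ` I) S"
proof -
  let ?g = "inv_into (carrier R) h"
  have g: "?g \<in> ring_iso S R" by (rule ring_iso_set_sym[OF R h])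
  have bij: "bij_betw h (carrier R) (carrier S)" using h by (simp add: ring_iso_def)
  have sur: "h ` carrier R = carrier S" and inj: "inj_on h (carrier R)"
    using bij by (auto simp: bij_betw_def)
  interpret hh: ring_hom_ring R S h
    by (rule ring_hom_ringI2[OF R S]) (use h in \<open>simp add: ring_iso_def\<close>)
  interpret gg: ring_hom_ring S R ?g
    by (rule ring_hom_ringI2[OF S R]) (use g in \<open>simp add: ring_iso_def\<close>)
  interpret I: maximalideal I R by (rule I)
  have Is: "I \<subseteq> carrier R" by (rule I.a_subset)
  have him: "h ` J = {s \<in> carrier S. ?g s \<in> J}" if "J \<subseteq> carrier R" for J
  proof (intro equalityI subsetI)
    fix s assume "s \<in> {s \<in> carrier S. ?g s \<in> J}"
    then show "s \<in> h ` J" using sur f_inv_into_f[of s h "carrier R"]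
      by (metis (no_types, lifting) image_eqI mem_Collect_eq)
  next
    fix s assume "s \<in> h ` J"
    then obtain r where r: "r \<in> J" "s = h r" by blast
    then have "r \<in> carrier R" using that by blast
    then show "s \<in> {s \<in> carrier S. ?g s \<in> J}" using r inv_into_f_f[OF inj] sur by auto
  qed
  show ?thesis
  proof (rule maximalidealI)
    show "ideal (h ` I) S" unfolding him[OF Is] by (rule gg.ideal_vimage[OF I.is_ideal])
    show "carrier S \<noteq> h ` I"
      using I.I_notcarr sur inj_on_image_eq_iff[OF inj Is order.refl] by auto
  next
    fix J assume J: "ideal J S" "h ` I \<subseteq> J" "J \<subseteq> carrier S"
    let ?V = "{r \<in> carrier R. h r \<in> J}"
    have "?V = I \<or> ?V = carrier R"
      by (rule I.I_maximal[OF hh.ideal_vimage[OF J(1)]]) (use J Is in auto)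
    moreover have "h ` ?V = J" using J sur by auto
    ultimately show "J = h ` I \<or> J = carrier S" using sur by auto
  qed
qed

lemma ring_iso_local:
  assumes h: "h \<in> ring_iso R S" and R: "local_ring R" and S: "cring S"
  shows "local_ring S" "max_ideal S = h ` max_ideal R"
    "local_hom R S h" "local_hom S R (inv_into (carrier R) h)"
proof -
  have rR: "ring R" and rS: "ring S" and cR: "cring R"
    using R S by (auto simp: local_ring_def cring.axioms(1))
  let ?g = "inv_into (carrier R) h"
  have g: "?g \<in> ring_iso S R" by (rule ring_iso_set_sym[OF rR h])
  obtain I where I: "maximalideal I R" "\<And>J. maximalideal J R \<Longrightarrow> J = I"
    using R by (auto simp: local_ring_def)
  have bij: "bij_betw h (carrier R) (carrier S)" using h by (simp add: ring_iso_def)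
  have sub: "J \<subseteq> carrier R" if "maximalideal J R" for J :: "'a set"
    using that by (meson additive_subgroup.a_subset ideal_def maximalideal_def)
  have subS: "J \<subseteq> carrier S" if "maximalideal J S" for J
    using that by (meson additive_subgroup.a_subset ideal_def maximalideal_def)
  have hI: "maximalideal (h ` I) S" by (rule ring_iso_maximalideal[OF h rR rS I(1)])
  have uniq: "J = h ` I" if J: "maximalideal J S" for J
  proof -
    have "?g ` J = I" using ring_iso_maximalideal[OF g rS rR J] I(2) by blast
    moreover have "h ` (?g ` J) = J"
      using subS[OF J] bij image_inv_into_cancel[of h "carrier R" "carrier S" J]
      by (simp add: bij_betw_def)
    ultimately show ?thesis by simp
  qed
  show "local_ring S" using S hI uniq by (auto simp: local_ring_def)
  have mR: "max_ideal R = I" unfolding max_ideal_def by (rule the_equality, rule I, erule I)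
  have mS: "max_ideal S = h ` I" unfolding max_ideal_def by (rule the_equality, rule hI, erule uniq)
  show "max_ideal S = h ` max_ideal R" by (simp add: mR mS)
  show "local_hom R S h" using h by (simp add: local_hom_def mR mS ring_iso_def)
  show "local_hom S R ?g" using g sub[OF I(1)] bij
    by (auto simp: local_hom_def mR mS ring_iso_def bij_betw_def inv_into_f_f subset_iff)
qed

section \<open>Ringed spaces of germs of constant functions\<close>

text \<open>Integral schemes, seen through their function field: the local rings are subrings of a
  field, and sections are locally constant functions with values in that field.\<close>

locale birational_space =
  fixes X :: "('p, 'k::field) rspace" and S :: "'p \<Rightarrow> 'k set" and k :: "complex \<Rightarrow> 'k"
  assumes k_hom: "k \<in> ring_hom (ring_on UNIV) (ring_on UNIV)"
    and stalk: "x \<in> topspace (rs_top X) \<Longrightarrow> rs_stalk X x = ring_on (S x)"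
    and local: "x \<in> topspace (rs_top X) \<Longrightarrow> local_subring (S x)"
    and const: "rs_const X = (\<lambda>x. k)"
    and range_k: "x \<in> topspace (rs_top X) \<Longrightarrow> k c \<in> S x"
    and open_mem: "openin (rs_top X) {x \<in> topspace (rs_top X). z \<in> S x}"
    and sec: "openin (rs_top X) W \<Longrightarrow> s \<in> rs_sec X W \<longleftrightarrow> s \<in> (\<Pi>\<^sub>E x\<in>W. S x) \<and>
      (\<forall>x\<in>W. \<exists>V z. openin (rs_top X) V \<and> x \<in> V \<and> V \<subseteq> W \<and> (\<forall>y\<in>V. s y = z))"
begin

lemma S_subring: "x \<in> topspace (rs_top X) \<Longrightarrow> field_subring (S x)"
  using local by (simp add: local_subring_def)

lemma secE:
  assumes "openin (rs_top X) W" "s \<in> rs_sec X W" "x \<in> W"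
  obtains V z where "openin (rs_top X) V" "x \<in> V" "V \<subseteq> W" "\<And>y. y \<in> V \<Longrightarrow> s y = z"
    "\<And>y. y \<in> V \<Longrightarrow> z \<in> S y"
proof -
  obtain V z where V: "openin (rs_top X) V" "x \<in> V" "V \<subseteq> W" "\<forall>y\<in>V. s y = z"
    using assms sec by metis
  moreover have "z \<in> S y" if "y \<in> V" for y
    using assms(2) sec[OF assms(1)] V that by (metis PiE_mem subsetD)
  ultimately show ?thesis using that by blast
qed

lemma secI:
  assumes "openin (rs_top X) W" "s \<in> extensional W" "\<And>x. x \<in> W \<Longrightarrow> s x \<in> S x"
    "\<And>x. x \<in> W \<Longrightarrow> \<exists>V z. openin (rs_top X) V \<and> x \<in> V \<and> V \<subseteq> W \<and> (\<forall>y\<in>V. s y = z)"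
  shows "s \<in> rs_sec X W"
  unfolding sec[OF assms(1)] PiE_iff using assms by blast

lemma sec_memD: "openin (rs_top X) W \<Longrightarrow> s \<in> rs_sec X W \<Longrightarrow> x \<in> W \<Longrightarrow> s x \<in> S x"
  using sec by (metis PiE_mem)

lemma open_top: "openin (rs_top X) W \<Longrightarrow> x \<in> W \<Longrightarrow> x \<in> topspace (rs_top X)"
  using openin_subset by blast

lemma sec_binop:
  assumes W: "openin (rs_top X) W" and s: "s \<in> rs_sec X W" and s': "s' \<in> rs_sec X W"
    and op: "\<And>x a b. x \<in> W \<Longrightarrow> a \<in> S x \<Longrightarrow> b \<in> S x \<Longrightarrow> f a b \<in> S x"
  shows "(\<lambda>x\<in>W. f (s x) (s' x)) \<in> rs_sec X W"
proof (rule secI[OF W])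
  fix x assume x: "x \<in> W"
  show "(\<lambda>x\<in>W. f (s x) (s' x)) x \<in> S x" using x op sec_memD[OF W s x] sec_memD[OF W s' x] by simp
  obtain V z where V: "openin (rs_top X) V" "x \<in> V" "V \<subseteq> W" "\<And>y. y \<in> V \<Longrightarrow> s y = z"
    by (rule secE[OF W s x]) blast
  obtain V' z' where V': "openin (rs_top X) V'" "x \<in> V'" "V' \<subseteq> W" "\<And>y. y \<in> V' \<Longrightarrow> s' y = z'"
    by (rule secE[OF W s' x]) blast
  show "\<exists>U z. openin (rs_top X) U \<and> x \<in> U \<and> U \<subseteq> W \<and> (\<forall>y\<in>U. (\<lambda>x\<in>W. f (s x) (s' x)) y = z)"
    using V V' by (intro exI[of _ "V \<inter> V'"] exI[of _ "f z z'"]) auto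
qed auto

lemma locally_ringed: "locally_ringed_space X"
  unfolding locally_ringed_space_def
proof (intro conjI ballI allI impI)
  fix x assume x: "x \<in> topspace (rs_top X)"
  show "local_ring (rs_stalk X x)" using local_ring_ring_on[OF local[OF x]] by (simp add: stalk[OF x])
  show "rs_const X x \<in> ring_hom (ring_on UNIV) (rs_stalk X x)"
    using k_hom range_k[OF x] by (auto simp: stalk[OF x] const ring_hom_def)
  fix z assume z: "z \<in> carrier (rs_stalk X x)"
  \<comment> \<open>A germ is an element of the field, so it extends as a constant to its whole
    domain of definition.\<close>
  let ?U = "{x \<in> topspace (rs_top X). z \<in> S x}"
  have "(\<lambda>x\<in>?U. z) \<in> rs_sec X ?U"
    by (rule secI[OF open_mem]) (auto intro!: exI[of _ ?U] open_mem)
  then show "\<exists>U. openin (rs_top X) U \<and> x \<in> U \<and> (\<exists>s\<in>rs_sec X U. s x = z)"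
    using open_mem[of z] z x stalk by (intro exI[of _ ?U] conjI bexI[of _ "\<lambda>x\<in>?U. z"]) auto
next
  fix U assume U: "openin (rs_top X) U"
  note top = open_top[OF U]
  have PiE_stalk: "(\<Pi>\<^sub>E x\<in>U. carrier (rs_stalk X x)) = (\<Pi>\<^sub>E x\<in>U. S x)"
    by (rule PiE_cong) (simp add: stalk[OF top])
  show "rs_sec X U \<subseteq> (\<Pi>\<^sub>E x\<in>U. carrier (rs_stalk X x))"
    unfolding PiE_stalk using sec[OF U] by auto
  show "(\<lambda>x\<in>U. rs_const X x c) \<in> rs_sec X U" for c
    by (rule secI[OF U]) (use U range_k top in \<open>auto simp: const\<close>)
  {
    fix s s' assume s: "s \<in> rs_sec X U" and s': "s' \<in> rs_sec X U"
    have "(\<lambda>x\<in>U. s x \<oplus>\<^bsub>rs_stalk X x\<^esub> s' x) = (\<lambda>x\<in>U. s x + s' x)"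
      by (rule restrict_ext) (simp add: stalk[OF top])
    then show "(\<lambda>x\<in>U. s x \<oplus>\<^bsub>rs_stalk X x\<^esub> s' x) \<in> rs_sec X U"
      using sec_binop[OF U s s', of "(+)"] fs_add[OF S_subring[OF top]] by simp
    have "(\<lambda>x\<in>U. s x \<otimes>\<^bsub>rs_stalk X x\<^esub> s' x) = (\<lambda>x\<in>U. s x * s' x)"
      by (rule restrict_ext) (simp add: stalk[OF top])
    then show "(\<lambda>x\<in>U. s x \<otimes>\<^bsub>rs_stalk X x\<^esub> s' x) \<in> rs_sec X U"
      using sec_binop[OF U s s', of "(*)"] fs_mult[OF S_subring[OF top]] by simp
    fix x assume x: "x \<in> U" and eq: "s x = s' x"
    obtain V z where V: "openin (rs_top X) V" "x \<in> V" "V \<subseteq> U" "\<And>y. y \<in> V \<Longrightarrow> s y = z"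
      by (rule secE[OF U s x]) blast
    obtain V' z' where V': "openin (rs_top X) V'" "x \<in> V'" "V' \<subseteq> U" "\<And>y. y \<in> V' \<Longrightarrow> s' y = z'"
      by (rule secE[OF U s' x]) blast
    \<comment> \<open>Both sections are constant near \<open>x\<close>, so equality of germs is
      equality of the two constants and spreads to a neighbourhood.\<close>
    have "z = z'" using V(2,4) V'(2,4) eq by metis
    then show "\<exists>V. openin (rs_top X) V \<and> x \<in> V \<and> V \<subseteq> U \<and> (\<forall>y\<in>V. s y = s' y)"
      using V V' by (intro exI[of _ "V \<inter> V'"]) auto
  }
  show "restrict s V \<in> rs_sec X V" if s: "s \<in> rs_sec X U" and V: "openin (rs_top X) V \<and> V \<subseteq> U" for s V
  proof (rule secI)
    fix x assume x: "x \<in> V"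
    then show "restrict s V x \<in> S x" using sec_memD[OF U s] V by auto
    obtain V' z where V': "openin (rs_top X) V'" "x \<in> V'" "V' \<subseteq> U" "\<And>y. y \<in> V' \<Longrightarrow> s y = z"
      using secE[OF U s] x V by (metis subsetD)
    then show "\<exists>Va z. openin (rs_top X) Va \<and> x \<in> Va \<and> Va \<subseteq> V \<and> (\<forall>y\<in>Va. restrict s V y = z)"
      using V x by (intro exI[of _ "V \<inter> V'"] exI[of _ z]) auto
  qed (use V in auto)
  show "s \<in> rs_sec X U" if s: "s \<in> (\<Pi>\<^sub>E x\<in>U. carrier (rs_stalk X x))"
    and loc: "\<forall>x\<in>U. \<exists>V. openin (rs_top X) V \<and> x \<in> V \<and> V \<subseteq> U \<and> restrict s V \<in> rs_sec X V" for s
  proof (rule secI[OF U])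
    show "s \<in> extensional U" using s by (auto simp: PiE_iff)
    fix x assume x: "x \<in> U"
    show "s x \<in> S x" using s x unfolding PiE_stalk by auto
    obtain V where V: "openin (rs_top X) V" "x \<in> V" "V \<subseteq> U" "restrict s V \<in> rs_sec X V"
      using loc x by blast
    obtain V' z where V': "openin (rs_top X) V'" "x \<in> V'" "V' \<subseteq> V" "\<And>y. y \<in> V' \<Longrightarrow> restrict s V y = z"
      using secE[OF V(1,4,2)] by metis
    have "s y = z" if "y \<in> V'" for y using V'(3,4) that by (metis restrict_apply' subsetD)
    then show "\<exists>V z. openin (rs_top X) V \<and> x \<in> V \<and> V \<subseteq> U \<and> (\<forall>y\<in>V. s y = z)"
      using V V' by (intro exI[of _ V'] exI[of _ z]) auto
  qed
qed

lemma birational_open_subspace: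
  assumes U: "openin (rs_top X) U"
  shows "birational_space (open_subspace X U) S k"
proof -
  have top: "topspace (rs_top (open_subspace X U)) = U"
    using openin_subset[OF U] by (auto simp: open_subspace_def)
  have op: "openin (rs_top (open_subspace X U)) V \<longleftrightarrow> openin (rs_top X) V \<and> V \<subseteq> U" for V
    using openin_open_subtopology[OF U] by (simp add: open_subspace_def)
  have stk: "rs_stalk (open_subspace X U) = rs_stalk X" "rs_sec (open_subspace X U) = rs_sec X"
    "rs_const (open_subspace X U) = rs_const X"
    by (simp_all add: open_subspace_def)
  note t = open_top[OF U]
  show ?thesis
  proof
    show "openin (rs_top (open_subspace X U)) {x \<in> topspace (rs_top (open_subspace X U)). z \<in> S x}" for z
    proof -
      have "{x \<in> U. z \<in> S x} = U \<inter> {x \<in> topspace (rs_top X). z \<in> S x}" using t by auto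
      then show ?thesis unfolding top op using openin_Int[OF U open_mem[of z]] by auto
    qed
    show "s \<in> rs_sec (open_subspace X U) W \<longleftrightarrow> s \<in> (\<Pi>\<^sub>E x\<in>W. S x) \<and>
      (\<forall>x\<in>W. \<exists>V z. openin (rs_top (open_subspace X U)) V \<and> x \<in> V \<and> V \<subseteq> W \<and> (\<forall>y\<in>V. s y = z))"
      if "openin (rs_top (open_subspace X U)) W" for W s
    proof -
      have W: "openin (rs_top X) W" "W \<subseteq> U" using that unfolding op by auto
      have "((openin (rs_top X) V \<and> V \<subseteq> U) \<and> x \<in> V \<and> V \<subseteq> W \<and> Q) \<longleftrightarrow>
          (openin (rs_top X) V \<and> x \<in> V \<and> V \<subseteq> W \<and> Q)" for V x Q
        using W(2) by auto
      then show ?thesis unfolding stk sec[OF W(1)] op by (simp only:)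
    qed
  qed (use k_hom stalk local const range_k t in \<open>auto simp: top stk\<close>)
qed

end

text \<open>With both structure sheaves inside one field, pulling back a section is composition with
  \<open>f\<close>. What remains to be known is that the local ring at \<open>x\<close> dominates
  the one at \<open>f x\<close>.\<close>

lemma birational_morphism:
  assumes X: "birational_space X S k" and Y: "birational_space Y T k"
    and f: "continuous_map (rs_top X) (rs_top Y) f"
    and sub: "\<And>x. x \<in> topspace (rs_top X) \<Longrightarrow> T (f x) \<subseteq> S x \<and> nonunits (T (f x)) \<subseteq> nonunits (S x)"
  shows "rs_morphism X Y f (\<lambda>x z. z)"
proof -
  interpret X: birational_space X S k by (rule X)
  interpret Y: birational_space Y T k by (rule Y)
  have ft: "f x \<in> topspace (rs_top Y)" if "x \<in> topspace (rs_top X)" for x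
    using f that by (auto simp: continuous_map_def)
  show ?thesis unfolding rs_morphism_def
  proof (intro conjI ballI allI impI)
    fix x assume x: "x \<in> topspace (rs_top X)"
    show "local_hom (rs_stalk Y (f x)) (rs_stalk X x) (\<lambda>z. z)"
      unfolding X.stalk[OF x] Y.stalk[OF ft[OF x]]
      by (rule local_hom_subset) (use X.local[OF x] Y.local[OF ft[OF x]] sub[OF x] in auto)
    show "rs_const Y (f x) c = rs_const X x c" for c by (simp add: X.const Y.const)
  next
    fix V s assume V: "openin (rs_top Y) V \<and> s \<in> rs_sec Y V"
    let ?U = "{x \<in> topspace (rs_top X). f x \<in> V}"
    have U: "openin (rs_top X) ?U" using f V by (auto simp: continuous_map_def)
    show "(\<lambda>x\<in>?U. s (f x)) \<in> rs_sec X ?U"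
    proof (rule X.secI[OF U])
      fix x assume x: "x \<in> ?U"
      show "(\<lambda>x\<in>?U. s (f x)) x \<in> S x" using x V Y.sec_memD[of V s "f x"] sub[of x] by auto
      obtain V' z where V': "openin (rs_top Y) V'" "f x \<in> V'" "V' \<subseteq> V" "\<And>y. y \<in> V' \<Longrightarrow> s y = z"
        using Y.secE[of V s "f x"] V x by (metis (no_types, lifting) mem_Collect_eq)
      let ?U' = "{x \<in> topspace (rs_top X). f x \<in> V'}"
      have "openin (rs_top X) ?U'" using f V' by (auto simp: continuous_map_def)
      then show "\<exists>V' z. openin (rs_top X) V' \<and> x \<in> V' \<and> V' \<subseteq> ?U \<and> (\<forall>y\<in>V'. (\<lambda>x\<in>?U. s (f x)) y = z)"
        using x V' by (intro exI[of _ ?U'] exI[of _ z]) auto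
    qed auto
  qed (rule f)
qed

section \<open>Spectra of subrings of a field\<close>

lemma topspace_zariski_ring_on: "field_subring A \<Longrightarrow> topspace (zariski (ring_on A)) = primes (ring_on A)"
  by (simp add: topspace_zariski cring_ring_on)

lemma spec_in_simps [simp]:
  "rs_top (spec_in k A) = zariski (ring_on A)"
  "rs_stalk (spec_in k A) = (\<lambda>p. ring_on (local_ring_in A p))"
  by (simp_all add: spec_in_def spec_with_def)

text \<open>In the field the local fractions \<open>a / b\<close> are just constants. Conversely, a
  constant value that lies in the local ring at \<open>p\<close> is a fraction there.\<close>

lemma spec_in_sec:
  assumes A: "field_subring A" and W: "openin (zariski (ring_on A)) W"
  shows "s \<in> rs_sec (spec_in k A) W \<longleftrightarrow> s \<in> (\<Pi>\<^sub>E p\<in>W. local_ring_in A p) \<and>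
    (\<forall>p\<in>W. \<exists>V z. openin (zariski (ring_on A)) V \<and> p \<in> V \<and> V \<subseteq> W \<and> (\<forall>q\<in>V. s q = z))"
    (is "_ \<longleftrightarrow> ?E \<and> ?L")
proof -
  have Wp: "W \<subseteq> primes (ring_on A)" using openin_subset[OF W] topspace_zariski_ring_on[OF A] by simp
  let ?F = "\<forall>p\<in>W. \<exists>V. openin (zariski (ring_on A)) V \<and> p \<in> V \<and> V \<subseteq> W \<and>
     (\<exists>a\<in>A. \<exists>b\<in>A. \<forall>q\<in>V. b \<notin> q \<and> s q = a / b)"
  have "s \<in> rs_sec (spec_in k A) W \<longleftrightarrow> ?E \<and> ?F"
    by (simp add: spec_in_def spec_with_def)
  moreover have "?F" if E: ?E and L: ?L
  proof
    fix p assume p: "p \<in> W"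
    then have pp: "p \<in> primes (ring_on A)" using Wp by auto
    obtain V z where V: "openin (zariski (ring_on A)) V" "p \<in> V" "V \<subseteq> W" "\<forall>q\<in>V. s q = z" using L p by blast
    have "z \<in> local_ring_in A p" using E p V by (metis PiE_mem)
    then obtain a b where ab: "a \<in> A" "b \<in> A - p" "z = a / b"
      by (auto simp: local_ring_in_def localization_in_def)
    \<comment> \<open>Shrinking makes \<open>b\<close> a denominator at every point of the
      neighbourhood, not only at \<open>p\<close>.\<close>
    let ?V = "V \<inter> {q \<in> primes (ring_on A). b \<notin> q}"
    have "openin (zariski (ring_on A)) ?V" using V openin_basic[OF A, of b] ab by auto
    moreover have "p \<in> ?V" using V ab pp by auto
    moreover have "\<exists>a\<in>A. \<exists>b\<in>A. \<forall>q\<in>?V. b \<notin> q \<and> s q = a / b"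
      using ab V by (intro bexI[of _ a] bexI[of _ b]) auto
    ultimately show "\<exists>V. openin (zariski (ring_on A)) V \<and> p \<in> V \<and> V \<subseteq> W \<and>
     (\<exists>a\<in>A. \<exists>b\<in>A. \<forall>q\<in>V. b \<notin> q \<and> s q = a / b)" using V(3) by (intro exI[of _ ?V]) auto
  qed
  moreover have "?L" if F: ?F
  proof
    fix p assume "p \<in> W"
    then obtain V where "openin (zariski (ring_on A)) V" "p \<in> V" "V \<subseteq> W"
      "\<exists>a\<in>A. \<exists>b\<in>A. \<forall>q\<in>V. b \<notin> q \<and> s q = a / b"
      using F by (metis (no_types, lifting))
    then show "\<exists>V z. openin (zariski (ring_on A)) V \<and> p \<in> V \<and> V \<subseteq> W \<and> (\<forall>q\<in>V. s q = z)" by blast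
  qed
  ultimately show ?thesis by blast
qed

lemma spec_in_birational:
  assumes A: "field_subring A" and k: "k \<in> ring_hom (ring_on UNIV) (ring_on UNIV)" "range k \<subseteq> A"
  shows "birational_space (spec_in k A) (local_ring_in A) k"
proof
  note top = topspace_zariski_ring_on[OF A]
  show "rs_const (spec_in k A) = (\<lambda>x. k)" by (simp add: spec_in_def spec_with_def)
  show "openin (rs_top (spec_in k A)) {x \<in> topspace (rs_top (spec_in k A)). z \<in> local_ring_in A x}" for z
    using openin_local_ring_mem[OF A] by (simp add: top)
  show "k c \<in> local_ring_in A x" if "x \<in> topspace (rs_top (spec_in k A))" for x c
    using that local_ring_in_incl[OF A, of x] k by (auto simp: top)
  show "local_subring (local_ring_in A x)" if "x \<in> topspace (rs_top (spec_in k A))" for x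
    using that local_subring_local[OF A] by (simp add: top)
qed (use k spec_in_sec[OF A] in auto)

text \<open>A scheme has to be covered by spectra of rings whose elements are functions from points to
  germs; the constant functions provide a copy of a given subring of the field.\<close>

definition const_copy :: "'k::field set \<Rightarrow> ('a \<Rightarrow> 'k) ring" where
  "const_copy A = \<lparr>carrier = (\<lambda>a _. a) ` A, mult = (\<lambda>f g x. f x * g x), one = (\<lambda>_. 1),
     ring.zero = (\<lambda>_. 0), ring.add = (\<lambda>f g x. f x + g x)\<rparr>"

lemma const_copy_simps [simp]:
  "carrier (const_copy A) = (\<lambda>a _. a) ` A" "f \<otimes>\<^bsub>const_copy A\<^esub> g = (\<lambda>x. f x * g x)"
  "f \<oplus>\<^bsub>const_copy A\<^esub> g = (\<lambda>x. f x + g x)" "\<one>\<^bsub>const_copy A\<^esub> = (\<lambda>_. 1)" "\<zero>\<^bsub>const_copy A\<^esub> = (\<lambda>_. 0)"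
  by (simp_all add: const_copy_def)

lemma inj_const: "inj_on (\<lambda>a (_::'a). a) A"
  by (rule inj_onI) (simp add: fun_eq_iff)

lemma const_copy_iso: "(\<lambda>a _. a) \<in> ring_iso (ring_on A) (const_copy A :: ('a \<Rightarrow> 'k::field) ring)"
  by (auto simp: ring_iso_def ring_hom_def bij_betw_def inj_const)

lemma cring_const_copy:
  assumes A: "field_subring A"
  shows "cring (const_copy A :: ('a \<Rightarrow> 'k::field) ring)"
proof -
  interpret cring "ring_on A" by (rule cring_ring_on[OF A])
  show ?thesis using ring_iso_imp_img_cring[OF const_copy_iso[of A]] by (simp add: const_copy_def)
qed

lemma primes_const_copy:
  assumes A: "field_subring A"
  shows "primes (const_copy A :: ('a \<Rightarrow> 'k::field) ring) = (\<lambda>p. (\<lambda>a _. a) ` p) ` primes (ring_on A)"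
proof -
  let ?C = "const_copy A :: ('a \<Rightarrow> 'k) ring" and ?c = "\<lambda>a (_::'a). a :: 'k"
  have cA: "cring (ring_on A)" and cC: "cring ?C" by (rule cring_ring_on[OF A], rule cring_const_copy[OF A])
  interpret c: ring_hom_ring "ring_on A" ?C ?c
    by (rule ring_hom_ringI2) (use cA cC cring.axioms(1) const_copy_iso in \<open>auto simp: ring_iso_def\<close>)
  \<comment> \<open>Evaluation at an arbitrary point inverts the embedding by constant
    functions.\<close>
  interpret d: ring_hom_ring ?C "ring_on A" "\<lambda>f. f undefined"
    by (rule ring_hom_ringI2) (use cA cC cring.axioms(1) in \<open>auto simp: ring_hom_def\<close>)
  show ?thesis
  proof (intro equalityI subsetI)
    fix P assume P: "P \<in> primes ?C"
    then have "P \<subseteq> carrier ?C"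
      by (auto simp: primes_def) (metis additive_subgroup.a_subset const_copy_simps(1) ideal_def primeideal_def subsetD)
    then have "P = ?c ` {a \<in> A. ?c a \<in> P}" by auto
    moreover have "{a \<in> A. ?c a \<in> P} \<in> primes (ring_on A)"
      using c.primeideal_vimage[OF cA] P by (simp add: primes_def)
    ultimately show "P \<in> (\<lambda>p. ?c ` p) ` primes (ring_on A)" by blast
  next
    fix P assume "P \<in> (\<lambda>p. ?c ` p) ` primes (ring_on A)"
    then obtain p where p: "p \<in> primes (ring_on A)" "P = ?c ` p" by blast
    have "p \<subseteq> A" by (rule pr_sub[OF A p(1)])
    then have "P = {r \<in> carrier ?C. r undefined \<in> p}" using p(2) by auto
    then show "P \<in> primes ?C" using d.primeideal_vimage[OF cC, of p] p by (simp add: primes_def)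
  qed
qed

text \<open>All representations of \<open>z\<close> as a fraction of constants. This is the
  equivalence class that stands for \<open>z\<close> in the abstract localization.\<close>

definition frac_class :: "'k::field set \<Rightarrow> 'k set \<Rightarrow> 'k \<Rightarrow> (('a \<Rightarrow> 'k) \<times> ('a \<Rightarrow> 'k)) set" where
  "frac_class A p z = {(\<lambda>_. b, \<lambda>_. u) | b u. b \<in> A \<and> u \<in> A - p \<and> b = z * u}"

context
  fixes A p :: "'k::field set" and C :: "('a \<Rightarrow> 'k) ring" and P :: "('a \<Rightarrow> 'k) set"
  assumes A: "field_subring A" and p: "p \<in> primes (ring_on A)"
    and C_def: "C = const_copy A" and P_def: "P = (\<lambda>a _. a) ` p"
begin

lemma minus_const_image: "carrier C - P = (\<lambda>a _. a) ` (A - p)"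
  using inj_const[of UNIV] by (auto simp: C_def P_def fun_eq_iff)

lemma fraction_const_copy:
  assumes a: "a \<in> A" and s: "s \<in> A" "s \<notin> p"
  shows "fraction C (carrier C - P) (\<lambda>_. a) (\<lambda>_. s) = frac_class A p (a / s)"
proof -
  have s0: "s \<noteq> 0" using s pr_zero[OF A p] by auto
  \<comment> \<open>In a domain the auxiliary factor \<open>v\<close> of \<open>frac_rel\<close>
    cancels.\<close>
  have eq: "(\<exists>v\<in>A - p. v * (a * u) = v * (b * s)) \<longleftrightarrow> b = (a / s) * u" for b u
  proof -
    have "(\<exists>v\<in>A - p. v * (a * u) = v * (b * s)) \<longleftrightarrow> a * u = b * s"
      using fs_one[OF A] pr_one[OF A p] pr_zero[OF A p] by auto
    then show ?thesis using s0 by (auto simp: field_simps)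
  qed
  have "fraction C (carrier C - P) (\<lambda>_. a) (\<lambda>_. s) =
    {(f, g). f \<in> (\<lambda>a _. a) ` A \<and> g \<in> (\<lambda>a _. a) ` (A - p) \<and>
      (\<exists>v\<in>A - p. (\<lambda>_::'a. v * (a * g undefined)) = (\<lambda>_. v * (f undefined * s)))}"
    unfolding fraction_def frac_rel_def minus_const_image using a s by (auto simp: C_def fun_eq_iff)
  also have "\<dots> = {(f, g). f \<in> (\<lambda>a _. a) ` A \<and> g \<in> (\<lambda>a _. a) ` (A - p) \<and> f undefined = (a / s) * g undefined}"
    by (simp only: fun_eq_iff simp_thms eq)
  also have "\<dots> = frac_class A p (a / s)" unfolding frac_class_def by auto
  finally show ?thesis .
qed

lemma frac_class_nonempty: "z \<in> local_ring_in A p \<Longrightarrow> \<exists>b u. (\<lambda>_. b,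
    \<lambda>_. u) \<in> (frac_class A p z :: (('a \<Rightarrow> 'k) \<times> _) set)"
  unfolding local_ring_in_def localization_in_def frac_class_def
  using pr_zero[OF A p] by force

lemma inj_on_frac_class: "inj_on (frac_class A p :: 'k \<Rightarrow> (('a \<Rightarrow> 'k) \<times> _) set) (local_ring_in A p)"
proof (rule inj_onI)
  fix z w assume z: "z \<in> local_ring_in A p" and eq: "(frac_class A p z :: (('a \<Rightarrow> 'k) \<times> _) set) =
      frac_class A p w"
  obtain b u where "(\<lambda>_. b, \<lambda>_. u) \<in> (frac_class A p z :: (('a \<Rightarrow> 'k) \<times> _) set)"
    using frac_class_nonempty[OF z] by blast
  moreover from this have "(\<lambda>_. b, \<lambda>_. u) \<in> (frac_class A p w :: (('a \<Rightarrow> 'k) \<times> _) set)" by (simp only: eq)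
  ultimately have "b = z * u" "b = w * u" "u \<notin> p"
    by (auto simp: frac_class_def fun_eq_iff)
  then show "z = w" using pr_zero[OF A p] by auto
qed

lemma localization_const_copy_iso:
  "frac_class A p \<in> ring_iso (ring_on (local_ring_in A p)) (localization C (carrier C - P))"
  (is "?f \<in> ring_iso _ ?L")
proof -
  have car: "carrier ?L = ?f ` local_ring_in A p"
  proof -
    have "carrier ?L = (\<lambda>(a, s). fraction C (carrier C - P) a s) ` (carrier C \<times> (carrier C - P))"
      by (auto simp: localization_def quotient_def fraction_def)
    also have "\<dots> = (\<lambda>(a, s). fraction C (carrier C - P) (\<lambda>_. a) (\<lambda>_. s)) ` (A \<times> (A - p))"
      unfolding minus_const_image by (force simp: C_def)
    also have "\<dots> = (\<lambda>(a, s). ?f (a / s)) ` (A \<times> (A - p))"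
      by (rule image_cong) (auto simp: fraction_const_copy)
    also have "\<dots> = ?f ` local_ring_in A p"
      unfolding local_ring_in_def localization_in_def by auto
    finally show ?thesis .
  qed
  \<comment> \<open>Operations in \<open>localization\<close> are unions over all representatives.
    Every pair of representatives contributes the same class, so addition and multiplication are
    treated by one argument with a variable numerator \<open>F\<close>.\<close>
  have binop: "(\<Union>(a, s)\<in>?f z. \<Union>(b, u)\<in>?f w. fraction C (carrier C - P) (F a s b u) (\<lambda>x. s x * u x)) = ?f y"
    if z: "z \<in> local_ring_in A p" and w: "w \<in> local_ring_in A p"
      and F: "\<And>a s b u. a \<in> A \<Longrightarrow> b \<in> A \<Longrightarrow> s \<in> A - p \<Longrightarrow> u \<in> A - p \<Longrightarrow> a = z * s \<Longrightarrow> b = w * u \<Longrightarrow>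
         \<exists>c\<in>A. F (\<lambda>_. a) (\<lambda>_. s) (\<lambda>_. b) (\<lambda>_. u) = (\<lambda>_. c) \<and> c = y * (s * u)" for z w y F
  proof -
    have each: "fraction C (carrier C - P) (F a s b u) (\<lambda>x. s x * u x) = ?f y"
      if "(a, s) \<in> ?f z" "(b, u) \<in> ?f w" for a s b u
    proof -
      obtain a' s' where as: "a = (\<lambda>_. a')" "s = (\<lambda>_. s')" "a' \<in> A" "s' \<in> A - p" "a' = z * s'"
        using \<open>(a, s) \<in> ?f z\<close> by (auto simp: frac_class_def)
      obtain b' u' where bu: "b = (\<lambda>_. b')" "u = (\<lambda>_. u')" "b' \<in> A" "u' \<in> A - p" "b' = w * u'"
        using \<open>(b, u) \<in> ?f w\<close> by (auto simp: frac_class_def)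
      obtain c where c: "c \<in> A" "F a s b u = (\<lambda>_. c)" "c = y * (s' * u')"
        using F[OF as(3) bu(3) as(4) bu(4) as(5) bu(5)] as bu by auto
      have su: "s' * u' \<in> A" "s' * u' \<notin> p"
        using as bu fs_mult[OF A] pr_mult_iff[OF A p] by auto
      have "s' * u' \<noteq> 0" using su pr_zero[OF A p] by metis
      then have "c / (s' * u') = y" using c by simp
      then show ?thesis using fraction_const_copy[OF c(1) su] c as bu by simp
    qed
    obtain a s b u where ne: "(a, s) \<in> ?f z" "(b, u) \<in> ?f w"
      using frac_class_nonempty[OF z] frac_class_nonempty[OF w] by blast
    show ?thesis
    proof (intro equalityI subsetI)
      fix v assume "v \<in> (\<Union>(a, s)\<in>?f z. \<Union>(b, u)\<in>?f w. fraction C (carrier C - P) (F a s b u) (\<lambda>x. s x * u x))"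
      then show "v \<in> ?f y" using each by blast
    next
      fix v assume "v \<in> ?f y"
      then show "v \<in> (\<Union>(a, s)\<in>?f z. \<Union>(b, u)\<in>?f w. fraction C (carrier C - P) (F a s b u) (\<lambda>x. s x * u x))"
        using each[OF ne] ne by blast
    qed
  qed
  show ?thesis
  proof (rule ring_iso_memI)
    fix z w assume z: "z \<in> carrier (ring_on (local_ring_in A p))"
        and w: "w \<in> carrier (ring_on (local_ring_in A p))"
    show "?f z \<in> carrier ?L" using z car by auto
    have "(\<Union>(a, s)\<in>?f z. \<Union>(b, u)\<in>?f w. fraction C (carrier C - P) (\<lambda>x. a x * b x) (\<lambda>x. s x * u x)) =
        ?f (z * w)"
    proof (rule binop)
      fix a s b u assume *: "a \<in> A" "b \<in> A" "a = z * s" "b = w * u"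
      have "a * b \<in> A" "a * b = z * w * (s * u)" using * fs_mult[OF A *(1,2)] by (simp_all add: mult_ac)
      then show "\<exists>c\<in>A. (\<lambda>x::'a. a * b) = (\<lambda>_. c) \<and> c = z * w * (s * u)" by blast
    qed (use z w in auto)
    then have "?f z \<otimes>\<^bsub>?L\<^esub> ?f w = ?f (z * w)"
      by (simp add: localization_def C_def)
    then show "?f (z \<otimes>\<^bsub>ring_on (local_ring_in A p)\<^esub> w) = ?f z \<otimes>\<^bsub>?L\<^esub> ?f w" by simp
    have "(\<Union>(a, s)\<in>?f z. \<Union>(b,
        u)\<in>?f w. fraction C (carrier C - P) (\<lambda>x. a x * u x + b x * s x) (\<lambda>x. s x * u x)) = ?f (z + w)"
    proof (rule binop)
      fix a s b u assume *: "a \<in> A" "b \<in> A" "a = z * s" "b = w * u" "s \<in> A - p" "u \<in> A - p"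
      have "a * u + b * s \<in> A" "a * u + b * s = (z + w) * (s * u)"
        using * fs_add[OF A fs_mult[OF A *(1), of u] fs_mult[OF A *(2), of s]]
          by (simp_all add: algebra_simps)
      then show "\<exists>c\<in>A. (\<lambda>x::'a. a * u + b * s) = (\<lambda>_. c) \<and> c = (z + w) * (s * u)" by blast
    qed (use z w in auto)
    then have "?f z \<oplus>\<^bsub>?L\<^esub> ?f w = ?f (z + w)"
      by (simp add: localization_def C_def)
    then show "?f (z \<oplus>\<^bsub>ring_on (local_ring_in A p)\<^esub> w) = ?f z \<oplus>\<^bsub>?L\<^esub> ?f w" by simp
  next
    show "?f \<one>\<^bsub>ring_on (local_ring_in A p)\<^esub> = \<one>\<^bsub>?L\<^esub>"
      using fraction_const_copy[OF fs_one[OF A] fs_one[OF A] pr_one[OF A p]]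
      by (simp add: localization_def C_def)
    show "bij_betw ?f (carrier (ring_on (local_ring_in A p))) (carrier ?L)"
      using inj_on_frac_class by (simp add: car bij_betw_def)
  qed
qed

lemma cring_localization_const_copy: "cring (localization C (carrier C - P))"
proof -
  have z: "frac_class A p 0 = \<zero>\<^bsub>localization C (carrier C - P)\<^esub>"
    using fraction_const_copy[OF fs_zero[OF A] fs_one[OF A] pr_one[OF A p]]
    by (simp add: localization_def C_def)
  interpret cring "ring_on (local_ring_in A p)" by (rule cring_ring_on[OF field_subring_local[OF A p]])
  show ?thesis using ring_iso_imp_img_cring[OF localization_const_copy_iso] by (simp add: z)
qed

end

text \<open>A criterion for being affine: the points are the primes of \<open>A\<close>, with the
  right local rings and the Zariski topology. The free type \<open>'a\<close> can later be
  instantiated with the point type, as \<open>is_scheme\<close> prescribes.\<close>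

lemma spec_const_copy_iso:
  fixes Y :: "('p, 'k::field) rspace" and pr :: "'p \<Rightarrow> 'k set"
  assumes Y: "birational_space Y S k" and A: "field_subring A" and kA: "range k \<subseteq> A"
    and bij: "bij_betw pr (topspace (rs_top Y)) (primes (ring_on A))"
    and S: "\<And>y. y \<in> topspace (rs_top Y) \<Longrightarrow> S y = local_ring_in A (pr y)"
    and op: "\<And>W. openin (rs_top Y) W \<longleftrightarrow> W \<subseteq> topspace (rs_top Y) \<and>
      (\<forall>y\<in>W. \<exists>a\<in>A - pr y. \<forall>y'\<in>topspace (rs_top Y). a \<notin> pr y' \<longrightarrow> y' \<in> W)"
  shows "\<exists>(R :: ('a \<Rightarrow> 'k) ring) k'. cring R \<and> k' \<in> ring_hom (ring_on UNIV) R \<and> rs_isomorphic Y (spec R k')"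
proof -
  interpret Y: birational_space Y S k by (rule Y)
  let ?c = "\<lambda>a (_::'a). a :: 'k"
  let ?R = "const_copy A :: ('a \<Rightarrow> 'k) ring" and ?k = "\<lambda>z. ?c (k z)" and ?T = "topspace (rs_top Y)"
  let ?X = "spec ?R ?k"
  define f where "f y = ?c ` pr y" for y
  define g where "g = inv_into ?T f"
  define h where "h y = inv_into (S y) (frac_class A (pr y) :: _ \<Rightarrow> (('a \<Rightarrow> 'k) \<times> ('a \<Rightarrow> 'k)) set)" for y
  define K where "K P = (frac_class A (pr (g P)) :: _ \<Rightarrow> (('a \<Rightarrow> 'k) \<times> ('a \<Rightarrow> 'k)) set)" for P
  have R: "cring ?R" by (rule cring_const_copy[OF A])
  have bijf: "bij_betw f ?T (primes ?R)"
  proof -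
    have "inj_on (\<lambda>p. ?c ` p) (primes (ring_on A))"
      by (rule inj_onI) (use inj_image_eq_iff[of ?c] inj_const[of UNIV] in blast)
    then have "bij_betw (\<lambda>p. ?c ` p) (primes (ring_on A)) (primes ?R)"
      by (simp add: bij_betw_def primes_const_copy[OF A])
    from bij_betw_trans[OF bij this] show ?thesis by (simp add: f_def[abs_def] comp_def)
  qed
  have topX: "topspace (rs_top ?X) = primes ?R"
    by (simp add: spec_def spec_with_def topspace_zariski[OF R])
  have rsX: "rs_top ?X = zariski ?R" by (simp add: spec_def spec_with_def)
  have gf: "g (f y) = y" if "y \<in> ?T" for y
    using that bijf unfolding g_def by (simp add: bij_betw_inv_into_left)
  have gT: "g P \<in> ?T" and fg: "f (g P) = P" if "P \<in> primes ?R" for P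
    using that bijf unfolding g_def by (simp_all add: bij_betw_inv_into_right bij_betw_def inv_into_into)
  have prp: "pr y \<in> primes (ring_on A)" if "y \<in> ?T" for y using bij that by (auto simp: bij_betw_def)
  have fp: "f y \<in> primes ?R" if "y \<in> ?T" for y using bijf that by (auto simp: bij_betw_def)
  have cpr: "?c a \<in> f y \<longleftrightarrow> a \<in> pr y" for a y by (auto simp: f_def fun_eq_iff)
  let ?L = "\<lambda>P. localization ?R (carrier ?R - P)"
  have iso: "frac_class A (pr y) \<in> ring_iso (ring_on (S y)) (?L (f y))" if "y \<in> ?T" for y
    using localization_const_copy_iso[OF A prp[OF that] refl f_def] by (simp add: S[OF that])
  have cringL: "cring (?L (f y))" if "y \<in> ?T" for y
    by (rule cring_localization_const_copy[OF A prp[OF that] refl f_def])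
  have frac: "fraction ?R (carrier ?R - f y) (?c a) (?c s) = frac_class A (pr y) (a / s)"
    if "y \<in> ?T" "a \<in> A" "s \<in> A" "s \<notin> pr y" for y a s
    using fraction_const_copy[OF A prp[OF that(1)] refl f_def] that by simp
  have lh: "local_hom (ring_on (S y)) (?L (f y)) (frac_class A (pr y))"
       "local_hom (?L (f y)) (ring_on (S y)) (h y)" if "y \<in> ?T" for y
    using ring_iso_local(3,4)[OF iso[OF that] local_ring_ring_on[OF Y.local[OF that]] cringL[OF that]]
    by (simp_all add: h_def)
  have stX: "rs_stalk ?X = ?L" by (simp add: spec_def spec_with_def)
  have carL: "carrier (?L (f y)) = frac_class A (pr y) ` S y" if "y \<in> ?T" for y
    using iso[OF that] by (simp add: ring_iso_def bij_betw_def)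
  have injS: "inj_on (frac_class A (pr y) :: _ \<Rightarrow> (('a \<Rightarrow> 'k) \<times> ('a \<Rightarrow> 'k)) set) (S y)" if "y \<in> ?T" for y
    using iso[OF that] by (simp add: ring_iso_def bij_betw_def)
  have hK: "h y (frac_class A (pr y) z) = z" if "y \<in> ?T" "z \<in> S y" for y z
    using inv_into_f_f[OF injS] that by (simp add: h_def)
  have div: "\<exists>a b. a \<in> A \<and> b \<in> A \<and> b \<notin> pr y \<and> z = a / b" if "y \<in> ?T" "z \<in> S y" for y z
    using that S by (auto simp: local_ring_in_def localization_in_def)
  have divS: "a / b \<in> S y" if "y \<in> ?T" "a \<in> A" "b \<in> A" "b \<notin> pr y" for y a b
    using local_ring_in_div[OF A prp] that S by simp
  have opR: "openin (zariski ?R) V \<longleftrightarrow> V \<subseteq> primes ?R \<and>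
      (\<forall>p\<in>V. \<exists>a\<in>carrier ?R - p. \<forall>q\<in>primes ?R. a \<notin> q \<longrightarrow> q \<in> V)" for V
    by (rule openin_zariski_iff[OF R])
  have op_f: "openin (rs_top Y) {y \<in> ?T. f y \<in> V}" if V: "openin (zariski ?R) V" for V
    unfolding op
  proof (intro conjI ballI)
    fix y assume y: "y \<in> {y \<in> ?T. f y \<in> V}"
    then obtain a where a: "a \<in> carrier ?R - f y" "\<forall>q\<in>primes ?R. a \<notin> q \<longrightarrow> q \<in> V"
      using V[unfolded opR] by blast
    then obtain a' where "a = ?c a'" "a' \<in> A" by auto
    then show "\<exists>a\<in>A - pr y. \<forall>y'\<in>?T. a \<notin> pr y' \<longrightarrow> y' \<in> {y \<in> ?T. f y \<in> V}"
      using a fp by (intro bexI[of _ a']) (auto simp: cpr)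
  qed auto
  have op_g: "openin (zariski ?R) {P \<in> primes ?R. g P \<in> W}" if W: "openin (rs_top Y) W" for W
    unfolding opR
  proof (intro conjI ballI)
    fix P assume P: "P \<in> {P \<in> primes ?R. g P \<in> W}"
    then obtain a where a: "a \<in> A - pr (g P)" "\<forall>y'\<in>?T. a \<notin> pr y' \<longrightarrow> y' \<in> W"
      using W[unfolded op] by blast
    have "?c a \<in> Q \<longleftrightarrow> a \<in> pr (g Q)" if "Q \<in> primes ?R" for Q using cpr[of a "g Q"] fg[OF that] by simp
    then show "\<exists>a\<in>carrier ?R - P. \<forall>q\<in>primes ?R. a \<notin> q \<longrightarrow> q \<in> {P \<in> primes ?R. g P \<in> W}"
      using a gT P by (intro bexI[of _ "?c a"]) auto
  qed auto
  have basic: "openin (rs_top Y) {y \<in> ?T. b \<notin> pr y}" if "b \<in> A" for b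
    unfolding op using that by blast
  have secX: "rs_sec ?X V = {s \<in> (\<Pi>\<^sub>E p\<in>V. carrier (?L p)). \<forall>p\<in>V. \<exists>V'. openin (zariski ?R) V' \<and> p \<in> V' \<and>
      V' \<subseteq> V \<and>
        (\<exists>a\<in>carrier ?R. \<exists>b\<in>carrier ?R. \<forall>q\<in>V'. b \<notin> q \<and> s q = fraction ?R (carrier ?R - q) a b)}" for V
    by (simp add: spec_def spec_with_def)
  have constX: "rs_const ?X P c = fraction ?R (carrier ?R - P) (?c (k c)) (?c 1)" for P c
    by (simp add: spec_def spec_with_def)
  have const: "rs_const ?X (f y) c = frac_class A (pr y) (k c)" if "y \<in> ?T" for y c
    using frac[OF that, of "k c" 1] kA fs_one[OF A] pr_one[OF A prp[OF that]]
      by (simp add: constX range_subsetD)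
  have m1: "rs_morphism Y ?X f h" unfolding rs_morphism_def
  proof (intro conjI ballI allI impI)
    show "continuous_map (rs_top Y) (rs_top ?X) f"
      using fp op_f by (auto simp: continuous_map_def rsX topspace_zariski[OF R])
    show "local_hom (rs_stalk ?X (f y)) (rs_stalk Y y) (h y)" if "y \<in> ?T" for y
      using lh(2)[OF that] by (simp add: stX Y.stalk[OF that])
    show "h y (rs_const ?X (f y) c) = rs_const Y y c" if "y \<in> ?T" for y c
      using that const hK Y.range_k by (simp add: Y.const)
  next
    fix V s assume V: "openin (rs_top ?X) V \<and> s \<in> rs_sec ?X V"
    let ?U = "{y \<in> ?T. f y \<in> V}"
    have U: "openin (rs_top Y) ?U" using op_f V rsX by simp
    have s: "s \<in> rs_sec ?X V" using V by blast
    show "(\<lambda>x\<in>?U. h x (s (f x))) \<in> rs_sec Y ?U"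
    proof (rule Y.secI[OF U])
      fix y assume y: "y \<in> ?U"
      obtain V' a b where V': "openin (zariski ?R) V'" "f y \<in> V'" "V' \<subseteq> V" "a \<in> A" "b \<in> A"
          "\<And>q. q \<in> V' \<Longrightarrow> ?c b \<notin> q \<and> s q = fraction ?R (carrier ?R - q) (?c a) (?c b)"
      proof -
        have "\<exists>V'. openin (zariski ?R) V' \<and> f y \<in> V' \<and> V' \<subseteq> V \<and>
        (\<exists>a\<in>carrier ?R. \<exists>b\<in>carrier ?R. \<forall>q\<in>V'. b \<notin> q \<and> s q = fraction ?R (carrier ?R - q) a b)"
          using s y unfolding secX by blast
        then show ?thesis using that by auto
      qed
      have val: "h y' (s (f y')) = a / b \<and> a / b \<in> S y'" if "y' \<in> ?T" "f y' \<in> V'" for y'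
      proof -
        have b: "b \<notin> pr y'" using V'(6)[OF that(2)] cpr by blast
        have "s (f y') = frac_class A (pr y') (a / b)"
          using V'(6)[OF that(2)] frac[OF that(1) V'(4,5) b] by simp
        then show ?thesis using hK[OF that(1)] divS[OF that(1) V'(4,5) b] by simp
      qed
      show "(\<lambda>x\<in>?U. h x (s (f x))) y \<in> S y" using val[of y] y V' by auto
      have "openin (rs_top Y) {y \<in> ?T. f y \<in> V'}" by (rule op_f[OF V'(1)])
      then show "\<exists>V' z. openin (rs_top Y) V' \<and> y \<in> V' \<and> V' \<subseteq> ?U \<and> (\<forall>y\<in>V'. (\<lambda>x\<in>?U. h x (s (f x))) y = z)"
        using val V' y by (intro exI[of _ "{y \<in> ?T. f y \<in> V'}"] exI[of _ "a / b"]) auto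
    qed auto
  qed
  have m2: "rs_morphism ?X Y g K" unfolding rs_morphism_def
  proof (intro conjI ballI allI impI)
    show "continuous_map (rs_top ?X) (rs_top Y) g"
      using gT op_g by (auto simp: continuous_map_def rsX topspace_zariski[OF R])
    show "local_hom (rs_stalk Y (g P)) (rs_stalk ?X P) (K P)" if "P \<in> topspace (rs_top ?X)" for P
      using that lh(1)[OF gT] fg Y.stalk[OF gT] by (simp add: stX topX K_def)
    show "K P (rs_const Y (g P) c) = rs_const ?X P c" if "P \<in> topspace (rs_top ?X)" for P c
      using that const[OF gT, of P c] fg by (simp add: topX K_def Y.const)
  next
    fix W s assume W: "openin (rs_top Y) W \<and> s \<in> rs_sec Y W"
    let ?U = "{P \<in> topspace (rs_top ?X). g P \<in> W}"
    show "(\<lambda>P\<in>?U. K P (s (g P))) \<in> rs_sec ?X ?U"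
      unfolding secX
    proof (intro CollectI conjI ballI)
      show "(\<lambda>P\<in>?U. K P (s (g P))) \<in> (\<Pi>\<^sub>E p\<in>?U. carrier (?L p))"
      proof (rule restrict_PiE_iff[THEN iffD2], rule ballI)
        fix P assume P: "P \<in> ?U"
        then show "K P (s (g P)) \<in> carrier (?L P)"
          using carL[OF gT, of P] fg[of P] Y.sec_memD[of W s "g P"] W by (simp add: topX K_def)
      qed
      fix P assume P: "P \<in> ?U"
      then have gP: "g P \<in> ?T" and PR: "P \<in> primes ?R" using gT topX by auto
      obtain V z where V: "openin (rs_top Y) V" "g P \<in> V" "V \<subseteq> W" "\<And>y. y \<in> V \<Longrightarrow> s y = z" "z \<in> S (g P)"
        using Y.secE[of W s "g P"] W P by (metis (no_types, lifting) mem_Collect_eq)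
      obtain a b where ab: "a \<in> A" "b \<in> A" "b \<notin> pr (g P)" "z = a / b" using div[OF gP V(5)] by blast
      let ?V = "V \<inter> {y \<in> ?T. b \<notin> pr y}"
      let ?V' = "{P \<in> primes ?R. g P \<in> ?V}"
      have "openin (zariski ?R) ?V'" by (rule op_g) (use V basic[OF ab(2)] in auto)
      moreover have "P \<in> ?V'" using PR V ab gP by auto
      moreover have "?V' \<subseteq> ?U" using V topX by auto
      moreover have "\<forall>Q\<in>?V'. ?c b \<notin> Q \<and> (\<lambda>P\<in>?U. K P (s (g P))) Q = fraction ?R (carrier ?R - Q) (?c a) (?c b)"
      proof
        fix Q assume Q: "Q \<in> ?V'"
        then have QR: "Q \<in> primes ?R" "Q \<in> ?U" and bQ: "b \<notin> pr (g Q)" using V topX by auto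
        show "?c b \<notin> Q \<and> (\<lambda>P\<in>?U. K P (s (g P))) Q = fraction ?R (carrier ?R - Q) (?c a) (?c b)"
          using frac[OF gT[OF QR(1)] ab(1,2) bQ] fg[OF QR(1)] V(4)[of "g Q"] Q QR(2) ab cpr[of b "g Q"] bQ
          by (simp add: K_def)
      qed
      moreover have "?c a \<in> carrier ?R" "?c b \<in> carrier ?R" using ab by auto
      ultimately show "\<exists>V'. openin (zariski ?R) V' \<and> P \<in> V' \<and> V' \<subseteq> ?U \<and>
        (\<exists>a\<in>carrier ?R. \<exists>b\<in>carrier ?R. \<forall>q\<in>V'. b \<notin> q \<and>
           (\<lambda>P\<in>?U. K P (s (g P))) q = fraction ?R (carrier ?R - q) a b)"
        by (intro exI[of _ ?V'] conjI bexI[of _ "?c a"] bexI[of _ "?c b"]) auto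
    qed
  qed
  have "rs_isomorphic Y ?X" unfolding rs_isomorphic_def
  proof (intro exI conjI ballI)
    show "rs_morphism Y ?X f h" "rs_morphism ?X Y g K" by (rule m1, rule m2)
    fix y assume y: "y \<in> ?T"
    show "g (f y) = y" by (rule gf[OF y])
    show "h y (K (f y) z) = z" if "z \<in> carrier (rs_stalk Y y)" for z
      using that hK[OF y] by (simp add: K_def gf[OF y] Y.stalk[OF y])
  next
    fix P assume P: "P \<in> topspace (rs_top ?X)"
    show "f (g P) = P" using fg P topX by simp
    show "K P (h (g P) z) = z" if "z \<in> carrier (rs_stalk ?X P)" for z
      using that carL[OF gT, of P] fg[of P] P f_inv_into_f[of z "frac_class A (pr (g P))" "S (g P)"]
      by (simp add: K_def h_def stX topX)
  qed
  moreover have "?k \<in> ring_hom (ring_on UNIV) ?R"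
    using Y.k_hom kA by (auto simp: ring_hom_def)
  ultimately show ?thesis using R by blast
qed

section \<open>Gluing spectra along equal local rings\<close>

text \<open>The last assumption gives the gluing relation the meaning "same local ring", and with it
  transitivity. Common faces supply it for the toric surface, finite generation for the
  family.\<close>

locale glued =
  fixes k :: "complex \<Rightarrow> 'k::field" and J :: "'i set" and A :: "'i \<Rightarrow> 'k set"
    and Bs :: "'i \<Rightarrow> 'i \<Rightarrow> 'k set set"
  assumes k_ring_hom: "k \<in> ring_hom (ring_on UNIV) (ring_on UNIV)"
    and A: "i \<in> J \<Longrightarrow> field_subring (A i)" and kA: "i \<in> J \<Longrightarrow> range k \<subseteq> A i"
    and Bs: "i \<in> J \<Longrightarrow> j \<in> J \<Longrightarrow> Bs i j \<subseteq> common_localizations (A i) (A j)"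
    and Bs_ex: "i \<in> J \<Longrightarrow> j \<in> J \<Longrightarrow> p \<in> primes (ring_on (A i)) \<Longrightarrow> q \<in> primes (ring_on (A j)) \<Longrightarrow>
      local_ring_in (A i) p = local_ring_in (A j) q \<Longrightarrow> \<exists>B\<in>Bs i j. B \<subseteq> local_ring_in (A i) p"
begin

abbreviation pr :: "'i \<Rightarrow> 'k set set" where "pr i \<equiv> primes (ring_on (A i))"

definition cls :: "'k set \<Rightarrow> ('i \<times> 'k set) set" where
  "cls L = {(i, p). i \<in> J \<and> p \<in> pr i \<and> local_ring_in (A i) p = L}"

definition pts :: "('i \<times> 'k set) set set" where
  "pts = {cls (local_ring_in (A i) p) | i p. i \<in> J \<and> p \<in> pr i}"

definition stalk :: "('i \<times> 'k set) set \<Rightarrow> 'k set" where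
  "stalk x = (\<Union>(i, p)\<in>x. local_ring_in (A i) p)"

abbreviation X :: "(('i \<times> 'k set) set, 'k) rspace" where "X \<equiv> glued_spec k J A Bs"

lemma BsD:
  assumes "i \<in> J" "j \<in> J" "B \<in> Bs i j"
  shows "field_subring B" "localizes B (A i)" "localizes B (A j)"
    "openin (zariski (ring_on (A i))) {q \<in> pr i. B \<subseteq> local_ring_in (A i) q}"
    "openin (zariski (ring_on (A j))) {q \<in> pr j. B \<subseteq> local_ring_in (A j) q}"
proof -
  have "B \<in> common_localizations (A i) (A j)" using Bs assms by blast
  then have *: "is_localization_of B (A i)" "is_localization_of B (A j)"
    "openin (zariski (ring_on (A i))) ((\<lambda>P. P \<inter> A i) ` primes (ring_on B))"
    "openin (zariski (ring_on (A j))) ((\<lambda>P. P \<inter> A j) ` primes (ring_on B))"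
    by (auto simp: common_localizations_def)
  show B: "field_subring B" and l: "localizes B (A i)" "localizes B (A j)"
    using is_localization_of_localizes A assms * by blast+
  show "openin (zariski (ring_on (A i))) {q \<in> pr i. B \<subseteq> local_ring_in (A i) q}"
    "openin (zariski (ring_on (A j))) {q \<in> pr j. B \<subseteq> local_ring_in (A j) q}"
    using *(3,4) localizes_primes_image[OF A[OF assms(1)] B l(1)]
      localizes_primes_image[OF A[OF assms(2)] B l(2)] by simp_all
qed

text \<open>A common localization contained in the local ring at \<open>q\<close> carries the point
  \<open>q\<close> of chart \<open>j\<close> over to chart \<open>i\<close>.\<close>

lemma Bs_prime:
  assumes ij: "i \<in> J" "j \<in> J" and B: "B \<in> Bs i j" and q: "q \<in> pr j" and sub: "B \<subseteq> local_ring_in (A j) q"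
  obtains P where "P \<in> primes (ring_on B)" "P \<inter> A j = q" "P \<inter> A i \<in> pr i"
    "local_ring_in (A i) (P \<inter> A i) = local_ring_in (A j) q"
proof -
  note B' = BsD[OF ij B]
  let ?P = "nonunits (local_ring_in (A j) q) \<inter> B"
  have P: "?P \<in> primes (ring_on B)"
    by (rule local_subring_primes[OF local_subring_local[OF A[OF ij(2)] q] B'(1) sub])
  have Pj: "?P \<inter> A j = q"
    using nonunits_local_Int[OF A[OF ij(2)] q] B'(3) by (auto simp: localizes_def)
  note li = local_ring_localizes[OF A[OF ij(1)] B'(1,2) P]
  note lj = local_ring_localizes[OF A[OF ij(2)] B'(1,3) P]
  show ?thesis by (rule that[OF P Pj li(1)]) (use li(2) lj(2) Pj in simp)
qed

text \<open>Localizations keep local rings, which gives one direction. For the other,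
  \<open>Bs_ex\<close> yields a common localization whose prime over \<open>q\<close> has the right
  local ring on chart \<open>i\<close>, and a prime is determined by its local ring.\<close>

lemma glue_rel_iff:
  "((i, p), (j, q)) \<in> glue_rel J A Bs \<longleftrightarrow> i \<in> J \<and> j \<in> J \<and> p \<in> pr i \<and> q \<in> pr j \<and>
     local_ring_in (A i) p = local_ring_in (A j) q"
proof
  assume r: "((i, p), (j, q)) \<in> glue_rel J A Bs"
  then obtain B P where ij: "i \<in> J" "j \<in> J" "p \<in> pr i" "q \<in> pr j" and B: "B \<in> Bs i j"
    and P: "P \<in> primes (ring_on B)" "P \<inter> A i = p" "P \<inter> A j = q"
    by (auto simp: glue_rel_def)
  note B' = BsD[OF ij(1,2) B]
  show "i \<in> J \<and> j \<in> J \<and> p \<in> pr i \<and> q \<in> pr j \<and> local_ring_in (A i) p = local_ring_in (A j) q"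
    using ij P local_ring_localizes(2)[OF A[OF ij(1)] B'(1,2) P(1)]
      local_ring_localizes(2)[OF A[OF ij(2)] B'(1,3) P(1)] by simp
next
  assume ij: "i \<in> J \<and> j \<in> J \<and> p \<in> pr i \<and> q \<in> pr j \<and> local_ring_in (A i) p = local_ring_in (A j) q"
  then obtain B where B: "B \<in> Bs i j" "B \<subseteq> local_ring_in (A j) q" using Bs_ex[of i j p q] by auto
  obtain P where P: "P \<in> primes (ring_on B)" "P \<inter> A j = q" "P \<inter> A i \<in> pr i"
    "local_ring_in (A i) (P \<inter> A i) = local_ring_in (A j) q"
    using Bs_prime[of i j B q] ij B by blast
  have "P \<inter> A i = p"
    using nonunits_local_Int[OF A P(3)] nonunits_local_Int[OF A, of i p] ij P(4) by metis
  then show "((i, p), (j, q)) \<in> glue_rel J A Bs" using ij B P by (auto simp: glue_rel_def)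
qed

lemma glue_class_eq: "i \<in> J \<Longrightarrow> p \<in> pr i \<Longrightarrow> glue_class J A Bs i p = cls (local_ring_in (A i) p)"
  by (auto simp: glue_class_def cls_def glue_rel_iff)

lemma pts_eq: "(SIGMA i:J. pr i) // glue_rel J A Bs = pts"
  unfolding quotient_def pts_def using glue_class_eq[unfolded glue_class_def] by fastforce

lemma in_cls: "i \<in> J \<Longrightarrow> p \<in> pr i \<Longrightarrow> (i, p) \<in> cls (local_ring_in (A i) p)"
  by (simp add: cls_def)

lemma cls_in_pts: "i \<in> J \<Longrightarrow> p \<in> pr i \<Longrightarrow> cls (local_ring_in (A i) p) \<in> pts"
  by (auto simp: pts_def)

lemma stalk_cls: "i \<in> J \<Longrightarrow> p \<in> pr i \<Longrightarrow> stalk (cls (local_ring_in (A i) p)) = local_ring_in (A i) p"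
  by (auto simp: stalk_def cls_def)

lemma ptsD:
  assumes "x \<in> pts" "(i, p) \<in> x"
  shows "i \<in> J" "p \<in> pr i" "stalk x = local_ring_in (A i) p" "x = cls (local_ring_in (A i) p)"
    "p = nonunits (stalk x) \<inter> A i"
proof -
  obtain j q where j: "j \<in> J" "q \<in> pr j" "x = cls (local_ring_in (A j) q)" using assms by (auto simp: pts_def)
  show i: "i \<in> J" "p \<in> pr i" using assms j by (auto simp: cls_def)
  have eq: "local_ring_in (A i) p = local_ring_in (A j) q" using assms j by (auto simp: cls_def)
  show "stalk x = local_ring_in (A i) p" "x = cls (local_ring_in (A i) p)"
    using j eq stalk_cls[OF j(1,2)] by auto
  then show "p = nonunits (stalk x) \<inter> A i" using nonunits_local_Int[OF A[OF i(1)] i(2)] by simp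
qed

lemma pts_ex: "x \<in> pts \<Longrightarrow> \<exists>i p. i \<in> J \<and> p \<in> pr i \<and> (i, p) \<in> x"
  unfolding pts_def using in_cls by blast

lemma pts_eqI: "x \<in> pts \<Longrightarrow> y \<in> pts \<Longrightarrow> stalk x = stalk y \<Longrightarrow> x = y"
  using pts_ex ptsD by metis

lemma local_stalk: "x \<in> pts \<Longrightarrow> local_subring (stalk x)"
  using pts_ex ptsD local_subring_local[OF A] by metis

definition pre :: "('i \<times> 'k set) set set \<Rightarrow> 'i \<Rightarrow> 'k set set" where
  "pre W i = {p \<in> pr i. cls (local_ring_in (A i) p) \<in> W}"

lemma pre_eq: "i \<in> J \<Longrightarrow> {p \<in> pr i. glue_class J A Bs i p \<in> W} = pre W i"
  by (auto simp: pre_def glue_class_eq)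

lemma openin_glued_pre: "openin (rs_top X) W \<longleftrightarrow> W \<subseteq> pts \<and> (\<forall>i\<in>J. openin (zariski (ring_on (A i))) (pre W i))"
proof -
  let ?O = "\<lambda>W. W \<subseteq> pts \<and> (\<forall>i\<in>J. openin (zariski (ring_on (A i))) (pre W i))"
  have top: "rs_top X = topology ?O"
    unfolding glued_spec_def Let_def pts_eq by (simp add: pre_eq cong: ball_cong)
  have "?O (U \<inter> V)" if "?O U" "?O V" for U V
  proof -
    have "pre (U \<inter> V) i = pre U i \<inter> pre V i" for i by (auto simp: pre_def)
    then show ?thesis using that by auto
  qed
  moreover have "?O (\<Union>\<U>)" if "\<forall>U\<in>\<U>. ?O U" for \<U>
  proof -
    have "pre (\<Union>\<U>) i = (\<Union>U\<in>\<U>. pre U i)" for i by (auto simp: pre_def)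
    then show ?thesis using that by auto
  qed
  ultimately have "istopology ?O" unfolding istopology_def by blast
  then show ?thesis by (simp add: top topology_inverse')
qed

lemma openin_pre: "openin (rs_top X) W \<Longrightarrow> i \<in> J \<Longrightarrow> openin (zariski (ring_on (A i))) (pre W i)"
  using openin_glued_pre by blast

lemma topspace_glued: "topspace (rs_top X) = pts"
proof -
  have "pre pts i = pr i" if "i \<in> J" for i using that by (auto simp: pre_def cls_in_pts)
  then have "openin (rs_top X) pts" unfolding openin_glued_pre
    using topspace_zariski_ring_on[OF A] openin_topspace by (metis order.refl)
  moreover have "U \<subseteq> pts" if "openin (rs_top X) U" for U using that openin_glued_pre by blast
  ultimately show ?thesis unfolding topspace_def by blast
qed

lemma openin_stalk_mem: "openin (rs_top X) {x \<in> pts. z \<in> stalk x}"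
proof -
  have "pre {x \<in> pts. z \<in> stalk x} i = {p \<in> pr i. z \<in> local_ring_in (A i) p}" if "i \<in> J" for i
    using that by (auto simp: pre_def cls_in_pts stalk_cls)
  then show ?thesis unfolding openin_glued_pre using openin_local_ring_mem[OF A] by auto
qed

text \<open>The distinguished open set of \<open>a\<close> in chart \<open>i\<close>, as a subset of
  the glued space.\<close>

definition basic :: "'i \<Rightarrow> 'k \<Rightarrow> ('i \<times> 'k set) set set" where
  "basic i a = {x \<in> pts. \<exists>p. (i, p) \<in> x \<and> a \<notin> p}"

text \<open>Openness has to be seen from every chart \<open>j\<close>. Where a common localization
  \<open>B\<close> is regular, points of chart \<open>j\<close> also lie on chart \<open>i\<close>,
  and there regularity of \<open>inverse a\<close> says that \<open>a\<close> avoids the prime; both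
  conditions are open.\<close>

lemma openin_basic_glued:
  assumes i: "i \<in> J" and a: "a \<in> A i"
  shows "openin (rs_top X) (basic i a)"
  unfolding openin_glued_pre
proof (intro conjI ballI)
  fix j assume j: "j \<in> J"
  show "openin (zariski (ring_on (A j))) (pre (basic i a) j)"
  proof (subst openin_subopen, rule ballI)
    fix q assume q: "q \<in> pre (basic i a) j"
    then have qj: "q \<in> pr j" by (simp add: pre_def)
    obtain p where p: "(i, p) \<in> cls (local_ring_in (A j) q)" "a \<notin> p"
      using q by (auto simp: pre_def basic_def)
    then have pi: "p \<in> pr i" "local_ring_in (A i) p = local_ring_in (A j) q" by (auto simp: cls_def)
    have a0: "a \<noteq> 0" using p pr_zero[OF A[OF i] pi(1)] by metis
    obtain B where B: "B \<in> Bs i j" "B \<subseteq> local_ring_in (A i) p" using Bs_ex[OF i j pi(1) qj pi(2)] by blast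
    let ?T = "{q \<in> pr j. B \<subseteq> local_ring_in (A j) q} \<inter> {q \<in> pr j. inverse a \<in> local_ring_in (A j) q}"
    have "openin (zariski (ring_on (A j))) ?T"
      using BsD(5)[OF i j B(1)] openin_local_ring_mem[OF A[OF j]] by blast
    moreover have "q \<in> ?T" using qj B pi inverse_in_local_ring[OF A[OF i] pi(1) a p(2)] by auto
    moreover have "?T \<subseteq> pre (basic i a) j"
    proof
      fix q' assume q': "q' \<in> ?T"
      have "q' \<in> pr j" "B \<subseteq> local_ring_in (A j) q'" using q' by auto
      then obtain P where P: "P \<inter> A i \<in> pr i" "local_ring_in (A i) (P \<inter> A i) = local_ring_in (A j) q'"
        by (rule Bs_prime[OF i j B(1)]) blast
      have "a \<notin> P \<inter> A i" using inverse_in_local_ring_iff[OF A[OF i] P(1) a a0] q' P(2) by simp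
      then show "q' \<in> pre (basic i a) j"
        using q' P in_cls[OF i P(1)] cls_in_pts[OF j] by (auto simp: pre_def basic_def)
    qed
    ultimately show "\<exists>T. openin (zariski (ring_on (A j))) T \<and> q \<in> T \<and> T \<subseteq> pre (basic i a) j" by blast
  qed
qed (auto simp: basic_def)

lemma openin_glued_basic_aux:
  assumes W: "openin (rs_top X) W" and x: "x \<in> W" "(i, p) \<in> x"
  shows "\<exists>a. a \<in> A i - p \<and> basic i a \<subseteq> W"
proof -
  have "x \<in> pts" using W x openin_glued_pre by blast
  note p = ptsD[OF this x(2)]
  have "p \<in> pre W i" using p(2) x(1) p(4)[symmetric] by (simp add: pre_def)
  then obtain a where a: "a \<in> A i - p" "\<forall>q\<in>pr i. a \<notin> q \<longrightarrow> q \<in> pre W i"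
    using openin_pre[OF W p(1)] openin_zariski_iff[OF cring_ring_on[OF A[OF p(1)]]] by auto
  have "basic i a \<subseteq> W"
  proof
    fix y assume "y \<in> basic i a"
    then obtain q where q: "y \<in> pts" "(i, q) \<in> y" "a \<notin> q" by (auto simp: basic_def)
    then have "q \<in> pre W i" using a ptsD(2)[OF q(1,2)] by blast
    then show "y \<in> W" using ptsD(4)[OF q(1,2), symmetric] by (simp add: pre_def)
  qed
  then show ?thesis using a by blast
qed

lemma openin_glued_iff:
  "openin (rs_top X) W \<longleftrightarrow> W \<subseteq> pts \<and> (\<forall>x\<in>W. \<exists>i p a. (i, p) \<in> x \<and> a \<in> A i - p \<and> basic i a \<subseteq> W)"
  (is "_ \<longleftrightarrow> ?R")
proof
  assume W: "openin (rs_top X) W"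
  have Wp: "W \<subseteq> pts" using W openin_glued_pre by blast
  show ?R
  proof (intro conjI ballI Wp)
    fix x assume x: "x \<in> W"
    then obtain i p where ip: "(i, p) \<in> x" using Wp pts_ex by blast
    show "\<exists>i p a. (i, p) \<in> x \<and> a \<in> A i - p \<and> basic i a \<subseteq> W"
      using openin_glued_basic_aux[OF W x ip] ip by blast
  qed
next
  assume R: ?R
  show "openin (rs_top X) W"
  proof (subst openin_subopen, rule ballI)
    fix x assume x: "x \<in> W"
    then obtain i p a where a: "(i, p) \<in> x" "a \<in> A i - p" "basic i a \<subseteq> W" using R by blast
    have "x \<in> pts" using R x by blast
    then have "x \<in> basic i a" "i \<in> J" using a ptsD by (auto simp: basic_def)
    then show "\<exists>T. openin (rs_top X) T \<and> x \<in> T \<and> T \<subseteq> W" using a openin_basic_glued by blast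
  qed
qed

text \<open>Sections are prescribed chart by chart. Constancy on a distinguished open set of one
  chart is constancy on an open set of the glued space, so local constancy does not depend on the
  chart.\<close>

lemma rs_sec_glued:
  assumes W: "openin (rs_top X) W"
  shows "s \<in> rs_sec X W \<longleftrightarrow> s \<in> (\<Pi>\<^sub>E x\<in>W. stalk x) \<and>
      (\<forall>x\<in>W. \<exists>V z. openin (rs_top X) V \<and> x \<in> V \<and> V \<subseteq> W \<and> (\<forall>y\<in>V. s y = z))" (is "_ \<longleftrightarrow> ?E \<and> ?L")
proof -
  have Wp: "W \<subseteq> pts" using W openin_glued_pre by blast
  let ?s = "\<lambda>i. \<lambda>p\<in>pre W i. s (cls (local_ring_in (A i) p))"
  have "s \<in> rs_sec X W \<longleftrightarrow> ?E \<and>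
      (\<forall>i\<in>J. (\<lambda>p\<in>pre W i. s (glue_class J A Bs i p)) \<in> rs_sec (spec_in k (A i)) (pre W i))"
    unfolding glued_spec_def Let_def by (simp add: pre_eq stalk_def cong: ball_cong)
  moreover have "(\<lambda>p\<in>pre W i. s (glue_class J A Bs i p)) = ?s i" if "i \<in> J" for i
    using that by (intro restrict_ext) (simp add: glue_class_eq pre_def)
  ultimately have sec: "s \<in> rs_sec X W \<longleftrightarrow> ?E \<and> (\<forall>i\<in>J. ?s i \<in> rs_sec (spec_in k (A i)) (pre W i))" by simp
  have "?L" if C: "\<forall>i\<in>J. ?s i \<in> rs_sec (spec_in k (A i)) (pre W i)"
  proof
    fix x assume x: "x \<in> W"
    then have xp: "x \<in> pts" using Wp by blast
    then obtain i p where i: "i \<in> J" "p \<in> pr i" "(i, p) \<in> x" using pts_ex by blast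
    have xc: "x = cls (local_ring_in (A i) p)" using ptsD(4)[OF xp i(3)] .
    then have pW: "p \<in> pre W i" using i(2) x by (simp add: pre_def)
    then obtain V z where V: "openin (zariski (ring_on (A i))) V" "p \<in> V" "V \<subseteq> pre W i" "\<forall>q\<in>V. ?s i q = z"
      using conjunct2[OF iffD1[OF spec_in_sec[OF A[OF i(1)] openin_pre[OF W i(1)]] bspec[OF C i(1)]]] pW
      by blast
    obtain a where a: "a \<in> A i - p" "\<forall>q\<in>pr i. a \<notin> q \<longrightarrow> q \<in> V"
      using V(1,2) openin_zariski_iff[OF cring_ring_on[OF A[OF i(1)]]] by auto
    have in_V: "q \<in> V" "y = cls (local_ring_in (A i) q)" if "y \<in> pts" "(i, q) \<in> y" "a \<notin> q" for y q
      using a(2) that(3) ptsD(2,4)[OF that(1,2)] by blast+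
    have sub_val: "basic i a \<subseteq> W" "\<forall>y\<in>basic i a. s y = z"
    proof -
      have *: "y \<in> W \<and> s y = z" if y: "y \<in> basic i a" for y
      proof -
        obtain q where q: "y \<in> pts" "(i, q) \<in> y" "a \<notin> q" using y by (auto simp: basic_def)
        have "q \<in> pre W i" "?s i q = z" using in_V(1)[OF q] V by auto
        then show ?thesis using in_V(2)[OF q, symmetric] by (simp add: pre_def)
      qed
      show "basic i a \<subseteq> W" using * by blast
      show "\<forall>y\<in>basic i a. s y = z" using * by blast
    qed
    have "x \<in> basic i a" using xp i a by (auto simp: basic_def)
    then show "\<exists>V z. openin (rs_top X) V \<and> x \<in> V \<and> V \<subseteq> W \<and> (\<forall>y\<in>V. s y = z)"
      using openin_basic_glued[OF i(1)] a sub_val by blast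
  qed
  moreover have "?s i \<in> rs_sec (spec_in k (A i)) (pre W i)" if E: ?E and L: ?L and i: "i \<in> J" for i
    unfolding spec_in_sec[OF A[OF i] openin_pre[OF W i]]
  proof (intro conjI ballI)
    show "?s i \<in> (\<Pi>\<^sub>E p\<in>pre W i. local_ring_in (A i) p)"
    proof (rule restrict_PiE_iff[THEN iffD2], rule ballI)
      fix p assume "p \<in> pre W i"
      then have p: "p \<in> pr i" "cls (local_ring_in (A i) p) \<in> W" by (auto simp: pre_def)
      then show "s (cls (local_ring_in (A i) p)) \<in> local_ring_in (A i) p"
        using E stalk_cls[OF i p(1)] by (metis PiE_mem)
    qed
    fix p assume "p \<in> pre W i"
    then have p: "p \<in> pr i" "cls (local_ring_in (A i) p) \<in> W" by (auto simp: pre_def)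
    then obtain V z where V: "openin (rs_top X) V" "cls (local_ring_in (A i) p) \<in> V" "V \<subseteq> W" "\<forall>y\<in>V. s y = z"
      using L by blast
    then show "\<exists>V z. openin (zariski (ring_on (A i))) V \<and> p \<in> V \<and> V \<subseteq> pre W i \<and> (\<forall>q\<in>V. ?s i q = z)"
      using openin_pre[OF V(1) i] p by (intro exI[of _ "pre V i"] exI[of _ z]) (auto simp: pre_def)
  qed
  ultimately show ?thesis using sec by blast
qed

lemma rs_stalk_glued: "rs_stalk X x = ring_on (stalk x)"
  by (simp add: glued_spec_def Let_def stalk_def)

sublocale birational_space X stalk k
proof
  show "rs_const X = (\<lambda>x. k)" by (simp add: glued_spec_def Let_def)
  show "k c \<in> stalk x" if "x \<in> topspace (rs_top X)" for x c
  proof -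
    have x: "x \<in> pts" using that topspace_glued by simp
    obtain i p where ip: "i \<in> J" "p \<in> pr i" "(i, p) \<in> x" using pts_ex[OF x] by blast
    show ?thesis unfolding ptsD(3)[OF x ip(3)] using kA[OF ip(1)] local_ring_in_incl[OF A ip(2)] ip(1)
      by blast
  qed
  show "openin (rs_top X) {x \<in> topspace (rs_top X). z \<in> stalk x}" for z
    unfolding topspace_glued by (rule openin_stalk_mem)
qed (use rs_sec_glued rs_stalk_glued k_ring_hom local_stalk topspace_glued in auto)

lemma is_scheme: "is_scheme X"
  unfolding is_scheme_def
proof (intro conjI ballI locally_ringed)
  fix x assume "x \<in> topspace (rs_top X)"
  then have x: "x \<in> pts" by (simp add: topspace_glued)
  then obtain i p where i: "i \<in> J" "p \<in> pr i" "(i, p) \<in> x" using pts_ex by blast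
  \<comment> \<open>No prime contains 1, so this open set is the whole chart
    \<open>i\<close>.\<close>
  have one: "basic i 1 = {x \<in> pts. \<exists>p. (i, p) \<in> x}"
    using pr_one[OF A] ptsD by (auto simp: basic_def) (metis)
  let ?U = "basic i 1"
  have U: "openin (rs_top X) ?U" by (rule openin_basic_glued[OF i(1) fs_one[OF A[OF i(1)]]])
  let ?Y = "open_subspace X ?U"
  have top: "topspace (rs_top ?Y) = ?U"
    using openin_subset[OF U] by (auto simp: open_subspace_def)
  have op: "openin (rs_top ?Y) V \<longleftrightarrow> openin (rs_top X) V \<and> V \<subseteq> ?U" for V
    using openin_open_subtopology[OF U] by (simp add: open_subspace_def)
  \<comment> \<open>The prime of \<open>y\<close> on chart \<open>i\<close>, recovered from the
    stalk.\<close>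
  define f where "f y = nonunits (stalk y) \<inter> A i" for y
  have f: "(i, f y) \<in> y" "f y \<in> pr i" "stalk y = local_ring_in (A i) (f y)" if "y \<in> ?U" for y
  proof -
    obtain q where q: "y \<in> pts" "(i, q) \<in> y" using \<open>y \<in> ?U\<close> one by blast
    then have "f y = q" unfolding f_def using ptsD(5) by metis
    then show "(i, f y) \<in> y" "f y \<in> pr i" "stalk y = local_ring_in (A i) (f y)" using q ptsD by metis+
  qed
  have "\<exists>(R :: (('i \<times> 'k set) set \<Rightarrow> 'k) ring) k'. cring R \<and> k' \<in> ring_hom (ring_on UNIV) R \<and>
      rs_isomorphic ?Y (spec R k')"
  proof (rule spec_const_copy_iso[OF birational_open_subspace[OF U] A[OF i(1)] kA[OF i(1)]])
    show "bij_betw f (topspace (rs_top ?Y)) (pr i)" unfolding top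
    proof (rule bij_betwI')
      show "f x = f y \<longleftrightarrow> x = y" if "x \<in> ?U" "y \<in> ?U" for x y
        using that f(3)[OF that(1)] f(3)[OF that(2)] pts_eqI[of x y] by (auto simp: basic_def)
      show "f x \<in> pr i" if "x \<in> ?U" for x by (rule f(2)[OF that])
      show "\<exists>x\<in>?U. q = f x" if q: "q \<in> pr i" for q
      proof (rule bexI)
        let ?x = "cls (local_ring_in (A i) q)"
        show "q = f ?x" using ptsD(5)[OF cls_in_pts in_cls] i q by (simp add: f_def)
        show "?x \<in> ?U" unfolding one using in_cls cls_in_pts i q by blast
      qed
    qed
    show "stalk y = local_ring_in (A i) (f y)" if "y \<in> topspace (rs_top ?Y)" for y
      using that f(3) top by simp
    show "openin (rs_top ?Y) W \<longleftrightarrow> W \<subseteq> topspace (rs_top ?Y) \<and>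
      (\<forall>y\<in>W. \<exists>a\<in>A i - f y. \<forall>y'\<in>topspace (rs_top ?Y). a \<notin> f y' \<longrightarrow> y' \<in> W)" for W
      unfolding top op
    proof (intro iffI conjI ballI)
      assume W: "openin (rs_top X) W \<and> W \<subseteq> ?U"
      then show "W \<subseteq> ?U" by blast
      fix y assume y: "y \<in> W"
      then have yU: "y \<in> ?U" using W by blast
      obtain a where a: "a \<in> A i - f y" "basic i a \<subseteq> W"
        using openin_glued_basic_aux[of W y i "f y"] W y f(1)[OF yU] by blast
      moreover have "y' \<in> basic i a" if "y' \<in> ?U" "a \<notin> f y'" for y'
        using that f(1)[OF that(1)] by (auto simp: basic_def)
      ultimately show "\<exists>a\<in>A i - f y. \<forall>y'\<in>?U. a \<notin> f y' \<longrightarrow> y' \<in> W" by blast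
    next
      assume W: "W \<subseteq> ?U \<and> (\<forall>y\<in>W. \<exists>a\<in>A i - f y. \<forall>y'\<in>?U. a \<notin> f y' \<longrightarrow> y' \<in> W)"
      then show "W \<subseteq> ?U" by blast
      show "openin (rs_top X) W" unfolding openin_glued_iff
      proof (intro conjI ballI)
        show "W \<subseteq> pts" using W by (auto simp: basic_def)
        fix y assume y: "y \<in> W"
        then obtain a where a: "a \<in> A i - f y" "\<forall>y'\<in>?U. a \<notin> f y' \<longrightarrow> y' \<in> W" using W by blast
        have "basic i a \<subseteq> W"
        proof
          fix y' assume "y' \<in> basic i a"
          then obtain q where q: "y' \<in> pts" "(i, q) \<in> y'" "a \<notin> q" by (auto simp: basic_def)
          then have "y' \<in> ?U" unfolding one by blast
          moreover have "f y' = q" using ptsD(5)[OF q(1,2)] by (simp add: f_def)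
          ultimately show "y' \<in> W" using a q by blast
        qed
        moreover have "(i, f y) \<in> y" using f(1) W y by blast
        ultimately show "\<exists>i p a. (i, p) \<in> y \<and> a \<in> A i - p \<and> basic i a \<subseteq> W" using a by blast
      qed
    qed
  qed
  moreover have "x \<in> ?U" using one x i by blast
  ultimately show "\<exists>U (R :: (('i \<times> 'k set) set \<Rightarrow> 'k) ring) k. openin (rs_top X) U \<and> x \<in> U \<and> cring R \<and>
      k \<in> ring_hom (ring_on UNIV) R \<and> rs_isomorphic (open_subspace X U) (spec R k)"
    using U by blast
qed

end

section \<open>Common localizations of finitely generated algebras\<close>

text \<open>The product of the denominators of finitely many generators serves all of
  \<open>calg k G\<close> up to powers: the elements cleared by some power of \<open>f\<close> form
  a subring.\<close>

lemma calg_common_denominator: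
  assumes A: "field_subring A" and p: "p \<in> primes (ring_on A)" and "finite G"
    and kA: "range k \<subseteq> A" and G: "G \<subseteq> local_ring_in A p"
  shows "\<exists>f\<in>A - p. \<forall>z\<in>calg k G. \<exists>n::nat. f ^ n * z \<in> A"
proof -
  have "\<exists>f\<in>A - p. \<forall>z\<in>G. f * z \<in> A" using \<open>finite G\<close> G
  proof induction
    case empty
    then show ?case using fs_one[OF A] pr_one[OF A p] by auto
  next
    case (insert g G)
    then obtain f where f: "f \<in> A - p" "\<forall>z\<in>G. f * z \<in> A" by auto
    obtain s where s: "s \<in> A - p" "s * g \<in> A" using insert.prems local_ring_in_iff[OF A p] by blast
    have "s * f \<in> A - p" using s f fs_mult[OF A] pr_mult_iff[OF A p] by auto
    moreover have "s * f * z \<in> A" if z: "z \<in> insert g G" for z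
    proof (cases "z = g")
      case True
      have "f * (s * g) \<in> A" using f s fs_mult[OF A] by auto
      then show ?thesis by (simp add: True mult_ac)
    next
      case False
      then have "s * (f * z) \<in> A" using z f s fs_mult[OF A] by auto
      then show ?thesis by (simp add: mult_ac)
    qed
    ultimately show ?case by blast
  qed
  then obtain f where f: "f \<in> A - p" "\<And>z. z \<in> G \<Longrightarrow> f * z \<in> A" by blast
  have fA: "f ^ n \<in> A" for n using f fs_power[OF A] by auto
  let ?B = "{z. \<exists>n::nat. f ^ n * z \<in> A}"
  have "field_subring ?B"
  proof (rule field_subringI)
    show "1 \<in> ?B" using fA[of 0] by (auto intro: exI[of _ 0])
    fix a b assume "a \<in> ?B" "b \<in> ?B"
    then obtain n m where nm: "f ^ n * a \<in> A" "f ^ m * b \<in> A" by blast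
    have "f ^ (n + m) * (a - b) = f ^ m * (f ^ n * a) - f ^ n * (f ^ m * b)"
      "f ^ (n + m) * (a * b) = (f ^ n * a) * (f ^ m * b)"
      by (simp_all add: algebra_simps power_add)
    then have "f ^ (n + m) * (a - b) \<in> A" "f ^ (n + m) * (a * b) \<in> A"
      using fs_diff[OF A fs_mult[OF A fA nm(1), of m] fs_mult[OF A fA nm(2), of n]] fs_mult[OF A nm]
      by (simp_all only:)
    then show "a - b \<in> ?B" "a * b \<in> ?B" by blast+
  qed
  moreover have "range k \<subseteq> ?B" using kA by (auto intro!: exI[of _ 0])
  moreover have "G \<subseteq> ?B" using f by (auto intro!: exI[of _ 1])
  ultimately have "calg k G \<subseteq> ?B" by (rule calg_minimal)
  then show ?thesis using f by blast
qed

text \<open>Let \<open>f\<close> clear the denominators of \<open>B\<close> over \<open>A\<close>,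
  and \<open>g\<close> those of \<open>A\<close> over \<open>B\<close>. Inverting both gives the
  same ring \<open>?C\<close> from either side. Both are units of the common local ring, so
  \<open>?C\<close> lies in it.\<close>

lemma calg_common_localization:
  assumes A: "A = calg k G" and B: "B = calg k H" and fin: "finite G" "finite H"
    and p: "p \<in> primes (ring_on A)" and q: "q \<in> primes (ring_on B)"
    and eq: "local_ring_in A p = local_ring_in B q"
  shows "\<exists>C\<in>common_localizations A B. C \<subseteq> local_ring_in A p"
proof -
  let ?L = "local_ring_in A p"
  have FA: "field_subring A" and FB: "field_subring B" using field_subring_calg by (auto simp: A B)
  have kAB: "range k \<subseteq> A" "range k \<subseteq> B" by (auto simp: A B calg_const)
  have AL: "A \<subseteq> ?L" by (rule local_ring_in_incl[OF FA p])
  have BL: "B \<subseteq> ?L" unfolding eq by (rule local_ring_in_incl[OF FB q])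
  have FL: "field_subring ?L" by (rule field_subring_local[OF FA p])
  have GH: "G \<subseteq> local_ring_in B q" "H \<subseteq> ?L"
    using AL BL eq by (auto simp: A B calg_incl subset_iff)
  obtain f where f: "f \<in> A - p" "\<forall>z\<in>calg k H. \<exists>n::nat. f ^ n * z \<in> A"
    using calg_common_denominator[OF FA p fin(2) kAB(1) GH(2)] by blast
  obtain g where g: "g \<in> B - q" "\<forall>z\<in>calg k G. \<exists>n::nat. g ^ n * z \<in> B"
    using calg_common_denominator[OF FB q fin(1) kAB(2) GH(1)] by blast
  have f0: "f \<noteq> 0" and g0: "g \<noteq> 0" using f g pr_zero[OF FA p] pr_zero[OF FB q] by auto
  have inv: "inverse f \<in> ?L" "inverse g \<in> ?L"
    using f g inverse_in_local_ring[OF FA p] inverse_in_local_ring[OF FB q] eq by auto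
  let ?C = "{z. \<exists>n m::nat. f ^ n * g ^ m * z \<in> A}"
  have fA: "f ^ n \<in> A" for n using f fs_power[OF FA] by auto
  have gB: "g ^ n \<in> B" for n using g fs_power[OF FB] by auto
  have C_B: "?C = {z. \<exists>n m::nat. f ^ n * g ^ m * z \<in> B}"
  proof (intro equalityI subsetI)
    fix z assume "z \<in> ?C"
    then obtain n m where "f ^ n * g ^ m * z \<in> A" by blast
    then obtain j where "g ^ j * (f ^ n * g ^ m * z) \<in> B" using g A by blast
    then have "f ^ n * g ^ (j + m) * z \<in> B" by (simp add: power_add mult_ac)
    then show "z \<in> {z. \<exists>n m::nat. f ^ n * g ^ m * z \<in> B}" by blast
  next
    fix z assume "z \<in> {z. \<exists>n m::nat. f ^ n * g ^ m * z \<in> B}"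
    then obtain n m where "f ^ n * g ^ m * z \<in> B" by blast
    then obtain j where "f ^ j * (f ^ n * g ^ m * z) \<in> A" using f B by blast
    then have "f ^ (j + n) * g ^ m * z \<in> A" by (simp add: power_add mult_ac)
    then show "z \<in> ?C" by blast
  qed
  have finv: "inverse f \<in> ?C"
    using fs_one[OF FA] f0 by (intro CollectI exI[of _ 1] exI[of _ 0]) simp
  have ginv: "inverse g \<in> ?C" unfolding C_B
    using fs_one[OF FB] g0 by (intro CollectI exI[of _ 0] exI[of _ 1]) simp
  \<comment> \<open>In general \<open>g\<close> is not in \<open>A\<close> and \<open>f\<close> is
    not in \<open>B\<close>. The multiples \<open>f ^ k0 * g\<close> and \<open>g ^ k1 * f\<close>
    are, and act as denominators.\<close>
  obtain k0 where k0: "f ^ k0 * g \<in> A" using f g B by blast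
  obtain k1 where k1: "g ^ k1 * f \<in> B" using f g A by blast
  have AC: "A \<subseteq> ?C" by (intro subsetI CollectI exI[of _ 0]) simp
  have BC: "B \<subseteq> ?C" unfolding C_B by (intro subsetI CollectI exI[of _ 0]) simp
  have norm: "\<exists>n m::nat. f ^ n * (f ^ k0 * g) ^ m * z \<in> A \<and> f ^ n * g ^ m * z \<in> A" if z: "z \<in> ?C" for z
  proof -
    obtain n m where nm: "f ^ n * g ^ m * z \<in> A" using z by blast
    have "f ^ n * (f ^ k0 * g) ^ m * z = f ^ (k0 * m) * (f ^ n * g ^ m * z)"
      by (simp add: power_mult_distrib power_mult mult_ac)
    then have "f ^ n * (f ^ k0 * g) ^ m * z \<in> A" using fs_mult[OF FA fA nm] by (simp only:)
    then show ?thesis using nm by blast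
  qed
  have mul: "f ^ n' * (f ^ k0 * g) ^ m' * x \<in> A" if "x \<in> A" for n' m' x
    using fs_mult[OF FA fs_mult[OF FA fA fs_power[OF FA k0]] that] .
  have FC: "field_subring ?C"
  proof (rule field_subringI)
    show "1 \<in> ?C" using AC fs_one[OF FA] by blast
    fix a b assume "a \<in> ?C" "b \<in> ?C"
    then obtain n m n' m' where *: "f ^ n * (f ^ k0 * g) ^ m * a \<in> A" "f ^ n' * (f ^ k0 * g) ^ m' * b \<in> A"
      using norm[OF \<open>a \<in> ?C\<close>] norm[OF \<open>b \<in> ?C\<close>] by blast
    let ?h = "f ^ k0 * g"
    have eq: "f ^ (n + n' + k0 * (m + m')) * g ^ (m + m') * y = f ^ n * f ^ n' * ?h ^ m * ?h ^ m' * y" for y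
      by (simp add: power_add power_mult power_mult_distrib algebra_simps)
    have "f ^ n * f ^ n' * ?h ^ m * ?h ^ m' * (a - b) =
        f ^ n' * ?h ^ m' * (f ^ n * ?h ^ m * a) - f ^ n * ?h ^ m * (f ^ n' * ?h ^ m' * b)"
      "f ^ n * f ^ n' * ?h ^ m * ?h ^ m' * (a * b) = (f ^ n * ?h ^ m * a) * (f ^ n' * ?h ^ m' * b)"
      by (simp_all add: algebra_simps)
    then have "f ^ n * f ^ n' * ?h ^ m * ?h ^ m' * (a - b) \<in> A"
        "f ^ n * f ^ n' * ?h ^ m * ?h ^ m' * (a * b) \<in> A"
      using fs_diff[OF FA mul[OF *(1)] mul[OF *(2)]] fs_mult[OF FA *] by (simp_all only:)
    then show "a - b \<in> ?C" "a * b \<in> ?C" unfolding eq[symmetric] by blast+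
  qed
  have loc: "localizes ?C A" unfolding localizes_def
  proof (intro conjI ballI AC)
    fix z assume "z \<in> ?C"
    then obtain n m where "f ^ n * (f ^ k0 * g) ^ m * z \<in> A" using norm by blast
    moreover have "f ^ n * (f ^ k0 * g) ^ m \<in> A" using mul[OF fs_one[OF FA]] by simp
    moreover have "inverse (f ^ n * (f ^ k0 * g) ^ m) \<in> ?C"
    proof -
      have "inverse (f ^ n * (f ^ k0 * g) ^ m) = inverse f ^ n * (inverse f ^ k0 * inverse g) ^ m"
        using f0 g0 by (simp add: power_inverse field_simps power_mult_distrib)
      then show ?thesis by (simp only:) (intro fs_mult[OF FC] fs_power[OF FC] finv ginv)
    qed
    ultimately show "\<exists>s\<in>A. s \<noteq> 0 \<and> inverse s \<in> ?C \<and> s * z \<in> A"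
      using f0 g0 by (intro bexI[of _ "f ^ n * (f ^ k0 * g) ^ m"]) auto
  qed
  have locB: "localizes ?C B" unfolding localizes_def
  proof (intro conjI ballI BC)
    fix z assume "z \<in> ?C"
    then obtain n m where nm: "f ^ n * g ^ m * z \<in> B" using C_B by blast
    have "g ^ (k1 * n) * (f ^ n * g ^ m * z) = (g ^ k1 * f) ^ n * g ^ m * z"
      by (simp add: power_mult_distrib power_mult mult_ac)
    then have "(g ^ k1 * f) ^ n * g ^ m * z \<in> B" using fs_mult[OF FB gB nm] by metis
    moreover have "(g ^ k1 * f) ^ n * g ^ m \<in> B" using fs_mult[OF FB fs_power[OF FB k1] gB] .
    moreover have "inverse ((g ^ k1 * f) ^ n * g ^ m) \<in> ?C"
    proof -
      have "inverse ((g ^ k1 * f) ^ n * g ^ m) = (inverse g ^ k1 * inverse f) ^ n * inverse g ^ m"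
        using f0 g0 by (simp add: power_inverse field_simps power_mult_distrib)
      then show ?thesis by (simp only:) (intro fs_mult[OF FC] fs_power[OF FC] finv ginv)
    qed
    ultimately show "\<exists>s\<in>B. s \<noteq> 0 \<and> inverse s \<in> ?C \<and> s * z \<in> B"
      using f0 g0 by (intro bexI[of _ "(g ^ k1 * f) ^ n * g ^ m"]) auto
  qed
  \<comment> \<open>Regularity of all of \<open>?C\<close> at a point amounts to regularity of two
    elements, which makes the image of its spectrum open.\<close>
  have sub_iff: "?C \<subseteq> R \<longleftrightarrow> inverse f \<in> R \<and> inverse g \<in> R" if "field_subring R" "A \<subseteq> R" for R
  proof (intro iffI conjI subsetI)
    fix z assume R: "inverse f \<in> R \<and> inverse g \<in> R" and "z \<in> ?C"
    then obtain n m where "f ^ n * g ^ m * z \<in> A" by blast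
    then have "inverse f ^ n * inverse g ^ m * (f ^ n * g ^ m * z) \<in> R"
      using R that fs_intros[OF that(1)] by (meson subsetD)
    moreover have "inverse f ^ n * inverse g ^ m * (f ^ n * g ^ m * z) = z"
      using f0 g0 by (simp add: power_inverse field_simps)
    ultimately show "z \<in> R" by simp
  qed (use finv ginv in auto)
  have sub_iff': "?C \<subseteq> R \<longleftrightarrow> inverse f \<in> R \<and> inverse g \<in> R" if "field_subring R" "B \<subseteq> R" for R
  proof (intro iffI conjI subsetI)
    fix z assume R: "inverse f \<in> R \<and> inverse g \<in> R" and "z \<in> ?C"
    then obtain n m where "f ^ n * g ^ m * z \<in> B" using C_B by blast
    then have "inverse f ^ n * inverse g ^ m * (f ^ n * g ^ m * z) \<in> R"
      using R that fs_intros[OF that(1)] by (meson subsetD)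
    moreover have "inverse f ^ n * inverse g ^ m * (f ^ n * g ^ m * z) = z"
      using f0 g0 by (simp add: power_inverse field_simps)
    ultimately show "z \<in> R" by simp
  qed (use finv ginv in auto)
  have imA: "(\<lambda>P. P \<inter> A) ` primes (ring_on ?C) =
     {q \<in> primes (ring_on A). inverse f \<in> local_ring_in A q} \<inter> {q \<in> primes (ring_on A). inverse g \<in> local_ring_in A q}"
    unfolding localizes_primes_image[OF FA FC loc]
    using sub_iff[OF field_subring_local[OF FA] local_ring_in_incl[OF FA]] by blast
  have imB: "(\<lambda>P. P \<inter> B) ` primes (ring_on ?C) =
     {q \<in> primes (ring_on B). inverse f \<in> local_ring_in B q} \<inter> {q \<in> primes (ring_on B). inverse g \<in> local_ring_in B q}"
    unfolding localizes_primes_image[OF FB FC locB]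
    using sub_iff'[OF field_subring_local[OF FB] local_ring_in_incl[OF FB]] by blast
  have "?C \<in> common_localizations A B"
    unfolding common_localizations_def mem_Collect_eq imA imB
    using localizes_is_localization_of[OF FA FC loc] localizes_is_localization_of[OF FB FC locB]
    by (intro conjI openin_Int openin_local_ring_mem FA FB)
  then show ?thesis using sub_iff[OF FL AL] inv by blast
qed

section \<open>Torsion-free modules over valuation rings are flat\<close>

text \<open>A valuation ring of its own fraction field; the ambient field may be much larger, so
  only quotients of elements of \<open>R\<close> are compared.\<close>

definition valuation_subring :: "'k::field set \<Rightarrow> bool" where
  "valuation_subring R \<longleftrightarrow> field_subring R \<and> (\<forall>a\<in>R. \<forall>b\<in>R. a \<noteq> 0 \<longrightarrow> b \<noteq> 0 \<longrightarrow> a / b \<in> R \<or> b / a \<in> R)"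

definition indep :: "'k::field set \<Rightarrow> nat \<Rightarrow> (nat \<Rightarrow> 'k) \<Rightarrow> bool" where
  "indep R n e \<longleftrightarrow> (\<forall>r. (\<forall>i<n. r i \<in> R) \<and> (\<Sum>i<n. r i * e i) = 0 \<longrightarrow> (\<forall>i<n. r i = 0))"

definition span_of :: "'k::field set \<Rightarrow> nat \<Rightarrow> (nat \<Rightarrow> 'k) \<Rightarrow> 'k set" where
  "span_of R n e = {\<Sum>i<n. r i * e i | r. \<forall>i<n. r i \<in> R}"

text \<open>Divisibility in a valuation ring is a total preorder, so a finite nonempty set of
  nonzero elements contains one that divides all the others.\<close>

lemma common_divisor:
  assumes R: "valuation_subring R" and I: "finite I" "I \<noteq> {}" "\<And>i. i \<in> I \<Longrightarrow> f i \<in> R \<and> f i \<noteq> 0"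
  shows "\<exists>j\<in>I. \<forall>i\<in>I. f i / f j \<in> R"
  using I
proof (induction rule: finite_ne_induct)
  case (singleton x)
  then show ?case using R fs_one by (auto simp: valuation_subring_def)
next
  case (insert x F)
  have FR: "field_subring R" using R by (simp add: valuation_subring_def)
  obtain j where j: "j \<in> F" "\<forall>i\<in>F. f i / f j \<in> R" using insert by auto
  have nz: "f x \<noteq> 0" "f j \<noteq> 0" "f x \<in> R" "f j \<in> R" using insert.prems j by auto
  show ?case
  proof (cases "f x / f j \<in> R")
    case True then show ?thesis using j by blast
  next
    case False
    then have *: "f j / f x \<in> R" using R nz unfolding valuation_subring_def by blast
    have "f i / f x \<in> R" if "i \<in> F" for i
      using fs_mult[OF FR *] j that nz by fastforce
    moreover have "f x / f x \<in> R" using nz fs_one[OF FR] by simp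
    ultimately show ?thesis by blast
  qed
qed

lemma span_of_memI: "(\<And>i. i < n \<Longrightarrow> r i \<in> R) \<Longrightarrow> z = (\<Sum>i<n. r i * e i) \<Longrightarrow> z \<in> span_of R n e"
  by (auto simp: span_of_def)

text \<open>Because \<open>r j\<close> divides \<rho> and all other coefficients, the relation can
  be solved for \<open>e j\<close> over \<open>R\<close>, and \<open>m\<close> can replace it in the
  basis.\<close>

lemma span_exchange:
  assumes FR: "field_subring R" and ind: "indep R n e" and j: "j < n"
    and r: "\<And>i. i < n \<Longrightarrow> r i \<in> R" and \<rho>: "\<rho> \<in> R" "\<rho> \<noteq> 0" and rel: "\<rho> * m = (\<Sum>i<n. r i * e i)"
    and rj: "r j \<noteq> 0" "\<rho> / r j \<in> R" "\<And>i. i < n \<Longrightarrow> r i / r j \<in> R"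
  shows "indep R n (e(j := m))" "span_of R n e \<subseteq> span_of R n (e(j := m))" "m \<in> span_of R n (e(j := m))"
proof -
  have split: "(\<Sum>i<n. s i * (e(j := m)) i) = (\<Sum>i\<in>{..<n} - {j}. s i * e i) + s j * m" for s
    using j by (simp add: sum.remove[of "{..<n}" j])
  have splite: "(\<Sum>i<n. s i * e i) = (\<Sum>i\<in>{..<n} - {j}. s i * e i) + s j * e j" for s
    using j by (simp add: sum.remove[of "{..<n}" j])
  show "indep R n (e(j := m))" unfolding indep_def
  proof (intro allI impI)
    fix s i assume s: "(\<forall>i<n. s i \<in> R) \<and> (\<Sum>i<n. s i * (e(j := m)) i) = 0" and i: "i < n"
    \<comment> \<open>The coefficients on the old basis after multiplying the relation by \<rho> and
      substituting for \<open>\<rho> * m\<close>.\<close>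
    let ?t = "\<lambda>i. if i = j then s j * r j else \<rho> * s i + s j * r i"
    have "(\<Sum>i<n. ?t i * e i) = (\<Sum>i\<in>{..<n} - {j}. (\<rho> * s i + s j * r i) * e i) + s j * r j * e j"
      unfolding splite by (auto intro!: sum.cong)
    also have "\<dots> = \<rho> * (\<Sum>i\<in>{..<n} - {j}. s i * e i) + s j * ((\<Sum>i\<in>{..<n} - {j}. r i * e i) + r j * e j)"
      by (simp add: sum.distrib sum_distrib_left algebra_simps)
    also have "(\<Sum>i\<in>{..<n} - {j}. r i * e i) + r j * e j = \<rho> * m"
      using rel splite[of r] by simp
    also have "\<rho> * (\<Sum>i\<in>{..<n} - {j}. s i * e i) + s j * (\<rho> * m) =
        \<rho> * ((\<Sum>i\<in>{..<n} - {j}. s i * e i) + s j * m)"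
      by (simp add: algebra_simps)
    also have "\<dots> = 0" using s unfolding split by simp
    finally have "(\<Sum>i<n. ?t i * e i) = 0" .
    moreover have "\<forall>i<n. ?t i \<in> R" using s r \<rho> j fs_add[OF FR] fs_mult[OF FR] by auto
    ultimately have z: "\<forall>i<n. ?t i = 0"
      by (intro mp[OF spec[OF ind[unfolded indep_def], of ?t]] conjI)
    then have sj: "s j = 0" using j rj(1) by force
    show "s i = 0"
    proof (cases "i = j")
      case False
      then have "\<rho> * s i + s j * r i = 0" using z i by metis
      then show ?thesis using sj \<rho> by simp
    qed (use sj in simp)
  qed
  have ej: "e j = (\<rho> / r j) * m - (\<Sum>i\<in>{..<n} - {j}. (r i / r j) * e i)"
  proof -
    have "\<rho> * m = (\<Sum>i\<in>{..<n} - {j}. r i * e i) + r j * e j" using rel splite[of r] by simp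
    moreover have "(\<Sum>i\<in>{..<n} - {j}. (r i / r j) * e i) = (\<Sum>i\<in>{..<n} - {j}. r i * e i) / r j"
      by (simp add: sum_divide_distrib)
    ultimately show ?thesis using rj(1) by (simp add: field_simps)
  qed
  show "span_of R n e \<subseteq> span_of R n (e(j := m))"
  proof
    fix z assume "z \<in> span_of R n e"
    then obtain x where x: "\<forall>i<n. x i \<in> R" "z = (\<Sum>i<n. x i * e i)" by (auto simp: span_of_def)
    let ?y = "\<lambda>i. if i = j then x j * (\<rho> / r j) else x i - x j * (r i / r j)"
    have "z = (\<Sum>i\<in>{..<n} - {j}. x i * e i) + x j * ((\<rho> / r j) * m - (\<Sum>i\<in>{..<n} - {j}. (r i / r j) * e i))"
      using x(2) splite[of x] ej by simp
    also have "\<dots> = (\<Sum>i\<in>{..<n} - {j}. (x i - x j * (r i / r j)) * e i) + x j * (\<rho> / r j) * m"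
      by (simp add: sum_subtractf sum_distrib_left algebra_simps)
    also have "\<dots> = (\<Sum>i<n. ?y i * (e(j := m)) i)"
      unfolding split by (auto intro!: sum.cong)
    finally have "z = (\<Sum>i<n. ?y i * (e(j := m)) i)" .
    moreover have "?y i \<in> R" if "i < n" for i
    proof -
      have "x j * (\<rho> / r j) \<in> R" "x i - x j * (r i / r j) \<in> R"
        using x(1) rj(2,3) j that fs_diff[OF FR] fs_mult[OF FR] by blast+
      then show ?thesis by simp
    qed
    ultimately show "z \<in> span_of R n (e(j := m))" by (intro span_of_memI)
  qed
  show "m \<in> span_of R n (e(j := m))"
  proof (rule span_of_memI)
    show "m = (\<Sum>i<n. (if i = j then 1 else 0) * (e(j := m)) i)"
      using split[of "\<lambda>i. if i = j then 1 else 0"] by simp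
  qed (use fs_one[OF FR] fs_zero[OF FR] in auto)
qed

text \<open>Elements are added one at a time. Either \<open>m\<close> is independent of the basis,
  or some \<open>\<rho> * m\<close> lies in the span. In the second case the coefficient that
  divides all others decides: if it is \<rho>, then \<open>m\<close> is already in the span,
  otherwise \<open>m\<close> is exchanged for a basis element.\<close>

lemma finite_in_free:
  assumes R: "valuation_subring R" and T: "finite T" "T \<subseteq> L"
  shows "\<exists>n e. indep R n e \<and> (\<forall>i<n. e i \<in> L) \<and> T \<subseteq> span_of R n e"
  using T
proof (induction rule: finite_induct)
  case empty
  show ?case by (rule exI[of _ 0]) (simp add: indep_def)
next
  case (insert m T)
  have FR: "field_subring R" using R by (simp add: valuation_subring_def)
  obtain n e where e: "indep R n e" "\<forall>i<n. e i \<in> L" "T \<subseteq> span_of R n e" using insert by auto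
  show ?case
  proof (cases "\<exists>\<rho>\<in>R. \<rho> \<noteq> 0 \<and> \<rho> * m \<in> span_of R n e")
    case False
    have "indep R (Suc n) (e(n := m))" unfolding indep_def
    proof (intro allI impI)
      fix r i assume r: "(\<forall>i<Suc n. r i \<in> R) \<and> (\<Sum>i<Suc n. r i * (e(n := m)) i) = 0" and i: "i < Suc n"
      have s: "(\<Sum>i<n. r i * e i) + r n * m = 0" using r by simp
      have "r n * m \<in> span_of R n e"
      proof (rule span_of_memI)
        show "r n * m = (\<Sum>i<n. (- r i) * e i)" using s by (simp add: sum_negf eq_neg_iff_add_eq_0 add.commute)
      qed (use r fs_minus[OF FR] in auto)
      then have rn: "r n = 0" using False r by auto
      then have "\<forall>i<n. r i = 0" using s e(1) r unfolding indep_def by simp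
      then show "r i = 0" using i rn less_Suc_eq by auto
    qed
    moreover have "insert m T \<subseteq> span_of R (Suc n) (e(n := m))"
    proof
      fix z assume z: "z \<in> insert m T"
      show "z \<in> span_of R (Suc n) (e(n := m))"
      proof (cases "z = m")
        case True
        show ?thesis
          by (rule span_of_memI[of _ "\<lambda>i. if i =
              n then 1 else 0"]) (use True fs_one[OF FR] fs_zero[OF FR] in auto)
      next
        case False
        then obtain x where x: "\<forall>i<n. x i \<in> R" "z = (\<Sum>i<n. x i * e i)" using z e(3)
          by (auto simp: span_of_def)
        show ?thesis
          by (rule span_of_memI[of _ "\<lambda>i. if i = n then 0 else x i"]) (use x fs_zero[OF FR] in auto)
      qed
    qed
    moreover have "\<forall>i<Suc n. (e(n := m)) i \<in> L" using e insert.prems by auto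
    ultimately show ?thesis by blast
  next
    case True
    then obtain \<rho> r where \<rho>: "\<rho> \<in> R" "\<rho> \<noteq> 0" and r: "\<And>i. i < n \<Longrightarrow> r i \<in> R" "\<rho> * m = (\<Sum>i<n. r i * e i)"
      by (auto simp: span_of_def)
    \<comment> \<open>The extra index \<open>n\<close> stands for the coefficient \<rho> of
      \<open>m\<close>.\<close>
    let ?I = "insert n {i. i < n \<and> r i \<noteq> 0}" and ?f = "r(n := \<rho>)"
    have "\<exists>j\<in>?I. \<forall>i\<in>?I. ?f i / ?f j \<in> R"
      by (rule common_divisor[OF R]) (use \<rho> r in auto)
    then obtain j where j: "j \<in> ?I" "\<forall>i\<in>?I. ?f i / ?f j \<in> R" by blast
    have fj: "r i / ?f j \<in> R" if "i < n" for i
      using j(2) that fs_zero[OF FR] by (cases "r i = 0") auto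
    show ?thesis
    proof (cases "j = n")
      case True
      have "m = (\<Sum>i<n. (r i / \<rho>) * e i)"
        using r(2) \<rho> by (simp add: sum_divide_distrib[symmetric] field_simps)
      then have "m \<in> span_of R n e" using fj True by (intro span_of_memI) auto
      then show ?thesis using e by blast
    next
      case False
      then have j': "j < n" "r j \<noteq> 0" using j by auto
      have "\<rho> / r j \<in> R" using j(2) False by auto
      note ex = span_exchange[OF FR e(1) j'(1) r(1) \<rho> r(2) j'(2) this]
      have "indep R n (e(j := m))" "span_of R n e \<subseteq> span_of R n (e(j := m))" "m \<in> span_of R n (e(j := m))"
        using ex fj False by auto
      moreover have "\<forall>i<n. (e(j := m)) i \<in> L" using e insert.prems by auto
      ultimately show ?thesis using e(3) by blast
    qed
  qed
qed

text \<open>Coordinate functions of a finite free submodule \<open>D\<close>. They are total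
  functions, hence linearity is asked for on \<open>D\<close> only.\<close>

definition free_coordinates :: "'k::field set \<Rightarrow> 'k set \<Rightarrow> nat \<Rightarrow> (nat \<Rightarrow> 'k) \<Rightarrow> (nat \<Rightarrow> 'k \<Rightarrow> 'k) \<Rightarrow> bool" where
  "free_coordinates R D n e c \<longleftrightarrow> (\<forall>i<n. e i \<in> D) \<and>
    (\<forall>m\<in>D. \<forall>i<n. c i m \<in> R) \<and> (\<forall>m\<in>D. m = (\<Sum>i<n. c i m * e i)) \<and>
    (\<forall>m\<in>D. \<forall>m'\<in>D. m + m' \<in> D \<and> (\<forall>i<n. c i (m + m') = c i m + c i m')) \<and>
    (\<forall>r\<in>R. \<forall>m\<in>D. r * m \<in> D \<and> (\<forall>i<n. c i (r * m) = r * c i m))"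

lemma free_coordinates_exist:
  assumes R: "valuation_subring R" and L: "field_subring L" "R \<subseteq> L" and T: "finite T" "T \<subseteq> L"
  shows "\<exists>D n e c. T \<subseteq> D \<and> D \<subseteq> L \<and> free_coordinates R D n e c"
proof -
  have FR: "field_subring R" using R by (simp add: valuation_subring_def)
  obtain n e where e: "indep R n e" "\<forall>i<n. e i \<in> L" "T \<subseteq> span_of R n e" using finite_in_free[OF R T] by blast
  let ?D = "span_of R n e"
  define C where "C m = (SOME r. (\<forall>i<n. r i \<in> R) \<and> m = (\<Sum>i<n. r i * e i))" for m
  have C: "(\<forall>i<n. C m i \<in> R) \<and> m = (\<Sum>i<n. C m i * e i)" if "m \<in> ?D" for m
  proof -
    have "\<exists>r. (\<forall>i<n. r i \<in> R) \<and> m = (\<Sum>i<n. r i * e i)" using that by (auto simp: span_of_def)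
    from someI_ex[OF this] show ?thesis unfolding C_def .
  qed
  have uniq: "\<forall>i<n. C m i = r i" if "\<forall>i<n. r i \<in> R" "m = (\<Sum>i<n. r i * e i)" for m r
  proof -
    have m: "m \<in> ?D" using that by (auto simp: span_of_def)
    have "(\<Sum>i<n. (C m i - r i) * e i) = 0"
      using C[OF m] that(2) by (simp add: left_diff_distrib sum_subtractf)
    moreover have "\<forall>i<n. C m i - r i \<in> R" using C[OF m] that fs_diff[OF FR] by auto
    ultimately have "\<forall>i<n. C m i - r i = 0"
      by (intro mp[OF spec[OF e(1)[unfolded indep_def], of "\<lambda>i. C m i - r i"]] conjI)
    then show ?thesis by simp
  qed
  have DL: "?D \<subseteq> L"
    unfolding span_of_def using e(2) L fs_mult[OF L(1)] by (auto intro!: fs_sum[OF L(1)])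
  have eD: "e i \<in> ?D" if "i < n" for i
    by (rule span_of_memI[of _ "\<lambda>j. if j = i then 1 else 0"])
      (use that fs_one[OF FR] fs_zero[OF FR] in \<open>auto simp: if_distrib[of "\<lambda>x. x * _"] cong: if_cong\<close>)
  have add: "m + m' \<in> ?D \<and> (\<forall>i<n. C (m + m') i = C m i + C m' i)" if "m \<in> ?D" "m' \<in> ?D" for m m'
  proof -
    have *: "\<forall>i<n. C m i + C m' i \<in> R" "m + m' = (\<Sum>i<n. (C m i + C m' i) * e i)"
      using C[OF that(1)] C[OF that(2)] fs_add[OF FR] by (auto simp: distrib_right sum.distrib)
    show ?thesis using uniq[OF *] * by (auto simp: span_of_def)
  qed
  have mul: "r * m \<in> ?D \<and> (\<forall>i<n. C (r * m) i = r * C m i)" if "r \<in> R" "m \<in> ?D" for r m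
  proof -
    have "(\<Sum>i<n. (r * C m i) * e i) = r * (\<Sum>i<n. C m i * e i)"
      by (simp only: sum_distrib_left mult.assoc)
    also have "\<dots> = r * m" by (rule arg_cong[OF conjunct2[OF C[OF that(2)], symmetric]])
    finally have *: "r * m = (\<Sum>i<n. (r * C m i) * e i)" by (rule sym)
    have **: "\<forall>i<n. r * C m i \<in> R" using C[OF that(2)] that(1) fs_mult[OF FR] by blast
    show ?thesis using uniq[OF ** *] * ** by (auto simp: span_of_def)
  qed
  have "free_coordinates R ?D n e (\<lambda>i m. C m i)" unfolding free_coordinates_def
  proof (intro conjI)
    show "\<forall>i<n. e i \<in> ?D" using eD by auto
    show "\<forall>m\<in>?D. \<forall>i<n. C m i \<in> R" using C by blast
    show "\<forall>m\<in>?D. m = (\<Sum>i<n. C m i * e i)" by (rule ballI, rule conjunct2[OF C])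
    show "\<forall>m\<in>?D. \<forall>m'\<in>?D. m + m' \<in> ?D \<and> (\<forall>i<n. C (m + m') i = C m i + C m' i)"
      by (intro ballI add)
    show "\<forall>r\<in>R. \<forall>m\<in>?D. r * m \<in> ?D \<and> (\<forall>i<n. C (r * m) i = r * C m i)"
      by (intro ballI mul)
  qed
  then show ?thesis using e(3) DL by blast
qed

section \<open>The relations of a tensor product\<close>

inductive_set additive_hull :: "'a::ab_group_add set \<Rightarrow> 'a set" for G where
  ah_zero: "0 \<in> additive_hull G"
| ah_gen: "x \<in> G \<Longrightarrow> x \<in> additive_hull G"
| ah_diff: "x \<in> additive_hull G \<Longrightarrow> y \<in> additive_hull G \<Longrightarrow> x - y \<in> additive_hull G"

lemma ah_minus: "x \<in> additive_hull G \<Longrightarrow> - x \<in> additive_hull G"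
  using ah_diff[OF ah_zero] by fastforce

lemma ah_add: "x \<in> additive_hull G \<Longrightarrow> y \<in> additive_hull G \<Longrightarrow> x + y \<in> additive_hull G"
  using ah_diff[OF _ ah_minus, of x G y] by simp

lemma ah_sum: "(\<And>i. i \<in> I \<Longrightarrow> f i \<in> additive_hull G) \<Longrightarrow> sum f I \<in> additive_hull G"
  by (induction I rule: infinite_finite_induct) (auto intro: ah_zero ah_add)

lemma additive_hull_mono: "x \<in> additive_hull G \<Longrightarrow> G \<subseteq> G' \<Longrightarrow> x \<in> additive_hull G'"
  by (induction rule: additive_hull.induct) (auto intro: additive_hull.intros)

lemma keys_diff_subset: "Poly_Mapping.keys a \<subseteq> S \<Longrightarrow> Poly_Mapping.keys b \<subseteq> S \<Longrightarrow> Poly_Mapping.keys (a - b) \<subseteq> S"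
  using keys_diff[of a b] by blast

text \<open>Replaces \<open>generate\<close> by a closure that does not mention the generating set
  \<open>S\<close> of the free group, so relations for different modules can be compared as subsets
  of one type.\<close>

lemma generate_free_Abelian_group:
  assumes G: "\<And>x. x \<in> G \<Longrightarrow> Poly_Mapping.keys x \<subseteq> S"
  shows "generate (free_Abelian_group S) G = additive_hull G"
proof -
  interpret group "free_Abelian_group S" by simp
  have sub: "subgroup (generate (free_Abelian_group S) G) (free_Abelian_group S)"
    by (rule generate_is_subgroup) (use G in auto)
  have "x \<in> additive_hull G" if "x \<in> generate (free_Abelian_group S) G" for x
    using that by induction (use G in \<open>auto intro: additive_hull.intros ah_minus ah_add\<close>)
  moreover have "x \<in> generate (free_Abelian_group S) G" if "x \<in> additive_hull G" for x
    using that
  proof induction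
    case ah_zero
    then show ?case using generate.one[of "free_Abelian_group S" G] by simp
  next
    case (ah_diff x y)
    have "Poly_Mapping.keys y \<subseteq> S" using subgroup.mem_carrier[OF sub ah_diff(4)] by simp
    then show ?case
      using subgroup.m_closed[OF sub ah_diff(3) subgroup.m_inv_closed[OF sub ah_diff(4)]] by simp
  qed (rule generate.incl)
  ultimately show ?thesis by blast
qed

context
  fixes R L :: "'k::field set" and N :: "('k, 'n) module"
  assumes R: "field_subring R" and L: "field_subring L" and RL: "R \<subseteq> L"
    and N: "Module.module (ring_on R) N"
begin

interpretation N: Module.module "ring_on R" N by (rule N)

definition tensor_gens :: "'k set \<Rightarrow> 'n set \<Rightarrow> (('k \<times> 'n) \<Rightarrow>\<^sub>0 int) set" where
  "tensor_gens D H =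
    {frag_of (m + m', n) - frag_of (m, n) - frag_of (m', n) | m m' n. m \<in> D \<and> m' \<in> D \<and> m + m' \<in> D \<and> n \<in> H} \<union>
    {frag_of (m, n \<oplus>\<^bsub>N\<^esub> n') - frag_of (m, n) - frag_of (m, n') | m n n'. m \<in> D \<and> n \<in> H \<and> n' \<in> H} \<union>
    {frag_of (r * m, n) - frag_of (m, r \<odot>\<^bsub>N\<^esub> n) | r m n. r \<in> R \<and> m \<in> D \<and> r * m \<in> D \<and> n \<in> H}"

lemma tensor_gens_mono: "D \<subseteq> D' \<Longrightarrow> tensor_gens D H \<subseteq> tensor_gens D' H"
  unfolding tensor_gens_def by blast

lemma tensor_gens_keys:
  assumes H: "submodule H (ring_on R) N" and x: "x \<in> tensor_gens D H"
  shows "Poly_Mapping.keys x \<subseteq> D \<times> H"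
proof -
  have Hadd: "a \<oplus>\<^bsub>N\<^esub> b \<in> H" if "a \<in> H" "b \<in> H" for a b
    using subgroup.m_closed[of H "add_monoid N" a b] H that by (simp add: submodule_def)
  have Hmul: "r \<odot>\<^bsub>N\<^esub> a \<in> H" if "r \<in> R" "a \<in> H" for r a
    using submodule.smult_closed[OF H, of r a] that by simp
  consider
      m m' n where "x = frag_of (m + m', n) - frag_of (m, n) - frag_of (m', n)" "m \<in> D" "m' \<in> D"
          "m + m' \<in> D" "n \<in> H"
    | m n n' where "x = frag_of (m, n \<oplus>\<^bsub>N\<^esub> n') - frag_of (m, n) - frag_of (m, n')" "m \<in> D" "n \<in> H" "n' \<in> H"
    | r m n where "x = frag_of (r * m, n) - frag_of (m, r \<odot>\<^bsub>N\<^esub> n)" "r \<in> R" "m \<in> D" "r * m \<in> D" "n \<in> H"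
    using x unfolding tensor_gens_def by blast
  then show ?thesis
    by cases (simp_all add: keys_diff_subset keys_frag_of Hadd Hmul)
qed

lemma submodule_carrier: "submodule (carrier N) (ring_on R) N"
  by (rule N.submoduleI) (auto intro: N.a_inv_closed)

lemma tensor_relations_eq:
  assumes H: "submodule H (ring_on R) N"
  shows "tensor_relations (ring_on R) (as_module (\<lambda>z. z) (ring_on L)) (N\<lparr>carrier := H\<rparr>) =
      additive_hull (tensor_gens L H)"
proof -
  have "tensor_relations (ring_on R) (as_module (\<lambda>z. z) (ring_on L)) (N\<lparr>carrier := H\<rparr>) =
    generate (free_Abelian_group (L \<times> H)) (tensor_gens L H)"
    unfolding tensor_relations_def tensor_gens_def
    using fs_add[OF L] fs_mult[OF L] RL
    by (intro arg_cong2[where f = generate] arg_cong2[where f = "(\<union>)"])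
      (auto simp: as_module_def ring_on_def subset_iff; blast)+
  also have "\<dots> = additive_hull (tensor_gens L H)"
    by (rule generate_free_Abelian_group) (rule tensor_gens_keys[OF H])
  finally show ?thesis .
qed

lemma additive_hull_finite_support:
  "x \<in> additive_hull (tensor_gens L H) \<Longrightarrow> \<exists>T. finite T \<and> T \<subseteq> L \<and> x \<in> additive_hull (tensor_gens T H)"
proof (induction rule: additive_hull.induct)
  case ah_zero
  then show ?case by (intro exI[of _ "{}"]) (auto intro: additive_hull.ah_zero)
next
  case (ah_gen x)
  have "\<exists>T. finite T \<and> T \<subseteq> L \<and> x \<in> tensor_gens T H"
  proof -
    consider m m' n where "x = frag_of (m + m', n) - frag_of (m, n) - frag_of (m', n)" "m \<in> L" "m' \<in> L"
        "m + m' \<in> L" "n \<in> H"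
      | m n n' where "x = frag_of (m, n \<oplus>\<^bsub>N\<^esub> n') - frag_of (m, n) - frag_of (m, n')" "m \<in> L" "n \<in> H" "n' \<in> H"
      | r m n where "x = frag_of (r * m, n) - frag_of (m, r \<odot>\<^bsub>N\<^esub> n)" "r \<in> R" "m \<in> L" "r * m \<in> L" "n \<in> H"
      using ah_gen unfolding tensor_gens_def by blast
    then show ?thesis
    proof cases
      case 1
      then show ?thesis by (intro exI[of _ "{m, m', m + m'}"]) (unfold tensor_gens_def, blast)
    next
      case 2
      then show ?thesis by (intro exI[of _ "{m}"]) (unfold tensor_gens_def, blast)
    next
      case 3
      then show ?thesis by (intro exI[of _ "{m, r * m}"]) (unfold tensor_gens_def, blast)
    qed
  qed
  then show ?case by (meson additive_hull.ah_gen)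
next
  case (ah_diff x y)
  then obtain T T' where T: "finite T" "T \<subseteq> L" "x \<in> additive_hull (tensor_gens T H)"
    and T': "finite T'" "T' \<subseteq> L" "y \<in> additive_hull (tensor_gens T' H)" by blast
  have "x - y \<in> additive_hull (tensor_gens (T \<union> T') H)"
    using additive_hull_mono[OF T(3) tensor_gens_mono, of "T \<union> T'"]
      additive_hull_mono[OF T'(3) tensor_gens_mono, of "T \<union> T'"] by (auto intro: additive_hull.ah_diff)
  then show ?case using T T' by (intro exI[of _ "T \<union> T'"]) auto
qed

text \<open>An element of the tensor product involves only finitely many elements of \<^term>\<open>L\<close>, which lie in
  a free submodule; its coordinates with respect to a basis detect whether it vanishes, and they do
  not depend on whether they are computed in the submodule or in \<^term>\<open>N\<close>.\<close>

lemma tensor_relations_restrict: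
  assumes val: "valuation_subring R" and H: "submodule H (ring_on R) N"
    and x: "x \<in> additive_hull (tensor_gens L (carrier N))" "Poly_Mapping.keys x \<subseteq> L \<times> H"
  shows "x \<in> additive_hull (tensor_gens L H)"
proof -
  have HN: "H \<subseteq> carrier N" using H by (simp add: submodule_def subgroup_def)
  have Hadd: "a \<oplus>\<^bsub>N\<^esub> b \<in> H" if "a \<in> H" "b \<in> H" for a b
    using subgroup.m_closed[of H "add_monoid N" a b] H that by (simp add: submodule_def)
  have Hmul: "r \<odot>\<^bsub>N\<^esub> a \<in> H" if "r \<in> R" "a \<in> H" for r a
    using submodule.smult_closed[OF H, of r a] that by simp
  have H0: "\<zero>\<^bsub>N\<^esub> \<in> H" using subgroup.one_closed[of H "add_monoid N"] H by (simp add: submodule_def)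
  have Hinv: "\<ominus>\<^bsub>N\<^esub> a \<in> H" if "a \<in> H" for a
    using subgroup.m_inv_closed[of H "add_monoid N" a] H that by (simp add: submodule_def a_inv_def)
  let ?K = "additive_hull (tensor_gens L H)"
  obtain T where T: "finite T" "T \<subseteq> L" "x \<in> additive_hull (tensor_gens T (carrier N))"
    using additive_hull_finite_support[OF x(1)] by blast
  \<comment> \<open>The first components occurring in \<open>x\<close> are added so that
    \<open>x\<close> itself is expressed over \<open>D\<close>.\<close>
  have "finite (T \<union> fst ` Poly_Mapping.keys x)" "T \<union> fst ` Poly_Mapping.keys x \<subseteq> L"
    using T x(2) by auto
  from free_coordinates_exist[OF val L RL this] obtain D n e c where
    TD: "T \<union> fst ` Poly_Mapping.keys x \<subseteq> D" and DL: "D \<subseteq> L" and coord: "free_coordinates R D n e c" by blast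
  note * = coord[unfolded free_coordinates_def]
  note eD = conjunct1[OF *] and ** = conjunct2[OF *]
  note cR = conjunct1[OF **] and *** = conjunct2[OF **]
  note repr = conjunct1[OF ***] and cadd = conjunct1[OF conjunct2[OF ***]] and cmul =
      conjunct2[OF conjunct2[OF ***]]
  \<comment> \<open>The map that sends \<open>(m, a)\<close> to the \<open>i\<close>-th coordinate
    of \<open>m\<close> times \<open>a\<close>. It kills the relations over \<open>D\<close>, so it
    factors through the tensor product.\<close>
  have "\<exists>h. h \<in> hom (free_Abelian_group (D \<times> carrier N)) (add_monoid N) \<and>
     (\<forall>m\<in>D. \<forall>a\<in>carrier N. h (frag_of (m, a)) = c i m \<odot>\<^bsub>N\<^esub> a)" if "i < n" for i
  proof -
    have "(\<lambda>(m, a). c i m \<odot>\<^bsub>N\<^esub> a) ` (D \<times> carrier N) \<subseteq> carrier (add_monoid N)"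
      using cR that by auto
    from comm_group.free_Abelian_group_universal[OF N.a_comm_group this] show ?thesis
      by (metis (no_types, lifting) SigmaI case_prod_conv)
  qed
  then obtain \<Phi> where \<Phi>: "\<And>i. i < n \<Longrightarrow> \<Phi> i \<in> hom (free_Abelian_group (D \<times> carrier N)) (add_monoid N)"
    and \<Phi>_frag: "\<And>i m a. i < n \<Longrightarrow> m \<in> D \<Longrightarrow> a \<in> carrier N \<Longrightarrow> \<Phi> i (frag_of (m, a)) = c i m \<odot>\<^bsub>N\<^esub> a"
    by metis
  have grp: "group (free_Abelian_group (D \<times> carrier N))" by simp
  have gh: "group_hom (free_Abelian_group (D \<times> carrier N)) (add_monoid N) (\<Phi> i)" if "i < n" for i
    by (rule group_hom.intro[OF grp comm_group.axioms(2)[OF N.a_comm_group]])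
      (use \<Phi>[OF that] in \<open>simp add: group_hom_axioms_def\<close>)
  have \<Phi>_closed: "\<Phi> i a \<in> carrier N" if "i < n" "Poly_Mapping.keys a \<subseteq> D \<times> carrier N" for i a
    using group_hom.hom_closed[OF gh[OF that(1)], of a] that(2) by simp
  have \<Phi>_zero: "\<Phi> i 0 = \<zero>\<^bsub>N\<^esub>" if "i < n" for i
    using group_hom.hom_one[OF gh[OF that]] by simp
  have \<Phi>_diff: "\<Phi> i (a - b) = \<Phi> i a \<ominus>\<^bsub>N\<^esub> \<Phi> i b"
    if "i < n" "Poly_Mapping.keys a \<subseteq> D \<times> carrier N" "Poly_Mapping.keys b \<subseteq> D \<times> carrier N" for i a b
    using group_hom.hom_mult[OF gh[OF that(1)], of a "- b"] group_hom.hom_inv[OF gh[OF that(1)], of b] that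
    by (simp add: a_minus_def a_inv_def)
  have keysD: "Poly_Mapping.keys (frag_of (m, a)) \<subseteq> D \<times> carrier N" if "m \<in> D" "a \<in> carrier N" for m a
    using that by (simp add: keys_frag_of)
  have van_gen: "\<Phi> i y = \<zero>\<^bsub>N\<^esub>" if i: "i < n" and y: "y \<in> tensor_gens D (carrier N)" for i y
  proof -
    have cc: "c i m \<odot>\<^bsub>N\<^esub> a \<in> carrier N" "c i m \<in> R" if "m \<in> D" "a \<in> carrier N" for m a using cR i that by auto
    have cancel: "u \<oplus>\<^bsub>N\<^esub> v \<ominus>\<^bsub>N\<^esub> u \<ominus>\<^bsub>N\<^esub> v = \<zero>\<^bsub>N\<^esub>" if "u \<in> carrier N" "v \<in> carrier N" for u v
    proof -
      have "u \<oplus>\<^bsub>N\<^esub> v \<ominus>\<^bsub>N\<^esub> u = v \<oplus>\<^bsub>N\<^esub> (u \<oplus>\<^bsub>N\<^esub> \<ominus>\<^bsub>N\<^esub> u)"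
        using that N.a_comm[of u v] by (simp add: a_minus_def N.a_assoc)
      then show ?thesis using that by (simp add: a_minus_def N.r_neg)
    qed
    consider m m' a where "y = frag_of (m + m', a) - frag_of (m, a) - frag_of (m', a)" "m \<in> D" "m' \<in> D"
        "m + m' \<in> D" "a \<in> carrier N"
      | m a b where "y = frag_of (m, a \<oplus>\<^bsub>N\<^esub> b) - frag_of (m, a) - frag_of (m, b)" "m \<in> D" "a \<in> carrier N"
          "b \<in> carrier N"
      | r m a where "y = frag_of (r * m, a) - frag_of (m, r \<odot>\<^bsub>N\<^esub> a)" "r \<in> R" "m \<in> D" "r * m \<in> D" "a \<in> carrier N"
      using y unfolding tensor_gens_def by blast
    then show ?thesis
    proof cases
      case 1
      have "c i (m + m') = c i m + c i m'" using cadd 1 i by blast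
      then have "c i (m + m') \<odot>\<^bsub>N\<^esub> a = c i m \<odot>\<^bsub>N\<^esub> a \<oplus>\<^bsub>N\<^esub> c i m' \<odot>\<^bsub>N\<^esub> a"
        using N.smult_l_distr[of "c i m" "c i m'" a] 1 cc by simp
      then show ?thesis using cancel 1 i keysD cc
        by (simp add: \<Phi>_diff \<Phi>_frag keys_diff_subset)
    next
      case 2
      have "c i m \<odot>\<^bsub>N\<^esub> (a \<oplus>\<^bsub>N\<^esub> b) = c i m \<odot>\<^bsub>N\<^esub> a \<oplus>\<^bsub>N\<^esub> c i m \<odot>\<^bsub>N\<^esub> b"
        using N.smult_r_distr[of "c i m" a b] 2 cc by simp
      then show ?thesis using cancel 2 i keysD cc
        by (simp add: \<Phi>_diff \<Phi>_frag keys_diff_subset)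
    next
      case 3
      have "c i (r * m) = c i m * r" using cmul 3 i by (metis mult.commute)
      then have "c i (r * m) \<odot>\<^bsub>N\<^esub> a = c i m \<odot>\<^bsub>N\<^esub> (r \<odot>\<^bsub>N\<^esub> a)"
        using N.smult_assoc1[of "c i m" r a] 3 cc by simp
      then show ?thesis using 3 i keysD cc N.smult_closed[of r a]
        by (simp add: \<Phi>_diff \<Phi>_frag N.r_neg a_minus_def)
    qed
  qed
  have van: "\<Phi> i y = \<zero>\<^bsub>N\<^esub> \<and> Poly_Mapping.keys y \<subseteq> D \<times> carrier N"
    if i: "i < n" and y: "y \<in> additive_hull (tensor_gens D (carrier N))" for i y
    using y
  proof induction
    case (ah_gen y)
    then show ?case using van_gen[OF i] tensor_gens_keys[OF submodule_carrier] by blast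
  next
    case (ah_diff y z)
    have "\<zero>\<^bsub>N\<^esub> \<ominus>\<^bsub>N\<^esub> \<zero>\<^bsub>N\<^esub> = \<zero>\<^bsub>N\<^esub>"
      using \<Phi>_diff[OF i, of 0 0] \<Phi>_zero[OF i] by simp
    with ah_diff show ?case using \<Phi>_diff[OF i, of y z] keys_diff_subset[of y "D \<times> carrier N" z]
      by simp
  qed (use \<Phi>_zero[OF i] in auto)
  have xD: "x \<in> additive_hull (tensor_gens D (carrier N))"
    using additive_hull_mono[OF T(3) tensor_gens_mono] TD by blast
  have van_x: "\<Phi> i x = \<zero>\<^bsub>N\<^esub>" if "i < n" for i using van[OF that xD] by blast
  have g1: "frag_of (m + m', a) - frag_of (m, a) - frag_of (m', a) \<in> ?K"
    if "m \<in> L" "m' \<in> L" "a \<in> H" for m m' a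
    by (rule additive_hull.ah_gen) (use that fs_add[OF L] in \<open>unfold tensor_gens_def, blast\<close>)
  have g2: "frag_of (m, a \<oplus>\<^bsub>N\<^esub> b) - frag_of (m, a) - frag_of (m, b) \<in> ?K" if "m \<in> L" "a \<in> H" "b \<in> H" for m a b
    by (rule additive_hull.ah_gen) (use that in \<open>unfold tensor_gens_def, blast\<close>)
  have g3: "frag_of (r * m, a) - frag_of (m, r \<odot>\<^bsub>N\<^esub> a) \<in> ?K" if "r \<in> R" "m \<in> L" "a \<in> H" for r m a
    by (rule additive_hull.ah_gen) (use that RL fs_mult[OF L] in \<open>unfold tensor_gens_def, blast\<close>)
  have z1: "frag_of (0, a) \<in> ?K" if "a \<in> H" for a
    using ah_minus[OF g1[OF fs_zero[OF L] fs_zero[OF L] that]] by simp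
  have z2: "frag_of (m, \<zero>\<^bsub>N\<^esub>) \<in> ?K" if "m \<in> L" for m
    using ah_minus[OF g2[OF that H0 H0]] by simp
  have g2d: "frag_of (m, a \<ominus>\<^bsub>N\<^esub> b) - (frag_of (m, a) - frag_of (m, b)) \<in> ?K"
    if "m \<in> L" "a \<in> H" "b \<in> H" for m a b
  proof -
    have ab: "a \<ominus>\<^bsub>N\<^esub> b \<in> H" using that Hadd Hinv by (simp add: a_minus_def)
    have "(a \<ominus>\<^bsub>N\<^esub> b) \<oplus>\<^bsub>N\<^esub> b = a" using that HN by (simp add: a_minus_def N.a_assoc N.l_neg subset_iff)
    then show ?thesis using ah_minus[OF g2[OF that(1) ab that(3)]] by (simp add: algebra_simps)
  qed
  have e_L: "e i \<in> L" if "i < n" for i using eD DL that by blast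
  \<comment> \<open>Modulo the relations for \<open>H\<close>, a symbol \<open>(m, a)\<close>
    becomes the sum of the \<open>(e i, c i m a)\<close>; partial sums of the expansion of
    \<open>m\<close> are split off one by one.\<close>
  have expand: "frag_of (m, a) - (\<Sum>i<n. frag_of (e i, c i m \<odot>\<^bsub>N\<^esub> a)) \<in> ?K" if m: "m \<in> D" and a: "a \<in> H" for m a
  proof -
    have "frag_of (\<Sum>i<j. c i m * e i, a) - (\<Sum>i<j. frag_of (e i, c i m \<odot>\<^bsub>N\<^esub> a)) \<in> ?K" if "j \<le> n" for j
      using that
    proof (induction j)
      case 0
      then show ?case using z1[OF a] by simp
    next
      case (Suc j)
      have cj: "c j m \<in> R" "e j \<in> L" using cR m e_L Suc by auto
      have ceL: "c i m * e i \<in> L" if "i < n" for i using cR m e_L[OF that] that RL fs_mult[OF L] by blast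
      have sL: "(\<Sum>i<j. c i m * e i) \<in> L" by (rule fs_sum[OF L]) (use Suc ceL in auto)
      have "frag_of ((\<Sum>i<j. c i m * e i) + c j m * e j, a) - frag_of (\<Sum>i<j. c i m * e i,
          a) - frag_of (c j m * e j, a) \<in> ?K"
        by (rule g1[OF sL ceL a]) (use Suc in auto)
      from ah_add[OF ah_add[OF this g3[OF cj a]] Suc.IH] Suc.prems
      show ?case by (simp add: algebra_simps)
    qed
    from this[of n] show ?thesis using repr m by simp
  qed
  \<comment> \<open>By additivity every element over \<open>D\<close> and \<open>H\<close> is
    congruent to the sum of the \<open>(e i, \<Phi> i y)\<close>. For \<open>y = x\<close> all
    second components are zero.\<close>
  have "(\<forall>i<n. \<Phi> i y \<in> H) \<and> Poly_Mapping.keys y \<subseteq> D \<times> H \<and> y - (\<Sum>i<n. frag_of (e i, \<Phi> i y)) \<in> ?K"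
    if "Poly_Mapping.keys y \<subseteq> D \<times> H" for y
    using that
  proof (induction rule: frag_induction)
    case zero
    have "(\<Sum>i<n. frag_of (e i, \<zero>\<^bsub>N\<^esub>)) \<in> ?K"
      by (rule ah_sum) (auto intro: z2 e_L)
    then show ?case using \<Phi>_zero H0 ah_minus by auto
  next
    case (one y)
    then obtain m a where y: "y = (m, a)" "m \<in> D" "a \<in> H" by auto
    have "\<Phi> i (frag_of (m, a)) = c i m \<odot>\<^bsub>N\<^esub> a" if "i < n" for i using \<Phi>_frag that y HN by blast
    then show ?case using expand[OF y(2,3)] y cR Hmul by (auto simp: keys_frag_of)
  next
    case (diff a b)
    have k: "Poly_Mapping.keys a \<subseteq> D \<times> carrier N" "Poly_Mapping.keys b \<subseteq> D \<times> carrier N" using diff HN by auto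
    have "\<Phi> i (a - b) = \<Phi> i a \<ominus>\<^bsub>N\<^esub> \<Phi> i b" if "i < n" for i using \<Phi>_diff[OF that k] .
    moreover have "(\<Sum>i<j. frag_of (e i, \<Phi> i a \<ominus>\<^bsub>N\<^esub> \<Phi> i b)) -
        ((\<Sum>i<j. frag_of (e i, \<Phi> i a)) - (\<Sum>i<j. frag_of (e i, \<Phi> i b))) \<in> ?K" if "j \<le> n" for j
      using that
    proof (induction j)
      case (Suc j)
      have "frag_of (e j, \<Phi> j a \<ominus>\<^bsub>N\<^esub> \<Phi> j b) - (frag_of (e j, \<Phi> j a) - frag_of (e j, \<Phi> j b)) \<in> ?K"
        by (rule g2d) (use Suc e_L diff in auto)
      from ah_add[OF this Suc.IH] Suc.prems show ?case by (simp add: algebra_simps)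
    qed (simp add: additive_hull.ah_zero)
    from this[OF order.refl] have "(\<Sum>i<n. frag_of (e i, \<Phi> i a \<ominus>\<^bsub>N\<^esub> \<Phi> i b)) -
        ((\<Sum>i<n. frag_of (e i, \<Phi> i a)) - (\<Sum>i<n. frag_of (e i, \<Phi> i b))) \<in> ?K" .
    from additive_hull.ah_diff[OF additive_hull.ah_diff[OF conjunct2[OF conjunct2[OF diff(1)]] conjunct2[OF conjunct2[OF diff(2)]]] this]
    have "(a - b) - (\<Sum>i<n. frag_of (e i, \<Phi> i a \<ominus>\<^bsub>N\<^esub> \<Phi> i b)) \<in> ?K" by (simp add: algebra_simps)
    ultimately show ?case using diff keys_diff_subset[of a "D \<times> H" b] Hadd Hinv by (simp add: a_minus_def)
  qed
  moreover have "Poly_Mapping.keys x \<subseteq> D \<times> H" using x(2) TD by force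
  ultimately have *: "x - (\<Sum>i<n. frag_of (e i, \<Phi> i x)) \<in> ?K" by blast
  have "(\<Sum>i<n. frag_of (e i, \<Phi> i x)) \<in> ?K"
    by (rule ah_sum) (auto intro: z2 e_L simp: van_x)
  from ah_add[OF * this] show ?thesis by simp
qed

end

text \<open>If two cosets for \<open>H\<close> have the same enlargement, their representatives
  differ by a relation for \<open>N\<close> that is supported on \<open>L\<close> times
  \<open>H\<close>; by the preceding lemma it is a relation for \<open>H\<close>.\<close>

theorem flat_module_valuation:
  assumes val: "valuation_subring R" and L: "field_subring L" and RL: "R \<subseteq> L"
  shows "flat_module TYPE('n) (ring_on R) (as_module (\<lambda>z. z) (ring_on L))"
  unfolding flat_module_def
proof (intro allI impI)
  fix N :: "('a, 'n) module" and H
  assume *: "Module.module (ring_on R) N \<and> submodule H (ring_on R) N"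
  then have N: "Module.module (ring_on R) N" and H: "submodule H (ring_on R) N" by auto
  have R: "field_subring R" using val by (simp add: valuation_subring_def)
  have HN: "H \<subseteq> carrier N" using H by (simp add: submodule_def subgroup_def)
  let ?M = "as_module (\<lambda>z. z) (ring_on L)"
  let ?K = "additive_hull (tensor_gens R N L H)" and ?KN = "additive_hull (tensor_gens R N L (carrier N))"
  have cM: "carrier ?M = L" by (simp add: as_module_def)
  have rel: "tensor_relations (ring_on R) ?M (N\<lparr>carrier := H\<rparr>) = ?K"
    by (rule tensor_relations_eq[OF R L RL N H])
  have "N\<lparr>carrier := carrier N\<rparr> = N" by simp
  then have relN: "tensor_relations (ring_on R) ?M N = ?KN"
    using tensor_relations_eq[OF R L RL N submodule_carrier[OF R L RL N]] by simp
  have keysK: "Poly_Mapping.keys x \<subseteq> L \<times> H" if "x \<in> ?K" for x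
    using that
  proof induction
    case (ah_gen x)
    then show ?case by (rule tensor_gens_keys[OF R L RL N H])
  next
    case (ah_diff x y)
    then show ?case by (intro keys_diff_subset)
  qed simp
  have sub: "?K \<subseteq> ?KN"
  proof
    fix x assume "x \<in> ?K"
    moreover have "tensor_gens R N L H \<subseteq> tensor_gens R N L (carrier N)"
      using HN unfolding tensor_gens_def[OF R L RL N] by blast
    ultimately show "x \<in> ?KN" by (rule additive_hull_mono)
  qed
  have car: "carrier (tensor (ring_on R) ?M (N\<lparr>carrier := H\<rparr>)) =
      {{h + z | h. h \<in> ?K} | z. Poly_Mapping.keys z \<subseteq> L \<times> H}"
  proof -
    have "?K #>\<^bsub>free_Abelian_group (L \<times> H)\<^esub> z = {h + z | h. h \<in> ?K}" for z
      by (auto simp: r_coset_def)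
    moreover have "(\<Union>z\<in>Z. {f z}) = {f z | z. z \<in> Z}" for Z :: "(('a \<times> 'n) \<Rightarrow>\<^sub>0 int) set"
      and f :: "_ \<Rightarrow> (('a \<times> 'n) \<Rightarrow>\<^sub>0 int) set" by blast
    ultimately show ?thesis unfolding tensor_def FactGroup_def rel by (simp add: RCOSETS_def cM)
  qed
  show "inj_on (\<lambda>C. tensor_relations (ring_on R) ?M N <#>\<^bsub>free_Abelian_group (carrier ?M \<times> carrier N)\<^esub> C)
       (carrier (tensor (ring_on R) ?M (N\<lparr>carrier := H\<rparr>)))"
  proof (rule inj_onI)
    fix C C' assume C: "C \<in> carrier (tensor (ring_on R) ?M (N\<lparr>carrier := H\<rparr>))"
      and C': "C' \<in> carrier (tensor (ring_on R) ?M (N\<lparr>carrier := H\<rparr>))"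
      and eq: "tensor_relations (ring_on R) ?M N <#>\<^bsub>free_Abelian_group (carrier ?M \<times> carrier N)\<^esub> C =
         tensor_relations (ring_on R) ?M N <#>\<^bsub>free_Abelian_group (carrier ?M \<times> carrier N)\<^esub> C'"
    obtain z where z: "C = {h + z | h. h \<in> ?K}" "Poly_Mapping.keys z \<subseteq> L \<times> H" using C car by blast
    obtain z' where z': "C' = {h + z' | h. h \<in> ?K}" "Poly_Mapping.keys z' \<subseteq> L \<times> H" using C' car by blast
    have eq': "{g + c | g c. g \<in> ?KN \<and> c \<in> C} = {g + c | g c. g \<in> ?KN \<and> c \<in> C'}"
    proof -
      have "?KN <#>\<^bsub>G\<^esub> B = {g + c | g c. g \<in> ?KN \<and> c \<in> B}"
        if "G = free_Abelian_group (carrier ?M \<times> carrier N)" for B G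
        unfolding that by (auto simp: set_mult_def)
      then show ?thesis using eq unfolding relN by simp
    qed
    have "z \<in> C" using z ah_zero[of "tensor_gens R N L H"] by force
    then have "0 + z \<in> {g + c | g c. g \<in> ?KN \<and> c \<in> C}" using ah_zero by blast
    then have "z \<in> {g + c | g c. g \<in> ?KN \<and> c \<in> C'}" using eq' by simp
    then obtain g h where gh: "g \<in> ?KN" "h \<in> ?K" "z = g + (h + z')" using z' by blast
    have "z - z' = g + h" using gh by simp
    then have "z - z' \<in> ?KN" using ah_add[OF gh(1) subsetD[OF sub gh(2)]] by simp
    then have d: "z - z' \<in> ?K"
      by (rule tensor_relations_restrict[OF R L RL N val H]) (rule keys_diff_subset[OF z(2) z'(2)])
    have "\<exists>h'. h + z = h' + z' \<and> h' \<in> ?K" if "h \<in> ?K" for h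
      using ah_add[OF that d] by (intro exI[of _ "h + (z - z')"]) simp
    moreover have "\<exists>h'. h + z' = h' + z \<and> h' \<in> ?K" if "h \<in> ?K" for h
      using ah_diff[OF that d] by (intro exI[of _ "h - (z - z')"]) simp
    ultimately show "C = C'" unfolding z z' by blast
  qed
qed

section \<open>Algebras spanned by monomials\<close>

text \<open>Covers both the characters of the torus and their lifts to a chart of the
  family.\<close>

locale monomials =
  fixes k :: "complex \<Rightarrow> 'k::field" and ch :: "int \<times> int \<Rightarrow> 'k"
  assumes k_add: "k (c + d) = k c + k d" and k_mult: "k (c * d) = k c * k d" and k_one: "k 1 = 1"
    and ch_add: "ch (u + w) = ch u * ch w" and ch_zero: "ch 0 = 1"
begin

lemma k_zero: "k 0 = 0" using k_add[of 0 0] by (metis add.right_neutral add_left_cancel)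

lemma k_minus: "k (- c) = - k c" using k_add[of c "- c"] k_zero by (simp add: eq_neg_iff_add_eq_0 add.commute)

lemma k_ring_hom: "k \<in> ring_hom (ring_on UNIV) (ring_on UNIV)"
  by (rule ring_hom_memI) (simp_all add: k_add k_mult k_one)

lemma ch_minus_mult: "ch u * ch (- u) = 1" using ch_add[of u "- u"] ch_zero by simp

lemma ch_nonzero: "ch u \<noteq> 0" using ch_minus_mult[of u] by auto

lemma ch_minus: "ch (- u) = inverse (ch u)"
  using ch_minus_mult[of u] ch_nonzero by (simp add: field_simps)

text \<open>For a monoid \<open>D\<close>, the image of its monoid algebra in the field.\<close>

definition mring :: "(int \<times> int) set \<Rightarrow> 'k set" where
  "mring D = {\<Sum>u\<in>F. k (c u) * ch u | F c. finite F \<and> F \<subseteq> D}"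

lemma mringI: "finite F \<Longrightarrow> F \<subseteq> D \<Longrightarrow> (\<Sum>u\<in>F. k (c u) * ch u) \<in> mring D"
  by (auto simp: mring_def)

lemma mring_mono: "D \<subseteq> D' \<Longrightarrow> mring D \<subseteq> mring D'"
  unfolding mring_def by blast

lemma mring_term: "u \<in> D \<Longrightarrow> k c * ch u \<in> mring D"
  using mringI[of "{u}" D "\<lambda>_. c"] by simp

lemma mring_ch: "u \<in> D \<Longrightarrow> ch u \<in> mring D"
  using mring_term[of u D 1] by (simp add: k_one)

lemma mring_diff:
  assumes "a \<in> mring D" "b \<in> mring D"
  shows "a - b \<in> mring D"
proof -
  obtain F c where F: "finite F" "F \<subseteq> D" "a = (\<Sum>u\<in>F. k (c u) * ch u)" using assms by (auto simp: mring_def)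
  obtain G d where G: "finite G" "G \<subseteq> D" "b = (\<Sum>u\<in>G. k (d u) * ch u)" using assms by (auto simp: mring_def)
  define c' where "c' u = (if u \<in> F then c u else 0)" for u
  define d' where "d' u = (if u \<in> G then d u else 0)" for u
  have "a = (\<Sum>u\<in>F \<union> G. k (c' u) * ch u)"
    unfolding F(3) by (rule sum.mono_neutral_cong_left) (use F G k_zero in \<open>auto simp: c'_def\<close>)
  moreover have "b = (\<Sum>u\<in>F \<union> G. k (d' u) * ch u)"
    unfolding G(3) by (rule sum.mono_neutral_cong_left) (use F G k_zero in \<open>auto simp: d'_def\<close>)
  moreover have "k (c' u - d' u) = k (c' u) - k (d' u)" for u
    using k_add[of "c' u" "- d' u"] by (simp add: k_minus)
  ultimately have "a - b = (\<Sum>u\<in>F \<union> G. k (c' u - d' u) * ch u)"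
    by (simp add: sum_subtractf left_diff_distrib)
  then show ?thesis using F G mringI[of "F \<union> G" D "\<lambda>u. c' u - d' u"] by simp
qed

lemma mring_zero: "0 \<in> mring D" using mringI[of "{}"] by simp

lemma mring_add: "a \<in> mring D \<Longrightarrow> b \<in> mring D \<Longrightarrow> a + b \<in> mring D"
  using mring_diff[of a D "- b"] mring_diff[OF mring_zero, of b] by simp

lemma mring_sum: "(\<And>i. i \<in> I \<Longrightarrow> f i \<in> mring D) \<Longrightarrow> sum f I \<in> mring D"
  by (induction I rule: infinite_finite_induct) (auto intro: mring_zero mring_add)

lemma mring_mult:
  assumes "a \<in> mring D" "b \<in> mring D'" and "\<And>u w. u \<in> D \<Longrightarrow> w \<in> D' \<Longrightarrow> u + w \<in> D''"
  shows "a * b \<in> mring D''"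
proof -
  obtain F c where F: "F \<subseteq> D" "a = (\<Sum>u\<in>F. k (c u) * ch u)" using assms(1) by (auto simp: mring_def)
  obtain G d where G: "G \<subseteq> D'" "b = (\<Sum>u\<in>G. k (d u) * ch u)" using assms(2) by (auto simp: mring_def)
  have "(k (c u) * ch u) * (k (d w) * ch w) \<in> mring D''" if "u \<in> F" "w \<in> G" for u w
    using mring_term[of "u + w" D'' "c u * d w"] assms(3)[of u w] that F G
    by (auto simp: k_mult ch_add mult_ac)
  then show ?thesis unfolding F G sum_product by (intro mring_sum)
qed

lemma field_subring_mring:
  assumes "0 \<in> D" "\<And>u w. u \<in> D \<Longrightarrow> w \<in> D \<Longrightarrow> u + w \<in> D"
  shows "field_subring (mring D)"
  by (rule field_subringI) (use assms mring_ch[of 0 D] ch_zero mring_diff mring_mult in auto)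

lemma mring_const: "0 \<in> D \<Longrightarrow> k c \<in> mring D"
  using mring_term[of 0 D c] by (simp add: ch_zero)

lemma mring_minimal:
  assumes "field_subring B" "range k \<subseteq> B" "ch ` D \<subseteq> B"
  shows "mring D \<subseteq> B"
proof
  fix z assume "z \<in> mring D"
  then obtain F c where F: "F \<subseteq> D" "z = (\<Sum>u\<in>F. k (c u) * ch u)" by (auto simp: mring_def)
  have "k (c u) * ch u \<in> B" if "u \<in> F" for u
    by (rule fs_mult[OF assms(1)]) (use assms(2,3) F(1) that in blast)+
  then show "z \<in> B" unfolding F(2) by (rule fs_sum[OF assms(1)])
qed

end

locale indep_monomials = monomials +
  assumes indep: "finite F \<Longrightarrow> (\<Sum>u\<in>F. k (c u) * ch u) = 0 \<Longrightarrow> u \<in> F \<Longrightarrow> c u = 0"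
begin

text \<open>By independence the coefficients of \<open>z * ch u\<close> are those of
  \<open>z\<close> shifted by \<open>u\<close>, so every exponent that really occurs in
  \<open>z\<close> meets both conditions.\<close>

lemma mring_Int_shift:
  assumes "z \<in> mring D" "z * ch u \<in> mring D'"
  shows "z \<in> mring {w \<in> D. w + u \<in> D'}"
proof -
  obtain F c where F: "finite F" "F \<subseteq> D" "z = (\<Sum>w\<in>F. k (c w) * ch w)" using assms(1) by (auto simp: mring_def)
  obtain G d where G: "finite G" "G \<subseteq> D'" "z * ch u = (\<Sum>w\<in>G. k (d w) * ch w)"
    using assms(2) by (auto simp: mring_def)
  let ?F = "(\<lambda>w. w + u) ` F"
  define c' where "c' v = (if v \<in> ?F then c (v - u) else 0)" for v
  define d' where "d' v = (if v \<in> G then d v else 0)" for v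
  have "z * ch u = (\<Sum>w\<in>F. k (c w) * ch (w + u))"
    unfolding F(3) by (simp add: sum_distrib_right ch_add mult.assoc)
  also have "\<dots> = (\<Sum>v\<in>?F. k (c (v - u)) * ch v)"
    by (subst sum.reindex) (auto simp: inj_on_def)
  also have "\<dots> = (\<Sum>v\<in>?F \<union> G. k (c' v) * ch v)"
    by (rule sum.mono_neutral_cong_left) (use F G k_zero in \<open>auto simp: c'_def\<close>)
  finally have 1: "z * ch u = (\<Sum>v\<in>?F \<union> G. k (c' v) * ch v)" .
  have 2: "z * ch u = (\<Sum>v\<in>?F \<union> G. k (d' v) * ch v)"
    unfolding G(3) by (rule sum.mono_neutral_cong_left) (use F G k_zero in \<open>auto simp: d'_def\<close>)
  have kd: "k (c' v - d' v) = k (c' v) - k (d' v)" for v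
    using k_add[of "c' v" "- d' v"] by (simp add: k_minus)
  have "(\<Sum>v\<in>?F \<union> G. k (c' v - d' v) * ch v) = 0"
    using 1 2 by (simp add: kd left_diff_distrib sum_subtractf)
  then have *: "c' v = d' v" if "v \<in> ?F \<union> G" for v
    using indep[of "?F \<union> G" "\<lambda>v. c' v - d' v" v] F(1) G(1) that by simp
  have in_D': "w + u \<in> D'" if "w \<in> F" "c w \<noteq> 0" for w
  proof -
    have "c' (w + u) = c w" using that by (simp add: c'_def)
    then have "d' (w + u) \<noteq> 0" using *[of "w + u"] that by simp
    then have "w + u \<in> G" by (rule contrapos_np) (simp add: d'_def)
    then show ?thesis using G by blast
  qed
  have "z = (\<Sum>w\<in>{w \<in> F. c w \<noteq> 0}. k (c w) * ch w)"
    unfolding F(3) by (rule sum.mono_neutral_right) (use F k_zero in auto)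
  moreover have "{w \<in> F. c w \<noteq> 0} \<subseteq> {w \<in> D. w + u \<in> D'}" using F in_D' by blast
  ultimately show ?thesis using mringI[of "{w \<in> F. c w \<noteq> 0}" "{w \<in> D. w + u \<in> D'}" c] F(1) by simp
qed

end

section \<open>Lattice points of dual cones and localization at faces\<close>

definition ip :: "int \<times> int \<Rightarrow> int \<times> int \<Rightarrow> int" where
  "ip v u = fst v * fst u + snd v * snd u"

lemma ip_simps [simp]: "ip v (u + w) = ip v u + ip v w" "ip v (u - w) = ip v u - ip v w"
  "ip v (- u) = - ip v u" "ip v 0 = 0"
  by (simp_all add: ip_def algebra_simps)

lemma ip_sum: "ip v (sum f I) = (\<Sum>i\<in>I. ip v (f i))"
  by (induction I rule: infinite_finite_induct) auto

definition dual_lattice :: "(int \<times> int) set \<Rightarrow> (int \<times> int) set" where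
  "dual_lattice V = {u. \<forall>v\<in>V. ip v u \<ge> 0}"

lemma dual_lattice_mono: "W \<subseteq> V \<Longrightarrow> dual_lattice V \<subseteq> dual_lattice W"
  by (auto simp: dual_lattice_def)

lemma dual_lattice_zero: "0 \<in> dual_lattice V"
  and dual_lattice_add: "u \<in> dual_lattice V \<Longrightarrow> w \<in> dual_lattice V \<Longrightarrow> u + w \<in> dual_lattice V"
  by (auto simp: dual_lattice_def)

text \<open>A smooth cone with generators \<^term>\<open>V\<close>, where \<^term>\<open>s\<close> is part of the dual basis.\<close>

definition dual_family :: "(int \<times> int) set \<Rightarrow> (int \<times> int \<Rightarrow> int \<times> int) \<Rightarrow> bool" where
  "dual_family V s \<longleftrightarrow> finite V \<and> (\<forall>v\<in>V. \<forall>w\<in>V. ip v (s w) = (if v = w then 1 else 0))"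

definition nmult :: "nat \<Rightarrow> int \<times> int \<Rightarrow> int \<times> int" where
  "nmult n u = (int n * fst u, int n * snd u)"

lemma ip_nmult [simp]: "ip v (nmult n u) = int n * ip v u"
  by (simp add: ip_def nmult_def algebra_simps)

lemma nmult_simps [simp]: "nmult 0 u = 0" "nmult (Suc n) u = u + nmult n u"
  by (auto simp: nmult_def prod_eq_iff algebra_simps)

context monomials
begin

lemma ch_nmult: "ch (nmult n u) = ch u ^ n"
  by (induction n) (simp_all add: ch_zero ch_add)

lemma field_subring_dual: "field_subring (mring (dual_lattice V))"
  by (rule field_subring_mring) (auto intro: dual_lattice_zero dual_lattice_add)

end

context monomials
begin

context
  fixes V W :: "(int \<times> int) set" and s
  assumes V: "dual_family V s" and W: "W \<subseteq> V"
begin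

text \<open>An exponent that is 0 on the generators of the face \<open>W\<close> and 1 on the
  others. Inverting its monomial passes from the cone to the face.\<close>

definition face_sum :: "int \<times> int" where "face_sum = (\<Sum>v\<in>V - W. s v)"

lemma ip_face_sum: "v \<in> V \<Longrightarrow> ip v face_sum = (if v \<in> W then 0 else 1)"
proof -
  assume v: "v \<in> V"
  have "ip v face_sum = (\<Sum>w\<in>V - W. if v = w then 1 else 0)"
    unfolding face_sum_def ip_sum using V v by (intro sum.cong) (auto simp: dual_family_def)
  also have "\<dots> = (if v \<in> W then 0 else 1)" using V v by (simp add: dual_family_def)
  finally show ?thesis .
qed

lemma face_sum_dual: "face_sum \<in> dual_lattice V" "- face_sum \<in> dual_lattice W"
  using ip_face_sum W by (auto simp: dual_lattice_def)

lemma face_denominator: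
  assumes z: "z \<in> mring (dual_lattice W)"
  shows "\<exists>n. ch face_sum ^ n * z \<in> mring (dual_lattice V)"
proof -
  obtain F c where F: "finite F" "F \<subseteq> dual_lattice W" "z = (\<Sum>w\<in>F. k (c w) * ch w)"
    using z by (auto simp: mring_def)
  have fV: "finite V" using V by (simp add: dual_family_def)
  \<comment> \<open>A common bound for all values \<open>ip v w\<close>, so that adding
    \<open>n\<close> times \<open>face_sum\<close> outweighs every negative value off the
    face.\<close>
  define n where "n = (\<Sum>v\<in>V. \<Sum>w\<in>F. nat \<bar>ip v w\<bar>)"
  have "nmult n face_sum + w \<in> dual_lattice V" if w: "w \<in> F" for w
    unfolding dual_lattice_def
  proof (intro CollectI ballI)
    fix v assume v: "v \<in> V"
    have "nat \<bar>ip v w\<bar> \<le> (\<Sum>w\<in>F. nat \<bar>ip v w\<bar>)" using F(1) w by (intro member_le_sum) auto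
    also have "\<dots> \<le> n" unfolding n_def using fV v by (intro member_le_sum) auto
    finally have "\<bar>ip v w\<bar> \<le> int n" by linarith
    moreover have "v \<in> W \<Longrightarrow> ip v w \<ge> 0" using F w by (auto simp: dual_lattice_def)
    ultimately show "0 \<le> ip v (nmult n face_sum + w)" using ip_face_sum[OF v] by auto
  qed
  then have "ch face_sum ^ n * (k (c w) * ch w) \<in> mring (dual_lattice V)" if "w \<in> F" for w
    using mring_term[of "nmult n face_sum + w" "dual_lattice V" "c w"] that
    by (simp add: ch_add ch_nmult mult_ac)
  then show ?thesis unfolding F(3) sum_distrib_left by (intro exI[of _ n] mring_sum)
qed

lemma face_localizes: "localizes (mring (dual_lattice W)) (mring (dual_lattice V))"
  unfolding localizes_def
proof (intro conjI ballI mring_mono dual_lattice_mono W)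
  fix z assume "z \<in> mring (dual_lattice W)"
  then obtain n where n: "ch face_sum ^ n * z \<in> mring (dual_lattice V)" using face_denominator by blast
  have "inverse (ch face_sum ^ n) \<in> mring (dual_lattice W)"
    using fs_power[OF field_subring_dual mring_ch[OF face_sum_dual(2)], of n]
      by (simp add: ch_minus power_inverse)
  then show "\<exists>s\<in>mring (dual_lattice V). s \<noteq> 0 \<and> inverse s \<in> mring (dual_lattice W) \<and>
      s * z \<in> mring (dual_lattice V)"
    using n fs_power[OF field_subring_dual mring_ch[OF face_sum_dual(1)], of n] ch_nonzero
    by (intro bexI[of _ "ch face_sum ^ n"]) auto
qed

lemma face_open:
  "openin (zariski (ring_on (mring (dual_lattice V))))
    {q \<in> primes (ring_on (mring (dual_lattice V))). mring (dual_lattice W) \<subseteq> local_ring_in (mring (dual_lattice V)) q}"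
proof -
  let ?A = "mring (dual_lattice V)"
  have FA: "field_subring ?A" by (rule field_subring_dual)
  have "mring (dual_lattice W) \<subseteq> local_ring_in ?A q \<longleftrightarrow> ch (- face_sum) \<in> local_ring_in ?A q"
    if q: "q \<in> primes (ring_on ?A)" for q
  proof
    assume "mring (dual_lattice W) \<subseteq> local_ring_in ?A q"
    then show "ch (- face_sum) \<in> local_ring_in ?A q" using mring_ch[OF face_sum_dual(2)] by blast
  next
    assume u: "ch (- face_sum) \<in> local_ring_in ?A q"
    show "mring (dual_lattice W) \<subseteq> local_ring_in ?A q"
    proof
      fix z assume "z \<in> mring (dual_lattice W)"
      then obtain n where n: "ch face_sum ^ n * z \<in> ?A" using face_denominator by blast
      have "ch (- face_sum) ^ n * (ch face_sum ^ n * z) \<in> local_ring_in ?A q"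
        by (intro fs_mult[OF field_subring_local[OF FA q]] fs_power[OF field_subring_local[OF FA q]] u
            subsetD[OF local_ring_in_incl[OF FA q]] n)
      moreover have "ch (- face_sum) ^ n * (ch face_sum ^ n * z) = z"
        using ch_nonzero by (simp add: ch_minus power_inverse)
      ultimately show "z \<in> local_ring_in ?A q" by simp
    qed
  qed
  then have "{q \<in> primes (ring_on ?A). mring (dual_lattice W) \<subseteq> local_ring_in ?A q} =
      {q \<in> primes (ring_on ?A). ch (- face_sum) \<in> local_ring_in ?A q}" by (intro Collect_cong) auto
  then show ?thesis using openin_local_ring_mem[OF FA] by simp
qed

end

end

text \<open>The monomials in the local ring at a point are those that are regular on the orbit of the
  point, that is on the face generated by the rays whose coordinate vanishes at the point.\<close>

lemma (in indep_monomials) monomial_in_local_ring_iff: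
  assumes V: "dual_family V s" and p: "p \<in> primes (ring_on (mring (dual_lattice V)))"
  shows "ch u \<in> local_ring_in (mring (dual_lattice V)) p \<longleftrightarrow> u \<in> dual_lattice {v \<in> V. ch (s v) \<in> p}"
proof
  let ?A = "mring (dual_lattice V)" and ?G = "{v \<in> V. ch (s v) \<in> p}"
  have FA: "field_subring ?A" by (rule field_subring_dual)
  have sV: "s v \<in> dual_lattice V" if "v \<in> V" for v using V that
    by (auto simp: dual_lattice_def dual_family_def)
  {
    assume "ch u \<in> local_ring_in ?A p"
    then obtain g where g: "g \<in> ?A - p" "g * ch u \<in> ?A" using local_ring_in_iff[OF FA p] by blast
    show "u \<in> dual_lattice ?G" unfolding dual_lattice_def
    proof (intro CollectI ballI, rule ccontr)
      fix v assume v: "v \<in> ?G" and neg: "\<not> 0 \<le> ip v u"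
      \<comment> \<open>If \<open>u\<close> is negative on \<open>v\<close>, all exponents of
        \<open>g\<close> must be positive on \<open>v\<close>. Then \<open>g\<close> is divisible by
        \<open>ch (s v)\<close>, which lies in \<open>p\<close>.\<close>
      have "g \<in> mring {w \<in> dual_lattice V. w + u \<in> dual_lattice V}"
        by (rule mring_Int_shift) (use g in auto)
      moreover have "ch (- s v) \<in> mring {- s v}" by (rule mring_ch) simp
      ultimately have "g * ch (- s v) \<in> ?A"
      proof (rule mring_mult)
        fix w w' assume w: "w \<in> {w \<in> dual_lattice V. w + u \<in> dual_lattice V}" "w' \<in> {- s v}"
        have "ip v' (w + w') \<ge> 0" if v': "v' \<in> V" for v'
        proof (cases "v' = v")
          case True
          have "ip v (w + u) \<ge> 0" using w v by (auto simp: dual_lattice_def simp del: ip_simps)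
          then show ?thesis using neg w True V v by (auto simp: dual_family_def)
        next
          case False
          then show ?thesis using w V v v' by (auto simp: dual_family_def dual_lattice_def)
        qed
        then show "w + w' \<in> dual_lattice V" by (simp add: dual_lattice_def)
      qed
      then have "(g * ch (- s v)) * ch (s v) \<in> p" using v pr_mult[OF FA p] by blast
      then show False using g ch_nonzero by (simp add: ch_minus mult.assoc)
    qed
  next
    assume u: "u \<in> dual_lattice ?G"
    \<comment> \<open>A product of monomials \<open>ch (s v)\<close> outside the prime
      \<open>p\<close>, hence an admissible denominator.\<close>
    have "ch (face_sum V ?G s) \<notin> p"
    proof -
      have "ch (\<Sum>v\<in>T. s v) \<notin> p \<and> (\<Sum>v\<in>T. s v) \<in> dual_lattice V" if "finite T" "T \<subseteq> V - ?G" for T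
        using that
      proof induction
        case empty
        then show ?case using ch_zero pr_one[OF FA p] dual_lattice_zero by simp
      next
        case (insert v T)
        have "ch (s v) \<notin> p" "s v \<in> dual_lattice V" using insert sV by auto
        then show ?case
          using insert pr_mult_iff[OF FA p mring_ch mring_ch] dual_lattice_add by (auto simp: ch_add)
      qed
      from this[of "V - ?G"] V show ?thesis
        unfolding face_sum_def[OF V, of ?G, simplified] dual_family_def by auto
    qed
    moreover have GV: "?G \<subseteq> V" by auto
    moreover obtain n where "ch (face_sum V ?G s) ^ n * ch u \<in> ?A"
      using face_denominator[OF V GV mring_ch[OF u]] by blast
    moreover have "ch (face_sum V ?G s) \<in> ?A" using mring_ch face_sum_dual(1)[OF V GV] by blast
    ultimately show "ch u \<in> local_ring_in ?A p"
      unfolding local_ring_in_iff[OF FA p]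
      using pr_power_iff[OF FA p] fs_power[OF FA] by (intro bexI[of _ "ch (face_sum V ?G s) ^ n"]) auto
  }
qed

section \<open>Reduction modulo the deformation parameter\<close>

text \<open>The variable \<open>t\<close> is the outermost one of \<^typ>\<open>field_xyt\<close>, so setting \<open>t = 0\<close> means
  taking constant coefficients.\<close>

definition regular :: "'a::idom poly fract set" where
  "regular = {Fract P Q | P Q. Polynomial.coeff Q 0 \<noteq> 0}"

text \<open>The residue map at \<open>t = 0\<close>, meaningful on \<open>regular\<close> only.
  Independence of the chosen fraction is proved next.\<close>

definition red :: "'a::idom poly fract \<Rightarrow> 'a fract" where
  "red z = (THE w. \<exists>P Q. Polynomial.coeff Q 0 \<noteq> 0 \<and> z = Fract P Q \<and> w =
      Fract (Polynomial.coeff P 0) (Polynomial.coeff Q 0))"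

lemma red_Fract:
  assumes "Polynomial.coeff Q 0 \<noteq> 0"
  shows "red (Fract P Q) = Fract (Polynomial.coeff P 0) (Polynomial.coeff Q 0)"
  unfolding red_def
proof (rule the_equality)
  show "\<exists>P' Q'. Polynomial.coeff Q' 0 \<noteq> 0 \<and> Fract P Q = Fract P' Q' \<and>
      Fract (Polynomial.coeff P 0) (Polynomial.coeff Q 0) =
      Fract (Polynomial.coeff P' 0) (Polynomial.coeff Q' 0)"
    using assms by blast
  fix w assume "\<exists>P' Q'. Polynomial.coeff Q' 0 \<noteq> 0 \<and> Fract P Q = Fract P' Q' \<and> w =
      Fract (Polynomial.coeff P' 0) (Polynomial.coeff Q' 0)"
  then obtain P' Q' where *: "Polynomial.coeff Q' 0 \<noteq> 0" "Fract P Q = Fract P' Q'" "w =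
      Fract (Polynomial.coeff P' 0) (Polynomial.coeff Q' 0)" by blast
  have "Q \<noteq> 0" "Q' \<noteq> 0" using assms * by auto
  then have "P * Q' = P' * Q" using *(2) by (simp add: eq_fract)
  then have "Polynomial.coeff P 0 * Polynomial.coeff Q' 0 = Polynomial.coeff P' 0 * Polynomial.coeff Q 0"
      by (metis coeff_mult_0)
  then show "w = Fract (Polynomial.coeff P 0) (Polynomial.coeff Q 0)" using assms * by (simp add: eq_fract)
qed

lemma regularE:
  assumes "z \<in> regular"
  obtains P Q where "Polynomial.coeff Q 0 \<noteq> 0" "z = Fract P Q" "red z =
      Fract (Polynomial.coeff P 0) (Polynomial.coeff Q 0)"
  using assms red_Fract by (auto simp: regular_def)

lemma regularI: "Polynomial.coeff Q 0 \<noteq> 0 \<Longrightarrow> Fract P Q \<in> regular"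
  by (auto simp: regular_def)

lemma regular_ops:
  assumes z: "z \<in> regular" and w: "w \<in> regular"
  shows "z - w \<in> regular" "red (z - w) = red z - red w"
    and "z + w \<in> regular" "red (z + w) = red z + red w"
    and "z * w \<in> regular" "red (z * w) = red z * red w"
proof -
  obtain P Q where z: "Polynomial.coeff Q 0 \<noteq> 0" "z = Fract P Q" "red z =
      Fract (Polynomial.coeff P 0) (Polynomial.coeff Q 0)" using regularE[OF z] .
  obtain P' Q' where w: "Polynomial.coeff Q' 0 \<noteq> 0" "w = Fract P' Q'" "red w =
      Fract (Polynomial.coeff P' 0) (Polynomial.coeff Q' 0)" using regularE[OF w] .
  have Q: "Q \<noteq> 0" "Q' \<noteq> 0" "Polynomial.coeff (Q * Q') 0 \<noteq> 0" using z w by (auto simp: coeff_mult_0)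
  have "z - w = Fract (P * Q' - P' * Q) (Q * Q')" "z + w = Fract (P * Q' + P' * Q) (Q * Q')"
    "z * w = Fract (P * P') (Q * Q')" using Q z w by simp_all
  then show "z - w \<in> regular" "red (z - w) = red z - red w" "z + w \<in> regular" "red (z + w) = red z + red w"
     "z * w \<in> regular" "red (z * w) = red z * red w"
    using z(1,3) w(1,3) Q(3) by (simp_all add: regularI red_Fract coeff_mult_0)
qed

lemma red_one: "1 \<in> regular" "red 1 = 1"
  by (simp_all add: One_fract_def regularI red_Fract)

lemma field_subring_regular: "field_subring regular"
  by (rule field_subringI) (use red_one regular_ops in auto)

lemma red_zero: "red 0 = 0"
  using regular_ops(2)[OF red_one(1) red_one(1)] by simp

lemma red_inverse:
  assumes "z \<in> regular" "red z \<noteq> 0"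
  shows "inverse z \<in> regular" "red (inverse z) = inverse (red z)"
proof -
  obtain P Q where z: "Polynomial.coeff Q 0 \<noteq> 0" "z = Fract P Q" "red z =
      Fract (Polynomial.coeff P 0) (Polynomial.coeff Q 0)" using regularE[OF assms(1)] .
  have "Polynomial.coeff P 0 \<noteq> 0" using assms(2) z by (metis fract_collapse(1))
  then show "inverse z \<in> regular" "red (inverse z) = inverse (red z)"
    using z by (simp_all add: regularI red_Fract)
qed

lemma red_power: "z \<in> regular \<Longrightarrow> z ^ n \<in> regular \<and> red (z ^ n) = red z ^ n"
  by (induction n) (simp_all add: red_one regular_ops)

lemma red_powi:
  assumes "z \<in> regular" "red z \<noteq> 0"
  shows "z powi n \<in> regular" "red (z powi n) = red z powi n"
  unfolding power_int_def
  using red_power[OF assms(1)] red_power[OF red_inverse(1)[OF assms]] red_inverse[OF assms] by auto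

lemma red_sum: "(\<And>i. i \<in> I \<Longrightarrow> f i \<in> regular) \<Longrightarrow> sum f I \<in> regular \<and> red (sum f I) = (\<Sum>i\<in>I. red (f i))"
  by (induction I rule: infinite_finite_induct)
    (auto simp: red_zero regular_ops fs_zero[OF field_subring_regular])

lemma red_vars:
  "const_xyt c \<in> regular" "red (const_xyt c) = const_xy c"
  "var_x \<in> regular" "red var_x = Fract [:[:0, 1:]:] 1"
  "var_y \<in> regular" "red var_y = Fract [:0, 1:] 1"
  "var_t \<in> regular" "red var_t = 0"
  by (simp_all add: const_xyt_def const_xy_def var_x_def var_y_def var_t_def regularI red_Fract fract_collapse)

lemma red_y_minus_t: "var_y - var_t \<in> regular" "red (var_y - var_t) = Fract [:0, 1:] 1"
  using regular_ops[OF red_vars(5) red_vars(7)] by (simp_all add: red_vars)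

lemma vars_nonzero:
  "Fract [:[:0, 1:]:] (1 :: complex poly poly) \<noteq> 0" "Fract [:0, 1:] (1 :: complex poly poly) \<noteq> 0"
  "var_x \<noteq> 0" "var_y \<noteq> 0" "var_t \<noteq> 0" "var_y - var_t \<noteq> 0"
proof -
  show *: "Fract [:[:0, 1:]:] (1 :: complex poly poly) \<noteq> 0" "Fract [:0, 1:] (1 :: complex poly poly) \<noteq> 0"
    by (simp_all add: Zero_fract_def eq_fract)
  show "var_x \<noteq> 0" "var_y \<noteq> 0" "var_t \<noteq> 0"
    by (simp_all add: Zero_fract_def eq_fract var_x_def var_y_def var_t_def)
  show "var_y - var_t \<noteq> 0" using red_y_minus_t red_zero * by metis
qed

section \<open>The characters of the torus and their lifts\<close>

lemma Fract_one_ops: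
  "Fract a 1 * Fract b 1 = Fract (a * b) 1" "Fract a 1 + Fract b 1 = Fract (a + b) (1::'a::idom)"
  "Fract a 1 ^ n = Fract (a ^ n) 1" "(\<Sum>i\<in>I. Fract (f i) 1) = Fract (sum f I) (1::'a::idom)"
proof -
  show "Fract a 1 ^ n = Fract (a ^ n) 1" by (induction n) (simp_all add: One_fract_def)
  show "(\<Sum>i\<in>I. Fract (f i) 1) = Fract (sum f I) (1::'a::idom)"
    by (induction I rule: infinite_finite_induct) (simp_all add: Zero_fract_def)
qed simp_all

lemma powi_shift: "z \<noteq> 0 \<Longrightarrow> - int N \<le> n \<Longrightarrow> z powi n * z powi int N = z ^ nat (n + int N)"
  for z :: "'a::field"
  using power_int_add[of z n "int N"] power_int_of_nat[of z "nat (n + int N)"] by simp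

text \<open>Multiplication by a high power of \<open>x * y\<close> turns characters into monomials
  of the polynomial ring, whose coefficients can be compared.\<close>

lemma character_shift:
  assumes "- int N \<le> fst u" "- int N \<le> snd u"
  shows "const_xy c * character u * character (int N, int N) =
    Fract (Polynomial.monom (Polynomial.monom c (nat (fst u + int N))) (nat (snd u + int N))) 1"
proof -
  let ?X = "Fract [:[:0, 1:]:] (1 :: complex poly poly)" and ?Y = "Fract [:0, 1:] (1 :: complex poly poly)"
  have "?X powi fst u * ?X powi int N = ?X ^ nat (fst u + int N)"
    "?Y powi snd u * ?Y powi int N = ?Y ^ nat (snd u + int N)"
    by (rule powi_shift, (rule vars_nonzero assms)+)+
  then have "const_xy c * character u * character (int N, int N) =
      const_xy c * (?X ^ nat (fst u + int N) * ?Y ^ nat (snd u + int N))"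
    by (simp add: character_def mult_ac)
  also have "\<dots> = Fract ([:[:c:]:] * ([:[:0, 1:]:] ^ nat (fst u + int N) * [:0, 1:] ^ nat (snd u + int N))) 1"
    by (simp only: const_xy_def Fract_one_ops)
  also have "[:[:c:]:] * ([:[:0, 1:]:] ^ nat (fst u + int N) * [:0, 1:] ^ nat (snd u + int N)) =
      Polynomial.monom (Polynomial.monom c (nat (fst u + int N))) (nat (snd u + int N))"
    by (simp add: monom_altdef poly_const_pow)
  finally show ?thesis .
qed

interpretation torus: indep_monomials const_xy character
proof
  show "const_xy (c + d) = const_xy c + const_xy d" "const_xy (c * d) = const_xy c * const_xy d" for c d
    by (simp_all add: const_xy_def mult.commute)
  show "const_xy 1 = 1" by (simp add: const_xy_def One_fract_def one_pCons)
  show "character (u + w) = character u * character w" for u w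
    using vars_nonzero by (simp add: character_def power_int_add mult_ac)
  show "character 0 = 1" by (simp add: character_def)
  fix F c u assume F: "finite F" "(\<Sum>u\<in>F. const_xy (c u) * character u) = 0" "u \<in> F"
  \<comment> \<open>Large enough to make all exponents in \<open>F\<close> nonnegative after the
    shift, so that \<open>nat\<close> stays injective on them.\<close>
  define N where "N = (\<Sum>u\<in>F. nat \<bar>fst u\<bar> + nat \<bar>snd u\<bar>)"
  have N: "- int N \<le> fst w \<and> - int N \<le> snd w" if "w \<in> F" for w
  proof -
    have "nat \<bar>fst w\<bar> + nat \<bar>snd w\<bar> \<le> N" unfolding N_def using F(1) that by (intro member_le_sum) auto
    then show ?thesis by linarith
  qed
  let ?m = "\<lambda>w. Polynomial.monom (Polynomial.monom (c w) (nat (fst w + int N))) (nat (snd w + int N))"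
  have "0 = (\<Sum>w\<in>F. const_xy (c w) * character w * character (int N, int N))"
    using F(2) by (simp add: sum_distrib_right[symmetric])
  also have "\<dots> = (\<Sum>w\<in>F. Fract (?m w) 1)"
    using N character_shift by (intro sum.cong) auto
  finally have "Fract (\<Sum>w\<in>F. ?m w) 1 = 0" by (simp add: Fract_one_ops)
  then have "(\<Sum>w\<in>F. ?m w) = 0" by (simp add: Zero_fract_def eq_fract)
  then have "Polynomial.coeff (Polynomial.coeff (\<Sum>w\<in>F. ?m w) (nat (snd u + int N))) (nat (fst u + int N)) = 0" by simp
  moreover have "Polynomial.coeff (Polynomial.coeff (?m w) (nat (snd u + int N))) (nat (fst u + int N)) =
      (if w = u then c w else 0)"
    if "w \<in> F" for w
  proof -
    have "nat (fst w + int N) = nat (fst u + int N) \<and> nat (snd w + int N) = nat (snd u + int N) \<longleftrightarrow> w = u"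
      using N[OF that] N[OF F(3)] by (auto simp: prod_eq_iff nat_eq_iff)
    then show ?thesis by auto
  qed
  ultimately have "(\<Sum>w\<in>F. if w = u then c w else 0) = 0" by (simp add: coeff_sum)
  then show "c u = 0" using F by simp
qed

lemma Ztilde_monomials: "monomials const_xyt (Ztilde a lam)"
proof
  show "const_xyt (c + d) = const_xyt c + const_xyt d" "const_xyt (c * d) = const_xyt c * const_xyt d" for c d
    by (simp_all add: const_xyt_def mult.commute)
  show "const_xyt 1 = 1" by (simp add: const_xyt_def One_fract_def one_pCons)
  show "Ztilde a lam 0 = 1" by (simp add: Ztilde_def)
  fix u w :: "int \<times> int"
  have "snd u + snd w + lam * (fst u + fst w) = (snd u + lam * fst u) + (snd w + lam * fst w)"
    "- (lam * (fst u + fst w)) = - (lam * fst u) + - (lam * fst w)" by (simp_all add: algebra_simps)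
  then show "Ztilde a lam (u + w) = Ztilde a lam u * Ztilde a lam w"
    using vars_nonzero unfolding Ztilde_def Let_def fst_add snd_add
    by (simp only: power_int_add vars_nonzero simp_thms split: if_split) (simp add: mult_ac)
qed

text \<open>Both \<open>y\<close> and \<open>y - t\<close> reduce to \<open>y\<close>, and their
  exponents in \<open>Ztilde\<close> add up to \<open>snd u\<close> for either sign.\<close>

lemma red_Ztilde: "Ztilde a lam u \<in> regular" "red (Ztilde a lam u) = character u"
proof -
  let ?X = "Fract [:[:0, 1:]:] (1 :: complex poly poly)" and ?Y = "Fract [:0, 1:] (1 :: complex poly poly)"
  have nz: "red var_x \<noteq> 0" "red var_y \<noteq> 0" "red (var_y - var_t) \<noteq> 0"
    using vars_nonzero by (simp_all add: red_vars red_y_minus_t)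
  note x = red_powi[OF red_vars(3) nz(1)] and y = red_powi[OF red_vars(5) nz(2)] and yt =
      red_powi[OF red_y_minus_t(1) nz(3)]
  have Y: "?Y powi i * ?Y powi j = ?Y powi (i + j)" for i j
    using vars_nonzero(2) by (simp add: power_int_add)
  have "Ztilde a lam u \<in> regular \<and> red (Ztilde a lam u) = character u"
  proof (cases "a = 1")
    case True
    then have Z: "Ztilde a lam u = var_x powi fst u * (var_y powi (snd u + lam * fst u) * (var_y - var_t) powi (- (lam * fst u)))"
      by (simp only: Ztilde_def Let_def True if_True mult.assoc)
    show ?thesis unfolding Z
      by (simp add: regular_ops x y yt) (simp add: red_vars red_y_minus_t Y character_def)
  next
    case False
    then have Z: "Ztilde a lam u = var_x powi fst u * (var_y powi (- (lam * fst u)) * (var_y - var_t) powi (snd u + lam * fst u))"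
      by (simp only: Ztilde_def Let_def False if_False mult.assoc)
    show ?thesis unfolding Z
      by (simp add: regular_ops x y yt) (simp add: red_vars red_y_minus_t Y character_def)
  qed
  then show "Ztilde a lam u \<in> regular" "red (Ztilde a lam u) = character u" by auto
qed

text \<open>Two charts lift the same monomial to elements that differ by a power of \<open>y / (y - t)\<close>.\<close>

definition twist :: "int \<Rightarrow> int \<Rightarrow> int \<times> int \<Rightarrow> int" where
  "twist a lam u = (if a = 1 then lam * fst u else - (snd u + lam * fst u))"

lemma Ztilde_twist: "Ztilde a lam u =
    var_x powi fst u * var_y powi snd u * (var_y / (var_y - var_t)) powi twist a lam u"
proof -
  have d: "(var_y / (var_y - var_t)) powi n = var_y powi n * (var_y - var_t) powi (- n)" for n
    using vars_nonzero by (simp add: divide_inverse power_int_mult_distrib power_int_minus power_int_inverse)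
  have y: "var_y powi i * var_y powi j = var_y powi (i + j)" for i j
    using vars_nonzero by (simp add: power_int_add)
  have e: "var_x powi fst u * var_y powi snd u * (var_y powi n * (var_y - var_t) powi (- n)) =
      var_x powi fst u * var_y powi (snd u + n) * (var_y - var_t) powi (- n)" for n
    unfolding y[symmetric] by (simp only: mult.assoc)
  show ?thesis
  proof (cases "a = 1")
    case True
    show ?thesis unfolding d e by (simp only: Ztilde_def twist_def Let_def True if_True simp_thms)
  next
    case False
    have "snd u + - (snd u + lam * fst u) = - (lam * fst u)" "- (- (snd u + lam * fst u)) =
        snd u + lam * fst u"
      by simp_all
    then show ?thesis unfolding d e by (simp only: Ztilde_def twist_def Let_def False if_False)
  qed
qed

lemma Ztilde_change:
  "Ztilde a' lam' u = Ztilde a lam u * (var_y / (var_y - var_t)) powi (twist a' lam' u - twist a lam u)"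
proof -
  have "var_y / (var_y - var_t) \<noteq> 0" using vars_nonzero by simp
  then show ?thesis unfolding Ztilde_twist[of a'] Ztilde_twist[of a] mult.assoc
    by (simp add: power_int_add[symmetric])
qed

section \<open>Smooth complete fans in the plane\<close>

lemma pairing_qvec: "pairing (qvec v) (qvec u) = of_int (ip v u)"
  by (simp add: pairing_def qvec_def ip_def)

lemma qvec_in_cone: "finite V \<Longrightarrow> v \<in> V \<Longrightarrow> qvec v \<in> cone_gen V"
proof -
  assume V: "finite V" "v \<in> V"
  let ?c = "\<lambda>w. if w = v then 1 else (0::rat)"
  have "(\<Sum>w\<in>V. ?c w * g w) = g v" for g :: "int \<times> int \<Rightarrow> rat"
    using V by (simp add: if_distrib[of "\<lambda>x. x * _"] cong: if_cong)
  then have "qvec v = (\<Sum>w\<in>V. ?c w * of_int (fst w), \<Sum>w\<in>V. ?c w * of_int (snd w))"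
    by (simp add: qvec_def)
  then show ?thesis unfolding cone_gen_def by (intro CollectI exI[of _ ?c]) auto
qed

lemma cone_gen_mono:
  assumes V: "finite V" and W: "W \<subseteq> V"
  shows "cone_gen W \<subseteq> cone_gen V"
proof
  fix x assume "x \<in> cone_gen W"
  then obtain c where c: "\<forall>v\<in>W. c v \<ge> (0::rat)"
    "x = (\<Sum>v\<in>W. c v * of_int (fst v), \<Sum>v\<in>W. c v * of_int (snd v))" by (auto simp: cone_gen_def)
  let ?c = "\<lambda>v. if v \<in> W then c v else 0"
  have "(\<Sum>v\<in>W. c v * g v) = (\<Sum>v\<in>V. ?c v * g v)" for g :: "int \<times> int \<Rightarrow> rat"
    by (rule sum.mono_neutral_cong_left) (use V W in auto)
  then show "x \<in> cone_gen V" using c unfolding cone_gen_def by (intro CollectI exI[of _ ?c]) auto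
qed

lemma pairing_sum:
  "pairing (\<Sum>v\<in>V. c v * of_int (fst v), \<Sum>v\<in>V. c v * of_int (snd v)) u = (\<Sum>v\<in>V. c v * pairing (qvec v) u)"
  by (simp add: pairing_def qvec_def sum_distrib_right sum_distrib_left sum.distrib algebra_simps)

lemma dual_cone_gen:
  assumes "finite V"
  shows "u \<in> dual_cone (cone_gen V) \<longleftrightarrow> (\<forall>v\<in>V. pairing (qvec v) u \<ge> 0)"
proof
  assume "u \<in> dual_cone (cone_gen V)"
  then show "\<forall>v\<in>V. pairing (qvec v) u \<ge> 0" using qvec_in_cone[OF assms] by (simp add: dual_cone_def)
next
  assume "\<forall>v\<in>V. pairing (qvec v) u \<ge> 0"
  then show "u \<in> dual_cone (cone_gen V)"
    by (auto simp: dual_cone_def cone_gen_def pairing_sum intro!: sum_nonneg)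
qed

lemma qvec_dual_cone: "finite V \<Longrightarrow> qvec u \<in> dual_cone (cone_gen V) \<longleftrightarrow> u \<in> dual_lattice V"
  by (simp add: dual_cone_gen dual_lattice_def pairing_qvec)

lemma toric_ring_cone_gen: "finite V \<Longrightarrow> toric_ring (cone_gen V) = torus.mring (dual_lattice V)"
  by (simp add: toric_ring_def torus.mring_def qvec_dual_cone)

text \<open>The dual basis of \<open>b\<close>, \<open>b'\<close> by Cramer's rule. The determinant
  is 1 or -1, so multiplying by it is the same as dividing.\<close>

definition sdual :: "int \<times> int \<Rightarrow> int \<times> int \<Rightarrow> int \<times> int \<Rightarrow> int \<times> int" where
  "sdual b b' v = (if v = b then (det2 b b' * snd b', - (det2 b b' * fst b'))
     else (- (det2 b b' * snd b), det2 b b' * fst b))"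

lemma det2_self [simp]: "det2 b b = 0" by (simp add: det2_def)

lemma det2_swap: "det2 b b' = - det2 b' b" by (simp add: det2_def)

text \<open>Squaring the determinant admits both orientations.\<close>

locale unimodular =
  fixes b b' :: "int \<times> int"
  assumes det: "det2 b b' * det2 b b' = 1"
begin

lemma ne: "b \<noteq> b'" using det by auto

lemma sdual_simps:
  "sdual b b' b = (det2 b b' * snd b', - (det2 b b' * fst b'))"
  "sdual b b' b' = (- (det2 b b' * snd b), det2 b b' * fst b)"
  using ne by (simp_all add: sdual_def)

lemma ip_sdual:
  "ip b (sdual b b' b) = 1" "ip b' (sdual b b' b) = 0" "ip b (sdual b b' b') = 0" "ip b' (sdual b b' b') = 1"
proof -
  have "ip b (sdual b b' b) = det2 b b' * det2 b b'" "ip b' (sdual b b' b') = det2 b b' * det2 b b'"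
    by (simp_all add: sdual_simps ip_def det2_def algebra_simps)
  then show "ip b (sdual b b' b) = 1" "ip b' (sdual b b' b') = 1" using det by simp_all
  show "ip b' (sdual b b' b) = 0" "ip b (sdual b b' b') = 0" by (simp_all add: sdual_simps ip_def)
qed

lemma dual_family_sdual: "V \<subseteq> {b, b'} \<Longrightarrow> dual_family V (sdual b b')"
  unfolding dual_family_def
proof (intro conjI ballI)
  assume V: "V \<subseteq> {b, b'}"
  then show "finite V" using finite_subset by auto
  fix v w assume "v \<in> V" "w \<in> V"
  then have "(v = b \<or> v = b') \<and> (w = b \<or> w = b')" using V by blast
  then show "ip v (sdual b b' w) = (if v = w then 1 else 0)" using ip_sdual ne by (elim conjE disjE) simp_all
qed

lemma expand: "u = (ip b u * fst (sdual b b' b) + ip b' u * fst (sdual b b' b'),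
    ip b u * snd (sdual b b' b) + ip b' u * snd (sdual b b' b'))"
proof -
  have 1: "ip b u * (det2 b b' * snd b') + ip b' u * (- (det2 b b' * snd b)) =
      (det2 b b' * det2 b b') * fst u"
    by (simp add: ip_def det2_def algebra_simps)
  have 2: "ip b u * (- (det2 b b' * fst b')) + ip b' u * (det2 b b' * fst b) =
      (det2 b b' * det2 b b') * snd u"
    by (simp add: ip_def det2_def algebra_simps)
  show ?thesis using 1 2 det by (auto simp: sdual_simps prod_eq_iff)
qed

lemma rat_expand: "x = (pairing x (qvec (sdual b b' b)) * of_int (fst b) + pairing x (qvec (sdual b b' b')) * of_int (fst b'),
    pairing x (qvec (sdual b b' b)) * of_int (snd b) + pairing x (qvec (sdual b b' b')) * of_int (snd b'))"
proof -
  let ?d = "of_int (det2 b b') :: rat"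
  have d: "?d * ?d = 1" using det by (metis of_int_1 of_int_mult)
  have dd: "?d = of_int (fst b) * of_int (snd b') - of_int (snd b) * of_int (fst b')" by (simp add: det2_def)
  have 1: "(fst x * (?d * of_int (snd b')) + snd x * (- (?d * of_int (fst b')))) * of_int (fst b) +
      (fst x * (- (?d * of_int (snd b))) + snd x * (?d * of_int (fst b))) * of_int (fst b') =
     ?d * (of_int (fst b) * of_int (snd b') - of_int (snd b) * of_int (fst b')) * fst x"
    by (simp add: algebra_simps)
  have 2: "(fst x * (?d * of_int (snd b')) + snd x * (- (?d * of_int (fst b')))) * of_int (snd b) +
      (fst x * (- (?d * of_int (snd b))) + snd x * (?d * of_int (fst b))) * of_int (snd b') =
     ?d * (of_int (fst b) * of_int (snd b') - of_int (snd b) * of_int (fst b')) * snd x"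
    by (simp add: algebra_simps)
  have "fst x = (fst x * (?d * of_int (snd b')) + snd x * (- (?d * of_int (fst b')))) * of_int (fst b) +
      (fst x * (- (?d * of_int (snd b))) + snd x * (?d * of_int (fst b))) * of_int (fst b')"
    unfolding 1 dd[symmetric] d by simp
  moreover have "snd x = (fst x * (?d * of_int (snd b')) + snd x * (- (?d * of_int (fst b')))) * of_int (snd b) +
      (fst x * (- (?d * of_int (snd b))) + snd x * (?d * of_int (fst b))) * of_int (snd b')"
    unfolding 2 dd[symmetric] d by simp
  ultimately show ?thesis by (simp add: sdual_simps pairing_def qvec_def prod_eq_iff)
qed

lemma mem_cone_gen_iff:
  assumes V: "V \<subseteq> {b, b'}"
  shows "x \<in> cone_gen V \<longleftrightarrow> (\<forall>v\<in>{b, b'}. if v \<in> V then pairing x (qvec (sdual b b' v)) \<ge> 0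
    else pairing x (qvec (sdual b b' v)) = 0)"
proof
  have fin: "finite V" using V finite_subset by auto
  assume "x \<in> cone_gen V"
  then obtain c where c: "\<forall>v\<in>V. c v \<ge> 0"
    "x = (\<Sum>v\<in>V. c v * of_int (fst v), \<Sum>v\<in>V. c v * of_int (snd v))" by (auto simp: cone_gen_def)
  show "\<forall>v\<in>{b, b'}. if v \<in> V then pairing x (qvec (sdual b b' v)) \<ge> 0 else pairing x (qvec (sdual b b' v)) = 0"
  proof
    fix v assume v: "v \<in> {b, b'}"
    have "pairing x (qvec (sdual b b' v)) = (\<Sum>w\<in>V. c w * of_int (ip w (sdual b b' v)))"
      by (simp add: c(2) pairing_sum pairing_qvec)
    also have "\<dots> = (\<Sum>w\<in>V. if w = v then c w else 0)"
      using V v dual_family_sdual[OF order.refl] by (intro sum.cong) (auto simp: dual_family_def)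
    finally show "if v \<in> V then pairing x (qvec (sdual b b' v)) \<ge> 0 else pairing x (qvec (sdual b b' v)) = 0"
      using fin c(1) by auto
  qed
next
  assume *: "\<forall>v\<in>{b, b'}. if v \<in> V then pairing x (qvec (sdual b b' v)) \<ge> 0 else pairing x (qvec (sdual b b' v)) = 0"
  let ?c = "\<lambda>v. pairing x (qvec (sdual b b' v))"
  have "(\<Sum>v\<in>V. ?c v * g v) = ?c b * g b + ?c b' * g b'" for g :: "int \<times> int \<Rightarrow> rat"
  proof -
    have "(\<Sum>v\<in>V. ?c v * g v) = (\<Sum>v\<in>{b, b'}. ?c v * g v)"
      by (rule sum.mono_neutral_left) (use V * in auto)
    then show ?thesis using ne by simp
  qed
  then have "x = (\<Sum>v\<in>V. ?c v * of_int (fst v), \<Sum>v\<in>V. ?c v * of_int (snd v))"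
    using rat_expand[of x] by simp
  then show "x \<in> cone_gen V" using * V unfolding cone_gen_def by (intro CollectI exI[of _ ?c]) auto
qed

text \<open>The functional is nonnegative on the generators, so where it vanishes on a nonnegative
  combination, only generators in its kernel contribute.\<close>

lemma face_of_smooth_cone:
  assumes V: "V \<subseteq> {b, b'}" and f: "face_of_cone \<tau> (cone_gen V)"
  shows "\<exists>W\<subseteq>V. \<tau> = cone_gen W"
proof -
  have fin: "finite V" using V finite_subset by auto
  obtain u where u: "u \<in> dual_cone (cone_gen V)" "\<tau> = {v \<in> cone_gen V. pairing v u = 0}"
    using f by (auto simp: face_of_cone_def)
  have pos: "pairing (qvec v) u \<ge> 0" if "v \<in> V" for v using u(1) that dual_cone_gen[OF fin] by auto
  let ?W = "{v \<in> V. pairing (qvec v) u = 0}"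
  have "x \<in> \<tau> \<longleftrightarrow> x \<in> cone_gen ?W" for x
  proof
    assume "x \<in> \<tau>"
    then obtain c where c: "\<forall>v\<in>V. c v \<ge> 0"
      "x = (\<Sum>v\<in>V. c v * of_int (fst v), \<Sum>v\<in>V. c v * of_int (snd v))" and x: "pairing x u = 0"
      using u by (auto simp: cone_gen_def)
    have "(\<Sum>v\<in>V. c v * pairing (qvec v) u) = 0" using x by (simp add: c(2) pairing_sum)
    then have z: "c v * pairing (qvec v) u = 0" if "v \<in> V" for v
      using sum_nonneg_eq_0_iff[OF fin, of "\<lambda>v. c v * pairing (qvec v) u"] c(1) pos that by auto
    have "(\<Sum>v\<in>V. c v * g v) = (\<Sum>v\<in>?W. c v * g v)" for g :: "int \<times> int \<Rightarrow> rat"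
      by (rule sum.mono_neutral_right) (use fin z in auto)
    then show "x \<in> cone_gen ?W" using c unfolding cone_gen_def by (intro CollectI exI[of _ c]) auto
  next
    assume x: "x \<in> cone_gen ?W"
    then obtain c where c: "x = (\<Sum>v\<in>?W. c v * of_int (fst v), \<Sum>v\<in>?W. c v * of_int (snd v))"
      by (auto simp: cone_gen_def)
    have "x \<in> cone_gen V" using x cone_gen_mono[OF fin, of ?W] by blast
    moreover have "pairing x u = 0" unfolding c pairing_sum by (rule sum.neutral) auto
    ultimately show "x \<in> \<tau>" using u by auto
  qed
  then show ?thesis by (intro exI[of _ ?W]) auto
qed

lemma face_of_smooth_coneI:
  assumes V: "V \<subseteq> {b, b'}" and W: "W \<subseteq> V"
  shows "face_of_cone (cone_gen W) (cone_gen V)"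
proof -
  have WV: "W \<subseteq> {b, b'}" using V W by auto
  have fin: "finite V" using V finite_subset by auto
  \<comment> \<open>The supporting functional of the face: it is 1 on exactly the generators that
    are dropped.\<close>
  define u where "u = (\<Sum>v\<in>V - W. sdual b b' v)"
  have ip: "ip v u = (if v \<in> W then 0 else 1)" if "v \<in> V" for v
    using torus.ip_face_sum[OF dual_family_sdual[OF V] W that]
    unfolding torus.face_sum_def[OF dual_family_sdual[OF V] W] u_def .
  have "qvec u \<in> dual_cone (cone_gen V)" using ip by (simp add: qvec_dual_cone fin dual_lattice_def)
  moreover have "cone_gen W = {v \<in> cone_gen V. pairing v (qvec u) = 0}"
  proof (intro equalityI subsetI)
    fix x assume x: "x \<in> cone_gen W"
    then obtain c where c: "x = (\<Sum>v\<in>W. c v * of_int (fst v), \<Sum>v\<in>W. c v * of_int (snd v))"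
      by (auto simp: cone_gen_def)
    have "x \<in> cone_gen V" using x cone_gen_mono[OF fin W] by blast
    moreover have "pairing x (qvec u) = 0" unfolding c pairing_sum pairing_qvec
      by (rule sum.neutral) (use ip W in auto)
    ultimately show "x \<in> {v \<in> cone_gen V. pairing v (qvec u) = 0}" by simp
  next
    fix x assume "x \<in> {v \<in> cone_gen V. pairing v (qvec u) = 0}"
    then obtain c where c: "\<forall>v\<in>V. c v \<ge> 0"
      "x = (\<Sum>v\<in>V. c v * of_int (fst v), \<Sum>v\<in>V. c v * of_int (snd v))" and x: "pairing x (qvec u) = 0"
      by (auto simp: cone_gen_def)
    have "(\<Sum>v\<in>V. c v * of_int (ip v u)) = 0" using x by (simp add: c(2) pairing_sum pairing_qvec)
    then have "c v * of_int (ip v u) = 0" if "v \<in> V" for v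
      using sum_nonneg_eq_0_iff[OF fin, of "\<lambda>v. c v * of_int (ip v u)"] c(1) ip that by auto
    then have z: "c v = 0" if "v \<in> V - W" for v using ip[of v] that by fastforce
    have "(\<Sum>v\<in>V. c v * g v) = (\<Sum>v\<in>W. c v * g v)" for g :: "int \<times> int \<Rightarrow> rat"
      by (rule sum.mono_neutral_right) (use fin W z in auto)
    then show "x \<in> cone_gen W" using c W unfolding cone_gen_def by (intro CollectI exI[of _ c]) auto
  qed
  ultimately show ?thesis unfolding face_of_cone_def by blast
qed

text \<open>Recovers a cone from the lattice points of its dual, hence a face from the monomials in
  a local ring. The vectors of the dual basis already test all coordinates.\<close>

lemma cone_gen_bidual:
  assumes V: "V \<subseteq> {b, b'}"
  shows "x \<in> cone_gen V \<longleftrightarrow> (\<forall>u\<in>dual_lattice V. pairing x (qvec u) \<ge> 0)"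
proof
  assume "x \<in> cone_gen V"
  then show "\<forall>u\<in>dual_lattice V. pairing x (qvec u) \<ge> 0"
    using qvec_dual_cone[of V] V finite_subset[of V "{b, b'}"] by (auto simp: dual_cone_def)
next
  assume *: "\<forall>u\<in>dual_lattice V. pairing x (qvec u) \<ge> 0"
  note D = dual_family_sdual[OF order.refl]
  have neg: "pairing x (qvec (- u)) = - pairing x (qvec u)" for u by (simp add: pairing_def qvec_def)
  show "x \<in> cone_gen V" unfolding mem_cone_gen_iff[OF V]
  proof
    fix v assume v: "v \<in> {b, b'}"
    have "sdual b b' v \<in> dual_lattice V" using D V v by (auto simp: dual_lattice_def dual_family_def)
    moreover have "- sdual b b' v \<in> dual_lattice V" if "v \<notin> V"
      using D V v that by (auto simp: dual_lattice_def dual_family_def)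
    ultimately show "if v \<in> V then pairing x (qvec (sdual b b' v)) \<ge> 0 else pairing x (qvec (sdual b b' v)) = 0"
      using bspec[OF *, of "sdual b b' v"] bspec[OF *, of "- sdual b b' v"] neg[of "sdual b b' v"]
      by (cases "v \<in> V") simp_all
  qed
qed

lemma primitive_basis: "primitive b" "primitive b'"
proof -
  have "g dvd 1" if "g dvd fst b" "g dvd snd b" for g
  proof -
    have "g dvd det2 b b'" using that by (auto simp: det2_def intro!: dvd_diff)
    then show ?thesis using det by (metis dvd_mult2)
  qed
  then show "primitive b" by (auto simp: primitive_def intro!: coprimeI)
  have "g dvd 1" if "g dvd fst b'" "g dvd snd b'" for g
  proof -
    have "g dvd det2 b b'" using that by (auto simp: det2_def intro!: dvd_diff)
    then show ?thesis using det by (metis dvd_mult2)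
  qed
  then show "primitive b'" by (auto simp: primitive_def intro!: coprimeI)
qed

text \<open>A point with two positive coordinates lies in no proper face; this is how overlapping
  cones will be identified.\<close>

lemma interior_generators:
  assumes W: "W \<subseteq> {b, b'}" and c: "c > 0" "c' > 0"
    and x: "(c * of_int (fst b) + c' * of_int (fst b'),
        c * of_int (snd b) + c' * of_int (snd b')) \<in> cone_gen W"
  shows "W = {b, b'}"
proof -
  let ?x = "(c * of_int (fst b) + c' * of_int (fst b'), c * of_int (snd b) + c' * of_int (snd b'))"
  have "pairing ?x (qvec (sdual b b' v)) =
      c * of_int (ip b (sdual b b' v)) + c' * of_int (ip b' (sdual b b' v))" for v
    by (simp add: pairing_def qvec_def ip_def algebra_simps)
  then have p: "pairing ?x (qvec (sdual b b' b)) = c" "pairing ?x (qvec (sdual b b' b')) = c'"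
    by (simp_all add: ip_sdual)
  show ?thesis using x c W unfolding mem_cone_gen_iff[OF W] using p by (auto split: if_splits)
qed

end

lemma unimodular_lattice_basis:
  assumes "lattice_basis b b'"
  shows "unimodular b b'"
proof
  have ex: "\<exists>i j. v = (i * fst b + j * fst b', i * snd b + j * snd b')" for v
    using assms unfolding lattice_basis_def by blast
  \<comment> \<open>The coordinates of the standard basis form an inverse matrix, so the determinant
    divides 1.\<close>
  obtain i j where 1: "(1, 0) = (i * fst b + j * fst b', i * snd b + j * snd b')" using ex by blast
  obtain i' j' where 2: "(0, 1) = (i' * fst b + j' * fst b', i' * snd b + j' * snd b')" using ex by blast
  have "(i * j' - j * i') * det2 b b' =
     (i * fst b + j * fst b') * (i' * snd b + j' * snd b') - (i * snd b + j * snd b') * (i' * fst b + j' * fst b')"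
    by (simp add: det2_def algebra_simps)
  also have "\<dots> = 1" using 1 2 by simp
  finally have "det2 b b' dvd 1" by (metis dvd_triv_right)
  then show "det2 b b' * det2 b b' = 1" by (auto simp: zdvd1_eq abs_if split: if_splits)
qed

lemma primitive_scaled_eq:
  assumes v: "primitive v" and w: "primitive w" and c: "c > 0" "c' > 0"
    and eq: "c * of_int (fst v) = c' * (of_int (fst w) :: rat)" "c * of_int (snd v) = c' * of_int (snd w)"
  shows "v = w"
proof -
  have "of_int (fst v * snd w) = (of_int (fst w * snd v) :: rat)"
  proof -
    have "c * c' * of_int (fst v * snd w) = (c * of_int (fst v)) * (c' * of_int (snd w))" by simp
    also have "\<dots> = (c' * of_int (fst w)) * (c * of_int (snd v))" by (simp only: eq)
    also have "\<dots> = c * c' * of_int (fst w * snd v)" by simp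
    finally show ?thesis using c by simp
  qed
  then have "fst v * snd w = fst w * snd v" by (simp only: of_int_eq_iff)
  then have "\<bar>fst v\<bar> * \<bar>snd w\<bar> = \<bar>fst w\<bar> * \<bar>snd v\<bar>" by (simp only: abs_mult[symmetric])
  then have abs: "\<bar>fst v\<bar> = \<bar>fst w\<bar>" "\<bar>snd v\<bar> = \<bar>snd w\<bar>"
    using coprime_crossproduct_int[of "fst v" "snd v" "fst w" "snd w"] v w by (auto simp: primitive_def)
  have sgn: "x = y" if "\<bar>x\<bar> = \<bar>y\<bar>" "c * of_int x = c' * (of_int y :: rat)" for x y :: int
  proof -
    have "x = y \<or> x = - y" using that(1) by linarith
    moreover have "y = 0" if "x = - y"
    proof -
      have "(c + c') * of_int y = (0::rat)" using that \<open>c * of_int x = c' * of_int y\<close>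
        by (simp add: algebra_simps)
      then show ?thesis using c by simp
    qed
    ultimately show ?thesis by auto
  qed
  show ?thesis using sgn[OF abs(1) eq(1)] sgn[OF abs(2) eq(2)] by (simp add: prod_eq_iff)
qed

lemma cone_gen_single: "x \<in> cone_gen {v} \<longleftrightarrow> (\<exists>c\<ge>0. x = (c * of_int (fst v), c * of_int (snd v)))"
  unfolding cone_gen_def by auto

lemma primitive_nonzero: "primitive v \<Longrightarrow> v \<noteq> 0"
  by (auto simp: primitive_def)

lemma qvec_zero_iff: "qvec v = 0 \<longleftrightarrow> v = 0"
  by (auto simp: qvec_def prod_eq_iff zero_prod_def)

lemma primitive_ray_eq:
  assumes "primitive v" "primitive w" "qvec v \<in> cone_gen {w}"
  shows "v = w"
proof -
  obtain c where c: "c \<ge> 0" "qvec v = (c * of_int (fst w), c * of_int (snd w))"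
    using assms(3) cone_gen_single by blast
  have "c \<noteq> 0"
  proof
    assume "c = 0"
    then have "qvec v = 0" using c by (simp add: zero_prod_def)
    then show False using assms(1) primitive_nonzero qvec_zero_iff by blast
  qed
  then show ?thesis using primitive_scaled_eq[OF assms(1,2), of 1 c] c by (simp add: qvec_def)
qed

lemma cone_gen_empty: "cone_gen {} = {0}"
  by (auto simp: cone_gen_def zero_prod_def)

section \<open>Rays and cones of a smooth complete fan\<close>

locale smooth_complete_fan =
  fixes \<Sigma> :: "(rat \<times> rat) set set" and l :: nat and \<nu> :: "nat \<Rightarrow> int \<times> int"
  assumes fan: "is_fan \<Sigma>" and complete: "complete_fan \<Sigma>" and smooth: "smooth_fan \<Sigma>"
    and rays: "numbers_rays \<Sigma> l \<nu>"
begin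

lemma smoothE:
  assumes "\<sigma> \<in> \<Sigma>"
  obtains b b' V where "unimodular b b'" "V \<subseteq> {b, b'}" "\<sigma> = cone_gen V"
  using smooth assms unimodular_lattice_basis unfolding smooth_fan_def by metis

lemma faces: "\<sigma> \<in> \<Sigma> \<Longrightarrow> \<tau> \<in> \<Sigma> \<Longrightarrow> face_of_cone (\<sigma> \<inter> \<tau>) \<sigma>"
  "\<sigma> \<in> \<Sigma> \<Longrightarrow> \<tau> \<in> \<Sigma> \<Longrightarrow> face_of_cone (\<sigma> \<inter> \<tau>) \<tau>"
  "\<sigma> \<in> \<Sigma> \<Longrightarrow> face_of_cone \<tau> \<sigma> \<Longrightarrow> \<tau> \<in> \<Sigma>"
  using fan unfolding is_fan_def by blast+

lemma nu_cyc: "\<nu> 0 = \<nu> l" and nu_prim: "k \<in> {1..l} \<Longrightarrow> primitive (\<nu> k)"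
  and nu_bij: "bij_betw (\<lambda>i. cone_gen {\<nu> i}) {1..l} (rays \<Sigma>)"
  and sigma_in: "i < l \<Longrightarrow> cone_gen {\<nu> i, \<nu> (Suc i)} \<in> \<Sigma>"
  and sigma_det: "i < l \<Longrightarrow> det2 (\<nu> i) (\<nu> (Suc i)) > 0"
  using rays unfolding numbers_rays_def by auto

lemma nu_ray: "k \<in> {1..l} \<Longrightarrow> cone_gen {\<nu> k} \<in> \<Sigma>"
  using nu_bij by (auto simp: bij_betw_def Defs.rays_def)

lemma nu_index: "i < l \<Longrightarrow> \<exists>k\<in>{1..l}. \<nu> i = \<nu> k"
proof (cases "i = 0")
  case True
  assume "i < l"
  then show ?thesis using True nu_cyc by (intro bexI[of _ l]) auto
next
  case False
  assume "i < l"
  then show ?thesis using False by (intro bexI[of _ i]) auto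
qed

lemma nu_inj: "j \<in> {1..l} \<Longrightarrow> k \<in> {1..l} \<Longrightarrow> \<nu> j = \<nu> k \<Longrightarrow> j = k"
  using inj_onD[OF bij_betw_imp_inj_on[OF nu_bij], of j k] by simp

text \<open>A ray of the fan contained in a cone is a face of it, because their intersection is.
  Faces of a smooth cone are spanned by subsets of its basis, and primitivity identifies the
  generator.\<close>

lemma ray_in_cone:
  assumes V: "unimodular b b'" "V \<subseteq> {b, b'}" "cone_gen V \<in> \<Sigma>"
    and v: "primitive v" "cone_gen {v} \<in> \<Sigma>" "qvec v \<in> cone_gen V"
  shows "v \<in> V"
proof -
  interpret unimodular b b' by (rule V(1))
  have "cone_gen {v} \<subseteq> cone_gen V"
  proof
    fix x assume "x \<in> cone_gen {v}"
    then obtain c where c: "c \<ge> 0" "x = (c * of_int (fst v), c * of_int (snd v))" using cone_gen_single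
      by blast
    have "pairing x u = c * pairing (qvec v) u" for u
      by (simp add: c(2) pairing_def qvec_def algebra_simps)
    then show "x \<in> cone_gen V" using v(3) c(1) unfolding mem_cone_gen_iff[OF V(2)] by (auto split: if_splits)
  qed
  then have "face_of_cone (cone_gen {v}) (cone_gen V)"
    using faces(2)[OF v(2) V(3)] by (simp add: Int_absorb2)
  then obtain W where W: "W \<subseteq> V" "cone_gen {v} = cone_gen W" using face_of_smooth_cone[OF V(2)] by blast
  have vW: "qvec v \<in> cone_gen W" using qvec_in_cone[of "{v}" v] W by simp
  have "W = {} \<or> W = {b} \<or> W = {b'} \<or> W = {b, b'}" using W V(2) by blast
  then show ?thesis
  proof (elim disjE)
    assume "W = {}"
    then show ?thesis using vW v(1) primitive_nonzero qvec_zero_iff by (auto simp: cone_gen_empty)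
  next
    assume "W = {b}"
    then show ?thesis using vW primitive_ray_eq[OF v(1) primitive_basis(1)] W by auto
  next
    assume "W = {b'}"
    then show ?thesis using vW primitive_ray_eq[OF v(1) primitive_basis(2)] W by auto
  next
    assume Wb: "W = {b, b'}"
    have "qvec b \<in> cone_gen {v}" "qvec b' \<in> cone_gen {v}"
      using qvec_in_cone[of W] W Wb by auto
    then have "b = v" "b' = v" using primitive_ray_eq primitive_basis v(1) by blast+
    then show ?thesis using ne by simp
  qed
qed

lemma nu_prim_ray: "i \<le> l \<Longrightarrow> l > 0 \<Longrightarrow> primitive (\<nu> i) \<and> cone_gen {\<nu> i} \<in> \<Sigma>"
  using nu_prim nu_ray nu_cyc by (cases "i = 0") auto

text \<open>Two consecutive rays are the two basis vectors of a smooth cone, up to order; the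
  numbering is counterclockwise, which fixes the sign.\<close>

lemma sigma_unimodular: assumes i: "i < l" shows "det2 (\<nu> i) (\<nu> (Suc i)) = 1"
proof -
  obtain b b' V where V: "unimodular b b'" "V \<subseteq> {b, b'}" "cone_gen {\<nu> i, \<nu> (Suc i)} = cone_gen V"
    using smoothE[OF sigma_in[OF i]] by metis
  have VS: "cone_gen V \<in> \<Sigma>" using sigma_in[OF i] V by simp
  have "\<nu> i \<in> V" "\<nu> (Suc i) \<in> V"
    using ray_in_cone[OF V(1,2) VS] nu_prim_ray[of i] nu_prim_ray[of "Suc i"] i
      qvec_in_cone[of "{\<nu> i, \<nu> (Suc i)}"] V(3) by auto
  moreover have "\<nu> i \<noteq> \<nu> (Suc i)" using sigma_det[OF i] by auto
  ultimately have "det2 (\<nu> i) (\<nu> (Suc i)) = det2 b b' \<or> det2 (\<nu> i) (\<nu> (Suc i)) = - det2 b b'"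
    using V(2) det2_swap[of b b'] by auto
  then have "det2 (\<nu> i) (\<nu> (Suc i)) * det2 (\<nu> i) (\<nu> (Suc i)) = 1" using unimodular.det[OF V(1)] by auto
  then show ?thesis using sigma_det[OF i] by (simp add: zmult_eq_1_iff)
qed

lemma sigma_unimod: "i < l \<Longrightarrow> unimodular (\<nu> i) (\<nu> (Suc i))"
  by (simp add: unimodular_def sigma_unimodular)

lemma ray_index:
  assumes "primitive v" "cone_gen {v} \<in> \<Sigma>"
  shows "\<exists>k\<in>{1..l}. v = \<nu> k"
proof -
  have "cone_gen {v} \<in> rays \<Sigma>" using assms(2) primitive_nonzero[OF assms(1)] unfolding Defs.rays_def by blast
  then have "cone_gen {v} \<in> (\<lambda>i. cone_gen {\<nu> i}) ` {1..l}" using bij_betw_imp_surj_on[OF nu_bij] by simp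
  then obtain k where k: "k \<in> {1..l}" "cone_gen {v} = cone_gen {\<nu> k}" by blast
  have "qvec v \<in> cone_gen {\<nu> k}" using qvec_in_cone[of "{v}" v] k by simp
  then show ?thesis using primitive_ray_eq[OF assms(1) nu_prim[OF k(1)]] k by blast
qed

lemma gen_ray:
  assumes "unimodular b b'" "V \<subseteq> {b, b'}" "cone_gen V \<in> \<Sigma>" "v \<in> V"
  shows "\<exists>k\<in>{1..l}. v = \<nu> k"
proof (rule ray_index)
  interpret unimodular b b' by (rule assms(1))
  show "primitive v" using primitive_basis assms by auto
  show "cone_gen {v} \<in> \<Sigma>"
    by (rule faces(3)[OF assms(3) face_of_smooth_coneI[OF assms(2)]]) (use assms in auto)
qed

lemma l_pos: "l > 0"
proof -
  have "(1, 0) \<in> \<Union>\<Sigma>" using complete by (simp add: complete_fan_def)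
  then obtain \<sigma> where s: "\<sigma> \<in> \<Sigma>" "(1, 0) \<in> \<sigma>" by blast
  obtain b b' V where V: "unimodular b b'" "V \<subseteq> {b, b'}" "\<sigma> = cone_gen V" using smoothE[OF s(1)] .
  have "V \<noteq> {}" using s V by (auto simp: cone_gen_empty zero_prod_def)
  then show ?thesis using gen_ray[OF V(1,2)] s V by fastforce
qed

lemma pred_index: "k \<in> {1..l} \<Longrightarrow> \<exists>i<l. \<nu> (Suc i) = \<nu> k"
  by (intro exI[of _ "k - 1"]) auto

lemma succ_index: "k \<in> {1..l} \<Longrightarrow> \<exists>i<l. \<nu> i = \<nu> k"
  using nu_cyc l_pos by (cases "k = l") (auto intro: exI[of _ 0] exI[of _ k])

text \<open>Consider the numbered cone that starts at the ray of \<open>b\<close>. Near this ray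
  both cones have interior points in common, so their intersection can be a face of each only if the
  two coincide.\<close>

lemma two_dim_cone:
  assumes V: "unimodular b b'" "cone_gen {b, b'} \<in> \<Sigma>" and d: "det2 b b' > 0"
  shows "\<exists>i<l. cone_gen {b, b'} = cone_gen {\<nu> i, \<nu> (Suc i)}"
proof -
  interpret unimodular b b' by (rule V(1))
  obtain k where k: "k \<in> {1..l}" "b = \<nu> k" using gen_ray[OF V(1) order.refl V(2), of b] by auto
  obtain i where i: "i < l" "\<nu> i = b" using succ_index[OF k(1)] k(2) by auto
  let ?n = "\<nu> (Suc i)"
  interpret n: unimodular b ?n using sigma_unimod[OF i(1)] i(2) by simp
  have n1: "det2 b ?n = 1" using sigma_unimodular[OF i(1)] i(2) by simp
  have d1: "det2 b b' = 1" using d det by (simp add: zmult_eq_1_iff)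
  \<comment> \<open>Both determinants with \<open>b\<close> are 1, so \<open>b'\<close> and the next
    ray generator differ by a multiple of \<open>b\<close>.\<close>
  define \<alpha> where "\<alpha> = det2 b' ?n"
  have b': "fst b' = \<alpha> * fst b + fst ?n" "snd b' = \<alpha> * snd b + snd ?n"
  proof -
    have "\<alpha> * fst b + det2 b b' * fst ?n = det2 b ?n * fst b'"
      "\<alpha> * snd b + det2 b b' * snd ?n = det2 b ?n * snd b'"
      by (simp_all add: \<alpha>_def det2_def algebra_simps)
    then show "fst b' = \<alpha> * fst b + fst ?n" "snd b' = \<alpha> * snd b + snd ?n" using n1 d1 by simp_all
  qed
  let ?\<tau> = "cone_gen {b, b'} \<inter> cone_gen {b, ?n}"
  have S: "cone_gen {b, ?n} \<in> \<Sigma>" using sigma_in[OF i(1)] i(2) by simp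
  \<comment> \<open>Chosen to make both \<open>c\<close> and \<open>c + \<alpha>\<close> positive;
    then \<open>c b + b' = (c + \<alpha>) b + \<nu> (Suc i)\<close> is interior to both
    cones.\<close>
  define c where "c = (of_int (\<bar>\<alpha>\<bar> + 1) :: rat)"
  have "c + of_int \<alpha> = of_int (\<bar>\<alpha>\<bar> + 1 + \<alpha>)" by (simp add: c_def)
  also have "\<dots> > 0" unfolding of_int_0_less_iff by linarith
  finally have c: "c > 0" "c + of_int \<alpha> > 0" by (simp_all add: c_def)
  let ?x = "(c * of_int (fst b) + 1 * of_int (fst b'), c * of_int (snd b) + 1 * of_int (snd b')) :: rat \<times> rat"
  have x2: "?x = ((c + of_int \<alpha>) * of_int (fst b) + 1 * of_int (fst ?n),
      (c + of_int \<alpha>) * of_int (snd b) + 1 * of_int (snd ?n))"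
    by (simp add: b' algebra_simps)
  have gen2: "(p * of_int (fst v) + q * of_int (fst w),
      p * of_int (snd v) + q * of_int (snd w)) \<in> cone_gen {v, w}"
    if "p \<ge> 0" "q \<ge> 0" "v \<noteq> w" for p q :: rat and v w
    unfolding cone_gen_def using that by (intro CollectI exI[of _ "\<lambda>z. if z = v then p else q"]) auto
  have "?x \<in> cone_gen {b, b'}" by (rule gen2) (use c ne in auto)
  moreover have "?x \<in> cone_gen {b, ?n}" unfolding x2 by (rule gen2) (use c n.ne in auto)
  ultimately have x: "?x \<in> ?\<tau>" by blast
  obtain W where W: "W \<subseteq> {b, b'}" "?\<tau> = cone_gen W"
    using face_of_smooth_cone[OF order.refl faces(1)[OF V(2) S]] by blast
  obtain W' where W': "W' \<subseteq> {b, ?n}" "?\<tau> = cone_gen W'"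
    using n.face_of_smooth_cone[OF order.refl faces(2)[OF V(2) S]] by blast
  have "W = {b, b'}" by (rule interior_generators[OF W(1) c(1), of 1]) (use x W(2) in simp_all)
  moreover have "W' = {b, ?n}"
    by (rule n.interior_generators[OF W'(1) c(2) zero_less_one]) (rule x[unfolded x2 W'(2)])
  ultimately have "cone_gen {b, b'} = cone_gen {b, ?n}" using W W' by simp
  then show ?thesis using i by auto
qed

lemma cone_classification:
  assumes s: "\<sigma> \<in> \<Sigma>"
  shows "\<exists>i<l. \<exists>W\<subseteq>{\<nu> i, \<nu> (Suc i)}. \<sigma> = cone_gen W"
proof -
  obtain b b' V where V: "unimodular b b'" "V \<subseteq> {b, b'}" "\<sigma> = cone_gen V" using smoothE[OF s] .
  have VS: "cone_gen V \<in> \<Sigma>" using s V by simp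
  consider "V = {}" | v where "V = {v}" | "V = {b, b'}" using V(2) by blast
  then show ?thesis
  proof cases
    case 1
    then show ?thesis using V l_pos by blast
  next
    case 2
    then obtain k where "k \<in> {1..l}" "v = \<nu> k" using gen_ray[OF V(1,2) VS, of v] by auto
    then obtain i where "i < l" "\<nu> (Suc i) = v" using pred_index by metis
    then show ?thesis using 2 V(3) by (intro exI[of _ i]) auto
  next
    case 3
    then have S: "cone_gen {b, b'} \<in> \<Sigma>" using VS by simp
    have "det2 b b' \<noteq> 0" using unimodular.det[OF V(1)] by auto
    then consider "det2 b b' > 0" | "det2 b' b > 0" using det2_swap[of b b'] by linarith
    then show ?thesis
    proof cases
      case 1
      then show ?thesis using two_dim_cone[OF V(1) S] 3 V(3) by auto
    next
      case 2
      have "unimodular b' b" using unimodular.det[OF V(1)] det2_swap[of b b'] by (simp add: unimodular_def)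
      then show ?thesis using two_dim_cone[of b' b] S 2 3 V(3) by (auto simp: insert_commute)
    qed
  qed
qed

lemma nu_in_sigma:
  assumes i: "i < l" and k: "k \<in> {1..l}" and q: "qvec (\<nu> k) \<in> cone_gen {\<nu> i, \<nu> (Suc i)}"
  shows "\<nu> k = \<nu> i \<or> \<nu> k = \<nu> (Suc i)"
  using ray_in_cone[OF sigma_unimod[OF i] order.refl sigma_in[OF i] nu_prim[OF k] nu_ray[OF k] q] by auto

text \<open>Each generator is a multiple of a dual basis vector, and the factor divides both of its
  coordinates. Primitivity and positivity leave only 1.\<close>

lemma dual_generators_ip:
  assumes i: "i < l" and g: "dual_generators \<nu> i w w'"
  shows "ip (\<nu> i) w = 1" "ip (\<nu> (Suc i)) w = 0" "ip (\<nu> i) w' = 0" "ip (\<nu> (Suc i)) w' = 1"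
proof -
  interpret unimodular "\<nu> i" "\<nu> (Suc i)" by (rule sigma_unimod[OF i])
  let ?b = "\<nu> i" and ?b' = "\<nu> (Suc i)"
  have prim: "primitive w" "primitive w'" and dc: "dual_cone (cone_gen {?b, ?b'}) = cone_gen {w, w'}"
    and z: "ip ?b' w = 0" "ip ?b w' = 0"
    using g by (auto simp: dual_generators_def pairing_qvec)
  have "qvec w \<in> dual_cone (cone_gen {?b, ?b'})" "qvec w' \<in> dual_cone (cone_gen {?b, ?b'})"
    unfolding dc by (auto intro: qvec_in_cone)
  then have pos: "ip ?b w \<ge> 0" "ip ?b' w' \<ge> 0" by (auto simp: qvec_dual_cone dual_lattice_def)
  have one: "n = 1" if "n \<ge> 0" "primitive u" "n dvd fst u" "n dvd snd u" for n :: int and u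
    using that coprime_common_divisor_int[of "fst u" "snd u" n] by (auto simp: primitive_def)
  show "ip ?b w = 1"
    by (rule one[OF pos(1) prim(1)]) (use expand[of w] z in \<open>(metis dvd_triv_left fst_conv snd_conv mult_zero_left add.right_neutral)+\<close>)
  show "ip ?b' w' = 1"
    by (rule one[OF pos(2) prim(2)]) (use expand[of w'] z in \<open>(metis dvd_triv_left fst_conv snd_conv mult_zero_left add.left_neutral)+\<close>)
  show "ip ?b' w = 0" "ip ?b w' = 0" by (rule z)+
qed

end

section \<open>The slice \<open>R = 1\<close>\<close>

context smooth_complete_fan
begin

lemma slice_cone_single:
  assumes "snd v > 0"
  shows "slice (cone_gen {v}) = {of_int (fst v) / of_int (snd v)}"
proof -
  have s: "(of_int (snd v) :: rat) > 0" using assms by simp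
  have "p \<in> slice (cone_gen {v}) \<longleftrightarrow> p = of_int (fst v) / of_int (snd v)" for p
  proof
    assume "p \<in> slice (cone_gen {v})"
    then obtain c where "p = c * of_int (fst v)" "1 = c * (of_int (snd v) :: rat)"
      by (auto simp: slice_def cone_gen_single)
    then show "p = of_int (fst v) / of_int (snd v)" using s by (simp add: field_simps)
  next
    assume "p = of_int (fst v) / of_int (snd v)"
    then show "p \<in> slice (cone_gen {v})" using s
      by (auto simp: slice_def cone_gen_single intro!: exI[of _ "1 / of_int (snd v)"])
  qed
  then show ?thesis by auto
qed

lemma slice_cone_single_subset: "p \<in> slice (cone_gen {v}) \<Longrightarrow> q \<in> slice (cone_gen {v}) \<Longrightarrow> p = q"
proof -
  assume "p \<in> slice (cone_gen {v})" "q \<in> slice (cone_gen {v})"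
  then obtain c d where *: "p = c * of_int (fst v)" "1 = c * (of_int (snd v) :: rat)"
    "q = d * of_int (fst v)" "1 = d * (of_int (snd v) :: rat)"
    by (auto simp: slice_def cone_gen_single)
  then have "(c - d) * of_int (snd v) = 0" by (simp add: left_diff_distrib)
  then have "c = d" using *(2) by auto
  then show "p = q" using * by simp
qed

text \<open>A ray with \<open>R > 0\<close> separates the slices of its two neighbouring cones, which are therefore
  consecutive segments.\<close>

lemma slice_two_cone:
  assumes i: "i < l" and x: "p \<in> slice (cone_gen {\<nu> i, \<nu> (Suc i)})"
  shows "p * of_int (snd (\<nu> i)) \<le> of_int (fst (\<nu> i))"
      "of_int (fst (\<nu> (Suc i))) \<le> p * of_int (snd (\<nu> (Suc i)))"
proof -
  interpret unimodular "\<nu> i" "\<nu> (Suc i)" by (rule sigma_unimod[OF i])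
  have "(p, 1) \<in> cone_gen {\<nu> i, \<nu> (Suc i)}" using x by (simp add: slice_def)
  then have "pairing (p, 1) (qvec (sdual (\<nu> i) (\<nu> (Suc i)) (\<nu> i))) \<ge> 0"
    "pairing (p, 1) (qvec (sdual (\<nu> i) (\<nu> (Suc i)) (\<nu> (Suc i)))) \<ge> 0"
    using mem_cone_gen_iff[OF order.refl] by auto
  then show "p * of_int (snd (\<nu> i)) \<le> of_int (fst (\<nu> i))"
      "of_int (fst (\<nu> (Suc i))) \<le> p * of_int (snd (\<nu> (Suc i)))"
    by (simp_all add: sdual_simps sigma_unimodular[OF i] pairing_def qvec_def)
qed

lemma slice_two_cone_point:
  assumes v: "snd v > 0" and d: "det2 v w \<noteq> 0"
  shows "of_int (fst v) / of_int (snd v) \<in> slice (cone_gen {v, w})"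
    "\<exists>p\<in>slice (cone_gen {v, w}). p \<noteq> of_int (fst v) / of_int (snd v)"
proof -
  have vw: "v \<noteq> w" using d by auto
  have gen: "(a * of_int (fst v) + b * of_int (fst w),
      a * of_int (snd v) + b * of_int (snd w)) \<in> cone_gen {v, w}"
    if "a \<ge> 0" "b \<ge> 0" for a b :: rat
    unfolding cone_gen_def using that vw by (intro CollectI exI[of _ "\<lambda>z. if z = v then a else b"]) auto
  have s: "(of_int (snd v) :: rat) > 0" using v by simp
  show "of_int (fst v) / of_int (snd v) \<in> slice (cone_gen {v, w})"
    using gen[of "1 / of_int (snd v)" 0] s by (simp add: slice_def)
  \<comment> \<open>Large enough for \<open>N v + w\<close> to have positive height \<open>D\<close>
    even when \<open>w\<close> points downwards; division by \<open>D\<close> then brings it to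
    height 1.\<close>
  define N where "N = (of_int (\<bar>snd w\<bar> + 1) :: rat)"
  define D where "D = N * of_int (snd v) + of_int (snd w)"
  have D: "D > 0"
  proof -
    have "of_int ((\<bar>snd w\<bar> + 1) * snd v + snd w) = D" by (simp add: D_def N_def)
    moreover have "(\<bar>snd w\<bar> + 1) * snd v + snd w > 0"
    proof -
      define P where "P = (\<bar>snd w\<bar> + 1) * snd v"
      have "(\<bar>snd w\<bar> + 1) * 1 \<le> P" unfolding P_def by (rule mult_left_mono) (use v in auto)
      then have "P + snd w > 0" by simp
      then show ?thesis by (simp only: P_def)
    qed
    ultimately show ?thesis by (metis of_int_0_less_iff)
  qed
  have N: "N \<ge> 0" by (simp add: N_def)
  let ?p = "(N * of_int (fst v) + of_int (fst w)) / D"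
  have "(?p, 1) = ((N / D) * of_int (fst v) + (1 / D) * of_int (fst w),
      (N / D) * of_int (snd v) + (1 / D) * of_int (snd w))"
  proof -
    have lin: "(N / D) * x + (1 / D) * y = (N * x + y) / D" for x y by (simp add: add_divide_distrib)
    have "(N / D) * of_int (snd v) + (1 / D) * of_int (snd w) = D / D" unfolding lin by (simp only: D_def)
    then show ?thesis using D lin[of "of_int (fst v)" "of_int (fst w)"] by simp
  qed
  then have "?p \<in> slice (cone_gen {v, w})" using gen[of "N / D" "1 / D"] N D by (simp add: slice_def)
  moreover have "?p \<noteq> of_int (fst v) / of_int (snd v)"
  proof
    assume "?p = of_int (fst v) / of_int (snd v)"
    then have "(N * of_int (fst v) + of_int (fst w)) * of_int (snd v) = of_int (fst v) * D"
      using D s by (simp add: field_simps)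
    then have "of_int (det2 v w) = (0::rat)" by (simp add: D_def det2_def algebra_simps)
    then show False using d by simp
  qed
  ultimately show "\<exists>p\<in>slice (cone_gen {v, w}). p \<noteq> of_int (fst v) / of_int (snd v)" by blast
qed

text \<open>The slice of a ray or of the origin has at most one point.\<close>

lemma segments_two_dim: "segments \<Sigma> \<subseteq> (\<lambda>i. slice (cone_gen {\<nu> i, \<nu> (Suc i)})) ` {..<l}"
proof
  fix D assume "D \<in> segments \<Sigma>"
  then obtain \<sigma> p q where s: "\<sigma> \<in> \<Sigma>" "D = slice \<sigma>" "p \<in> D" "q \<in> D" "p \<noteq> q" by (auto simp: segments_def)
  obtain i W where W: "i < l" "W \<subseteq> {\<nu> i, \<nu> (Suc i)}" "\<sigma> = cone_gen W" using cone_classification[OF s(1)]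
    by blast
  have "W \<noteq> {}" using s W by (auto simp: slice_def cone_gen_empty zero_prod_def)
  moreover have "W \<noteq> {v}" for v using slice_cone_single_subset[of p v q] s W by auto
  ultimately have "W = {\<nu> i, \<nu> (Suc i)}" using W(2) by blast
  then show "D \<in> (\<lambda>i. slice (cone_gen {\<nu> i, \<nu> (Suc i)})) ` {..<l}" using W s by auto
qed

text \<open>The slices of the two cones at \<open>\<nu> k\<close> meet in the point
  \<open>p0\<close> and lie on different sides of it, so they are consecutive segments. The
  numbering assigns their common point to a ray, which is that of \<open>\<nu> k\<close> since both
  generators are primitive.\<close>

lemma positive_ray:
  assumes seg: "numbers_segments \<Sigma> \<nu> m \<Delta>" and k: "k \<in> {1..l}" and pos: "snd (\<nu> k) > 0"
  shows "k \<le> m + 1" "k < l" "slice (cone_gen {\<nu> k}) = \<Delta> (k - 1) \<inter> \<Delta> k"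
proof -
  have bij: "bij_betw \<Delta> {0..m+1} (segments \<Sigma>)" and ord: "\<And>i. i \<le> m \<Longrightarrow> set_geq (\<Delta> i) (\<Delta> (Suc i))"
    and sl: "\<And>i. i \<in> {1..m+1} \<Longrightarrow> slice (cone_gen {\<nu> i}) = \<Delta> (i - 1) \<inter> \<Delta> i"
    using seg by (auto simp: numbers_segments_def)
  \<comment> \<open>Distinct segments come from distinct two-dimensional cones, of which there are
    at most \<open>l\<close>. So index \<open>m + 1\<close> stays below \<open>l\<close>, clear of
    the cyclic identification of 0 and \<open>l\<close>.\<close>
  have "m + 2 = card (segments \<Sigma>)" using bij_betw_same_card[OF bij] by simp
  also have "\<dots> \<le> card ((\<lambda>i. slice (cone_gen {\<nu> i, \<nu> (Suc i)})) ` {..<l})"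
    by (rule card_mono[OF _ segments_two_dim]) simp
  also have "\<dots> \<le> l" using card_image_le[of "{..<l}" "\<lambda>i. slice (cone_gen {\<nu> i, \<nu> (Suc i)})"] by simp
  finally have ml: "m + 1 < l" by simp
  have nondeg: "\<exists>p\<in>\<Delta> i. \<exists>q\<in>\<Delta> i. p \<noteq> q" if "i \<le> m + 1" for i
  proof -
    have "\<Delta> i \<in> segments \<Sigma>" using bij_betw_apply[OF bij] that by simp
    then show ?thesis unfolding segments_def by blast
  qed
  have geq: "set_geq (\<Delta> i) (\<Delta> j)" if "i < j" "j \<le> m + 1" for i j
    using that
  proof (induction j)
    case (Suc j)
    show ?case
    proof (cases "i = j")
      case True then show ?thesis using ord Suc by simp
    next
      case False
      then have "set_geq (\<Delta> i) (\<Delta> j)" "set_geq (\<Delta> j) (\<Delta> (Suc j))" using Suc ord by auto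
      moreover obtain r where "r \<in> \<Delta> j" using nondeg[of j] Suc by auto
      ultimately show ?thesis unfolding set_geq_def by (meson order.trans)
    qed
  qed simp
  define p0 where "p0 = (of_int (fst (\<nu> k)) / of_int (snd (\<nu> k)) :: rat)"
  have s: "(of_int (snd (\<nu> k)) :: rat) > 0" using pos by simp
  obtain i where i: "i < l" "\<nu> (Suc i) = \<nu> k" using pred_index[OF k] by blast
  obtain j where j: "j < l" "\<nu> j = \<nu> k" using succ_index[OF k] by blast
  let ?A = "slice (cone_gen {\<nu> i, \<nu> k})" and ?B = "slice (cone_gen {\<nu> k, \<nu> (Suc j)})"
  have A: "p0 \<in> ?A" "\<exists>p\<in>?A. p \<noteq> p0" "\<And>p. p \<in> ?A \<Longrightarrow> p \<ge> p0"
  proof -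
    have "det2 (\<nu> k) (\<nu> i) \<noteq> 0" using sigma_det[OF i(1)] i(2) det2_swap[of "\<nu> k" "\<nu> i"] by simp
    from slice_two_cone_point[OF pos this] show "p0 \<in> ?A" "\<exists>p\<in>?A. p \<noteq> p0"
      by (simp_all add: p0_def insert_commute)
    show "p \<ge> p0" if "p \<in> ?A" for p
      using slice_two_cone(2)[OF i(1), of p] that i(2) s by (simp add: p0_def field_simps)
  qed
  have B: "p0 \<in> ?B" "\<exists>p\<in>?B. p \<noteq> p0" "\<And>p. p \<in> ?B \<Longrightarrow> p \<le> p0"
  proof -
    have "det2 (\<nu> k) (\<nu> (Suc j)) \<noteq> 0" using sigma_det[OF j(1)] j(2) by simp
    from slice_two_cone_point[OF pos this] show "p0 \<in> ?B" "\<exists>p\<in>?B. p \<noteq> p0"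
      by (simp_all add: p0_def)
    show "p \<le> p0" if "p \<in> ?B" for p
      using slice_two_cone(1)[OF j(1), of p] that j(2) s by (simp add: p0_def field_simps)
  qed
  have "?A \<in> segments \<Sigma>" "?B \<in> segments \<Sigma>"
    using A(1,2) B(1,2) sigma_in[OF i(1)] sigma_in[OF j(1)] i(2) j(2) unfolding segments_def by auto
  then obtain a b where a: "a \<le> m + 1" "\<Delta> a = ?A" and b: "b \<le> m + 1" "\<Delta> b = ?B"
    using bij_betw_imp_surj_on[OF bij] by (metis (no_types, lifting) atLeastAtMost_iff imageE)
  have "a < b"
  proof (rule ccontr)
    assume "\<not> a < b"
    then consider "a = b" | "b < a" by linarith
    then show False
    proof cases
      case 1
      then show False using A B a b by (metis antisym)
    next
      case 2
      then have "set_geq ?B ?A" using geq[of b a] a b by simp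
      then show False using A B unfolding set_geq_def by (metis antisym)
    qed
  qed
  \<comment> \<open>A segment strictly between the two would be squeezed to the single point
    \<open>p0\<close>.\<close>
  moreover have "b \<le> Suc a"
  proof (rule ccontr)
    assume ab: "\<not> b \<le> Suc a"
    then have "set_geq ?A (\<Delta> (Suc a))" "set_geq (\<Delta> (Suc a)) ?B"
      using geq[of a "Suc a"] geq[of "Suc a" b] a b by auto
    then have "r = p0" if "r \<in> \<Delta> (Suc a)" for r using that A(1) B(1) unfolding set_geq_def by (meson antisym)
    then show False using nondeg[of "Suc a"] ab b by auto
  qed
  ultimately have b_eq: "b = Suc a" by simp
  have a1: "Suc a \<in> {1..m+1}" using b b_eq by auto
  have "p0 \<in> slice (cone_gen {\<nu> (Suc a)})" using sl[OF a1] A(1) B(1) a b b_eq by simp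
  then obtain c where c: "c \<ge> 0" "p0 = c * of_int (fst (\<nu> (Suc a)))" "1 =
      c * (of_int (snd (\<nu> (Suc a))) :: rat)"
    by (auto simp: slice_def cone_gen_single)
  have aL: "Suc a \<in> {1..l}" using a1 ml by auto
  have "\<nu> (Suc a) = \<nu> k"
  proof (rule primitive_scaled_eq[OF nu_prim[OF aL] nu_prim[OF k]])
    show "c > 0" using c by (metis less_eq_rat_def mult_zero_left zero_neq_one)
    show "1 / (of_int (snd (\<nu> k)) :: rat) > 0" using s by simp
    show "c * of_int (fst (\<nu> (Suc a))) = 1 / of_int (snd (\<nu> k)) * of_int (fst (\<nu> k))" using c
      by (simp add: p0_def)
    show "c * of_int (snd (\<nu> (Suc a))) = 1 / of_int (snd (\<nu> k)) * of_int (snd (\<nu> k))" using c s by simp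
  qed
  then have "k = Suc a" using nu_inj[OF aL k] by simp
  then show "k \<le> m + 1" "k < l" "slice (cone_gen {\<nu> k}) = \<Delta> (k - 1) \<inter> \<Delta> k" using a1 ml sl[OF a1] by auto
qed

text \<open>The ray meets height 1 in \<open>fst / snd\<close>; for a primitive generator with
  positive height this is an integer only if the height is 1.\<close>

lemma positive_ray_lattice_point:
  assumes seg: "numbers_segments \<Sigma> \<nu> m \<Delta>" and k: "k \<in> {1..l}" and pos: "snd (\<nu> k) > 0"
    and pt: "\<Delta> (k - 1) \<inter> \<Delta> k = {of_int n}"
  shows "\<nu> k = (n, 1)"
proof -
  have "of_int (fst (\<nu> k)) / of_int (snd (\<nu> k)) = (of_int n :: rat)"
    using positive_ray(3)[OF seg k pos] slice_cone_single[OF pos] pt by auto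
  then have "of_int (fst (\<nu> k)) = (of_int (n * snd (\<nu> k)) :: rat)" using pos by (simp add: field_simps)
  then have f: "fst (\<nu> k) = n * snd (\<nu> k)" by (simp only: of_int_eq_iff)
  then have "coprime (n * snd (\<nu> k)) (snd (\<nu> k))" using nu_prim[OF k] by (simp add: primitive_def)
  then have "snd (\<nu> k) dvd 1" by (metis coprime_absorb_right dvd_triv_right)
  then have "snd (\<nu> k) = 1" using pos by (simp add: zdvd1_eq)
  then show ?thesis using f by (simp add: prod_eq_iff)
qed

section \<open>The toric surface as a glued space\<close>

lemma mring_common_localization:
  assumes ub: "unimodular b b'" and V: "V \<subseteq> {b, b'}" and W: "W \<subseteq> V"
  shows "is_localization_of (torus.mring (dual_lattice W)) (torus.mring (dual_lattice V))"
    "openin (zariski (ring_on (torus.mring (dual_lattice V))))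
      ((\<lambda>P. P \<inter> torus.mring (dual_lattice V)) ` primes (ring_on (torus.mring (dual_lattice W))))"
proof -
  interpret unimodular b b' by (rule ub)
  note D = dual_family_sdual[OF V]
  note loc = torus.face_localizes[OF D W]
  show "is_localization_of (torus.mring (dual_lattice W)) (torus.mring (dual_lattice V))"
    by (rule localizes_is_localization_of[OF torus.field_subring_dual torus.field_subring_dual loc])
  show "openin (zariski (ring_on (torus.mring (dual_lattice V))))
      ((\<lambda>P. P \<inter> torus.mring (dual_lattice V)) ` primes (ring_on (torus.mring (dual_lattice W))))"
    unfolding localizes_primes_image[OF torus.field_subring_dual torus.field_subring_dual loc]
    by (rule torus.face_open[OF D W])
qed

lemma toric_ring_Int:
  assumes s: "\<sigma> \<in> \<Sigma>" and f: "face_of_cone \<tau> \<sigma>"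
  shows "is_localization_of (toric_ring \<tau>) (toric_ring \<sigma>)"
    "openin (zariski (ring_on (toric_ring \<sigma>))) ((\<lambda>P. P \<inter> toric_ring \<sigma>) ` primes (ring_on (toric_ring \<tau>)))"
proof -
  obtain b b' V where V: "unimodular b b'" "V \<subseteq> {b, b'}" "\<sigma> = cone_gen V" using smoothE[OF s] .
  obtain W where W: "W \<subseteq> V" "\<tau> = cone_gen W" using unimodular.face_of_smooth_cone[OF V(1,2)] f V(3) by blast
  have fin: "finite V" "finite W" using V(2) W(1) finite_subset[of V "{b, b'}"] finite_subset by auto
  show "is_localization_of (toric_ring \<tau>) (toric_ring \<sigma>)"
    "openin (zariski (ring_on (toric_ring \<sigma>))) ((\<lambda>P. P \<inter> toric_ring \<sigma>) ` primes (ring_on (toric_ring \<tau>)))"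
    unfolding V(3) W(2) toric_ring_cone_gen[OF fin(1)] toric_ring_cone_gen[OF fin(2)]
    by (rule mring_common_localization[OF V(1,2) W(1)])+
qed

lemma toric_field_subring: "\<sigma> \<in> \<Sigma> \<Longrightarrow> field_subring (toric_ring \<sigma>)"
proof -
  assume s: "\<sigma> \<in> \<Sigma>"
  obtain b b' V where V: "unimodular b b'" "V \<subseteq> {b, b'}" "\<sigma> = cone_gen V" using smoothE[OF s] .
  have "finite V" using V(2) finite_subset by auto
  then show ?thesis using torus.field_subring_dual V(3) by (simp add: toric_ring_cone_gen)
qed

lemma toric_local_ring_face:
  assumes V: "unimodular b b'" "V \<subseteq> {b, b'}" and p: "p \<in> primes (ring_on (toric_ring (cone_gen V)))"
  shows "\<exists>G\<subseteq>V. \<forall>u. character u \<in> local_ring_in (toric_ring (cone_gen V)) p \<longleftrightarrow> u \<in> dual_lattice G"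
proof -
  interpret unimodular b b' by (rule V(1))
  have "finite V" using V(2) finite_subset by auto
  then have eq: "toric_ring (cone_gen V) = torus.mring (dual_lattice V)" by (rule toric_ring_cone_gen)
  show ?thesis
    using torus.monomial_in_local_ring_iff[OF dual_family_sdual[OF V(2)] p[unfolded eq]] unfolding eq
    by (intro exI[of _ "{v \<in> V. character (sdual b b' v) \<in> p}"]) auto
qed

text \<open>Points of two charts with the same local ring lie on the orbit of a common face, because the
  monomials in the local ring determine the face.\<close>

lemma equal_local_rings_face:
  assumes V: "unimodular b b'" "V \<subseteq> {b, b'}" and V': "unimodular d d'" "V' \<subseteq> {d, d'}"
    and G: "G \<subseteq> V" "G' \<subseteq> V'" and eq: "dual_lattice G = dual_lattice G'"
  shows "cone_gen G = cone_gen G'" "cone_gen G \<subseteq> cone_gen V \<inter> cone_gen V'"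
proof -
  have Gb: "G \<subseteq> {b, b'}" "G' \<subseteq> {d, d'}" using assms by auto
  show c: "cone_gen G = cone_gen G'"
  proof (intro equalityI subsetI)
    show "x \<in> cone_gen G'" if "x \<in> cone_gen G" for x
      using that
        unfolding unimodular.cone_gen_bidual[OF V(1) Gb(1)] unimodular.cone_gen_bidual[OF V'(1) Gb(2)] eq .
    show "x \<in> cone_gen G" if "x \<in> cone_gen G'" for x
      using that
        unfolding unimodular.cone_gen_bidual[OF V(1) Gb(1)] unimodular.cone_gen_bidual[OF V'(1) Gb(2)] eq .
  qed
  have "finite V" "finite V'" using V V' finite_subset by (meson finite.emptyI finite.insertI)+
  then show "cone_gen G \<subseteq> cone_gen V \<inter> cone_gen V'"
    using cone_gen_mono[of V G] cone_gen_mono[of V' G'] G c by simp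
qed

sublocale toric: glued const_xy \<Sigma> toric_ring "\<lambda>\<sigma> \<tau>. {toric_ring (\<sigma> \<inter> \<tau>)}"
proof
  show "const_xy \<in> ring_hom (ring_on UNIV) (ring_on UNIV)" by (rule torus.k_ring_hom)
  show "field_subring (toric_ring \<sigma>)" if "\<sigma> \<in> \<Sigma>" for \<sigma> by (rule toric_field_subring[OF that])
  show "range const_xy \<subseteq> toric_ring \<sigma>" if s: "\<sigma> \<in> \<Sigma>" for \<sigma>
  proof -
    obtain b b' V where V: "unimodular b b'" "V \<subseteq> {b, b'}" "\<sigma> = cone_gen V" using smoothE[OF s] .
    have "finite V" using V(2) finite_subset by auto
    then show ?thesis unfolding V(3) by (auto simp: toric_ring_cone_gen torus.mring_const dual_lattice_zero)
  qed
  show "{toric_ring (\<sigma> \<inter> \<tau>)} \<subseteq> common_localizations (toric_ring \<sigma>) (toric_ring \<tau>)"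
    if s: "\<sigma> \<in> \<Sigma>" "\<tau> \<in> \<Sigma>" for \<sigma> \<tau>
    using toric_ring_Int[OF s(1) faces(1)[OF s]] toric_ring_Int[OF s(2) faces(2)[OF s]]
    by (simp add: common_localizations_def)
  show "\<exists>B\<in>{toric_ring (\<sigma> \<inter> \<tau>)}. B \<subseteq> local_ring_in (toric_ring \<sigma>) p"
    if s: "\<sigma> \<in> \<Sigma>" "\<tau> \<in> \<Sigma>" and p: "p \<in> primes (ring_on (toric_ring \<sigma>))"
        and q: "q \<in> primes (ring_on (toric_ring \<tau>))"
      and eq: "local_ring_in (toric_ring \<sigma>) p = local_ring_in (toric_ring \<tau>) q" for \<sigma> \<tau> p q
  proof -
    obtain b b' V where V: "unimodular b b'" "V \<subseteq> {b, b'}" "\<sigma> = cone_gen V" using smoothE[OF s(1)] .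
    obtain d d' V' where V': "unimodular d d'" "V' \<subseteq> {d, d'}" "\<tau> = cone_gen V'" using smoothE[OF s(2)] .
    obtain G where G: "G \<subseteq> V" "\<forall>u. character u \<in> local_ring_in (toric_ring \<sigma>) p \<longleftrightarrow> u \<in> dual_lattice G"
      using toric_local_ring_face[OF V(1,2) p[unfolded V(3)]] unfolding V(3)[symmetric]
        by (elim exE conjE) (rule that)
    obtain G' where G': "G' \<subseteq> V'" "\<forall>u. character u \<in> local_ring_in (toric_ring \<tau>) q \<longleftrightarrow> u \<in> dual_lattice G'"
      using toric_local_ring_face[OF V'(1,2) q[unfolded V'(3)]] unfolding V'(3)[symmetric]
        by (elim exE conjE) (rule that)
    have "dual_lattice G = dual_lattice G'" using G(2) G'(2) eq by auto
    then have sub: "cone_gen G \<subseteq> \<sigma> \<inter> \<tau>"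
      using equal_local_rings_face(2)[OF V(1,2) V'(1,2) G(1) G'(1)] V(3) V'(3) by simp
    have finG: "finite G" using G(1) V(2) finite_subset by (meson finite.emptyI finite.insertI)
    \<comment> \<open>Dualizing reverses the inclusion: the ring of the intersection is contained in
      that of the common face \<open>G\<close>, whose monomials are regular at the point.\<close>
    have "dual_cone (\<sigma> \<inter> \<tau>) \<subseteq> dual_cone (cone_gen G)" using sub by (auto simp: dual_cone_def)
    then have "toric_ring (\<sigma> \<inter> \<tau>) \<subseteq> toric_ring (cone_gen G)" unfolding toric_ring_def by blast
    also have "\<dots> = torus.mring (dual_lattice G)" by (rule toric_ring_cone_gen[OF finG])
    also have "\<dots> \<subseteq> local_ring_in (toric_ring \<sigma>) p"
    proof (rule torus.mring_minimal)
      have F: "field_subring (toric_ring \<sigma>)" by (rule toric_field_subring[OF s(1)])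
      show "field_subring (local_ring_in (toric_ring \<sigma>) p)" by (rule field_subring_local[OF F p])
      have "const_xy c \<in> toric_ring \<sigma>" for c
        using V(2,3) finite_subset[of V "{b, b'}"]
        by (simp add: toric_ring_cone_gen torus.mring_const dual_lattice_zero)
      then show "range const_xy \<subseteq> local_ring_in (toric_ring \<sigma>) p" using local_ring_in_incl[OF F p] by blast
      show "character ` dual_lattice G \<subseteq> local_ring_in (toric_ring \<sigma>) p" using G(2) by blast
    qed
    finally show ?thesis by simp
  qed
qed

end

section \<open>The affine line\<close>

lemma const_xyt_ring_hom: "const_xyt \<in> ring_hom (ring_on UNIV) (ring_on UNIV)"
  by (rule monomials.k_ring_hom[OF Ztilde_monomials])

lemma const_xyt_zero: "const_xyt 0 = 0" by (rule monomials.k_zero[OF Ztilde_monomials])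

lemma const_xy_eq_0_iff: "const_xy c = 0 \<longleftrightarrow> c = 0"
  by (simp add: const_xy_def Zero_fract_def eq_fract)

definition poly_t :: "complex poly \<Rightarrow> field_xyt" where
  "poly_t P = poly (map_poly const_xyt P) var_t"

lemma poly_t_simps [simp]: "poly_t 0 = 0" "poly_t (pCons c P) = const_xyt c + var_t * poly_t P"
  by (simp_all add: poly_t_def map_poly_pCons const_xyt_zero)

lemma const_xyt_ops: "const_xyt (c + d) = const_xyt c + const_xyt d" "const_xyt (c * d) =
    const_xyt c * const_xyt d"
  "const_xyt 1 = 1" "const_xyt (- c) = - const_xyt c"
  using monomials.k_add[OF Ztilde_monomials] monomials.k_mult[OF Ztilde_monomials]
    monomials.k_one[OF Ztilde_monomials] monomials.k_minus[OF Ztilde_monomials] by auto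

lemma poly_t_add: "poly_t (P + Q) = poly_t P + poly_t Q"
  by (induction P Q rule: poly_induct2) (simp_all add: const_xyt_ops algebra_simps)

lemma poly_t_smult: "poly_t (Polynomial.smult c P) = const_xyt c * poly_t P"
  by (induction P) (simp_all add: const_xyt_ops algebra_simps)

lemma poly_t_mult: "poly_t (P * Q) = poly_t P * poly_t Q"
  by (induction P) (simp_all add: poly_t_add poly_t_smult const_xyt_zero algebra_simps)

lemma poly_t_one: "poly_t 1 = 1"
  by (simp add: one_pCons const_xyt_ops)

lemma field_subring_ring_t: "field_subring ring_t"
  by (simp add: ring_t_def field_subring_calg)

lemma var_t_in_ring_t: "var_t \<in> ring_t" and const_in_ring_t: "const_xyt c \<in> ring_t"
  by (simp_all add: ring_t_def calg_incl calg_const)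

text \<open>Makes division by \<open>t\<close> with remainder, gcds and Bezout coefficients of
  polynomials available in \<open>ring_t\<close>.\<close>

lemma ring_t_eq: "ring_t = range poly_t"
proof
  have "poly_t P \<in> ring_t" for P
    by (induction P) (auto intro: fs_intros[OF field_subring_ring_t] var_t_in_ring_t const_in_ring_t)
  then show "range poly_t \<subseteq> ring_t" by blast
  show "ring_t \<subseteq> range poly_t" unfolding ring_t_def
  proof (rule calg_minimal)
    show "field_subring (range poly_t)"
    proof (rule field_subringI)
      show "1 \<in> range poly_t" by (rule range_eqI[of _ _ 1]) (simp add: poly_t_one)
      fix x y assume "x \<in> range poly_t" "y \<in> range poly_t"
      then obtain P Q where "x = poly_t P" "y = poly_t Q" by blast
      then have "x - y = poly_t (P + Polynomial.smult (- 1) Q)" "x * y = poly_t (P * Q)"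
        by (simp_all only: poly_t_add poly_t_smult poly_t_mult const_xyt_ops) simp
      then show "x - y \<in> range poly_t" "x * y \<in> range poly_t" by blast+
    qed
    show "range const_xyt \<subseteq> range poly_t"
    proof
      fix x assume "x \<in> range const_xyt"
      then obtain c where "x = const_xyt c" by blast
      then have "x = poly_t [:c:]" by simp
      then show "x \<in> range poly_t" by blast
    qed
    have "var_t = poly_t [:0, 1:]" by (simp add: const_xyt_ops const_xyt_zero)
    then show "{var_t} \<subseteq> range poly_t" by blast
  qed
qed

lemma ring_t_regular: "ring_t \<subseteq> regular"
  unfolding ring_t_def by (rule calg_minimal[OF field_subring_regular]) (use red_vars in auto)

text \<open>The kernel of a ring homomorphism into a field.\<close>

lemma red_zero_prime:
  assumes A: "field_subring A" "A \<subseteq> regular"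
  shows "{z \<in> A. red z = 0} \<in> primes (ring_on A)"
  unfolding primes_ring_on_iff[OF A(1)]
  using A(2) fs_intros[OF A(1)] by (auto simp: subset_iff regular_ops red_one red_zero)

lemma ring_t_decompose: "z \<in> ring_t \<Longrightarrow> \<exists>c z'. z' \<in> ring_t \<and> z = const_xyt c + var_t * z'"
proof -
  assume "z \<in> ring_t"
  then obtain P where P: "z = poly_t P" using ring_t_eq by blast
  obtain c Q where "P = pCons c Q" by (cases P)
  then have "z = const_xyt c + var_t * poly_t Q" using P by simp
  moreover have "poly_t Q \<in> ring_t" using ring_t_eq by blast
  ultimately show ?thesis by blast
qed

lemma ring_t_red_zero: "z \<in> ring_t \<Longrightarrow> red z = 0 \<Longrightarrow> \<exists>z'\<in>ring_t. z = var_t * z'"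
proof -
  assume z: "z \<in> ring_t" "red z = 0"
  obtain c z' where z': "z' \<in> ring_t" "z = const_xyt c + var_t * z'" using ring_t_decompose[OF z(1)] by blast
  have "z' \<in> regular" using ring_t_regular z' by blast
  then have "red z = const_xy c" using z'(2) by (simp add: regular_ops red_vars)
  then have "c = 0" using z const_xy_eq_0_iff by simp
  then show ?thesis using z' const_xyt_zero by auto
qed

lemma origin_eq: "origin = {z \<in> ring_t. red z = 0}" (is "_ = ?I")
proof -
  interpret cring "ring_on ring_t" by (rule cring_ring_on[OF field_subring_ring_t])
  have P: "?I \<in> primes (ring_on ring_t)" by (rule red_zero_prime[OF field_subring_ring_t ring_t_regular])
  then have I: "ideal ?I (ring_on ring_t)" by (simp add: primes_def primeideal_def)
  have "origin \<subseteq> ?I" unfolding origin_def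
    by (rule genideal_minimal[OF I]) (use var_t_in_ring_t red_vars in auto)
  moreover have "?I \<subseteq> origin"
  proof
    fix z assume "z \<in> ?I"
    then obtain z' where z': "z' \<in> ring_t" "z = var_t * z'" using ring_t_red_zero by blast
    have g: "ideal origin (ring_on ring_t)" unfolding origin_def
      by (rule genideal_ideal) (use var_t_in_ring_t in auto)
    have "var_t \<in> origin" unfolding origin_def
      using genideal_self[of "{var_t}"] var_t_in_ring_t by auto
    then have "z' * var_t \<in> origin" using g z'(1) unfolding ideal_ring_on_iff[OF field_subring_ring_t] by simp
    then show "z \<in> origin" using z' by (simp add: mult.commute)
  qed
  ultimately show ?thesis by blast
qed

lemma origin_prime: "origin \<in> primes (ring_on ring_t)"
  unfolding origin_eq by (rule red_zero_prime[OF field_subring_ring_t ring_t_regular])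

lemma valuation_local_ring_t:
  assumes q: "q \<in> primes (ring_on ring_t)"
  shows "valuation_subring (local_ring_in ring_t q)"
  unfolding valuation_subring_def
proof (intro conjI ballI impI)
  note F = field_subring_ring_t
  let ?L = "local_ring_in ring_t q"
  show FL: "field_subring ?L" by (rule field_subring_local[OF F q])
  have base: "x / y \<in> ?L \<or> y / x \<in> ?L" if xy: "x \<in> ring_t" "y \<in> ring_t" "x \<noteq> 0" "y \<noteq> 0" for x y
  proof -
    obtain P Q where PQ: "x = poly_t P" "y = poly_t Q" using xy ring_t_eq by blast
    \<comment> \<open>After division by the gcd, Bezout's identity keeps the two polynomials from
      both lying in \<open>q\<close>, so one of the two quotients has an admissible
      denominator.\<close>
    define g where "g = gcd P Q"
    have "P \<noteq> 0" using PQ xy by auto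
    then have g0: "g \<noteq> 0" by (simp add: g_def)
    obtain P' where P': "P = g * P'" using gcd_dvd1[of P Q] unfolding g_def by (elim dvdE)
    obtain Q' where Q': "Q = g * Q'" using gcd_dvd2[of P Q] unfolding g_def by (elim dvdE)
    obtain u v where "u * P + v * Q = g" unfolding g_def using bezout_coefficients_fst_snd by metis
    then have "g * (u * P' + v * Q') = g * 1" by (simp add: P' Q' algebra_simps)
    then have "u * P' + v * Q' = 1" using g0 by (simp only: mult_cancel_left) simp
    then have one: "poly_t u * poly_t P' + poly_t v * poly_t Q' = 1"
      by (metis poly_t_add poly_t_mult poly_t_one)
    have in_t: "poly_t R \<in> ring_t" for R using ring_t_eq by blast
    have gz: "poly_t g \<noteq> 0" using xy PQ P' by (auto simp: poly_t_mult)
    then have xy': "x / y = poly_t P' / poly_t Q'" "y / x = poly_t Q' / poly_t P'"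
      using PQ P' Q' by (simp_all add: poly_t_mult)
    have "poly_t P' \<notin> q \<or> poly_t Q' \<notin> q"
    proof (rule ccontr)
      assume "\<not> ?thesis"
      then have "poly_t u * poly_t P' + poly_t v * poly_t Q' \<in> q"
        using pr_add[OF F q] pr_mult[OF F q] in_t by auto
      then show False using one pr_one[OF F q] by simp
    qed
    then show ?thesis using xy' local_ring_in_div[OF F q] in_t by auto
  qed
  fix x y assume x: "x \<in> ?L" "x \<noteq> 0" and y: "y \<in> ?L" "y \<noteq> 0"
  obtain s where s: "s \<in> ring_t - q" "s * x \<in> ring_t" using x local_ring_in_iff[OF F q] by blast
  obtain r where r: "r \<in> ring_t - q" "r * y \<in> ring_t" using y local_ring_in_iff[OF F q] by blast
  have nz: "s \<noteq> 0" "r \<noteq> 0" using s r pr_zero[OF F q] by auto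
  have "(r * (s * x)) / (s * (r * y)) \<in> ?L \<or> (s * (r * y)) / (r * (s * x)) \<in> ?L"
    by (rule base) (use s r nz x y fs_mult[OF F] in auto)
  then show "x / y \<in> ?L \<or> y / x \<in> ?L" using nz by (simp add: mult_ac)
qed

section \<open>The charts of the family\<close>

locale deformation = smooth_complete_fan +
  fixes m :: nat and \<Delta> :: "nat \<Rightarrow> rat set" and a lam :: "nat \<Rightarrow> int" and w1 w2 :: "nat \<Rightarrow> int \<times> int"
  assumes seg: "numbers_segments \<Sigma> \<nu> m \<Delta>"
    and adm: "admissible_tuple m \<Delta> a"
    and lam_seq: "lambda_sequence m \<Delta> a lam"
    and gens: "i < l \<Longrightarrow> dual_generators \<nu> i (w1 i) (w2 i)"
begin

text \<open>Together with \<open>cl\<close>, the sign and shift of a chart extended by the defaults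
  1 and 0, so that all charts are handled uniformly.\<close>

definition ca :: "nat \<Rightarrow> int" where "ca i = (if i \<le> m + 1 then a i else 1)"
definition cl :: "nat \<Rightarrow> int" where "cl i = (if i \<le> m + 1 then lam i else 0)"
definition lift :: "nat \<Rightarrow> int \<times> int \<Rightarrow> field_xyt" where "lift i = Ztilde (ca i) (cl i)"
abbreviation At :: "nat \<Rightarrow> field_xyt set" where "At \<equiv> Atilde m a lam w1 w2"
abbreviation gen :: "nat \<Rightarrow> (int \<times> int) set" where "gen i \<equiv> {\<nu> i, \<nu> (Suc i)}"
abbreviation A0 :: "nat \<Rightarrow> field_xy set" where "A0 i \<equiv> toric_ring (cone_gen (gen i))"
abbreviation \<eta> :: field_xyt where "\<eta> \<equiv> var_y / (var_y - var_t)"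

lemma lift_monomials: "monomials const_xyt (lift i)"
  unfolding lift_def by (rule Ztilde_monomials)

lemma A0_eq: "A0 i = torus.mring (dual_lattice (gen i))"
  by (rule toric_ring_cone_gen) simp

lemma At_eq: "At i = calg const_xyt ({var_t, lift i (w1 i), lift i (w2 i)} \<union> (if i \<le> m + 1 then {} else {\<eta>}))"
  by (simp add: Atilde_def lift_def ca_def cl_def insert_commute)

lemma At_subring: "field_subring (At i)" unfolding At_eq by (rule field_subring_calg)

lemma const_At: "const_xyt c \<in> At i" and t_At: "var_t \<in> At i"
  and gens_At: "lift i (w1 i) \<in> At i" "lift i (w2 i) \<in> At i" and eta_At: "\<not> i \<le> m + 1 \<Longrightarrow> \<eta> \<in> At i"
  unfolding At_eq by (auto intro: calg_const calg_incl)

lemma red_lift: "lift i u \<in> regular" "red (lift i u) = character u"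
  by (simp_all add: lift_def red_Ztilde)

lemma red_eta: "\<eta> \<in> regular" "red \<eta> = 1"
proof -
  have nz: "red (var_y - var_t) \<noteq> 0" using vars_nonzero by (simp add: red_y_minus_t)
  note inv = red_inverse[OF red_y_minus_t(1) nz]
  show "\<eta> \<in> regular" using regular_ops(5)[OF red_vars(5) inv(1)] by (simp only: divide_inverse)
  have "red \<eta> = red var_y * inverse (red (var_y - var_t))"
    using regular_ops(6)[OF red_vars(5) inv(1)] inv(2) by (simp only: divide_inverse)
  also have "red (var_y - var_t) = red var_y" by (simp only: red_vars red_y_minus_t)
  also have "red var_y * inverse (red var_y) = 1" using nz
    by (intro right_inverse) (simp add: red_vars red_y_minus_t)
  finally show "red \<eta> = 1" .
qed

lemma At_regular: "At i \<subseteq> regular"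
  unfolding At_eq by (rule calg_minimal[OF field_subring_regular]) (use red_vars red_lift red_eta in auto)

lemma gen_ip: "i < l \<Longrightarrow> ip (\<nu> i) (w1 i) = 1" "i < l \<Longrightarrow> ip (\<nu> (Suc i)) (w1 i) = 0"
  "i < l \<Longrightarrow> ip (\<nu> i) (w2 i) = 0" "i < l \<Longrightarrow> ip (\<nu> (Suc i)) (w2 i) = 1"
  using dual_generators_ip[OF _ gens] by blast+

lemma w_dual: "i < l \<Longrightarrow> w1 i \<in> dual_lattice (gen i)" "i < l \<Longrightarrow> w2 i \<in> dual_lattice (gen i)"
  by (auto simp: dual_lattice_def gen_ip)

text \<open>In the basis dual to the rays the exponent has nonnegative integer coordinates, so its
  lift is a product of powers of the two generators.\<close>

lemma lift_At:
  assumes i: "i < l" and u: "u \<in> dual_lattice (gen i)"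
  shows "lift i u \<in> At i"
proof -
  interpret unimodular "\<nu> i" "\<nu> (Suc i)" by (rule sigma_unimod[OF i])
  interpret L: monomials const_xyt "lift i" by (rule lift_monomials)
  define n n' where "n = nat (ip (\<nu> i) u)" "n' = nat (ip (\<nu> (Suc i)) u)"
  have nn: "int n = ip (\<nu> i) u" "int n' = ip (\<nu> (Suc i)) u" using u by (auto simp: n_n'_def dual_lattice_def)
  have "u - (nmult n (w1 i) + nmult n' (w2 i)) = 0"
    using expand[of "u - (nmult n (w1 i) + nmult n' (w2 i))"] nn gen_ip[OF i] by (simp add: zero_prod_def)
  then have "u = nmult n (w1 i) + nmult n' (w2 i)" by simp
  then have "lift i u = lift i (w1 i) ^ n * lift i (w2 i) ^ n'" by (simp add: L.ch_add L.ch_nmult)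
  then show ?thesis using fs_intros[OF At_subring] gens_At by simp
qed

text \<open>Rays with \<open>R > 0\<close> have index at most \<open>m + 1\<close>. A chart beyond
  has both rays in \<open>R <= 0\<close>, so the inverse of \<open>y\<close> is regular on its toric
  chart.\<close>

lemma negative_chart:
  assumes i: "i < l" and c: "\<not> i \<le> m + 1"
  shows "(0, -1) \<in> dual_lattice (gen i)"
proof -
  have "snd (\<nu> k) \<le> 0" if "k \<in> {1..l}" "k > m + 1" for k
    using positive_ray(1)[OF seg that(1)] that(2) by linarith
  then have "snd (\<nu> i) \<le> 0" "snd (\<nu> (Suc i)) \<le> 0" using i c by auto
  then show ?thesis by (simp add: dual_lattice_def ip_def)
qed

lemma inverse_y_At:
  assumes i: "i < l" and c: "\<not> i \<le> m + 1"
  shows "inverse (var_y - var_t) \<in> At i"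
proof -
  have "lift i (0, -1) = inverse var_y" using c
    by (simp add: lift_def ca_def cl_def Ztilde_def power_int_minus)
  then have "inverse var_y * \<eta> \<in> At i"
    using fs_mult[OF At_subring] lift_At[OF i negative_chart[OF assms]] eta_At[OF c] by metis
  then show ?thesis using vars_nonzero by (simp add: field_simps)
qed

text \<open>Modulo \<open>t\<close> the chart ring consists of combinations of lifted monomials:
  these, together with multiples of \<open>t\<close>, form a subring. It contains \<eta> as well,
  because \<open>\<eta> = 1 + t / (y - t)\<close>.\<close>

lemma At_decompose:
  assumes i: "i < l" and z: "z \<in> At i"
  shows "\<exists>g z'. g \<in> monomials.mring const_xyt (lift i) (dual_lattice (gen i)) \<and> z' \<in> At i \<and> z =
      g + var_t * z'"
proof -
  interpret L: monomials const_xyt "lift i" by (rule lift_monomials)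
  let ?M = "L.mring (dual_lattice (gen i))"
  let ?E = "{g + var_t * z' | g z'. g \<in> ?M \<and> z' \<in> At i}"
  have FM: "field_subring ?M" by (rule L.field_subring_dual)
  have MA: "?M \<subseteq> At i" by (rule L.mring_minimal[OF At_subring]) (use const_At lift_At[OF i] in auto)
  have ME: "?M \<subseteq> ?E"
  proof
    fix g assume "g \<in> ?M"
    then show "g \<in> ?E" using fs_zero[OF At_subring[of i]] by (intro CollectI exI[of _ g] exI[of _ 0]) auto
  qed
  have "At i \<subseteq> ?E"
  proof (rule ord_eq_le_trans[OF At_eq], rule calg_minimal)
    show "field_subring ?E"
    proof (rule field_subringI)
      show "1 \<in> ?E" using ME fs_one[OF FM] by blast
      fix x y assume "x \<in> ?E" "y \<in> ?E"
      then obtain g z h w where x: "g \<in> ?M" "z \<in> At i" "x = g + var_t * z" and y: "h \<in> ?M" "w \<in> At i"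
          "y = h + var_t * w"
        by blast
      have gA: "g \<in> At i" "h \<in> At i" using x y MA by auto
      have "x - y = (g - h) + var_t * (z - w)" using x y by (simp add: algebra_simps)
      then show "x - y \<in> ?E" using fs_diff[OF FM x(1) y(1)] fs_diff[OF At_subring x(2) y(2)] by blast
      have "x * y = g * h + var_t * (g * w + z * h + var_t * z * w)" using x y by (simp add: algebra_simps)
      moreover have "g * w + z * h + var_t * z * w \<in> At i"
        using x y gA t_At by (intro fs_add[OF At_subring] fs_mult[OF At_subring])
      ultimately show "x * y \<in> ?E" using fs_mult[OF FM x(1) y(1)] by blast
    qed
    show "range const_xyt \<subseteq> ?E" using ME L.mring_const[OF dual_lattice_zero] by blast
    have "var_t = 0 + var_t * 1" by simp
    then have "var_t \<in> ?E" using fs_zero[OF FM] fs_one[OF At_subring] by blast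
    moreover have "lift i (w1 i) \<in> ?E" "lift i (w2 i) \<in> ?E" using ME L.mring_ch w_dual[OF i] by blast+
    moreover have "\<eta> \<in> ?E" if "\<not> i \<le> m + 1"
    proof -
      have "\<eta> = 1 + var_t * inverse (var_y - var_t)" using vars_nonzero by (simp add: field_simps)
      then show ?thesis using fs_one[OF FM] inverse_y_At[OF i that] by blast
    qed
    ultimately show "{var_t, lift i (w1 i), lift i (w2 i)} \<union> (if i \<le> m + 1 then {} else {\<eta>}) \<subseteq> ?E" by auto
  qed
  then show ?thesis using z by blast
qed

lemma red_mring:
  assumes "finite F"
  shows "red (\<Sum>u\<in>F. const_xyt (c u) * lift i u) = (\<Sum>u\<in>F. const_xy (c u) * character u)"
proof -
  have "const_xyt (c u) * lift i u \<in> regular \<and> red (const_xyt (c u) * lift i u) =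
      const_xy (c u) * character u" for u
    using regular_ops(5,6)[OF red_vars(1) red_lift(1)] by (simp add: red_vars red_lift)
  then show ?thesis using red_sum[of F "\<lambda>u. const_xyt (c u) * lift i u"] by simp
qed

text \<open>This is why the special fibre of a chart of the family is its toric chart.\<close>

lemma At_red_zero:
  assumes i: "i < l" and z: "z \<in> At i" "red z = 0"
  shows "\<exists>z'\<in>At i. z = var_t * z'"
proof -
  interpret L: monomials const_xyt "lift i" by (rule lift_monomials)
  obtain g z' where gz: "g \<in> L.mring (dual_lattice (gen i))" "z' \<in> At i" "z = g + var_t * z'"
    using At_decompose[OF i z(1)] by blast
  obtain F c where F: "finite F" "g = (\<Sum>u\<in>F. const_xyt (c u) * lift i u)" using gz(1)
    by (auto simp: L.mring_def)
  have "g \<in> regular"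
  proof -
    have "L.mring (dual_lattice (gen i)) \<subseteq> At i"
      by (rule L.mring_minimal[OF At_subring]) (use const_At lift_At[OF i] in auto)
    then have "g \<in> At i" using gz(1) by blast
    then show ?thesis using At_regular by blast
  qed
  moreover have "z' \<in> regular" using gz(2) At_regular by blast
  ultimately have "red z = red g" using gz(3) by (simp add: regular_ops red_vars)
  \<comment> \<open>The lifted monomials of \<open>g\<close> reduce to characters, whose
    independence forces all coefficients to vanish.\<close>
  then have "(\<Sum>u\<in>F. const_xy (c u) * character u) = 0" using z(2) F red_mring by simp
  then have "c u = 0" if "u \<in> F" for u using torus.indep[OF F(1)] that by blast
  then have "g = 0" using F by (simp add: const_xyt_zero)
  then show ?thesis using gz by auto
qed

lemma red_At: assumes i: "i < l" shows "red ` At i = A0 i"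
proof
  have A0_subring: "field_subring (A0 i)" unfolding A0_eq by (rule torus.field_subring_dual)
  have "field_subring {z \<in> regular. red z \<in> A0 i}"
    by (rule field_subringI) (use fs_intros[OF A0_subring] in \<open>auto simp: red_one regular_ops\<close>)
  then have "At i \<subseteq> {z \<in> regular. red z \<in> A0 i}" unfolding At_eq
  proof (rule calg_minimal)
    have "const_xy c \<in> A0 i" for c unfolding A0_eq by (rule torus.mring_const[OF dual_lattice_zero])
    then show "range const_xyt \<subseteq> {z \<in> regular. red z \<in> A0 i}" using red_vars by auto
    have "character (w1 i) \<in> A0 i" "character (w2 i) \<in> A0 i" unfolding A0_eq
      using torus.mring_ch w_dual[OF i] by blast+
    then show "{var_t, lift i (w1 i),
        lift i (w2 i)} \<union> (if i \<le> m + 1 then {} else {\<eta>}) \<subseteq> {z \<in> regular. red z \<in> A0 i}"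
      using red_vars(7,8) red_lift red_eta fs_zero[OF A0_subring] fs_one[OF A0_subring] by auto
  qed
  then show "red ` At i \<subseteq> A0 i" by blast
  show "A0 i \<subseteq> red ` At i"
  proof
    fix w assume "w \<in> A0 i"
    then obtain F c where F: "finite F" "F \<subseteq> dual_lattice (gen i)" "w = (\<Sum>u\<in>F. const_xy (c u) * character u)"
      by (auto simp: A0_eq torus.mring_def)
    let ?z = "\<Sum>u\<in>F. const_xyt (c u) * lift i u"
    have "?z \<in> At i" using F(2) lift_At[OF i] const_At fs_mult[OF At_subring]
      by (intro fs_sum[OF At_subring]) blast
    moreover have "red ?z = w" using red_mring[OF F(1)] F(3) by simp
    ultimately show "w \<in> red ` At i" by blast
  qed
qed

end

section \<open>Local rings along the special fibre\<close>

text \<open>What the comparison uses of a local ring over the origin: \<open>red\<close> is defined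
  on it, and its kernel there is generated by the nonunit \<open>t\<close>.\<close>

definition special_local :: "field_xyt set \<Rightarrow> bool" where
  "special_local L \<longleftrightarrow> local_subring L \<and> L \<subseteq> regular \<and> var_t \<in> nonunits L \<and>
    (\<forall>z\<in>L. red z = 0 \<longrightarrow> (\<exists>z'\<in>L. z = var_t * z'))"

text \<open>If \<open>w\<close> lifts the inverse of \<open>red z\<close>, then \<open>z * w\<close>
  is 1 plus a multiple of \<open>t\<close>, hence a unit of the local ring.\<close>

lemma special_unit:
  assumes L: "special_local L" and z: "z \<in> L" "red z \<noteq> 0" "inverse (red z) \<in> red ` L"
  shows "inverse z \<in> L"
proof -
  have FL: "field_subring L" and loc: "local_subring L" and reg: "L \<subseteq> regular" and t: "var_t \<in> nonunits L"
    using L by (auto simp: special_local_def local_subring_def)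
  obtain w where w: "w \<in> L" "red w = inverse (red z)" using z(3) by auto
  have zw: "z * w \<in> L" by (rule fs_mult[OF FL z(1) w(1)])
  have regs: "z \<in> regular" "w \<in> regular" using z w reg by auto
  have "red (z * w - 1) = 0"
    using regular_ops(5,6)[OF regs] regular_ops(2)[OF _ red_one(1), of "z * w"] w(2) z(2)
      by (simp add: red_one)
  then obtain z' where z': "z' \<in> L" "z * w - 1 = var_t * z'"
    using L fs_diff[OF FL zw fs_one[OF FL]] unfolding special_local_def by blast
  have n: "- var_t * z' \<in> nonunits L"
    using nonunits_mult[OF FL fs_minus[OF FL z'(1)] t] by (simp add: mult.commute)
  have "z * w \<notin> nonunits L"
  proof
    assume "z * w \<in> nonunits L"
    then have "z * w + - var_t * z' \<in> nonunits L" using n loc unfolding local_subring_def by blast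
    moreover have "z * w + - var_t * z' = 1" using z'(2) by (simp add: algebra_simps)
    ultimately show False using fs_one[OF FL] by (simp add: nonunits_def)
  qed
  then have "z * w \<noteq> 0" "inverse (z * w) \<in> L" using zw by (auto simp: nonunits_def)
  then have "w * inverse (z * w) \<in> L" using fs_mult[OF FL w(1)] by blast
  moreover have "w * inverse (z * w) = inverse z" using \<open>z * w \<noteq> 0\<close> by (auto simp: field_simps)
  ultimately show ?thesis by (simp only:)
qed

section \<open>Points of the charts over the origin\<close>

context deformation
begin

lemma A0_subring: "field_subring (A0 i)" unfolding A0_eq by (rule torus.field_subring_dual)

context
  fixes i p
  assumes i: "i < l" and p: "p \<in> primes (ring_on (At i))" and tp: "var_t \<in> p"
begin

text \<open>As \<open>t\<close> lies in \<open>p\<close>, so does the kernel of \<open>red\<close>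
  on the chart ring.\<close>

lemma red_mem_iff: "z \<in> At i \<Longrightarrow> red z \<in> red ` p \<longleftrightarrow> z \<in> p"
proof
  assume z: "z \<in> At i" "red z \<in> red ` p"
  then obtain z' where z': "z' \<in> p" "red z = red z'" by auto
  have z'A: "z' \<in> At i" using z' pr_sub[OF At_subring p] by blast
  have "red (z - z') = 0" using z'(2) regular_ops(2)[of z z'] z(1) z'A At_regular[of i]
    by (simp add: subset_iff)
  then obtain w where w: "w \<in> At i" "z - z' = var_t * w"
    using At_red_zero[OF i fs_diff[OF At_subring z(1) z'A]] by blast
  have "w * var_t \<in> p" by (rule pr_mult[OF At_subring p w(1) tp])
  then have "z - z' \<in> p" using w by (simp add: mult.commute)
  then have "(z - z') + z' \<in> p" using pr_add[OF At_subring p] z' by blast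
  then show "z \<in> p" by simp
qed auto

lemma red_prime: "red ` p \<in> primes (ring_on (A0 i))"
  unfolding primes_ring_on_iff[OF A0_subring]
proof (intro conjI ballI impI)
  have reg: "z \<in> regular" if "z \<in> At i" for z using that At_regular by blast
  have sub: "p \<subseteq> At i" by (rule pr_sub[OF At_subring p])
  show "red ` p \<subseteq> A0 i" using sub red_At[OF i] by blast
  show "0 \<in> red ` p" using pr_zero[OF At_subring p] red_zero by force
  show "1 \<notin> red ` p" using red_mem_iff[OF fs_one[OF At_subring]] pr_one[OF At_subring p]
    by (simp add: red_one)
  show "a + b \<in> red ` p" if ab: "a \<in> red ` p" "b \<in> red ` p" for a b
  proof -
    obtain z w where zw: "z \<in> p" "w \<in> p" "a = red z" "b = red w" using ab by blast
    have "a + b = red (z + w)" using regular_ops(4)[OF reg reg, of z w] zw subsetD[OF sub] by simp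
    then show ?thesis using pr_add[OF At_subring p zw(1,2)] by (rule image_eqI)
  qed
  fix a b assume a: "a \<in> A0 i"
  obtain z where z: "z \<in> At i" "a = red z" using a red_At[OF i] by blast
  show "a * b \<in> red ` p" if b: "b \<in> red ` p"
  proof -
    obtain w where w: "w \<in> p" "b = red w" using b by blast
    have "a * b = red (z * w)" using regular_ops(6)[OF reg reg, of z w] z w subsetD[OF sub] by simp
    then show ?thesis using pr_mult[OF At_subring p z(1) w(1)] by (rule image_eqI)
  qed
  assume b: "b \<in> A0 i" and ab: "a * b \<in> red ` p"
  obtain w where w: "w \<in> At i" "b = red w" using b red_At[OF i] by blast
  have "red (z * w) \<in> red ` p" using ab z w regular_ops(6)[OF reg reg] by simp
  then have "z * w \<in> p" using red_mem_iff[OF fs_mult[OF At_subring z(1) w(1)]] by simp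
  then show "a \<in> red ` p \<or> b \<in> red ` p" using pr_mult_iff[OF At_subring p z(1) w(1)] z w by blast
qed

lemma red_local: "red ` local_ring_in (At i) p = local_ring_in (A0 i) (red ` p)"
  and special_local: "special_local (local_ring_in (At i) p)"
proof -
  let ?L = "local_ring_in (At i) p"
  have reg: "z \<in> regular" if "z \<in> At i" for z using that At_regular by blast
  have unit: "red s \<noteq> 0 \<and> inverse s \<in> regular \<and> red (inverse s) = inverse (red s) \<and> s \<noteq> 0"
    if s: "s \<in> At i - p" for s
  proof -
    have "red s \<noteq> 0" using red_mem_iff[of s] s pr_zero[OF A0_subring red_prime] by auto
    then show ?thesis using red_inverse[OF reg] s red_zero by auto
  qed
  have Lreg: "?L \<subseteq> regular"
  proof
    fix z assume "z \<in> ?L"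
    then obtain s where s: "s \<in> At i - p" "s * z \<in> At i" using local_ring_in_iff[OF At_subring p] by blast
    then have "(s * z) * inverse s \<in> regular" using regular_ops(5)[OF reg] unit by blast
    moreover have "(s * z) * inverse s = z" using unit[OF s(1)] by simp
    ultimately show "z \<in> regular" by simp
  qed
  show "red ` ?L = local_ring_in (A0 i) (red ` p)"
  proof (intro equalityI subsetI)
    fix w assume "w \<in> red ` ?L"
    then obtain z where z: "z \<in> ?L" "w = red z" by blast
    then obtain s where s: "s \<in> At i - p" "s * z \<in> At i" using local_ring_in_iff[OF At_subring p] by blast
    have "red s * w = red (s * z)" using z Lreg s reg by (simp add: regular_ops subset_iff)
    then have "red s * w \<in> A0 i" "red s \<in> A0 i - red ` p"
      using s red_At[OF i] red_mem_iff[of s] by auto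
    then show "w \<in> local_ring_in (A0 i) (red ` p)" using local_ring_in_iff[OF A0_subring red_prime] by blast
  next
    fix w assume "w \<in> local_ring_in (A0 i) (red ` p)"
    then obtain s0 where s0: "s0 \<in> A0 i - red ` p" "s0 * w \<in> A0 i"
      using local_ring_in_iff[OF A0_subring red_prime] by blast
    then obtain s b where s: "s \<in> At i" "s0 = red s" and b: "b \<in> At i" "s0 * w = red b"
      using red_At[OF i] by blast
    have sp: "s \<in> At i - p" using s s0 by auto
    have "b / s \<in> ?L" using local_ring_in_div[OF At_subring p b(1)] sp by blast
    moreover have "red (b / s) = w"
    proof -
      have "red (b / s) = red b * inverse (red s)"
        using unit[OF sp] regular_ops(6)[OF reg[OF b(1)]] by (simp add: divide_inverse)
      also have "\<dots> = w" using b(2) s(2) unit[OF sp] by (simp flip: b(2))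
      finally show ?thesis .
    qed
    ultimately show "w \<in> red ` ?L" by blast
  qed
  have "\<exists>z'\<in>?L. z = var_t * z'" if z: "z \<in> ?L" "red z = 0" for z
  proof -
    obtain s where s: "s \<in> At i - p" "s * z \<in> At i" using local_ring_in_iff[OF At_subring p] z by blast
    have "red (s * z) = 0" using z Lreg s reg by (simp add: regular_ops subset_iff)
    then obtain b where b: "b \<in> At i" "s * z = var_t * b" using At_red_zero[OF i s(2)] by blast
    have "z = var_t * (b / s)" using b(2) unit[OF s(1)] by (simp add: field_simps)
    then show ?thesis using local_ring_in_div[OF At_subring p b(1)] s by blast
  qed
  moreover have "var_t \<in> nonunits ?L" using nonunits_local_Int[OF At_subring p] tp by blast
  ultimately show "special_local ?L"
    using local_subring_local[OF At_subring p] Lreg by (simp add: special_local_def)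
qed

lemma lift_local:
  assumes u: "character u \<in> local_ring_in (A0 i) (red ` p)"
  shows "lift i u \<in> local_ring_in (At i) p"
proof -
  interpret unimodular "\<nu> i" "\<nu> (Suc i)" by (rule sigma_unimod[OF i])
  interpret L: monomials const_xyt "lift i" by (rule lift_monomials)
  let ?s = "sdual (\<nu> i) (\<nu> (Suc i))" and ?q = "red ` p"
  note D = dual_family_sdual[OF order.refl]
  have q: "?q \<in> primes (ring_on (torus.mring (dual_lattice (gen i))))" using red_prime A0_eq by simp
  let ?G = "{v \<in> gen i. character (?s v) \<in> ?q}"
  note mon = torus.monomial_in_local_ring_iff[OF D q]
  define f where "f = torus.face_sum (gen i) ?G ?s"
  have Gs: "?G \<subseteq> gen i" by blast
  have f: "f \<in> dual_lattice (gen i)" "- f \<in> dual_lattice ?G"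
    unfolding f_def by (rule torus.face_sum_dual[OF D Gs])+
  have ipf: "ip v f = (if v \<in> ?G then 0 else 1)" if "v \<in> gen i" for v
    unfolding f_def by (rule torus.ip_face_sum[OF D Gs that])
  have uG: "u \<in> dual_lattice ?G" using u mon A0_eq by simp
  define n where "n = nat \<bar>ip (\<nu> i) u\<bar> + nat \<bar>ip (\<nu> (Suc i)) u\<bar>"
  have "nmult n f + u \<in> dual_lattice (gen i)" unfolding dual_lattice_def
  proof (intro CollectI ballI)
    fix v assume v: "v \<in> gen i"
    have "\<bar>ip v u\<bar> \<le> int n" using v by (auto simp: n_def)
    moreover have "v \<in> ?G \<Longrightarrow> ip v u \<ge> 0" using uG unfolding dual_lattice_def by blast
    ultimately show "0 \<le> ip v (nmult n f + u)" using ipf[OF v] by (cases "v \<in> ?G") auto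
  qed
  then have 1: "lift i f ^ n * lift i u \<in> At i" using lift_At[OF i] by (metis L.ch_add L.ch_nmult)
  have "inverse (character f) \<in> local_ring_in (A0 i) ?q" using f(2) mon A0_eq by (simp flip: torus.ch_minus)
  moreover have "character f \<in> A0 i" using f(1) torus.mring_ch A0_eq by simp
  ultimately have "character f \<notin> ?q"
    using inverse_in_local_ring_iff[OF A0_subring red_prime] torus.ch_nonzero by blast
  then have "lift i f \<notin> p" using red_lift(2)[of i f] by (metis image_eqI)
  then have "lift i f ^ n \<in> At i - p"
    using lift_At[OF i f(1)] fs_power[OF At_subring] pr_power_iff[OF At_subring p] by blast
  then show ?thesis using 1 local_ring_in_iff[OF At_subring p] by blast
qed

text \<open>Depending on the sign of the chart, either \<open>inverse \<eta> = 1 - t / y\<close> or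
  \<open>\<eta> = 1 + t / (y - t)\<close>, and the fraction is the lift of the inverse of
  \<open>y\<close>. Both have reduction 1, so they are units.\<close>

lemma eta_local:
  assumes u: "character (0, -1) \<in> local_ring_in (A0 i) (red ` p)"
  shows "\<eta> \<in> local_ring_in (At i) p" "inverse \<eta> \<in> local_ring_in (At i) p"
proof -
  let ?L = "local_ring_in (At i) p"
  have FL: "field_subring ?L" by (rule field_subring_local[OF At_subring p])
  have h: "lift i (0, -1) \<in> ?L" by (rule lift_local[OF u])
  have t: "var_t \<in> ?L" using t_At local_ring_in_incl[OF At_subring p] by blast
  have one: "1 \<in> red ` ?L" using fs_one[OF FL] red_one(2) by force
  have nz: "red \<eta> \<noteq> 0" by (simp add: red_eta)
  have ri: "red (inverse \<eta>) = 1" using red_inverse(2)[OF red_eta(1) nz] by (simp only: red_eta inverse_1)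
  have "\<eta> \<in> ?L \<and> inverse \<eta> \<in> ?L"
  proof (cases "ca i = 1")
    case True
    then have "lift i (0, -1) = inverse var_y" by (simp add: lift_def Ztilde_def power_int_minus)
    then have "inverse \<eta> = 1 - var_t * lift i (0, -1)" using vars_nonzero by (simp add: field_simps)
    then have e: "inverse \<eta> \<in> ?L" using fs_diff[OF FL fs_one[OF FL] fs_mult[OF FL t h]] by simp
    have "inverse (inverse \<eta>) \<in> ?L"
      by (rule special_unit[OF special_local e]) (simp_all only: ri inverse_1 one one_neq_zero not_False_eq_True)
    then show ?thesis using e by (simp only: inverse_inverse_eq)
  next
    case False
    then have "lift i (0, -1) = inverse (var_y - var_t)" by (simp add: lift_def Ztilde_def power_int_minus)
    then have "\<eta> = 1 + var_t * lift i (0, -1)" using vars_nonzero by (simp add: field_simps)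
    then have e: "\<eta> \<in> ?L" using fs_add[OF FL fs_one[OF FL] fs_mult[OF FL t h]] by simp
    have "inverse \<eta> \<in> ?L"
      by (rule special_unit[OF special_local e]) (simp_all only: red_eta inverse_1 one one_neq_zero not_False_eq_True)
    then show ?thesis using e by simp
  qed
  then show "\<eta> \<in> ?L" "inverse \<eta> \<in> ?L" by auto
qed

end

text \<open>The only repetition among the indices is that of 0 and \<open>l\<close>, which
  \<open>k < l\<close> excludes.\<close>

lemma nu_index_cases:
  assumes i: "i < l" and k: "k \<in> {1..l}" "k < l" and eq: "\<nu> k = \<nu> i \<or> \<nu> k = \<nu> (Suc i)"
  shows "i = k \<or> Suc i = k"
  using eq
proof
  assume e: "\<nu> k = \<nu> i"
  show ?thesis
  proof (cases "i = 0")
    case True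
    then have "\<nu> k = \<nu> l" using e nu_cyc by simp
    then show ?thesis using nu_inj[OF k(1), of l] k by auto
  next
    case False
    then show ?thesis using nu_inj[OF k(1), of i] e i by auto
  qed
next
  assume "\<nu> k = \<nu> (Suc i)"
  then show ?thesis using nu_inj[OF k(1), of "Suc i"] i by auto
qed

text \<open>Across a ray with \<open>R > 0\<close> where the sign \<^term>\<open>a\<close> changes, the twist of a monomial is the
  order of vanishing along that ray; this is where the relation between the \<open>\<lambda>\<^sub>i\<close> enters.\<close>

lemma lift_other_chart:
  assumes i: "i < l" and p: "p \<in> primes (ring_on (At i))" and tp: "var_t \<in> p"
    and j: "j < l" and q: "q \<in> primes (ring_on (At j))" and tq: "var_t \<in> q"
    and eq: "local_ring_in (A0 i) (red ` p) = local_ring_in (A0 j) (red ` q)"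
    and u: "character u \<in> local_ring_in (A0 i) (red ` p)"
  shows "lift j u \<in> local_ring_in (At i) p"
proof -
  let ?L = "local_ring_in (At i) p" and ?R = "local_ring_in (A0 i) (red ` p)"
  have FL: "field_subring ?L" by (rule field_subring_local[OF At_subring p])
  have lu: "lift i u \<in> ?L" by (rule lift_local[OF i p tp u])
  have change: "lift j u = lift i u * \<eta> powi (twist (ca j) (cl j) u - twist (ca i) (cl i) u)"
    unfolding lift_def by (rule Ztilde_change)
  show ?thesis
  \<comment> \<open>The inverse of \<open>y\<close> is regular at the point exactly if no ray of its
    face has \<open>R > 0\<close>; then \<eta> is a unit and the change of lift is harmless.\<close>
  proof (cases "character (0, -1) \<in> ?R")
    case True
    then show ?thesis unfolding change
      using fs_mult[OF FL lu fs_powi[OF FL]] eta_local[OF i p tp] by blast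
  next
    case False
    obtain G where G: "G \<subseteq> gen i" "\<And>u. character u \<in> ?R \<longleftrightarrow> u \<in> dual_lattice G"
      using toric_local_ring_face[OF sigma_unimod[OF i] order.refl red_prime[OF i p tp]]
        by (elim exE conjE) (rule that, assumption, erule spec)
    obtain G' where G': "G' \<subseteq> gen j" "\<And>u. character u \<in> ?R \<longleftrightarrow> u \<in> dual_lattice G'"
      using toric_local_ring_face[OF sigma_unimod[OF j] order.refl red_prime[OF j q tq]]
        unfolding eq[symmetric]
      by (elim exE conjE) (rule that, assumption, erule spec)
    have "dual_lattice G = dual_lattice G'" using G(2) G'(2) by blast
    then have sub: "cone_gen G \<subseteq> cone_gen (gen j)"
      using equal_local_rings_face(2)[OF sigma_unimod[OF i] order.refl sigma_unimod[OF j] order.refl G(1) G'(1)] by blast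
    have finG: "finite G" using G(1) finite_subset by (meson finite.emptyI finite.insertI)
    have idx: "\<exists>k\<in>{1..l}. v = \<nu> k" if "v \<in> G" for v
      
    proof -
      have "v = \<nu> i \<or> v = \<nu> (Suc i)" using that G(1) by blast
      moreover have "Suc i \<in> {1..l}" using i by simp
      ultimately show ?thesis using nu_index[OF i] by metis
    qed
    have in_j: "v \<in> gen j" if "v \<in> G" for v
    proof -
      obtain k where k: "k \<in> {1..l}" "v = \<nu> k" using idx[OF \<open>v \<in> G\<close>] by blast
      then show ?thesis using nu_in_sigma[OF j k(1)] sub qvec_in_cone[OF finG \<open>v \<in> G\<close>] by auto
    qed
    have "(0, -1) \<notin> dual_lattice G" using False G(2) by blast
    then obtain v where v: "v \<in> G" "snd v > 0" by (auto simp: dual_lattice_def ip_def)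
    obtain k where k: "k \<in> {1..l}" "v = \<nu> k" using idx[OF v(1)] by blast
    have kpos: "snd (\<nu> k) > 0" using v k by simp
    note pos = positive_ray[OF seg k(1) kpos]
    have ik: "i = k \<or> Suc i = k" using subsetD[OF G(1) v(1)] unfolding k(2)
      by (intro nu_index_cases[OF i k(1) pos(2)]) blast
    have jk: "j = k \<or> Suc j = k" using in_j[OF v(1)] unfolding k(2)
      by (intro nu_index_cases[OF j k(1) pos(2)]) blast
    show ?thesis
    proof (cases "i = j")
      case True then show ?thesis using lu by simp
    next
      case ij: False
      obtain c where c: "Suc c = k" "{i, j} = {c, k}" using ik jk ij by (cases k) auto
      have cm: "c \<le> m" "c < l" using c pos by auto
      \<comment> \<open>A second generator shared by the two adjacent cones would have to lie on
        both sides of \<open>\<nu> k\<close>.\<close>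
      have "w = \<nu> k" if w: "w \<in> G" for w
      proof (rule ccontr)
        assume ne: "w \<noteq> \<nu> k"
        have "w \<in> gen c" "w \<in> gen k" using w G(1) in_j[OF w] c(2) by (auto simp: doubleton_eq_iff)
        then have "w = \<nu> c" "w = \<nu> (Suc k)" using ne c(1) by auto
        then show False using sigma_det[OF cm(2)] sigma_det[OF pos(2)] det2_swap[of w "\<nu> k"] c(1) by simp
      qed
      then have Gk: "G = {\<nu> k}" using v k by blast
      have ca: "ca c = a c" "ca k = a k" "cl c = lam c" "cl k = lam k" using cm pos c
        by (auto simp: ca_def cl_def)
      have "a e = 1 \<or> a e = -1" if "e \<le> Suc m" for e using adm that by (auto simp: admissible_tuple_def)
      from this[of c] this[of k] have sgn: "a c = 1 \<or> a c = -1" "a k = 1 \<or> a k = -1" using cm pos by simp_all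
      show ?thesis
      proof (cases "a k = a c")
        case True
        then have "lam k = lam c" using lam_seq cm c(1) unfolding lambda_sequence_def by metis
        then have "lift c = lift k" unfolding lift_def ca using True by simp
        then have "lift j = lift i" using c(2) by (auto simp: doubleton_eq_iff)
        then show ?thesis using lu by simp
      next
        case False
        then have "\<Delta> c \<inter> \<Delta> (Suc c) = {of_int (lam c + lam (Suc c))}"
          using lam_seq cm c(1) unfolding lambda_sequence_def by metis
        then have "\<Delta> (k - 1) \<inter> \<Delta> k = {of_int (lam c + lam k)}" by (simp only: flip: c(1)) simp
        then have "\<nu> k = (lam c + lam k, 1)" by (rule positive_ray_lattice_point[OF seg k(1) kpos])
        then have nuk: "\<nu> k = (cl i + cl j, 1)" using c(2) ca by (auto simp: doubleton_eq_iff)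
        have signs: "(ca i = 1 \<and> ca j = -1) \<or> (ca i = -1 \<and> ca j = 1)"
          using False sgn ca c(2) by (auto simp: doubleton_eq_iff)
        interpret L: monomials const_xyt "lift i" by (rule lift_monomials)
        \<comment> \<open>The order of vanishing of the monomial along the divisor of
          \<open>\<nu> k\<close>.\<close>
        define n where "n = nat (ip (\<nu> k) u)"
        have n: "int n = (cl i + cl j) * fst u + snd u"
          using u G(2) Gk by (simp add: n_def dual_lattice_def ip_def nuk)
        \<comment> \<open>As \<open>\<nu> k\<close> has height 1, the exponent \<open>(0, 1)\<close>
          has order 1. Splitting off \<open>n\<close> copies leaves an exponent of order 0, so both
          parts have lifts in the local ring.\<close>
        define u0 where "u0 = u - nmult n (0, 1)"
        have "ip (\<nu> k) u0 = 0" unfolding u0_def ip_simps ip_nmult using n by (simp add: ip_def nuk)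
        then have "u0 \<in> dual_lattice G" by (simp add: Gk dual_lattice_def)
        then have l0: "lift i u0 \<in> ?L" using lift_local[OF i p tp] G(2) by blast
        have "(0, 1) \<in> dual_lattice G" by (simp add: Gk dual_lattice_def ip_def nuk)
        then have l1: "lift i (0, 1) \<in> ?L" using lift_local[OF i p tp] G(2) by blast
        have t: "var_t \<in> ?L" using t_At local_ring_in_incl[OF At_subring p] by blast
        have "u = nmult n (0, 1) + u0" by (simp add: u0_def)
        then have split: "lift i u = lift i (0, 1) ^ n * lift i u0" by (metis L.ch_add L.ch_nmult)
        show ?thesis using signs
        proof (elim disjE conjE)
          \<comment> \<open>Changing the chart replaces the factor \<open>y ^ n\<close> by
            \<open>(y - t) ^ n\<close>, which stays in the local ring because \<open>t\<close> does.
            The other case exchanges the two.\<close>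
          assume s: "ca i = 1" "ca j = -1"
          then have "twist (ca j) (cl j) u - twist (ca i) (cl i) u = - int n"
            using n by (simp add: twist_def algebra_simps)
          moreover have y: "lift i (0, 1) = var_y" using s by (simp add: lift_def Ztilde_def)
          ultimately have "lift j u = lift i u0 * (var_y * inverse \<eta>) ^ n"
            using change split
              by (simp add: power_int_minus power_mult_distrib power_inverse power_divide mult_ac)
          also have "var_y * inverse \<eta> = var_y - var_t" using vars_nonzero by (simp add: field_simps)
          finally show ?thesis using fs_mult[OF FL l0 fs_power[OF FL fs_diff[OF FL l1 t]]] y by simp
        next
          assume s: "ca i = -1" "ca j = 1"
          then have "twist (ca j) (cl j) u - twist (ca i) (cl i) u = int n"
            using n by (simp add: twist_def algebra_simps)
          moreover have y: "lift i (0, 1) = var_y - var_t" using s by (simp add: lift_def Ztilde_def)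
          ultimately have "lift j u = lift i u0 * ((var_y - var_t) * \<eta>) ^ n"
            using change split by (simp only: power_int_of_nat power_mult_distrib mult_ac)
          also have "(var_y - var_t) * \<eta> = (var_y - var_t) + var_t" using vars_nonzero
            by (simp add: field_simps)
          finally show ?thesis using fs_mult[OF FL l0 fs_power[OF FL fs_add[OF FL l1 t]]] y by simp
        qed
      qed
    qed
  qed
qed

text \<open>The generators of chart \<open>j\<close> lift into the local ring by
  \<open>lift_other_chart\<close> and \<open>eta_local\<close>. Denominators become units by
  \<open>special_unit\<close>, since their reductions are units of the common local ring of
  \<open>Y\<close>.\<close>

lemma local_ring_subset:
  assumes i: "i < l" and p: "p \<in> primes (ring_on (At i))" and tp: "var_t \<in> p"
    and j: "j < l" and q: "q \<in> primes (ring_on (At j))" and tq: "var_t \<in> q"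
    and eq: "local_ring_in (A0 i) (red ` p) = local_ring_in (A0 j) (red ` q)"
  shows "local_ring_in (At j) q \<subseteq> local_ring_in (At i) p"
proof (rule local_ring_in_subset_eq[OF At_subring q At_subring p])
  let ?L = "local_ring_in (At i) p"
  have FL: "field_subring ?L" by (rule field_subring_local[OF At_subring p])
  have A0R: "A0 j \<subseteq> local_ring_in (A0 i) (red ` p)" unfolding eq
    by (rule local_ring_in_incl[OF A0_subring red_prime[OF j q tq]])
  have AL: "At i \<subseteq> ?L" by (rule local_ring_in_incl[OF At_subring p])
  have ch: "character u \<in> local_ring_in (A0 i) (red ` p)" if "u \<in> dual_lattice (gen j)" for u
    using A0R torus.mring_ch[OF that] A0_eq by blast
  note lift_j = lift_other_chart[OF i p tp j q tq eq]
  show "At j \<subseteq> ?L" unfolding At_eq[of j]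
  proof (rule calg_minimal[OF FL])
    show "range const_xyt \<subseteq> ?L" using AL const_At by blast
    show "{var_t, lift j (w1 j), lift j (w2 j)} \<union> (if j \<le> m + 1 then {} else {\<eta>}) \<subseteq> ?L"
      using AL t_At lift_j ch w_dual[OF j] eta_local(1)[OF i p tp] negative_chart[OF j] by auto
  qed
  fix z assume z: "z \<in> At j - q"
  then have rz: "red z \<in> A0 j - red ` q" using red_At[OF j] red_mem_iff[OF j q tq] by blast
  have "red z \<noteq> 0" using rz pr_zero[OF A0_subring red_prime[OF j q tq]] by auto
  moreover have "inverse (red z) \<in> red ` ?L" unfolding red_local[OF i p tp] eq
    using inverse_in_local_ring[OF A0_subring red_prime[OF j q tq]] rz by blast
  ultimately show "inverse z \<in> ?L" using special_unit[OF special_local[OF i p tp]] z \<open>At j \<subseteq> ?L\<close> by blast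
qed

sublocale fam: glued const_xyt "{0..<l}" At "\<lambda>i j. common_localizations (At i) (At j)"
proof
  show "const_xyt \<in> ring_hom (ring_on UNIV) (ring_on UNIV)" by (rule const_xyt_ring_hom)
  show "field_subring (At i)" for i by (rule At_subring)
  show "range const_xyt \<subseteq> At i" for i using const_At by blast
  show "\<exists>B\<in>common_localizations (At i) (At j). B \<subseteq> local_ring_in (At i) p"
    if "p \<in> primes (ring_on (At i))" "q \<in> primes (ring_on (At j))"
      "local_ring_in (At i) p = local_ring_in (At j) q" for i j p q
    by (rule calg_common_localization[OF At_eq At_eq _ _ that]) auto
qed simp

lemma family_eq: "family l m a lam w1 w2 = fam.X"
  by (simp add: family_def)

end

section \<open>Reduction as a quotient map\<close>

lemma reduction_coset:
  assumes S: "field_subring S" "S \<subseteq> regular" and z: "z \<in> S"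
  shows "{z \<in> S. red z = 0} +>\<^bsub>ring_on S\<^esub> z = {z' \<in> S. red z' = red z}"
proof (intro equalityI subsetI)
  fix z' assume "z' \<in> {z \<in> S. red z = 0} +>\<^bsub>ring_on S\<^esub> z"
  then obtain h where "h \<in> S" "red h = 0" "z' = h + z" by (auto simp: a_r_coset_def')
  then show "z' \<in> {z' \<in> S. red z' = red z}" using z S fs_add[OF S(1)] regular_ops(4)[of h z] by auto
next
  fix z' assume z': "z' \<in> {z' \<in> S. red z' = red z}"
  then have "z' - z \<in> {z \<in> S. red z = 0}" using z S fs_diff[OF S(1)] regular_ops(2)[of z' z] by auto
  moreover have "z' = (z' - z) + z" by simp
  ultimately show "z' \<in> {z \<in> S. red z = 0} +>\<^bsub>ring_on S\<^esub> z" unfolding a_r_coset_def' by force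
qed

text \<open>The coset of the kernel of \<open>red\<close> labelled by its common reduction: the
  inverse of the isomorphism from the quotient to the image.\<close>

definition residue_class :: "field_xyt set \<Rightarrow> field_xy \<Rightarrow> field_xyt set" where
  "residue_class S w = {z \<in> S. red z = w}"

lemma residue_class_iso:
  assumes S: "field_subring S" "S \<subseteq> regular"
  shows "residue_class S \<in> ring_iso (ring_on (red ` S)) (ring_on S Quot {z \<in> S. red z = 0})"
    "cring (ring_on S Quot {z \<in> S. red z = 0})"
proof -
  let ?I = "{z \<in> S. red z = 0}"
  have I: "ideal ?I (ring_on S)"
    using red_zero_prime[OF S] by (simp add: primes_def primeideal_def)
  show "cring (ring_on S Quot ?I)" by (rule ideal.quotient_is_cring[OF I cring_ring_on[OF S(1)]])
  have hom: "(+>\<^bsub>ring_on S\<^esub>) ?I \<in> ring_hom (ring_on S) (ring_on S Quot ?I)" by (rule ideal.rcos_ring_hom[OF I])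
  have co: "residue_class S (red z) = ?I +>\<^bsub>ring_on S\<^esub> z" if "z \<in> S" for z
    using reduction_coset[OF S that] by (simp add: residue_class_def)
  show "residue_class S \<in> ring_iso (ring_on (red ` S)) (ring_on S Quot ?I)"
  proof (rule ring_iso_memI)
    fix x y assume "x \<in> carrier (ring_on (red ` S))" "y \<in> carrier (ring_on (red ` S))"
    then obtain z w where z: "z \<in> S" "x = red z" and w: "w \<in> S" "y = red w" by auto
    show "residue_class S x \<in> carrier (ring_on S Quot ?I)"
      using ring_hom_memE(1)[OF hom, of z] z co by simp
    have "x * y = red (z * w)" "x + y = red (z + w)" using z w subsetD[OF S(2)] regular_ops(4,6)[of z w]
      by simp_all
    then show "residue_class S (x \<otimes>\<^bsub>ring_on (red ` S)\<^esub> y) =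
        residue_class S x \<otimes>\<^bsub>ring_on S Quot ?I\<^esub> residue_class S y"
      "residue_class S (x \<oplus>\<^bsub>ring_on (red ` S)\<^esub> y) = residue_class S x \<oplus>\<^bsub>ring_on S Quot ?I\<^esub> residue_class S y"
      using ring_hom_memE(2,3)[OF hom, of z w] z w co fs_mult[OF S(1)] fs_add[OF S(1)] by simp_all
  next
    show "residue_class S \<one>\<^bsub>ring_on (red ` S)\<^esub> = \<one>\<^bsub>ring_on S Quot ?I\<^esub>"
      using ring_hom_memE(4)[OF hom] co[OF fs_one[OF S(1)]] by (simp add: red_one)
    have "inj_on (residue_class S) (red ` S)"
    proof (rule inj_onI)
      fix x y assume x: "x \<in> red ` S" and eq: "residue_class S x = residue_class S y"
      obtain z where "z \<in> S" "x = red z" using x by blast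
      then have "z \<in> residue_class S y" using eq[symmetric] by (simp add: residue_class_def)
      then show "x = y" using \<open>x = red z\<close> by (simp add: residue_class_def)
    qed
    moreover have "residue_class S ` red ` S = carrier (ring_on S Quot ?I)"
    proof -
      have "carrier (ring_on S Quot ?I) = (\<lambda>z. ?I +>\<^bsub>ring_on S\<^esub> z) ` S"
        by (auto simp: FactRing_def A_RCOSETS_def')
      also have "\<dots> = (\<lambda>z. residue_class S (red z)) ` S" by (rule image_cong) (simp_all add: co)
      finally show ?thesis by (simp add: image_image)
    qed
    ultimately show "bij_betw (residue_class S) (carrier (ring_on (red ` S))) (carrier (ring_on S Quot ?I))"
      by (simp add: bij_betw_def)
  qed
qed

context deformation
begin

section \<open>The family over the affine line\<close>

lemma ring_t_At: "ring_t \<subseteq> At i"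
  unfolding ring_t_def by (rule calg_minimal[OF At_subring]) (use const_At t_At in auto)

lemma ring_t_stalk: "x \<in> fam.pts \<Longrightarrow> ring_t \<subseteq> fam.stalk x"
  using fam.pts_ex[of x] fam.ptsD(1-3)[of x] ring_t_At local_ring_in_incl[OF At_subring]
    by (metis subset_trans)

text \<open>All representatives of a point contract to the same prime, so \<open>the_elem\<close> in
  \<open>family_map\<close> is applied to a singleton.\<close>

lemma family_map_eq: "x \<in> fam.pts \<Longrightarrow> family_map x = nonunits (fam.stalk x) \<inter> ring_t"
proof -
  assume x: "x \<in> fam.pts"
  have "p \<inter> ring_t = nonunits (fam.stalk x) \<inter> ring_t" if "(i, p) \<in> x" for i p
    using fam.ptsD(5)[OF x that] ring_t_At[of i] by blast
  then have eq: "(case e of (i, p) \<Rightarrow> p \<inter> ring_t) = nonunits (fam.stalk x) \<inter> ring_t" if "e \<in> x" for e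
    using that by (cases e) simp
  have "x \<noteq> {}" using fam.pts_ex[OF x] by blast
  then have "(\<lambda>(i, p). p \<inter> ring_t) ` x = {nonunits (fam.stalk x) \<inter> ring_t}"
    by (subst image_cong[OF refl eq]) auto
  then show ?thesis by (simp add: family_map_def)
qed

lemma family_map_prime: "x \<in> fam.pts \<Longrightarrow> family_map x \<in> primes (ring_on ring_t)"
  using local_subring_primes[OF fam.local_stalk field_subring_ring_t ring_t_stalk]
    by (simp add: family_map_eq)

text \<open>Elements of \<open>ring_t\<close> outside the contracted prime are units of the
  stalk.\<close>

lemma stalk_over_line:
  assumes x: "x \<in> fam.pts"
  shows "local_ring_in ring_t (family_map x) \<subseteq> fam.stalk x"
    "nonunits (local_ring_in ring_t (family_map x)) \<subseteq> nonunits (fam.stalk x)"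
proof -
  let ?L = "fam.stalk x" and ?q = "family_map x"
  have FL: "field_subring ?L" using fam.local_stalk[OF x] by (simp add: local_subring_def)
  have q: "?q \<in> primes (ring_on ring_t)" by (rule family_map_prime[OF x])
  have unit: "s \<noteq> 0 \<and> inverse s \<in> ?L" if "s \<in> ring_t - ?q" for s
    using that ring_t_stalk[OF x] by (auto simp: family_map_eq[OF x] nonunits_def)
  have eq: "z = inverse s * (s * z)" if "s \<in> ring_t - ?q" for s z using unit[OF that] by simp
  show "local_ring_in ring_t ?q \<subseteq> ?L"
  proof
    fix z assume "z \<in> local_ring_in ring_t ?q"
    then obtain s where s: "s \<in> ring_t - ?q" "s * z \<in> ring_t"
      using local_ring_in_iff[OF field_subring_ring_t q] by blast
    then have "inverse s * (s * z) \<in> ?L" using unit ring_t_stalk[OF x] fs_mult[OF FL] by blast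
    then show "z \<in> ?L" using eq[OF s(1), of z] by simp
  qed
  show "nonunits (local_ring_in ring_t ?q) \<subseteq> nonunits ?L"
  proof
    fix z assume "z \<in> nonunits (local_ring_in ring_t ?q)"
    then obtain s where s: "s \<in> ring_t - ?q" "s * z \<in> ?q"
      using nonunits_local_iff[OF field_subring_ring_t q] by blast
    have "s * z \<in> nonunits ?L" using s(2) by (simp add: family_map_eq[OF x])
    then have "inverse s * (s * z) \<in> nonunits ?L" using unit[OF s(1)] nonunits_mult[OF FL] by blast
    then show "z \<in> nonunits ?L" using eq[OF s(1), of z] by simp
  qed
qed

lemma affine_line_birational: "birational_space affine_line (local_ring_in ring_t) const_xyt"
  unfolding affine_line_def
  by (rule spec_in_birational[OF field_subring_ring_t const_xyt_ring_hom]) (use const_in_ring_t in auto)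

lemma affine_line_simps: "rs_top affine_line = zariski (ring_on ring_t)"
  "rs_stalk affine_line = (\<lambda>p. ring_on (local_ring_in ring_t p))"
  by (simp_all add: affine_line_def)

lemma continuous_family_map: "continuous_map (rs_top fam.X) (rs_top affine_line) family_map"
  unfolding continuous_map_def fam.topspace_glued affine_line_simps topspace_zariski_ring_on[OF field_subring_ring_t]
proof (intro conjI allI impI)
  show "family_map \<in> fam.pts \<rightarrow> primes (ring_on ring_t)" using family_map_prime by blast
  fix V assume V: "openin (zariski (ring_on ring_t)) V"
  show "openin (rs_top fam.X) {x \<in> fam.pts. family_map x \<in> V}" unfolding fam.openin_glued_iff
  proof (intro conjI ballI)
    fix x assume "x \<in> {x \<in> fam.pts. family_map x \<in> V}"
    then have x: "x \<in> fam.pts" "family_map x \<in> V" by auto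
    obtain b where b: "b \<in> ring_t - family_map x" "\<forall>q\<in>primes (ring_on ring_t). b \<notin> q \<longrightarrow> q \<in> V"
      using V x(2) openin_zariski_iff[OF cring_ring_on[OF field_subring_ring_t]] by auto
    obtain i p where ip: "(i, p) \<in> x" using fam.pts_ex[OF x(1)] by blast
    have mem: "b \<in> p' \<longleftrightarrow> b \<in> family_map x'" if "x' \<in> fam.pts" "(i, p') \<in> x'" for x' p'
      using fam.ptsD(5)[OF that] family_map_eq[OF that(1)] b(1) ring_t_At[of i] by blast
    have "fam.basic i b \<subseteq> {x \<in> fam.pts. family_map x \<in> V}"
      using mem b(2) family_map_prime by (auto simp: fam.basic_def)
    moreover have "b \<in> At i - p" using mem[OF x(1) ip] b(1) ring_t_At[of i] by blast
    ultimately show "\<exists>i p a. (i, p) \<in> x \<and> a \<in> At i - p \<and> fam.basic i a \<subseteq> {x \<in> fam.pts. family_map x \<in> V}"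
      using ip by blast
  qed auto
qed

lemma family_stalk_map_eq: "family_stalk_map = (\<lambda>x z. z)"
  by (rule ext) (simp add: family_stalk_map_def)

lemma family_morphism: "rs_morphism fam.X affine_line family_map family_stalk_map"
  unfolding family_stalk_map_eq
  by (rule birational_morphism[OF fam.birational_space_axioms affine_line_birational continuous_family_map])
    (use stalk_over_line in \<open>auto simp: fam.topspace_glued\<close>)

lemma family_flat: "flat_morphism TYPE('n) fam.X affine_line family_map family_stalk_map"
  unfolding flat_morphism_def
proof
  fix x assume "x \<in> topspace (rs_top fam.X)"
  then have x: "x \<in> fam.pts" by (simp add: fam.topspace_glued)
  have FL: "field_subring (fam.stalk x)" using fam.local_stalk[OF x] by (simp add: local_subring_def)
  show "flat_module TYPE('n) (rs_stalk affine_line (family_map x)) (as_module (family_stalk_map x) (rs_stalk fam.X x))"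
    unfolding family_stalk_map_eq affine_line_simps fam.rs_stalk_glued
    by (rule flat_module_valuation[OF valuation_local_ring_t[OF family_map_prime[OF x]] FL stalk_over_line(1)[OF x]])
qed

section \<open>The special fibre\<close>

definition sp :: "(nat \<times> field_xyt set) set set" where
  "sp = {x \<in> fam.pts. family_map x = origin}"

text \<open>An element of \<open>ring_t\<close> is a constant plus a multiple of \<open>t\<close>,
  and nonzero constants are units. So once \<open>t\<close> is a nonunit, the contraction is the
  ideal generated by \<open>t\<close>.\<close>

lemma sp_iff:
  assumes x: "x \<in> fam.pts"
  shows "x \<in> sp \<longleftrightarrow> var_t \<in> nonunits (fam.stalk x)"
proof
  assume "x \<in> sp"
  moreover have "var_t \<in> origin" using var_t_in_ring_t red_vars by (simp add: origin_eq)
  ultimately show "var_t \<in> nonunits (fam.stalk x)" using family_map_eq[OF x] by (auto simp: sp_def)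
next
  let ?L = "fam.stalk x"
  assume t: "var_t \<in> nonunits ?L"
  have FL: "field_subring ?L" and loc: "local_subring ?L" using fam.local_stalk[OF x]
    by (auto simp: local_subring_def)
  have tz: "var_t * z \<in> nonunits ?L" if "z \<in> ring_t" for z
    using nonunits_mult[OF FL _ t, of z] ring_t_stalk[OF x] that by (auto simp: mult.commute)
  have "nonunits ?L \<inter> ring_t = origin"
  proof (intro equalityI subsetI)
    fix z assume z: "z \<in> nonunits ?L \<inter> ring_t"
    obtain c z' where z': "z' \<in> ring_t" "z = const_xyt c + var_t * z'" using ring_t_decompose z by blast
    have "z + var_t * (- z') \<in> nonunits ?L"
      using loc z tz[OF fs_minus[OF field_subring_ring_t z'(1)]] by (auto simp: local_subring_def)
    then have n: "const_xyt c \<in> nonunits ?L" using z'(2) by simp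
    have "c = 0"
    proof (rule ccontr)
      assume c: "c \<noteq> 0"
      then have "const_xyt (inverse c) * const_xyt c = 1"
        using const_xyt_ops(2)[of "inverse c" c] const_xyt_ops(3) by simp
      moreover have "const_xyt (inverse c) * const_xyt c \<in> nonunits ?L"
        by (rule nonunits_mult[OF FL _ n]) (use ring_t_stalk[OF x] const_in_ring_t in blast)
      ultimately show False using fs_one[OF FL] by (simp add: nonunits_def)
    qed
    moreover have "z' \<in> regular" using z'(1) ring_t_regular by blast
    ultimately have "red z = 0" using z'(2) by (simp add: const_xyt_zero regular_ops red_vars)
    then show "z \<in> origin" using z by (simp add: origin_eq)
  next
    fix z assume "z \<in> origin"
    then have z: "z \<in> ring_t" "red z = 0" by (auto simp: origin_eq)
    then obtain z' where "z' \<in> ring_t" "z = var_t * z'" using ring_t_red_zero by blast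
    then show "z \<in> nonunits ?L \<inter> ring_t" using z tz by simp
  qed
  then show "x \<in> sp" using family_map_eq[OF x] x by (simp add: sp_def)
qed

lemma sp_pts: "x \<in> sp \<Longrightarrow> x \<in> fam.pts" by (simp add: sp_def)

lemma sigma_Sigma: "i < l \<Longrightarrow> cone_gen (gen i) \<in> \<Sigma>" by (rule sigma_in)

lemma sp_chart:
  assumes x: "x \<in> sp" and ip: "(i, p) \<in> x"
  shows "i < l" "p \<in> primes (ring_on (At i))" "var_t \<in> p" "fam.stalk x = local_ring_in (At i) p"
    "red ` fam.stalk x = local_ring_in (A0 i) (red ` p)" "red ` p \<in> primes (ring_on (A0 i))"
proof -
  note P = fam.ptsD[OF sp_pts[OF x] ip]
  show i: "i < l" using P(1) by simp
  show p: "p \<in> primes (ring_on (At i))" by (rule P(2))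
  show s: "fam.stalk x = local_ring_in (At i) p" by (rule P(3))
  show t: "var_t \<in> p" using P(5) sp_iff[OF sp_pts[OF x]] x t_At by blast
  show "red ` fam.stalk x = local_ring_in (A0 i) (red ` p)" using red_local[OF i p t] s by simp
  show "red ` p \<in> primes (ring_on (A0 i))" by (rule red_prime[OF i p t])
qed

lemma sp_ex: "x \<in> sp \<Longrightarrow> \<exists>i p. (i, p) \<in> x"
  using fam.pts_ex sp_pts by blast

lemma sp_special: "x \<in> sp \<Longrightarrow> special_local (fam.stalk x)"
  using sp_ex sp_chart special_local by metis

text \<open>The point of \<open>Y\<close> is named by its local ring, so no chart has to be
  chosen.\<close>

definition to_toric :: "(nat \<times> field_xyt set) set \<Rightarrow> ((rat \<times> rat) set \<times> field_xy set) set" where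
  "to_toric x = toric.cls (red ` fam.stalk x)"

lemma to_toric_chart:
  assumes x: "x \<in> sp" and ip: "(i, p) \<in> x"
  shows "to_toric x \<in> toric.pts" "toric.stalk (to_toric x) = red ` fam.stalk x" "(cone_gen (gen i),
      red ` p) \<in> to_toric x"
proof -
  note P = sp_chart[OF x ip]
  have "to_toric x = toric.cls (local_ring_in (A0 i) (red ` p))" using P(5) by (simp add: to_toric_def)
  then show "to_toric x \<in> toric.pts" "toric.stalk (to_toric x) = red ` fam.stalk x" "(cone_gen (gen i),
      red ` p) \<in> to_toric x"
    using toric.cls_in_pts[OF sigma_Sigma[OF P(1)] P(6)] toric.stalk_cls[OF sigma_Sigma[OF P(1)] P(6)]
      toric.in_cls[OF sigma_Sigma[OF P(1)] P(6)] P(5) by auto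
qed

lemma to_toric_pts: "x \<in> sp \<Longrightarrow> to_toric x \<in> toric.pts" and to_toric_stalk: "x \<in> sp \<Longrightarrow>
    toric.stalk (to_toric x) = red ` fam.stalk x"
  using sp_ex to_toric_chart by blast+

text \<open>Charts might contribute different points over one point of \<open>Y\<close>;
  \<open>local_ring_subset\<close>, applied in both directions, rules this out.\<close>

lemma to_toric_inj: "inj_on to_toric sp"
proof (rule inj_onI)
  fix x y assume x: "x \<in> sp" and y: "y \<in> sp" and eq: "to_toric x = to_toric y"
  obtain i p where ip: "(i, p) \<in> x" using sp_ex[OF x] by blast
  obtain j q where jq: "(j, q) \<in> y" using sp_ex[OF y] by blast
  note P = sp_chart[OF x ip] and Q = sp_chart[OF y jq]
  have e: "local_ring_in (A0 i) (red ` p) = local_ring_in (A0 j) (red ` q)"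
    using to_toric_stalk[OF x] to_toric_stalk[OF y] eq P(5) Q(5) by simp
  have "fam.stalk x = fam.stalk y"
    using local_ring_subset[OF P(1-3) Q(1-3) e] local_ring_subset[OF Q(1-3) P(1-3) e[symmetric]] P(4) Q(4) by blast
  then show "x = y" using fam.pts_eqI sp_pts x y by blast
qed

text \<open>The preimage of \<open>q\<close> under \<open>red\<close> is a prime of the chart ring
  that contains \<open>t\<close>.\<close>

lemma to_toric_surj_chart:
  assumes i: "i < l" and q: "q \<in> primes (ring_on (A0 i))"
  shows "\<exists>x\<in>sp. (i, {z \<in> At i. red z \<in> q}) \<in> x \<and> red ` {z \<in> At i. red z \<in> q} = q \<and> to_toric x =
      toric.cls (local_ring_in (A0 i) q)"
proof -
  let ?p = "{z \<in> At i. red z \<in> q}"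
  have reg: "z \<in> regular" if "z \<in> At i" for z using that At_regular by blast
  have A0: "red z \<in> A0 i" if "z \<in> At i" for z using red_At[OF i] that by blast
  have p: "?p \<in> primes (ring_on (At i))"
    unfolding primes_ring_on_iff[OF At_subring]
    using fs_intros[OF At_subring[of i]] prime_simps[OF A0_subring q] A0 reg
      by (auto simp: regular_ops red_one red_zero)
  have t: "var_t \<in> ?p" using t_At pr_zero[OF A0_subring q] red_vars by simp
  have "q \<subseteq> red ` At i" using pr_sub[OF A0_subring q] red_At[OF i] by simp
  then have rp: "red ` ?p = q" by auto
  have i': "i \<in> {0..<l}" using i by simp
  let ?x = "fam.cls (local_ring_in (At i) ?p)"
  have xp: "?x \<in> fam.pts" and ix: "(i, ?p) \<in> ?x" and sx: "fam.stalk ?x = local_ring_in (At i) ?p"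
    by (rule fam.cls_in_pts[OF i' p], rule fam.in_cls[OF i' p], rule fam.stalk_cls[OF i' p])
  have "var_t \<in> nonunits (fam.stalk ?x)" unfolding sx
    using subsetD[OF equalityD2[OF nonunits_local_Int[OF At_subring p]] t] by (rule IntD1)
  then have "?x \<in> sp" using sp_iff[OF xp] by simp
  moreover have "to_toric ?x = toric.cls (local_ring_in (A0 i) q)" using sx red_local[OF i p t] rp
    by (simp add: to_toric_def)
  ultimately show ?thesis using ix rp by blast
qed

lemma to_toric_surj: "to_toric ` sp = toric.pts"
proof (intro equalityI subsetI)
  fix y assume y: "y \<in> toric.pts"
  obtain \<sigma> q' where s: "\<sigma> \<in> \<Sigma>" "q' \<in> primes (ring_on (toric_ring \<sigma>))" "(\<sigma>, q') \<in> y"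
    using toric.pts_ex[OF y] by blast
  \<comment> \<open>The surface is glued over all cones, the family over the two-dimensional ones
    only. A point on the chart of a smaller cone already lies on that of a cone containing it as a
    face.\<close>
  obtain i W where W: "i < l" "W \<subseteq> gen i" "\<sigma> = cone_gen W" using cone_classification[OF s(1)] by blast
  interpret unimodular "\<nu> i" "\<nu> (Suc i)" by (rule sigma_unimod[OF W(1)])
  have finW: "finite W" using W(2) finite_subset by (meson finite.emptyI finite.insertI)
  have B: "toric_ring \<sigma> = torus.mring (dual_lattice W)" using toric_ring_cone_gen[OF finW] W(3) by simp
  note loc = local_ring_localizes[OF torus.field_subring_dual torus.field_subring_dual
      torus.face_localizes[OF dual_family_sdual[OF order.refl] W(2)] s(2)[unfolded B]]
  let ?q = "q' \<inter> A0 i"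
  have q: "?q \<in> primes (ring_on (A0 i))" "local_ring_in (toric_ring \<sigma>) q' = local_ring_in (A0 i) ?q"
    using loc by (simp_all add: A0_eq B)
  have "y = toric.cls (local_ring_in (A0 i) ?q)" using toric.ptsD(4)[OF y s(3)] q(2) by simp
  then show "y \<in> to_toric ` sp" using to_toric_surj_chart[OF W(1) q(1)] by force
qed (use to_toric_pts in auto)

definition from_toric :: "((rat \<times> rat) set \<times> field_xy set) set \<Rightarrow> (nat \<times> field_xyt set) set" where
  "from_toric = inv_into sp to_toric"

lemma from_toric_sp: "y \<in> toric.pts \<Longrightarrow> from_toric y \<in> sp" and to_from_toric: "y \<in> toric.pts \<Longrightarrow>
    to_toric (from_toric y) = y"
  and from_to_toric: "x \<in> sp \<Longrightarrow> from_toric (to_toric x) = x"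
  using to_toric_surj to_toric_inj by (simp_all add: from_toric_def inv_into_into f_inv_into_f inv_into_f_f)

section \<open>The fibre as a ringed space\<close>

abbreviation Fib :: "((nat \<times> field_xyt set) set, field_xyt set) rspace" where
  "Fib \<equiv> fiber fam.X affine_line family_map family_stalk_map origin"

abbreviation fib_ideal :: "(nat \<times> field_xyt set) set \<Rightarrow> field_xyt set" where
  "fib_ideal \<equiv> fiber_ideal fam.X affine_line family_map family_stalk_map"

lemma stalk_ring: "x \<in> sp \<Longrightarrow> field_subring (fam.stalk x)" "x \<in> sp \<Longrightarrow> fam.stalk x \<subseteq> regular"
  using sp_special by (auto simp: special_local_def local_subring_def)

text \<open>The maximal ideal at the origin reduces to 0 and contains \<open>t\<close>, which
  generates the kernel of \<open>red\<close> on the stalk.\<close>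

lemma fiber_ideal_eq:
  assumes x: "x \<in> sp"
  shows "fib_ideal x = {z \<in> fam.stalk x. red z = 0}"
proof -
  let ?S = "fam.stalk x" and ?I = "{z \<in> fam.stalk x. red z = 0}"
  let ?N = "nonunits (local_ring_in ring_t origin)"
  note S = stalk_ring[OF x]
  have fx: "family_map x = origin" using x by (simp add: sp_def)
  interpret cring "ring_on ?S" by (rule cring_ring_on[OF S(1)])
  have "max_ideal (ring_on (local_ring_in ring_t origin)) = ?N"
    by (rule max_ideal_ring_on[OF local_subring_local[OF field_subring_ring_t origin_prime]])
  then have fib_ideal: "fib_ideal x = genideal (ring_on ?S) ?N"
    by (simp add: fiber_ideal_def fam.rs_stalk_glued affine_line_simps fx family_stalk_map_eq)
  have NS: "?N \<subseteq> ?S" using stalk_over_line(1)[OF sp_pts[OF x]] fx by (auto simp: nonunits_def)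
  have NI: "?N \<subseteq> ?I"
  proof
    fix z assume z: "z \<in> ?N"
    obtain s where s: "s \<in> ring_t - origin" "s * z \<in> origin"
      using z nonunits_local_iff[OF field_subring_ring_t origin_prime] by blast
    have zS: "z \<in> ?S" using NS z by blast
    have "s \<in> regular" "red s \<noteq> 0" using s(1) ring_t_regular by (auto simp: origin_eq)
    moreover have "red (s * z) = 0" using s(2) by (simp add: origin_eq)
    ultimately show "z \<in> ?I" using zS S(2) regular_ops(6)[of s z] by auto
  qed
  have I: "ideal ?I (ring_on ?S)" using red_zero_prime[OF S] by (simp add: primes_def primeideal_def)
  have "fib_ideal x \<subseteq> ?I" unfolding fib_ideal by (rule genideal_minimal[OF I NI])
  moreover have "?I \<subseteq> fib_ideal x"
  proof
    fix z assume "z \<in> ?I"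
    then obtain z' where z': "z' \<in> ?S" "z = var_t * z'" using sp_special[OF x]
      by (auto simp: special_local_def)
    have "var_t \<in> origin" using var_t_in_ring_t red_vars by (simp add: origin_eq)
    then have "var_t \<in> ?N" using nonunits_local_Int[OF field_subring_ring_t origin_prime] by blast
    then have t: "var_t \<in> fib_ideal x" unfolding fib_ideal using genideal_self[of ?N] NS by auto
    have "ideal (fib_ideal x) (ring_on ?S)" unfolding fib_ideal by (rule genideal_ideal) (use NS in auto)
    then have "z' * var_t \<in> fib_ideal x" using t z'(1) unfolding ideal_ring_on_iff[OF S(1)] by simp
    then show "z \<in> fib_ideal x" using z' by (simp add: mult.commute)
  qed
  ultimately show ?thesis by blast
qed

lemma Fib_simps:
  "rs_top Fib = subtopology (rs_top fam.X) sp"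
  "rs_stalk Fib = (\<lambda>x. ring_on (fam.stalk x) Quot fib_ideal x)"
  "rs_const Fib = (\<lambda>x c. fib_ideal x +>\<^bsub>ring_on (fam.stalk x)\<^esub> const_xyt c)"
  "rs_sec Fib U = {s \<in> (\<Pi>\<^sub>E x\<in>U. carrier (ring_on (fam.stalk x) Quot fib_ideal x)). \<forall>x\<in>U. \<exists>W \<sigma>.
            openin (rs_top fam.X) W \<and> x \<in> W \<and> \<sigma> \<in> rs_sec fam.X W \<and>
            (\<forall>y\<in>W \<inter> U. s y = fib_ideal y +>\<^bsub>ring_on (fam.stalk y)\<^esub> \<sigma> y)}"
  unfolding fiber_def Let_def by (simp_all add: fam.rs_stalk_glued fam.topspace_glued fam.const sp_def)

lemma topspace_Fib: "topspace (rs_top Fib) = sp"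
  using sp_pts by (auto simp: Fib_simps fam.topspace_glued)

lemma coset_residue: "x \<in> sp \<Longrightarrow> z \<in> fam.stalk x \<Longrightarrow> fib_ideal x +>\<^bsub>ring_on (fam.stalk x)\<^esub> z =
    residue_class (fam.stalk x) (red z)"
  using reduction_coset[OF stalk_ring] by (simp add: fiber_ideal_eq residue_class_def)

lemma residue_iso:
  assumes x: "x \<in> sp"
  shows "residue_class (fam.stalk x) \<in> ring_iso (ring_on (red ` fam.stalk x)) (ring_on (fam.stalk x) Quot fib_ideal x)"
    "local_hom (ring_on (red ` fam.stalk x)) (ring_on (fam.stalk x) Quot fib_ideal x) (residue_class (fam.stalk x))"
    "local_hom (ring_on (fam.stalk x) Quot fib_ideal x) (ring_on (red ` fam.stalk x))
      (inv_into (red ` fam.stalk x) (residue_class (fam.stalk x)))"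
proof -
  note S = stalk_ring[OF x]
  show iso: "residue_class (fam.stalk x) \<in> ring_iso (ring_on (red ` fam.stalk x)) (ring_on (fam.stalk x) Quot fib_ideal x)"
    using residue_class_iso(1)[OF S] by (simp add: fiber_ideal_eq[OF x])
  have "local_ring (ring_on (red ` fam.stalk x))"
    using local_ring_ring_on[OF toric.local_stalk[OF to_toric_pts[OF x]]] to_toric_stalk[OF x] by simp
  moreover have "cring (ring_on (fam.stalk x) Quot fib_ideal x)"
    using residue_class_iso(2)[OF S] by (simp add: fiber_ideal_eq[OF x])
  ultimately show "local_hom (ring_on (red ` fam.stalk x)) (ring_on (fam.stalk x) Quot fib_ideal x) (residue_class (fam.stalk x))"
    "local_hom (ring_on (fam.stalk x) Quot fib_ideal x) (ring_on (red ` fam.stalk x))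
      (inv_into (red ` fam.stalk x) (residue_class (fam.stalk x)))"
    using ring_iso_local(3,4)[OF iso] by simp_all
qed

text \<open>The distinguished open set of \<open>b\<close> pulls back to that of any lift of
  \<open>b\<close> to the chart ring, restricted to the fibre.\<close>

lemma open_to_toric:
  assumes V: "openin (rs_top toric.X) V"
  shows "openin (rs_top Fib) {x \<in> sp. to_toric x \<in> V}"
proof (subst openin_subopen, rule ballI)
  fix x assume "x \<in> {x \<in> sp. to_toric x \<in> V}"
  then have x: "x \<in> sp" "to_toric x \<in> V" by auto
  obtain i p where ip: "(i, p) \<in> x" using sp_ex[OF x(1)] by blast
  note P = sp_chart[OF x(1) ip]
  obtain b where b: "b \<in> A0 i - red ` p" "toric.basic (cone_gen (gen i)) b \<subseteq> V"
    using toric.openin_glued_basic_aux[OF V x(2) to_toric_chart(3)[OF x(1) ip]] by blast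
  obtain z where z: "z \<in> At i" "b = red z" using red_At[OF P(1)] b by blast
  let ?U = "fam.basic i z \<inter> sp"
  have "openin (rs_top Fib) ?U" unfolding Fib_simps
    using fam.openin_basic_glued[of i z] P(1) z(1) by (auto simp: openin_subtopology)
  moreover have "x \<in> ?U" using x b z ip sp_pts by (auto simp: fam.basic_def)
  moreover have "?U \<subseteq> {x \<in> sp. to_toric x \<in> V}"
  proof
    fix x' assume x': "x' \<in> ?U"
    then obtain p' where p': "(i, p') \<in> x'" "z \<notin> p'" by (auto simp: fam.basic_def)
    have xs: "x' \<in> sp" using x' by blast
    note P' = sp_chart[OF xs p'(1)]
    have "b \<notin> red ` p'" using red_mem_iff[OF P'(1-3) z(1)] p'(2) z(2) by simp
    then have "to_toric x' \<in> toric.basic (cone_gen (gen i)) b"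
      unfolding toric.basic_def using to_toric_chart(1,3)[OF xs p'(1)] by blast
    then show "x' \<in> {x \<in> sp. to_toric x \<in> V}" using b(2) xs by blast
  qed
  ultimately show "\<exists>U. openin (rs_top Fib) U \<and> x \<in> U \<and> U \<subseteq> {x \<in> sp. to_toric x \<in> V}" by blast
qed

lemma open_from_toric:
  assumes W: "openin (rs_top Fib) W"
  shows "openin (rs_top toric.X) {y \<in> toric.pts. from_toric y \<in> W}"
  unfolding toric.openin_glued_iff
proof (intro conjI ballI)
  obtain W' where W': "openin (rs_top fam.X) W'" "W = W' \<inter> sp" using W
    by (auto simp: Fib_simps openin_subtopology)
  fix y assume "y \<in> {y \<in> toric.pts. from_toric y \<in> W}"
  then have y: "y \<in> toric.pts" "from_toric y \<in> W'" using W' by auto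
  note x = from_toric_sp[OF y(1)]
  obtain i p where ip: "(i, p) \<in> from_toric y" using sp_ex[OF x] by blast
  note P = sp_chart[OF x ip]
  obtain z where z: "z \<in> At i - p" "fam.basic i z \<subseteq> W'"
    using fam.openin_glued_basic_aux[OF W'(1) y(2) ip] by blast
  have "red z \<in> A0 i - red ` p" using z(1) red_At[OF P(1)] red_mem_iff[OF P(1-3)] by blast
  moreover have "(cone_gen (gen i), red ` p) \<in> y"
    using to_toric_chart(3)[OF x ip] to_from_toric[OF y(1)] by simp
  moreover have "toric.basic (cone_gen (gen i)) (red z) \<subseteq> {y \<in> toric.pts. from_toric y \<in> W}"
  proof
    fix y' assume "y' \<in> toric.basic (cone_gen (gen i)) (red z)"
    then obtain q where q: "y' \<in> toric.pts" "(cone_gen (gen i), q) \<in> y'" "red z \<notin> q"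
      by (auto simp: toric.basic_def)
    note Q = toric.ptsD[OF q(1,2)]
    obtain x' where x': "x' \<in> sp" "(i, {z \<in> At i. red z \<in> q}) \<in> x'" "to_toric x' =
        toric.cls (local_ring_in (A0 i) q)"
      using to_toric_surj_chart[OF P(1) Q(2)] by blast
    have "to_toric x' = y'" using x'(3) Q(4) by simp
    then have "from_toric y' = x'" using from_to_toric[OF x'(1)] by simp
    moreover have "x' \<in> fam.basic i z" unfolding fam.basic_def using x' q(3) sp_pts by blast
    ultimately show "y' \<in> {y \<in> toric.pts. from_toric y \<in> W}" using z(2) W'(2) x'(1) q(1) by blast
  qed
  ultimately show "\<exists>\<sigma> p a. (\<sigma>, p) \<in> y \<and> a \<in> toric_ring \<sigma> - p \<and>
      toric.basic \<sigma> a \<subseteq> {y \<in> toric.pts. from_toric y \<in> W}" by blast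
qed auto

lemma fiber_to_toric: "rs_morphism Fib toric.X to_toric (\<lambda>x. residue_class (fam.stalk x))"
  unfolding rs_morphism_def topspace_Fib
proof (intro conjI ballI allI impI)
  show "continuous_map (rs_top Fib) (rs_top toric.X) to_toric"
    unfolding continuous_map_def topspace_Fib toric.topspace_glued using to_toric_pts open_to_toric by blast
  fix x assume x: "x \<in> sp"
  show "local_hom (rs_stalk toric.X (to_toric x)) (rs_stalk Fib x) (residue_class (fam.stalk x))"
    using residue_iso(2)[OF x] by (simp add: toric.rs_stalk_glued to_toric_stalk[OF x] Fib_simps)
  have "const_xyt c \<in> fam.stalk x" for c using ring_t_stalk[OF sp_pts[OF x]] const_in_ring_t by blast
  then show "residue_class (fam.stalk x) (rs_const toric.X (to_toric x) c) = rs_const Fib x c" for c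
    using coset_residue[OF x] by (simp add: toric.const Fib_simps red_vars)
next
  fix V s assume "openin (rs_top toric.X) V \<and> s \<in> rs_sec toric.X V"
  then have V: "openin (rs_top toric.X) V" and s: "s \<in> rs_sec toric.X V" by auto
  let ?U = "{x \<in> sp. to_toric x \<in> V}"
  show "(\<lambda>x\<in>?U. residue_class (fam.stalk x) (s (to_toric x))) \<in> rs_sec Fib ?U"
    unfolding Fib_simps(4)
  proof (intro CollectI conjI ballI)
    have "residue_class (fam.stalk x) (s (to_toric x)) \<in> carrier (ring_on (fam.stalk x) Quot fib_ideal x)" if x: "x \<in> ?U" for x
    proof -
      have xs: "x \<in> sp" "to_toric x \<in> V" using x by auto
      have "s (to_toric x) \<in> red ` fam.stalk x"
        using toric.sec_memD[OF V s xs(2)] to_toric_stalk[OF xs(1)] by simp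
      then show ?thesis using residue_iso(1)[OF xs(1)] by (auto simp: ring_iso_def bij_betw_def)
    qed
    then show "(\<lambda>x\<in>?U. residue_class (fam.stalk x) (s (to_toric x))) \<in> (\<Pi>\<^sub>E x\<in>?U. carrier (ring_on (fam.stalk x) Quot fib_ideal x))"
      unfolding restrict_PiE_iff by blast
    fix x assume "x \<in> ?U"
    then have x: "x \<in> sp" "to_toric x \<in> V" by auto
    obtain V' w where V': "openin (rs_top toric.X) V'" "to_toric x \<in> V'" "V' \<subseteq> V" "\<And>y. y \<in> V' \<Longrightarrow> s y = w"
      "\<And>y. y \<in> V' \<Longrightarrow> w \<in> toric.stalk y" by (rule toric.secE[OF V s x(2)]) blast
    \<comment> \<open>A section of \<open>Y\<close> is a constant \<open>w\<close> near the point.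
      Any lift of \<open>w\<close> to the stalk is a section of \<open>X\<close> on its domain of
      definition and induces the required section of the fibre.\<close>
    obtain z where z: "z \<in> fam.stalk x" "w = red z" using V'(5)[OF V'(2)] to_toric_stalk[OF x(1)] by auto
    obtain W1 where W1: "openin (rs_top fam.X) W1" "{x \<in> sp. to_toric x \<in> V'} = W1 \<inter> sp"
      using open_to_toric[OF V'(1)] by (auto simp: Fib_simps openin_subtopology)
    let ?W = "W1 \<inter> {x \<in> fam.pts. z \<in> fam.stalk x}"
    have W: "openin (rs_top fam.X) ?W" using W1(1) fam.openin_stalk_mem by blast
    have "(\<lambda>x\<in>?W. z) \<in> rs_sec fam.X ?W"
      by (rule fam.secI[OF W]) (use W in auto)
    moreover have "x \<in> ?W" using W1(2) x V'(2) z sp_pts by blast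
    moreover have "(\<lambda>x\<in>?U. residue_class (fam.stalk x) (s (to_toric x))) y =
        fib_ideal y +>\<^bsub>ring_on (fam.stalk y)\<^esub> (\<lambda>x\<in>?W. z) y"
      if y: "y \<in> ?W \<inter> ?U" for y
    proof -
      have ys: "y \<in> sp" "to_toric y \<in> V'" "z \<in> fam.stalk y" using y W1(2) by blast+
      then show ?thesis using y V'(4)[OF ys(2)] coset_residue[OF ys(1,3)] z(2) by simp
    qed
    ultimately show "\<exists>W \<sigma>. openin (rs_top fam.X) W \<and> x \<in> W \<and> \<sigma> \<in> rs_sec fam.X W \<and>
       (\<forall>y\<in>W \<inter> ?U. (\<lambda>x\<in>?U. residue_class (fam.stalk x) (s (to_toric x))) y =
           fib_ideal y +>\<^bsub>ring_on (fam.stalk y)\<^esub> \<sigma> y)"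
      using W by blast
  qed
qed

definition residue_value :: "((rat \<times> rat) set \<times> field_xy set) set \<Rightarrow> field_xyt set \<Rightarrow> field_xy" where
  "residue_value y = inv_into (red ` fam.stalk (from_toric y)) (residue_class (fam.stalk (from_toric y)))"

lemma residue_value_residue: "y \<in> toric.pts \<Longrightarrow> w \<in> red ` fam.stalk (from_toric y) \<Longrightarrow>
    residue_value y (residue_class (fam.stalk (from_toric y)) w) = w"
  using residue_iso(1)[OF from_toric_sp]
    by (auto simp: residue_value_def ring_iso_def bij_betw_def inv_into_f_f)

lemma toric_stalk_from_toric: "y \<in> toric.pts \<Longrightarrow> toric.stalk y = red ` fam.stalk (from_toric y)"
  using to_toric_stalk[OF from_toric_sp] to_from_toric by simp

lemma toric_to_fiber: "rs_morphism toric.X Fib from_toric residue_value"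
  unfolding rs_morphism_def toric.topspace_glued
proof (intro conjI ballI allI impI)
  show "continuous_map (rs_top toric.X) (rs_top Fib) from_toric"
    unfolding continuous_map_def topspace_Fib toric.topspace_glued using from_toric_sp open_from_toric
      by blast
  fix y assume y: "y \<in> toric.pts"
  show "local_hom (rs_stalk Fib (from_toric y)) (rs_stalk toric.X y) (residue_value y)"
    using residue_iso(3)[OF from_toric_sp[OF y]]
      by (simp add: toric.rs_stalk_glued toric_stalk_from_toric[OF y] Fib_simps residue_value_def)
  fix c
  have "const_xyt c \<in> fam.stalk (from_toric y)"
    using ring_t_stalk[OF sp_pts[OF from_toric_sp[OF y]]] const_in_ring_t by blast
  moreover from this have "const_xy c \<in> red ` fam.stalk (from_toric y)" using red_vars(2)[of c]
    by (metis imageI)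
  ultimately show "residue_value y (rs_const Fib (from_toric y) c) = rs_const toric.X y c"
    using coset_residue[OF from_toric_sp[OF y]] residue_value_residue[OF y]
      by (simp add: toric.const Fib_simps red_vars)
next
  fix W s assume "openin (rs_top Fib) W \<and> s \<in> rs_sec Fib W"
  then have W: "openin (rs_top Fib) W" and s: "s \<in> rs_sec Fib W" by auto
  let ?U = "{y \<in> toric.pts. from_toric y \<in> W}"
  have U: "openin (rs_top toric.X) ?U" by (rule open_from_toric[OF W])
  obtain W0 where W0: "openin (rs_top fam.X) W0" "W = W0 \<inter> sp" using W
    by (auto simp: Fib_simps openin_subtopology)
  show "(\<lambda>y\<in>?U. residue_value y (s (from_toric y))) \<in> rs_sec toric.X ?U"
  proof (rule toric.secI[OF U])
    fix y assume y: "y \<in> ?U"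
    then have yp: "y \<in> toric.pts" and GW: "from_toric y \<in> W" by auto
    obtain W' \<sigma> where W': "openin (rs_top fam.X) W'" "from_toric y \<in> W'" "\<sigma> \<in> rs_sec fam.X W'"
      "\<forall>x\<in>W' \<inter> W. s x = fib_ideal x +>\<^bsub>ring_on (fam.stalk x)\<^esub> \<sigma> x"
      using s GW unfolding Fib_simps(4) by blast
    obtain V z where V: "openin (rs_top fam.X) V" "from_toric y \<in> V" "V \<subseteq> W'" "\<And>x. x \<in> V \<Longrightarrow> \<sigma> x = z"
      "\<And>x. x \<in> V \<Longrightarrow> z \<in> fam.stalk x" by (rule fam.secE[OF W'(1,3,2)]) blast
    \<comment> \<open>A section of the fibre comes locally from a constant \<open>z\<close> of the
      big field, so its value on \<open>Y\<close> is the constant \<open>red z\<close>.\<close>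
    have val: "residue_value y' (s (from_toric y')) = red z \<and> red z \<in> toric.stalk y'"
      if "y' \<in> toric.pts" "from_toric y' \<in> V" "from_toric y' \<in> W" for y'
    proof -
      have zS: "z \<in> fam.stalk (from_toric y')" by (rule V(5)[OF that(2)])
      have "s (from_toric y') = residue_class (fam.stalk (from_toric y')) (red z)"
        using W'(4) V(3,4) that(2,3) coset_residue[OF from_toric_sp[OF that(1)] zS] by auto
      then show ?thesis
        using residue_value_residue[OF that(1), of "red z"] zS toric_stalk_from_toric[OF that(1)] by simp
    qed
    show "(\<lambda>y\<in>?U. residue_value y (s (from_toric y))) y \<in> toric.stalk y" using val[OF yp V(2) GW] y by simp
    have "openin (rs_top Fib) (V \<inter> W)"
      unfolding Fib_simps openin_subtopology using V(1) W0 by (intro exI[of _ "V \<inter> W0"]) auto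
    from open_from_toric[OF this] have "openin (rs_top toric.X) {y \<in> toric.pts. from_toric y \<in> V \<inter> W}" .
    then show "\<exists>V z. openin (rs_top toric.X) V \<and> y \<in> V \<and> V \<subseteq> ?U \<and>
        (\<forall>y\<in>V. (\<lambda>y\<in>?U. residue_value y (s (from_toric y))) y = z)"
      using val yp V(2) GW by (intro exI[of _ "{y \<in> toric.pts. from_toric y \<in> V \<inter> W}"] exI[of _ "red z"]) auto
  qed auto
qed

lemma fiber_isomorphic: "rs_isomorphic Fib toric.X"
  unfolding rs_isomorphic_def topspace_Fib toric.topspace_glued
proof (intro exI conjI ballI)
  show "rs_morphism Fib toric.X to_toric (\<lambda>x. residue_class (fam.stalk x))" by (rule fiber_to_toric)
  show "rs_morphism toric.X Fib from_toric residue_value" by (rule toric_to_fiber)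
  fix x assume x: "x \<in> sp"
  show "from_toric (to_toric x) = x" by (rule from_to_toric[OF x])
  fix C assume "C \<in> carrier (rs_stalk Fib x)"
  then have "C \<in> residue_class (fam.stalk x) ` red ` fam.stalk x"
    using residue_iso(1)[OF x] by (simp add: Fib_simps ring_iso_def bij_betw_def)
  then show "residue_class (fam.stalk x) (residue_value (to_toric x) C) = C"
    unfolding residue_value_def from_to_toric[OF x] by (rule f_inv_into_f)
next
  fix y assume y: "y \<in> toric.pts"
  show "to_toric (from_toric y) = y" by (rule to_from_toric[OF y])
  fix w assume "w \<in> carrier (rs_stalk toric.X y)"
  then have "w \<in> red ` fam.stalk (from_toric y)" using toric_stalk_from_toric[OF y]
    by (simp add: toric.rs_stalk_glued)
  then show "residue_value y (residue_class (fam.stalk (from_toric y)) w) = w"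
    by (rule residue_value_residue[OF y])
qed

lemma family_deformation:
  "one_parameter_deformation TYPE('n) (toric_surface \<Sigma>) (family l m a lam w1 w2) family_map family_stalk_map"
proof -
  have "toric_surface \<Sigma> = toric.X" by (simp add: toric_surface_def)
  then show ?thesis
    using fam.is_scheme family_morphism family_flat[where 'n = 'n] fiber_isomorphic
    by (simp add: one_parameter_deformation_def family_eq)
qed

end

theorem theorem2p1:
  fixes \<Sigma> :: "(rat \<times> rat) set set"
    and l m :: nat
    and \<nu> w1 w2 :: "nat \<Rightarrow> int \<times> int"
    and \<Delta> D0 Dt :: "nat \<Rightarrow> rat set"
    and a lam :: "nat \<Rightarrow> int"
  assumes "is_fan \<Sigma>" and "complete_fan \<Sigma>" and "smooth_fan \<Sigma>"
    and "numbers_rays \<Sigma> l \<nu>"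
    and "numbers_segments \<Sigma> \<nu> m \<Delta>"
    and "admissible_decomposition m \<Delta> D0 Dt"
    and "encodes_decomposition m \<Delta> D0 Dt a lam"
    and "\<forall>i<l. dual_generators \<nu> i (w1 i) (w2 i)"
  shows "one_parameter_deformation TYPE('n) (toric_surface \<Sigma>)
           (family l m a lam w1 w2) family_map family_stalk_map"
proof -
  interpret deformation \<Sigma> l \<nu> m \<Delta> a lam w1 w2
    by unfold_locales (use assms in \<open>auto simp: encodes_decomposition_def\<close>)
  show ?thesis by (rule family_deformation)
qed

end
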